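(* Consider a multi-resolution times lattice Boltzmann scheme with data $v_j$, $M$, $\Phi$, $S$ as described in the context, under the following hypotheses: the discrete particle distribution is the restriction to the lattice of a very regular function of continuous space $x\in\mathbb R^d$ and time $t$; the scaling is acoustic ($\Delta x/\Delta t$ is fixed as $\Delta x,\Delta t\to0$); and the relaxation matrix $S$ is held fixed as $\Delta t\to0$. Consider the fourth-order Taylor expansion of the scheme with respect to the time step $\Delta t$, $$\partial_tW+\Gamma_1(W)+\Delta t\,\Gamma_2(W)+\Delta t^2\,\Gamma_3(W)+\Delta t^3\,\Gamma_4(W)=O(\Delta t^4),$$ $$Y=\Phi(W)+S^{-1}\big(\Delta t\,\Psi_1(W)+\Delta t^2\,\Psi_2(W)+\Delta t^3\,\Psi_3(W)\big)+O(\Delta t^4),$$ where $\Gamma_j$, $\Psi_j$ are differential operators in space acting on $W$, independent of $\Delta t$. Then the Taylor and Chapman-Enskog expansions give identical results: the operators $\Gamma_1,\Psi_1,\Gamma_2,\Psi_2,\Gamma_3,\Psi_3,\Gamma_4$ of the Taylor expansion are equal to the operators with the same names of the fourth-order Chapman-Enskog expansion of the scheme; precisely, with $\Sigma=S^{-1}-\tfrac12\,\mathrm I$, they are given by $$\Gamma_1=A\,W+B\,\Phi(W),$$ $$\Psi_1={\rm d}\Phi(W).\Gamma_1-(C\,W+D\,\Phi(W)),\qquad \Gamma_2=B\,\Sigma\,\Psi_1,$$ $$\Psi_2=\Sigma\,{\rm d}\Psi_1.\Gamma_1+{\rm d}\Phi(W).\Gamma_2-D\,\Sigma\,\Psi_1,$$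 $$\Gamma_3=B\,\Sigma\,\Psi_2-\tfrac16\,B\,{\rm d}\Psi_1.\Gamma_1+\tfrac1{12}\,B_2\,\Psi_1,$$ $$\Psi_3=\Sigma\,{\rm d}\Psi_1.\Gamma_2+{\rm d}\Phi.\Gamma_3-D\,\Sigma\,\Psi_2+\Sigma\,{\rm d}\Psi_2.\Gamma_1+\tfrac16\,D\,{\rm d}\Psi_1.\Gamma_1-\tfrac1{12}\,D_2\,\Psi_1-\tfrac1{12}\,{\rm d}({\rm d}\Psi_1.\Gamma_1).\Gamma_1,$$ $$\Gamma_4=B\,\Sigma\,\Psi_3+\tfrac14\,B_2\,\Psi_2+\tfrac16\,B\,D_2\,\Sigma\,\Psi_1-\tfrac16\,A\,B\,\Psi_2-\tfrac16\,B\,{\rm d}({\rm d}\Phi.\Gamma_1).\Gamma_2-\tfrac16\,B\,{\rm d}({\rm d}\Phi.\Gamma_2).\Gamma_1-\tfrac16\,B\,\Sigma\,{\rm d}({\rm d}\Psi_1.\Gamma_1).\Gamma_1 .$$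
   Context: **The scheme.** Let $d\ge1$ be the space dimension, $q$ the number of discrete velocities $v_0,\dots,v_{q-1}\in\mathbb R^d$ (the map $j\mapsto v_j$ need not be injective), and let $M$ be an invertible real $q\times q$ matrix. A particle distribution $f(x,t)=(f_j(x,t))_{0\le j<q}$ has moments $m=Mf$, split into blocks $m=(W,Y)^{\rm t}$, where $W$ (the first block) consists of the conserved moments and $Y$ of the nonconserved moments. A smooth function $\Phi$ gives the equilibrium $Y^{\rm eq}=\Phi(W)$, and $f^{\rm eq}=M^{-1}(W,\Phi(W))^{\rm t}$. The relaxation matrix $S$ is a constant invertible square matrix acting on the nonconserved block. One time step: relaxation $W^*=W$, $Y^*=Y+S(\Phi(W)-Y)$, $m^*=(W,Y^* )^{\rm t}$, $f^*=M^{-1}m^*$, followed by advection $f_j(x,t+\Delta t)=f_j^*(x-v_j\Delta t,t)$. Under the acoustic scaling $v_j$, $M$, $\Phi$ are fixed as $\Delta t\to0$. **The operator $\Lambda$.** $\Lambda=M\,\mathrm{diag}_j\big(\sum_{\alpha=1}^d v_j^\alpha\,\partial_\alpha\big)\,M^{-1}$ is a $q\times q$ matrix whose entries are constant-coefficient first-order linear differential operators in space. It is decomposed into blocks compatible with $m=(W,Y)^{\rm t}$: $$\Lambda=\begin{pmatrix}A&B\\C&D\end{pmatrix},\qquad \Lambda^2=\begin{pmatrix}A_2&B_2\\C_2&D_2\end{pmatrix},$$ so $A_2=A^2+BC$, $B_2=AB+BD$, $C_2=CA+DC$, $D_2=CB+D^2$. With Taylor expansion in space, the scheme in terms of moments reads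 $m(x,t+\Delta t)=\exp(-\Delta t\,\Lambda)\,m^*(x,t)$, where the exponential is the formal power series. **Notation for derivatives.** Each $\Gamma_j(W)$, $\Psi_j(W)$ is a (generally nonlinear) differential operator in space, a smooth function of $W$ and its spatial derivatives. For such an operator $F$, ${\rm d}F.G$ denotes the derivative of $F$ with respect to $W$ (taking into account the dependence on spatial derivatives of $W$) in the direction $G$: ${\rm d}F(W).G=\frac{{\rm d}}{{\rm d}s}F(W+sG)\big|_{s=0}$. For example ${\rm d}({\rm d}\Psi_1.\Gamma_1).\Gamma_1$ is the derivative, in the direction $\Gamma_1(W)$, of $W\mapsto{\rm d}\Psi_1(W).\Gamma_1(W)$. **Taylor expansion method.** There is a single time variable and no a priori expansion of $f$ is postulated. The relation $m(x,t+\Delta t)=\exp(-\Delta t\,\Lambda)\,m^*(x,t)$ is expanded in powers of $\Delta t$ on both sides (Taylor expansion of $m(x,t+\Delta t)$ in time), and time derivatives are successively eliminated using the lower-order results; all expansions are formal (the $O(\Delta t^k)$ remainders may be differentiated). This yields the two displayed expansions of the claim for $\partial_tW$ and $Y$, whose coefficients $\Gamma_j$, $\Psi_j$ are the operators "of the Taylor expansion". **Chapman-Enskog expansion.** Put $\Delta t=\varepsilon\,\tau_0$ with $\tau_0>0$ fixed. One postulates $$Y=\Phi(W)+S^{-1}\big(\varepsilon\tau_0\Psi_1(W)+\varepsilon^2\tau_0^2\Psi_2(W)+\varepsilon^3\tau_0^3\Psi_3(W)\big)+O(\varepsilon^4),$$ $$\partial_t=\partial_{t_1}+\varepsilon\,\partial_{t_2}+\varepsilon^2\,\partial_{t_3}+\varepsilon^3\,\partial_{t_4}+O(\varepsilon^4),$$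 where the $\partial_{t_k}$ are linear operators, not assumed to commute with one another, commuting with constant matrices and spatial derivatives and acting by the chain rule $\partial_{t_k}F(W)={\rm d}F(W).\partial_{t_k}W$. Inserting these in $\exp(\varepsilon\tau_0\partial_t)\,m=\exp(-\varepsilon\tau_0\Lambda)\,m^*$ and identifying order by order in $\varepsilon$ determines $\Psi_1,\Psi_2,\Psi_3$ and the operators $\Gamma_k$ defined by $\partial_{t_k}W+\tau_0^{k-1}\Gamma_k(W)=0$, $1\le k\le4$; these are the operators "of the Chapman-Enskog expansion". *)

theory Defs
  imports "HOL-Analysis.Analysis"
begin

primrec Ck :: "nat \<Rightarrow> ('a::real_normed_vector \<Rightarrow> 'b::real_normed_vector) \<Rightarrow> bool" where
  "Ck 0 f \<longleftrightarrow> continuous_on UNIV f"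
| "Ck (Suc k) f \<longleftrightarrow>
     (\<forall>x. f differentiable at x) \<and> (\<forall>u. Ck k (\<lambda>x. frechet_derivative f (at x) u))"

text \<open>Used for finite-dimensional \<open>'a\<close> only, where this is the usual notion of a
  \<open>C\<close>-infinity map.\<close>

definition smooth :: "('a::real_normed_vector \<Rightarrow> 'b::real_normed_vector) \<Rightarrow> bool" where
  "smooth f \<longleftrightarrow> (\<forall>k. Ck k f)"

primrec nder :: "'a::real_normed_vector list \<Rightarrow> ('a \<Rightarrow> 'b::real_normed_vector) \<Rightarrow> 'a \<Rightarrow> 'b" where
  "nder [] f = f"
| "nder (u # us) f = (\<lambda>x. frechet_derivative (nder us f) (at x) u)"

definition pd :: "'d::finite \<Rightarrow> (real^'d \<Rightarrow> 'b::real_normed_vector) \<Rightarrow> real^'d \<Rightarrow> 'b" where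
  "pd \<alpha> u x = frechet_derivative u (at x) (axis \<alpha> 1)"

text \<open>A differential operator takes a field \<open>W\<close> and a point \<open>x\<close>; only its values on smooth
  fields are meaningful. It is a smooth function of finitely many of the derivatives of the
  components of \<open>W\<close> at \<open>x\<close>. The order is not bounded in advance, so that function is defined on
  \<open>'j \<Rightarrow> real\<close>, depends on finitely many coordinates only, and has continuous iterated partial
  derivatives of all orders (for the product topology).\<close>

definition coord_deriv :: "'j \<Rightarrow> (('j \<Rightarrow> real) \<Rightarrow> real) \<Rightarrow> ('j \<Rightarrow> real) \<Rightarrow> real" where
  "coord_deriv j g z = deriv (\<lambda>s. g (z(j := s))) (z j)"

definition smooth_fin :: "'j set \<Rightarrow> (('j \<Rightarrow> real) \<Rightarrow> real) \<Rightarrow> bool" where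
  "smooth_fin J g \<longleftrightarrow> finite J \<and>
     (\<forall>z z'. (\<forall>j\<in>J. z j = z' j) \<longrightarrow> g z = g z') \<and>
     (\<forall>js. continuous_on UNIV (foldr coord_deriv js g) \<and>
        (\<forall>j z. (\<lambda>s. foldr coord_deriv js g (z(j := s))) differentiable at (z j)))"

definition jet :: "(real^'d::finite \<Rightarrow> real^'n::finite) \<Rightarrow> real^'d \<Rightarrow> 'd list \<times> 'n \<Rightarrow> real" where
  "jet W x = (\<lambda>(as, i). nder (map (\<lambda>\<alpha>. axis \<alpha> 1) as) W x $ i)"

definition scalar_diffop ::
  "((real^'d::finite \<Rightarrow> real^'n::finite) \<Rightarrow> real^'d \<Rightarrow> real) \<Rightarrow> bool" where
  "scalar_diffop F \<longleftrightarrow>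
     (\<exists>J g. smooth_fin J g \<and> (\<forall>W x. smooth W \<longrightarrow> F W x = g (jet W x)))"

definition diffop ::
  "((real^'d::finite \<Rightarrow> real^'n::finite) \<Rightarrow> real^'d \<Rightarrow> real^'m::finite) \<Rightarrow> bool" where
  "diffop F \<longleftrightarrow> (\<forall>i. scalar_diffop (\<lambda>W x. F W x $ i))"

text \<open>\<open>dd F G\<close> is the operator written \<open>dF.G\<close>.\<close>

definition dd ::
  "((real^'d::finite \<Rightarrow> real^'n::finite) \<Rightarrow> real^'d \<Rightarrow> 'b::real_normed_vector)
    \<Rightarrow> ((real^'d \<Rightarrow> real^'n) \<Rightarrow> real^'d \<Rightarrow> real^'n) \<Rightarrow> (real^'d \<Rightarrow> real^'n) \<Rightarrow> real^'d \<Rightarrow> 'b" where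
  "dd F G W x = vector_derivative (\<lambda>s. F (\<lambda>y. W y + s *\<^sub>R G W y) x) (at 0)"

text \<open>Velocities are indexed by \<open>'q\<close>, moments by \<open>'n + 'p\<close> (conserved: \<open>Inl\<close>, nonconserved:
  \<open>Inr\<close>). Invertibility of \<open>M :: real^'q^('n + 'p)\<close> forces both index types to have the same
  cardinality.\<close>

definition join :: "real^'n::finite \<Rightarrow> real^'p::finite \<Rightarrow> real^('n + 'p)" where
  "join w y = (\<chi> i. case i of Inl a \<Rightarrow> w $ a | Inr b \<Rightarrow> y $ b)"

definition cpart :: "real^('n::finite + 'p::finite) \<Rightarrow> real^'n" where
  "cpart m = (\<chi> a. m $ Inl a)"

definition npart :: "real^('n::finite + 'p::finite) \<Rightarrow> real^'p" where
  "npart m = (\<chi> b. m $ Inr b)"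

definition diag :: "('q::finite \<Rightarrow> real) \<Rightarrow> real^'q^'q" where
  "diag c = (\<chi> i j. if i = j then c j else 0)"

definition Lam :: "('q::finite \<Rightarrow> real^'d::finite) \<Rightarrow> real^'q^('n::finite + 'p::finite)
    \<Rightarrow> (real^'d \<Rightarrow> real^('n + 'p)) \<Rightarrow> real^'d \<Rightarrow> real^('n + 'p)" where
  "Lam v M m x =
     (\<Sum>\<alpha>\<in>UNIV. (M ** diag (\<lambda>j. v j $ \<alpha>) ** matrix_inv M) *v pd \<alpha> m x)"

definition blkA :: "((real^'d::finite \<Rightarrow> real^('n::finite + 'p::finite)) \<Rightarrow> real^'d \<Rightarrow> real^('n + 'p))
    \<Rightarrow> (real^'d \<Rightarrow> real^'n) \<Rightarrow> real^'d \<Rightarrow> real^'n" where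
  "blkA L w x = cpart (L (\<lambda>y. join (w y) 0) x)"

definition blkB :: "((real^'d::finite \<Rightarrow> real^('n::finite + 'p::finite)) \<Rightarrow> real^'d \<Rightarrow> real^('n + 'p))
    \<Rightarrow> (real^'d \<Rightarrow> real^'p) \<Rightarrow> real^'d \<Rightarrow> real^'n" where
  "blkB L u x = cpart (L (\<lambda>y. join 0 (u y)) x)"

definition blkC :: "((real^'d::finite \<Rightarrow> real^('n::finite + 'p::finite)) \<Rightarrow> real^'d \<Rightarrow> real^('n + 'p))
    \<Rightarrow> (real^'d \<Rightarrow> real^'n) \<Rightarrow> real^'d \<Rightarrow> real^'p" where
  "blkC L w x = npart (L (\<lambda>y. join (w y) 0) x)"

definition blkD :: "((real^'d::finite \<Rightarrow> real^('n::finite + 'p::finite)) \<Rightarrow> real^'d \<Rightarrow> real^('n + 'p))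
    \<Rightarrow> (real^'d \<Rightarrow> real^'p) \<Rightarrow> real^'d \<Rightarrow> real^'p" where
  "blkD L u x = npart (L (\<lambda>y. join 0 (u y)) x)"

definition relax :: "real^'q::finite^('n::finite + 'p::finite) \<Rightarrow> (real^'n \<Rightarrow> real^'p) \<Rightarrow> real^'p^'p
    \<Rightarrow> real^'q \<Rightarrow> real^'q" where
  "relax M \<Phi> S g =
     (let W = cpart (M *v g); Y = npart (M *v g)
      in matrix_inv M *v join W (Y + S *v (\<Phi> W - Y)))"

text \<open>\<open>f h (x, t)\<close> is the particle distribution of the scheme with time step \<open>h\<close>. The function
  below is \<open>f_j(x, t + h) - f*_j(x - h v_j, t)\<close>, so it vanishes identically for an exact
  solution of the scheme.\<close>

definition residual :: "('q::finite \<Rightarrow> real^'d::finite) \<Rightarrow> real^'q^('n::finite + 'p::finite)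
    \<Rightarrow> (real^'n \<Rightarrow> real^'p) \<Rightarrow> real^'p^'p
    \<Rightarrow> (real \<Rightarrow> ((real^'d) \<times> real) \<Rightarrow> real^'q) \<Rightarrow> real \<Rightarrow> ((real^'d) \<times> real) \<Rightarrow> real^'q" where
  "residual v M \<Phi> S f h z =
     (\<chi> j. f h (fst z, snd z + h) $ j - relax M \<Phi> S (f h (fst z - h *\<^sub>R v j, snd z)) $ j)"

definition unif_O :: "nat \<Rightarrow> 'a set \<Rightarrow> (real \<Rightarrow> 'a \<Rightarrow> 'b::real_normed_vector) \<Rightarrow> bool" where
  "unif_O n K u \<longleftrightarrow> (\<exists>C. \<forall>\<^sub>F h in at_right 0. \<forall>z\<in>K. norm (u h z) \<le> C * h ^ n)"

text \<open>Very regular: smooth in space-time, with all derivatives locally bounded as \<open>h\<close> tends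
  to \<open>0\<close>. No expansion in powers of \<open>h\<close> is presupposed.\<close>

definition very_regular :: "(real \<Rightarrow> ((real^'d::finite) \<times> real) \<Rightarrow> real^'q::finite) \<Rightarrow> bool" where
  "very_regular f \<longleftrightarrow> (\<forall>\<^sub>F h in at_right 0. smooth (f h)) \<and>
     (\<forall>us K. compact K \<longrightarrow> unif_O 0 K (\<lambda>h. nder us (f h)))"

text \<open>The scheme relation holds at time \<open>t\<close> up to an \<open>O(h^5)\<close> remainder that may be differentiated
  \<open>r\<close> times in space and time. Exact very regular solutions satisfy this at every \<open>t\<close> and for
  every \<open>r\<close>. Asking for it at one time only is what makes the expansion formal: the equations
  \<open>\<partial>\<^sub>t W + \<Gamma>\<^sub>1(W) + ... = 0\<close> need not be solvable on any time interval.\<close>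

definition scheme_at :: "nat \<Rightarrow> ('q::finite \<Rightarrow> real^'d::finite) \<Rightarrow> real^'q^('n::finite + 'p::finite)
    \<Rightarrow> (real^'n \<Rightarrow> real^'p) \<Rightarrow> real^'p^'p
    \<Rightarrow> (real \<Rightarrow> ((real^'d) \<times> real) \<Rightarrow> real^'q) \<Rightarrow> real \<Rightarrow> bool" where
  "scheme_at r v M \<Phi> S f t \<longleftrightarrow>
     (\<forall>us K. length us \<le> r \<longrightarrow> compact K \<longrightarrow>
        unif_O 5 (K \<times> {t}) (\<lambda>h. nder us (residual v M \<Phi> S f h)))"

definition taylor_expansion :: "('q::finite \<Rightarrow> real^'d::finite) \<Rightarrow> real^'q^('n::finite + 'p::finite)
    \<Rightarrow> (real^'n \<Rightarrow> real^'p) \<Rightarrow> real^'p^'p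
    \<Rightarrow> (nat \<Rightarrow> (real^'d \<Rightarrow> real^'n) \<Rightarrow> real^'d \<Rightarrow> real^'n)
    \<Rightarrow> (nat \<Rightarrow> (real^'d \<Rightarrow> real^'n) \<Rightarrow> real^'d \<Rightarrow> real^'p) \<Rightarrow> bool" where
  "taylor_expansion v M \<Phi> S \<Gamma> \<Psi> \<longleftrightarrow>
     (\<forall>k\<in>{1..4}. diffop (\<Gamma> k)) \<and> (\<forall>k\<in>{1..3}. diffop (\<Psi> k)) \<and>
     (\<exists>r. \<forall>f t K. very_regular f \<longrightarrow> scheme_at r v M \<Phi> S f t \<longrightarrow> compact K \<longrightarrow>
        (let W = (\<lambda>h s x. cpart (M *v f h (x, s))); Y = (\<lambda>h s x. npart (M *v f h (x, s)))
         in unif_O 4 K (\<lambda>h x. vector_derivative (\<lambda>s. W h s x) (at t)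
                               + (\<Sum>k=1..4. h ^ (k - 1) *\<^sub>R \<Gamma> k (W h t) x)) \<and>
            unif_O 4 K (\<lambda>h x. Y h t x - (\<Phi> (W h t x)
                               + matrix_inv S *v (\<Sum>k=1..3. h ^ k *\<^sub>R \<Psi> k (W h t) x)))))"

text \<open>A time derivation acts on scalar differential operators \<open>F\<close>, i.e. on the quantities
  \<open>F(W)\<close>, and componentwise on vector-valued ones; by linearity it then commutes with constant
  matrices.\<close>

definition lift ::
  "(((real^'d::finite \<Rightarrow> real^'n::finite) \<Rightarrow> real^'d \<Rightarrow> real) \<Rightarrow> (real^'d \<Rightarrow> real^'n) \<Rightarrow> real^'d \<Rightarrow> real)
    \<Rightarrow> ((real^'d \<Rightarrow> real^'n) \<Rightarrow> real^'d \<Rightarrow> real^'m::finite)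
    \<Rightarrow> (real^'d \<Rightarrow> real^'n) \<Rightarrow> real^'d \<Rightarrow> real^'m" where
  "lift T F W x = (\<chi> i. T (\<lambda>U y. F U y $ i) W x)"

definition time_derivation ::
  "(((real^'d::finite \<Rightarrow> real^'n::finite) \<Rightarrow> real^'d \<Rightarrow> real) \<Rightarrow> (real^'d \<Rightarrow> real^'n) \<Rightarrow> real^'d \<Rightarrow> real)
    \<Rightarrow> bool" where
  "time_derivation T \<longleftrightarrow>
     (\<forall>F. scalar_diffop F \<longrightarrow> scalar_diffop (T F)) \<and>
     (\<forall>F G a b W x. scalar_diffop F \<longrightarrow> scalar_diffop G \<longrightarrow> smooth W \<longrightarrow>
        T (\<lambda>U y. a * F U y + b * G U y) W x = a * T F W x + b * T G W x) \<and>
     (\<forall>F \<alpha> W x. scalar_diffop F \<longrightarrow> smooth W \<longrightarrow> T (\<lambda>U. pd \<alpha> (F U)) W x = pd \<alpha> (T F W) x) \<and>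
     (\<forall>F W x. scalar_diffop F \<longrightarrow> smooth W \<longrightarrow> T F W x = dd F (lift T (\<lambda>U. U)) W x)"

text \<open>A formal power series in \<open>\<epsilon>\<close> is the sequence of its coefficients. If the operator \<open>P\<close> on
  series raises the order in \<open>\<epsilon>\<close> by at least one, then \<open>exp_series P\<close> is its exponential.\<close>

definition exp_series ::
  "((nat \<Rightarrow> (real^'d::finite \<Rightarrow> real^'n::finite) \<Rightarrow> real^'d \<Rightarrow> real^'m::finite)
     \<Rightarrow> nat \<Rightarrow> (real^'d \<Rightarrow> real^'n) \<Rightarrow> real^'d \<Rightarrow> real^'m)
    \<Rightarrow> (nat \<Rightarrow> (real^'d \<Rightarrow> real^'n) \<Rightarrow> real^'d \<Rightarrow> real^'m)
    \<Rightarrow> nat \<Rightarrow> (real^'d \<Rightarrow> real^'n) \<Rightarrow> real^'d \<Rightarrow> real^'m" where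
  "exp_series P u N W x = (\<Sum>l\<le>N. (1 / fact l) *\<^sub>R (P ^^ l) u N W x)"

text \<open>The operators \<open>\<epsilon>\<tau>\<^sub>0\<partial>\<^sub>t\<close>, with \<open>\<partial>\<^sub>t\<close> the sum of the \<open>\<epsilon>^(k - 1) T k\<close> for \<open>1 \<le> k \<le> 4\<close>,
  and \<open>-\<epsilon>\<tau>\<^sub>0\<Lambda>\<close>.\<close>

definition time_step ::
  "real \<Rightarrow> (nat \<Rightarrow> ((real^'d::finite \<Rightarrow> real^'n::finite) \<Rightarrow> real^'d \<Rightarrow> real)
                \<Rightarrow> (real^'d \<Rightarrow> real^'n) \<Rightarrow> real^'d \<Rightarrow> real)
    \<Rightarrow> (nat \<Rightarrow> (real^'d \<Rightarrow> real^'n) \<Rightarrow> real^'d \<Rightarrow> real^'m::finite)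
    \<Rightarrow> nat \<Rightarrow> (real^'d \<Rightarrow> real^'n) \<Rightarrow> real^'d \<Rightarrow> real^'m" where
  "time_step \<tau>\<^sub>0 T u N W x = (\<Sum>k\<in>{1..min 4 N}. \<tau>\<^sub>0 *\<^sub>R lift (T k) (u (N - k)) W x)"

definition space_step ::
  "real \<Rightarrow> ('q::finite \<Rightarrow> real^'d::finite) \<Rightarrow> real^'q^('n::finite + 'p::finite)
    \<Rightarrow> (nat \<Rightarrow> (real^'d \<Rightarrow> real^'n) \<Rightarrow> real^'d \<Rightarrow> real^('n + 'p))
    \<Rightarrow> nat \<Rightarrow> (real^'d \<Rightarrow> real^'n) \<Rightarrow> real^'d \<Rightarrow> real^('n + 'p)" where
  "space_step \<tau>\<^sub>0 v M u N W x = (if N = 0 then 0 else - \<tau>\<^sub>0 *\<^sub>R Lam v M (u (N - 1) W) x)"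

text \<open>Coefficients of \<open>m = (W, Y)\<close> and \<open>m* = (W, Y + S(\<Phi>(W) - Y))\<close> for the postulated \<open>Y\<close>.
  The ones of order 4 and more are not postulated; the identification below does not use them.\<close>

definition ce_Y :: "(real^'n::finite \<Rightarrow> real^'p::finite) \<Rightarrow> real^'p^'p \<Rightarrow> real
    \<Rightarrow> (nat \<Rightarrow> (real^'d::finite \<Rightarrow> real^'n) \<Rightarrow> real^'d \<Rightarrow> real^'p)
    \<Rightarrow> nat \<Rightarrow> (real^'d \<Rightarrow> real^'n) \<Rightarrow> real^'d \<Rightarrow> real^'p" where
  "ce_Y \<Phi> S \<tau>\<^sub>0 \<Psi> N W x =
     (if N = 0 then \<Phi> (W x)
      else if N \<le> 3 then matrix_inv S *v (\<tau>\<^sub>0 ^ N *\<^sub>R \<Psi> N W x) else 0)"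

definition ce_m :: "(real^'n::finite \<Rightarrow> real^'p::finite) \<Rightarrow> real^'p^'p \<Rightarrow> real
    \<Rightarrow> (nat \<Rightarrow> (real^'d::finite \<Rightarrow> real^'n) \<Rightarrow> real^'d \<Rightarrow> real^'p)
    \<Rightarrow> nat \<Rightarrow> (real^'d \<Rightarrow> real^'n) \<Rightarrow> real^'d \<Rightarrow> real^('n + 'p)" where
  "ce_m \<Phi> S \<tau>\<^sub>0 \<Psi> N W x = join (if N = 0 then W x else 0) (ce_Y \<Phi> S \<tau>\<^sub>0 \<Psi> N W x)"

definition ce_mstar :: "(real^'n::finite \<Rightarrow> real^'p::finite) \<Rightarrow> real^'p^'p \<Rightarrow> real
    \<Rightarrow> (nat \<Rightarrow> (real^'d::finite \<Rightarrow> real^'n) \<Rightarrow> real^'d \<Rightarrow> real^'p)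
    \<Rightarrow> nat \<Rightarrow> (real^'d \<Rightarrow> real^'n) \<Rightarrow> real^'d \<Rightarrow> real^('n + 'p)" where
  "ce_mstar \<Phi> S \<tau>\<^sub>0 \<Psi> N W x =
     join (if N = 0 then W x else 0)
       (ce_Y \<Phi> S \<tau>\<^sub>0 \<Psi> N W x
        + S *v ((if N = 0 then \<Phi> (W x) else 0) - ce_Y \<Phi> S \<tau>\<^sub>0 \<Psi> N W x))"

text \<open>Since \<open>Y\<close> is postulated up to \<open>O(\<epsilon>^4)\<close>, the identification of
  \<open>exp(\<epsilon>\<tau>\<^sub>0\<partial>\<^sub>t) m = exp(-\<epsilon>\<tau>\<^sub>0\<Lambda>) m*\<close> is possible up to order 4 for the conserved block
  (where \<open>W* = W\<close>) and up to order 3 for the nonconserved block.\<close>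

definition chapman_enskog :: "('q::finite \<Rightarrow> real^'d::finite) \<Rightarrow> real^'q^('n::finite + 'p::finite)
    \<Rightarrow> (real^'n \<Rightarrow> real^'p) \<Rightarrow> real^'p^'p \<Rightarrow> real
    \<Rightarrow> (nat \<Rightarrow> (real^'d \<Rightarrow> real^'n) \<Rightarrow> real^'d \<Rightarrow> real^'n)
    \<Rightarrow> (nat \<Rightarrow> (real^'d \<Rightarrow> real^'n) \<Rightarrow> real^'d \<Rightarrow> real^'p) \<Rightarrow> bool" where
  "chapman_enskog v M \<Phi> S \<tau>\<^sub>0 \<Gamma> \<Psi> \<longleftrightarrow>
     (\<forall>k\<in>{1..4}. diffop (\<Gamma> k)) \<and> (\<forall>k\<in>{1..3}. diffop (\<Psi> k)) \<and>
     (\<exists>T. (\<forall>k\<in>{1..4}. time_derivation (T k) \<and>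
             (\<forall>W x. smooth W \<longrightarrow> lift (T k) (\<lambda>U. U) W x + \<tau>\<^sub>0 ^ (k - 1) *\<^sub>R \<Gamma> k W x = 0)) \<and>
          (\<forall>W x. smooth W \<longrightarrow>
             (\<forall>N\<le>4. cpart (exp_series (time_step \<tau>\<^sub>0 T) (ce_m \<Phi> S \<tau>\<^sub>0 \<Psi>) N W x) =
                     cpart (exp_series (space_step \<tau>\<^sub>0 v M) (ce_mstar \<Phi> S \<tau>\<^sub>0 \<Psi>) N W x)) \<and>
             (\<forall>N\<le>3. npart (exp_series (time_step \<tau>\<^sub>0 T) (ce_m \<Phi> S \<tau>\<^sub>0 \<Psi>) N W x) =
                     npart (exp_series (space_step \<tau>\<^sub>0 v M) (ce_mstar \<Phi> S \<tau>\<^sub>0 \<Psi>) N W x))))"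

end

theory Submission
  imports Defs "HOL-Library.Function_Algebras"
begin

text \<open>Write h for the time step, m = (W, Y) for the moments, m' = (W, Y') for the relaxed
  moments, and R = h (d/dt + Lambda). Since Lambda has constant coefficients, it commutes with d/dt,
  so the scheme exp(h d/dt) m = exp(-h Lambda) m' is the same as exp(R) m = m'. Put P = S (Y -
  \<Phi>(W)). Relaxation conserves W, hence m - m' = (0, P), and the mean of m and m' is g = (W,
  \<Phi>(W) + \<Sigma> P) with \<Sigma> = S^-1 - I/2. In the symmetric variables g and m' - m the
  relation exp(R) m = m' becomes m' - m = 2 tanh(R/2) g. As x coth x = 1 + x^2/3 + O(x^4), R raises
  the order in h by one and P has order one, this amounts to

  R g + (0, P) + R^2 (0, P) / 12 = 0 up to terms of order 5,

  an equation with very few terms (\<open>exp_diff_iff\<close>, \<open>exp4_iff_tanh\<close>).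

  In either expansion, the time derivative of F(W) is minus the sum of the h^(k-1) dF.\<Gamma>_k, by
  the chain rule, and P is the sum of the h^k \<Psi>_k. The coefficient of h^N in the equation above
  then has conserved part \<open>recC\<close> - \<Gamma>_N and nonconserved part \<Psi>_N -
  \<open>recN\<close> (\<open>Z_join\<close>). Here \<open>recC\<close> involves only lower orders,
  and \<open>recN\<close> only lower orders and \<Gamma>_N (\<open>rec_cong\<close>). The system is
  triangular, so on smooth fields it has exactly one solution (\<open>rec_exists\<close>,
  \<open>rec_unique\<close>). The theorem follows once both expansions are shown to be governed by
  this recursion.

  For Chapman-Enskog the equation is an identity of formal series, and \<open>CE_iff\<close> shows
  that the postulated identification is equivalent to the recursion.

  For the Taylor expansion two things are needed. First, the solution of the recursion is an
  expansion of every very regular approximate solution of the scheme (\<open>taylor_exists\<close>).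
  The remainders \<open>eta\<close> of the evolution equation and \<open>delta\<close> of P satisfy
  (h eta, delta) = O(h^5) up to terms that are smaller than the remainders themselves, so their
  orders improve alternately up to 4 (\<open>npart_Zfam\<close>, \<open>cpart_Zfam\<close>,
  \<open>eta_delta_neg\<close>). Second, no other operators have this property
  (\<open>taylor_unique\<close>). For every smooth field W0 there is an approximate solution of the
  scheme that equals W0 at time 0 and follows the recursion there (\<open>formal_solution\<close>,
  \<open>approximate_solution\<close>). Comparing polynomials in h at one point identifies all
  coefficients.

  The displayed formulas are the recursion at orders 1 to 4. Only \<Gamma>_4 needs a rearrangement,
  in which the formulas for \<Psi>_1 and \<Psi>_2 are differentiated once more
  (\<open>explicit_formulas\<close>).\<close>

subsection \<open>Directional derivatives and smooth maps\<close>

definition dir :: "'a::real_normed_vector \<Rightarrow> ('a \<Rightarrow> 'b::real_normed_vector) \<Rightarrow> 'a \<Rightarrow> 'b" where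
  "dir u f x = frechet_derivative f (at x) u"

lemma dir_eqI: "(f has_derivative f') (at x) \<Longrightarrow> dir u f x = f' u"
  unfolding dir_def by (metis frechet_derivative_at)

lemma has_derivative_dir: "f differentiable at x \<Longrightarrow> (f has_derivative (\<lambda>u. dir u f x)) (at x)"
  unfolding dir_def by (simp add: frechet_derivative_works[symmetric])

lemma linear_dir: "f differentiable at x \<Longrightarrow> linear (\<lambda>u. dir u f x)"
  using has_derivative_dir has_derivative_linear by blast

lemma pd_dir: "pd \<alpha> f = dir (axis \<alpha> 1) f"
  by (simp add: fun_eq_iff pd_def dir_def)

lemma nder_Cons_dir: "nder (u # us) f = dir u (nder us f)"
  by (simp add: fun_eq_iff dir_def)

lemma nder_append: "nder (us @ vs) f = nder us (nder vs f)"
  by (induction us) auto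

lemma nder_snoc: "nder (us @ [u]) f = nder us (dir u f)"
  by (simp add: nder_append dir_def[abs_def])

lemma smooth_unfold:
  "smooth f \<longleftrightarrow> (\<forall>x. f differentiable at x) \<and> (\<forall>u. smooth (dir u f))"
proof
  assume "smooth f"
  then have "Ck (Suc k) f" for k by (simp add: smooth_def)
  then show "(\<forall>x. f differentiable at x) \<and> (\<forall>u. smooth (dir u f))"
    by (simp add: smooth_def dir_def[abs_def])
next
  assume r: "(\<forall>x. f differentiable at x) \<and> (\<forall>u. smooth (dir u f))"
  have "Ck k f" for k
  proof (cases k)
    case 0
    then show ?thesis using r
      by (auto intro!: continuous_at_imp_continuous_on differentiable_imp_continuous_within)
  next
    case (Suc j)
    then show ?thesis using r by (simp add: smooth_def dir_def[abs_def])
  qed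
  then show "smooth f" by (simp add: smooth_def)
qed

lemma smooth_differentiable: "smooth f \<Longrightarrow> f differentiable at x"
  using smooth_unfold by blast

lemma smooth_dir: "smooth f \<Longrightarrow> smooth (dir u f)"
  using smooth_unfold by blast

lemma smooth_nder: "smooth f \<Longrightarrow> smooth (nder us f)"
  by (induction us) (auto simp: smooth_dir nder_Cons_dir simp del: nder.simps(2))

lemma smooth_continuous: "smooth f \<Longrightarrow> continuous_on UNIV f"
  by (auto intro!: continuous_at_imp_continuous_on differentiable_imp_continuous_within
      smooth_differentiable)

lemma has_derivative_smooth: "smooth f \<Longrightarrow> (f has_derivative (\<lambda>u. dir u f x)) (at x)"
  by (simp add: has_derivative_dir smooth_differentiable)

lemma dir_lin_direction:
  assumes "smooth f"
  shows "dir (a *\<^sub>R u + b *\<^sub>R v) f x = a *\<^sub>R dir u f x + b *\<^sub>R dir v f x"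
  using linear_dir[OF smooth_differentiable[OF assms, of x]]
  by (simp add: linear_iff)

lemma dir_bounded_linear:
  assumes "bounded_linear T" "f differentiable at x"
  shows "dir u (\<lambda>x. T (f x)) x = T (dir u f x)"
  by (rule dir_eqI) (rule bounded_linear.has_derivative[OF assms(1) has_derivative_dir[OF assms(2)]])

lemma dir_add:
  "f differentiable at x \<Longrightarrow> g differentiable at x \<Longrightarrow> dir u (\<lambda>x. f x + g x) x = dir u f x + dir u g x"
  by (rule dir_eqI) (intro has_derivative_add has_derivative_dir)

lemma dir_bilinear:
  assumes "bounded_bilinear bm" "f differentiable at x" "g differentiable at x"
  shows "dir u (\<lambda>x. bm (f x) (g x)) x = bm (f x) (dir u g x) + bm (dir u f x) (g x)"
  by (rule dir_eqI)
    (rule bounded_bilinear.FDERIV[OF assms(1) has_derivative_dir[OF assms(2)] has_derivative_dir[OF assms(3)]])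

lemma dir_comp_linear:
  assumes "bounded_linear l" "f differentiable at (l x)"
  shows "dir u (\<lambda>x. f (l x)) x = dir (l u) f (l x)"
proof (rule dir_eqI)
  have "(l has_derivative l) (at x)" using assms(1) by (simp add: bounded_linear_imp_has_derivative)
  from has_derivative_compose[OF this has_derivative_dir[OF assms(2)]]
  show "((\<lambda>x. f (l x)) has_derivative (\<lambda>u. dir (l u) f (l x))) (at x)" .
qed

lemma dir_translate:
  assumes "f differentiable at (x + c)"
  shows "dir u (\<lambda>x. f (x + c)) x = dir u f (x + c)"
proof (rule dir_eqI)
  have "((\<lambda>x. x + c) has_derivative (\<lambda>u. u + 0)) (at x)"
    by (intro has_derivative_add has_derivative_ident has_derivative_const)
  then have "((\<lambda>x. x + c) has_derivative (\<lambda>u. u)) (at x)" by simp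
  from has_derivative_compose[OF this has_derivative_dir[OF assms(1)]]
  show "((\<lambda>x. f (x + c)) has_derivative (\<lambda>u. dir u f (x + c))) (at x)" .
qed

section \<open>Functions depending on the time step, with locally bounded derivatives of every
  order\<close>

subsection \<open>Regular families\<close>

lemma unif_O_mono: "unif_O n K u \<Longrightarrow> K' \<subseteq> K \<Longrightarrow> unif_O n K' u"
  unfolding unif_O_def by (elim exE, rule exI, erule eventually_mono) auto

lemma unif_O_bound:
  assumes "unif_O n K u"
  obtains C where "C \<ge> 0" "\<forall>\<^sub>F h in at_right 0. \<forall>z\<in>K. norm (u h z) \<le> C * h ^ n"
proof -
  obtain C where C: "\<forall>\<^sub>F h in at_right 0. \<forall>z\<in>K. norm (u h z) \<le> C * h ^ n"
    using assms unif_O_def by blast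
  have "\<forall>\<^sub>F h in at_right 0. \<forall>z\<in>K. norm (u h z) \<le> \<bar>C\<bar> * h ^ n"
    using C eventually_at_right_less[of 0]
  proof eventually_elim
    case (elim h)
    have "C * h ^ n \<le> \<bar>C\<bar> * h ^ n" using elim by (simp add: mult_right_mono)
    then show ?case using elim(1) by (meson order_trans)
  qed
  then show thesis using that[of "\<bar>C\<bar>"] by simp
qed

lemma unif_O_add:
  assumes "unif_O n K u" "unif_O n K v"
  shows "unif_O n K (\<lambda>h z. u h z + v h z)"
proof -
  obtain C where C: "\<forall>\<^sub>F h in at_right 0. \<forall>z\<in>K. norm (u h z) \<le> C * h ^ n"
    using assms(1) unif_O_def by blast
  obtain D where D: "\<forall>\<^sub>F h in at_right 0. \<forall>z\<in>K. norm (v h z) \<le> D * h ^ n"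
    using assms(2) unif_O_def by blast
  show ?thesis unfolding unif_O_def
    using C D by (intro exI[of _ "C + D"], eventually_elim) (auto simp: algebra_simps intro: norm_triangle_mono)
qed

lemma unif_O_bilinear:
  assumes "bounded_bilinear bm" "unif_O m K u" "unif_O n K v"
  shows "unif_O (m + n) K (\<lambda>h z. bm (u h z) (v h z))"
proof -
  obtain C where C: "C \<ge> 0" "\<forall>\<^sub>F h in at_right 0. \<forall>z\<in>K. norm (u h z) \<le> C * h ^ m"
    using unif_O_bound[OF assms(2)] .
  obtain D where D: "D \<ge> 0" "\<forall>\<^sub>F h in at_right 0. \<forall>z\<in>K. norm (v h z) \<le> D * h ^ n"
    using unif_O_bound[OF assms(3)] .
  obtain E where E: "E \<ge> 0" "\<And>a b. norm (bm a b) \<le> norm a * norm b * E"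
    using bounded_bilinear.nonneg_bounded[OF assms(1)] by blast
  have "\<forall>\<^sub>F h in at_right 0. \<forall>z\<in>K. norm (bm (u h z) (v h z)) \<le> (C * D * E) * h ^ (m + n)"
    using C(2) D(2) eventually_at_right_less[of 0]
  proof eventually_elim
    case (elim h)
    have "norm (bm (u h z) (v h z)) \<le> (C * D * E) * h ^ (m + n)" if "z \<in> K" for z
    proof -
      have "norm (u h z) * norm (v h z) \<le> (C * h ^ m) * (D * h ^ n)"
        using elim that C(1) D(1) by (intro mult_mono) auto
      then have "norm (u h z) * norm (v h z) * E \<le> (C * h ^ m) * (D * h ^ n) * E"
        using E(1) by (simp add: mult_right_mono)
      then show ?thesis using E(2)[of "u h z" "v h z"] by (simp add: power_add mult_ac)
    qed
    then show ?case by blast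
  qed
  then show ?thesis unfolding unif_O_def by blast
qed

lemma unif_O_linear:
  assumes "bounded_linear T" "unif_O n K u"
  shows "unif_O n K (\<lambda>h z. T (u h z))"
proof -
  obtain C where C: "C \<ge> 0" "\<forall>\<^sub>F h in at_right 0. \<forall>z\<in>K. norm (u h z) \<le> C * h ^ n"
    using unif_O_bound[OF assms(2)] .
  obtain E where E: "E \<ge> 0" "\<And>a. norm (T a) \<le> norm a * E"
    using bounded_linear.nonneg_bounded[OF assms(1)] by blast
  have "\<forall>\<^sub>F h in at_right 0. \<forall>z\<in>K. norm (T (u h z)) \<le> (C * E) * h ^ n"
    using C(2)
  proof eventually_elim
    case (elim h)
    show ?case
    proof
      fix z assume "z \<in> K"
      then have "norm (u h z) * E \<le> C * h ^ n * E" using elim E(1) by (simp add: mult_right_mono)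
      then show "norm (T (u h z)) \<le> (C * E) * h ^ n" using E(2)[of "u h z"] by (simp add: mult_ac)
    qed
  qed
  then show ?thesis unfolding unif_O_def by blast
qed

text \<open>A sequence of families of functions, indexed by the time step. The sequence index serves to
  state properties that hold to any prescribed order of differentiation from some index on.\<close>

type_synonym ('a, 'b) fam = "nat \<Rightarrow> real \<Rightarrow> 'a \<Rightarrow> 'b"

definition bdd :: "('a::real_normed_vector, 'b::real_normed_vector) fam \<Rightarrow> bool" where
  "bdd u \<longleftrightarrow> (\<forall>N K. compact K \<longrightarrow> unif_O 0 K (u N))"

text \<open>Smoothness is asked for every \<open>h\<close>, not only for small ones, so that
  derivatives can be computed without side conditions; bounds are asked for small \<open>h\<close>
  only. Nothing is uniform in the sequence index: the members of a sequence may be unrelated to each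
  other.\<close>

definition reg :: "('a::real_normed_vector, 'b::real_normed_vector) fam \<Rightarrow> bool" where
  "reg u \<longleftrightarrow> (\<forall>N h. smooth (u N h)) \<and> (\<forall>us. bdd (\<lambda>N h. nder us (u N h)))"

abbreviation fdir :: "'a::real_normed_vector \<Rightarrow> ('a, 'b::real_normed_vector) fam \<Rightarrow> ('a, 'b) fam" where
  "fdir e u \<equiv> (\<lambda>N h. dir e (u N h))"

lemma reg_smooth: "reg u \<Longrightarrow> smooth (u N h)"
  by (simp add: reg_def)

lemma reg_differentiable: "reg u \<Longrightarrow> u N h differentiable at x"
  by (simp add: reg_def smooth_differentiable)

lemma reg_bdd: "reg u \<Longrightarrow> bdd u"
  unfolding reg_def by (drule conjunct2, drule spec[of _ "[]"]) simp

lemma reg_fdir: "reg u \<Longrightarrow> reg (fdir e u)"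
  unfolding reg_def by (auto simp: smooth_dir nder_snoc[symmetric])

lemma reg_nder: "reg u \<Longrightarrow> reg (\<lambda>N h. nder us (u N h))"
  unfolding reg_def by (auto simp: smooth_nder nder_append[symmetric])

text \<open>Regularity is the largest class of differentiable, locally bounded families that is
  closed under directional derivatives. With this principle a closure property requires only a first
  derivative, never a formula for higher ones.\<close>

lemma reg_coinduct:
  assumes X: "X u"
    and step: "\<And>u. X u \<Longrightarrow> (\<forall>N h x. u N h differentiable at x) \<and> bdd u \<and> (\<forall>e. X (fdir e u))"
  shows "reg u"
proof -
  have "X u \<Longrightarrow> Ck k (u N h)" for k N h u
  proof (induction k arbitrary: u)
    case 0
    then show ?case using step[OF 0]
      by (auto intro!: continuous_at_imp_continuous_on differentiable_imp_continuous_within)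
  next
    case (Suc k)
    then have "X (fdir e u)" for e using step by blast
    from Suc.IH[OF this] show ?case using step[OF Suc.prems] by (simp add: dir_def[abs_def])
  qed
  then have "smooth (u N h)" for N h using X by (simp add: smooth_def)
  moreover have "X u \<Longrightarrow> bdd (\<lambda>N h. nder us (u N h))" for us u
    by (induction us arbitrary: u rule: rev_induct) (use step in \<open>auto simp: nder_snoc\<close>)
  ultimately show ?thesis using X by (simp add: reg_def)
qed

lemma bdd_add: "bdd u \<Longrightarrow> bdd v \<Longrightarrow> bdd (\<lambda>N h x. u N h x + v N h x)"
  unfolding bdd_def by (simp add: unif_O_add)

lemma bdd_bilinear:
  fixes u :: "('x::real_normed_vector, 'b::real_normed_vector) fam"
  assumes "bounded_bilinear bm" "bdd u" "bdd v"
  shows "bdd (\<lambda>N h x. bm (u N h x) (v N h x))"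
  unfolding bdd_def
proof (intro allI impI)
  fix N and K :: "'x set" assume K: "compact K"
  have "unif_O (0 + 0) K (\<lambda>h x. bm (u N h x) (v N h x))"
    using assms K by (intro unif_O_bilinear) (auto simp: bdd_def)
  then show "unif_O 0 K (\<lambda>h x. bm (u N h x) (v N h x))" by simp
qed

lemma bdd_linear: "bounded_linear T \<Longrightarrow> bdd u \<Longrightarrow> bdd (\<lambda>N h x. T (u N h x))"
  unfolding bdd_def by (simp add: unif_O_linear)

lemma bdd_const_fam:
  assumes "continuous_on UNIV f" shows "bdd (\<lambda>N h. f)"
  unfolding bdd_def unif_O_def
proof safe
  fix K :: "'a set" assume "compact K"
  then have "compact (f ` K)" using assms compact_continuous_image continuous_on_subset by blast
  then obtain C where "\<forall>y\<in>f ` K. norm y \<le> C" using compact_imp_bounded bounded_iff by metis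
  then show "\<exists>C. \<forall>\<^sub>F h in at_right 0. \<forall>z\<in>K. norm (f z) \<le> C * h ^ 0" by auto
qed

text \<open>A single smooth function is bounded on compact sets together with its derivatives.
  Through this equivalence every closure rule for families yields the rule for smooth
  functions.\<close>

lemma reg_const_fam_iff: "reg (\<lambda>N h. f) \<longleftrightarrow> smooth f"
  unfolding reg_def by (auto intro!: bdd_const_fam smooth_continuous smooth_nder)

lemma dir_const [simp]: "dir e (\<lambda>x. c) = (\<lambda>x. 0)"
  by (simp add: dir_def fun_eq_iff)

lemma reg_bounded_linear:
  assumes "bounded_linear T" "reg u"
  shows "reg (\<lambda>N h x. T (u N h x))"
proof (rule reg_coinduct[of "\<lambda>w. \<exists>u. reg u \<and> w = (\<lambda>N h x. T (u N h x))"])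
  show "\<exists>u'. reg u' \<and> (\<lambda>N h x. T (u N h x)) = (\<lambda>N h x. T (u' N h x))"
    by (intro exI[of _ u] conjI assms refl)
next
  fix w :: "('c, 'b) fam" assume "\<exists>u. reg u \<and> w = (\<lambda>N h x. T (u N h x))"
  then obtain u where u: "reg u" and w: "w = (\<lambda>N h x. T (u N h x))" by blast
  have d: "w N h differentiable at x" for N h x unfolding w
    using bounded_linear.has_derivative[OF assms(1) has_derivative_dir[OF reg_differentiable[OF u]]]
    by (rule differentiableI)
  have fd: "fdir e w = (\<lambda>N h x. T (fdir e u N h x))" for e
    unfolding w using dir_bounded_linear[OF assms(1) reg_differentiable[OF u]] by (simp add: fun_eq_iff)
  have "\<exists>u. reg u \<and> fdir e w = (\<lambda>N h x. T (u N h x))" for e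
    by (intro exI[of _ "fdir e u"] conjI reg_fdir u fd)
  moreover have "bdd w" unfolding w by (rule bdd_linear[OF assms(1) reg_bdd[OF u]])
  ultimately show "(\<forall>N h x. w N h differentiable at x) \<and> bdd w \<and>
      (\<forall>e. \<exists>u. reg u \<and> fdir e w = (\<lambda>N h x. T (u N h x)))" using d by simp
qed

text \<open>Sums of products are closed under the Leibniz rule, while single products are not; this
  is the invariant class for the coinduction in \<open>reg_bilinear\<close>.\<close>

inductive bilspan :: "('b::real_normed_vector \<Rightarrow> 'c::real_normed_vector \<Rightarrow> 'd::real_normed_vector)
    \<Rightarrow> ('a::real_normed_vector, 'd) fam \<Rightarrow> bool" for bm where
  bm: "reg f \<Longrightarrow> reg g \<Longrightarrow> bilspan bm (\<lambda>N h x. bm (f N h x) (g N h x))"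
| add: "bilspan bm a \<Longrightarrow> bilspan bm b \<Longrightarrow> bilspan bm (\<lambda>N h x. a N h x + b N h x)"

lemma bilspan_step:
  assumes "bounded_bilinear bm" "bilspan bm w"
  shows "(\<forall>N h x. w N h differentiable at x) \<and> bdd w \<and> (\<forall>e. bilspan bm (fdir e w))"
  using assms(2)
proof induction
  case (bm f g)
  have d: "(\<lambda>x. bm (f N h x) (g N h x)) differentiable at x" for N h x
    using bounded_bilinear.FDERIV[OF assms(1) has_derivative_dir[OF reg_differentiable[OF bm(1)]]
      has_derivative_dir[OF reg_differentiable[OF bm(2)]]] by (rule differentiableI)
  have "fdir e (\<lambda>N h x. bm (f N h x) (g N h x)) =
    (\<lambda>N h x. bm (f N h x) (fdir e g N h x) + bm (fdir e f N h x) (g N h x))" for e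
    using dir_bilinear[OF assms(1) reg_differentiable[OF bm(1)] reg_differentiable[OF bm(2)]]
    by (simp add: fun_eq_iff)
  moreover have "bilspan bm (\<lambda>N h x. bm (f N h x) (fdir e g N h x) + bm (fdir e f N h x) (g N h x))" for e
    by (intro bilspan.add bilspan.bm bm reg_fdir)
  moreover have "bdd (\<lambda>N h x. bm (f N h x) (g N h x))"
    using bm by (intro bdd_bilinear[OF assms(1)] reg_bdd)
  ultimately show ?case using d by simp
next
  case (add a b)
  have "fdir e (\<lambda>N h x. a N h x + b N h x) = (\<lambda>N h x. fdir e a N h x + fdir e b N h x)" for e
    using add.IH by (simp add: fun_eq_iff dir_add)
  moreover have "bilspan bm (\<lambda>N h x. fdir e a N h x + fdir e b N h x)" for e
    using add.IH by (intro bilspan.add) auto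
  ultimately show ?case using add.IH by (simp add: bdd_add)
qed

lemma reg_bilinear:
  assumes "bounded_bilinear bm" "reg u" "reg v"
  shows "reg (\<lambda>N h x. bm (u N h x) (v N h x))"
  by (rule reg_coinduct[of "bilspan bm"])
    (rule bilspan.bm[OF assms(2,3)], rule bilspan_step[OF assms(1)])

lemma reg_const [simp]: "reg (\<lambda>N h x. c)"
proof -
  have "smooth (\<lambda>x. c)" unfolding smooth_def
  proof
    fix k show "Ck k (\<lambda>x. c)" by (induction k arbitrary: c) auto
  qed
  then show ?thesis by (simp add: reg_const_fam_iff)
qed

lemma reg_scalar_fam:
  assumes "unif_O 0 {()} (\<lambda>h _. c h)"
  shows "reg (\<lambda>N h (x::'a::real_normed_vector). c h)"
proof -
  have sm: "smooth (\<lambda>x::'a. c h)" for h using reg_const[of "c h"] reg_const_fam_iff by blast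
  have b: "bdd (\<lambda>N h. nder us (\<lambda>x::'a. c h))" for us
  proof (cases us rule: rev_cases)
    case Nil
    then show ?thesis using assms by (auto simp: bdd_def unif_O_def)
  next
    case (snoc ys y)
    have "nder ys (\<lambda>x::'a. 0) = (\<lambda>x. 0)" by (induction ys) auto
    then show ?thesis using snoc by (auto simp: nder_snoc bdd_def unif_O_def fun_eq_iff intro!: exI[of _ 0])
  qed
  show ?thesis using sm b by (simp add: reg_def)
qed

lemma reg_h: "reg (\<lambda>N h x. h ^ k)"
proof (rule reg_scalar_fam)
  have "\<forall>\<^sub>F h in at_right 0. \<forall>z\<in>{()}. norm (h ^ k) \<le> 1 * h ^ 0"
    using eventually_at_right_real[OF zero_less_one] by eventually_elim (auto intro: power_le_one)
  then show "unif_O 0 {()} (\<lambda>h _. h ^ k :: real)" unfolding unif_O_def by blast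
qed

lemma reg_add: assumes "reg u" "reg v" shows "reg (\<lambda>N h x. u N h x + v N h x)"
proof (rule reg_coinduct[of "\<lambda>w. \<exists>u v. reg u \<and> reg v \<and> w = (\<lambda>N h x. u N h x + v N h x)"])
  fix w :: "('a, 'b) fam" assume "\<exists>u v. reg u \<and> reg v \<and> w = (\<lambda>N h x. u N h x + v N h x)"
  then obtain u v where u: "reg u" "reg v" and w: "w = (\<lambda>N h x. u N h x + v N h x)" by blast
  have fd: "fdir e w = (\<lambda>N h x. fdir e u N h x + fdir e v N h x)" for e unfolding w
    using dir_add[OF reg_differentiable[OF u(1)] reg_differentiable[OF u(2)]] by (simp add: fun_eq_iff)
  moreover have "w N h differentiable at x" for N h x
    unfolding w using u by (intro differentiable_add reg_differentiable)
  moreover have "bdd w" unfolding w using u by (intro bdd_add reg_bdd)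
  moreover have "\<exists>u v. reg u \<and> reg v \<and> fdir e w = (\<lambda>N h x. u N h x + v N h x)" for e
    by (intro exI[of _ "fdir e u"] exI[of _ "fdir e v"] conjI reg_fdir u fd)
  ultimately show "(\<forall>N h x. w N h differentiable at x) \<and> bdd w \<and>
      (\<forall>e. \<exists>u v. reg u \<and> reg v \<and> fdir e w = (\<lambda>N h x. u N h x + v N h x))" by simp
qed (intro exI[of _ u] exI[of _ v] conjI assms refl)

lemma reg_scaleR: "reg c \<Longrightarrow> reg u \<Longrightarrow> reg (\<lambda>N h x. c N h x *\<^sub>R u N h x)"
  by (rule reg_bilinear[OF bounded_bilinear_scaleR])

lemma reg_mult: "reg c \<Longrightarrow> reg u \<Longrightarrow> reg (\<lambda>N h x. c N h x * u N h x :: real)"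
  by (rule reg_bilinear[OF bounded_bilinear_mult])

lemma reg_cscaleR: "reg u \<Longrightarrow> reg (\<lambda>N h x. c *\<^sub>R u N h x)"
  by (rule reg_scaleR[OF reg_const])

lemma reg_diff: "reg u \<Longrightarrow> reg v \<Longrightarrow> reg (\<lambda>N h x. u N h x - v N h x)"
  using reg_add[of u "\<lambda>N h x. (-1) *\<^sub>R v N h x"] reg_cscaleR[of v "-1"] by simp

lemma reg_minus: "reg v \<Longrightarrow> reg (\<lambda>N h x. - v N h x)"
  using reg_cscaleR[of v "-1"] by simp

lemma reg_sum: "(\<And>i. i \<in> I \<Longrightarrow> reg (u i)) \<Longrightarrow> reg (\<lambda>N h x. \<Sum>i\<in>I. u i N h x)"
  by (induction I rule: infinite_finite_induct) (auto intro: reg_add)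

lemma reg_comp_linear:
  assumes "bounded_linear l" "reg u"
  shows "reg (\<lambda>N h x. u N h (l x))"
proof (rule reg_coinduct[of "\<lambda>w. \<exists>u. reg u \<and> w = (\<lambda>N h x. u N h (l x))"])
  fix w :: "('a, 'c) fam" assume "\<exists>u. reg u \<and> w = (\<lambda>N h x. u N h (l x))"
  then obtain u where u: "reg u" and w: "w = (\<lambda>N h x. u N h (l x))" by blast
  have fd: "fdir e w = (\<lambda>N h x. fdir (l e) u N h (l x))" for e unfolding w
    using dir_comp_linear[OF assms(1) reg_differentiable[OF u]] by (simp add: fun_eq_iff)
  have "(l has_derivative l) (at x)" for x using assms(1) by (simp add: bounded_linear_imp_has_derivative)
  from has_derivative_compose[OF this has_derivative_dir[OF reg_differentiable[OF u]]]
  have "w N h differentiable at x" for N h x unfolding w by (rule differentiableI)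
  moreover have "bdd w" unfolding bdd_def
  proof (intro allI impI)
    fix N K assume "compact (K :: 'a set)"
    then have "compact (l ` K)"
      using assms(1) compact_continuous_image linear_continuous_on by blast
    then have "unif_O 0 (l ` K) (u N)" using reg_bdd[OF u] bdd_def by blast
    then show "unif_O 0 K (w N)" unfolding w unif_O_def by simp
  qed
  moreover have "\<exists>u. reg u \<and> fdir e w = (\<lambda>N h x. u N h (l x))" for e
    by (intro exI[of _ "fdir (l e) u"] conjI reg_fdir u fd)
  ultimately show "(\<forall>N h x. w N h differentiable at x) \<and> bdd w \<and>
      (\<forall>e. \<exists>u. reg u \<and> fdir e w = (\<lambda>N h x. u N h (l x)))" by simp
qed (intro exI[of _ u] conjI assms refl)

section \<open>The chain rule for functions of finitely many coordinates in an infinite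
  product\<close>

subsection \<open>Smooth functions of finitely many coordinates\<close>

lemma smooth_fin_finite: "smooth_fin J g \<Longrightarrow> finite J"
  and smooth_fin_dep: "smooth_fin J g \<Longrightarrow> (\<And>j. j \<in> J \<Longrightarrow> z j = z' j) \<Longrightarrow> g z = g z'"
  and smooth_fin_continuous: "smooth_fin J g \<Longrightarrow> continuous_on UNIV g"
  and smooth_fin_differentiable: "smooth_fin J g \<Longrightarrow> (\<lambda>s. g (z(j := s))) differentiable at (z j)"
proof -
  assume a: "smooth_fin J g"
  show "finite J" and "(\<And>j. j \<in> J \<Longrightarrow> z j = z' j) \<Longrightarrow> g z = g z'" using a by (auto simp: smooth_fin_def)
  have "\<forall>js. continuous_on UNIV (foldr coord_deriv js g) \<and>
        (\<forall>j z. (\<lambda>s. foldr coord_deriv js g (z(j := s))) differentiable at (z j))"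
    using a by (simp add: smooth_fin_def)
  from spec[OF this, of "[]"]
  show "continuous_on UNIV g" "(\<lambda>s. g (z(j := s))) differentiable at (z j)" by auto
qed

lemma smooth_fin_DERIV:
  assumes "smooth_fin J g"
  shows "((\<lambda>s. g (z(j := s))) has_field_derivative coord_deriv j g (z(j := t))) (at t)"
  using smooth_fin_differentiable[OF assms, of "z(j := t)" j]
  by (simp add: coord_deriv_def DERIV_deriv_iff_real_differentiable)

lemma smooth_fin_coord_deriv:
  assumes "smooth_fin J g" shows "smooth_fin J (coord_deriv j g)"
  unfolding smooth_fin_def
proof (intro conjI allI impI)
  show "finite J" by (rule smooth_fin_finite[OF assms])
next
  fix z z' :: "'a \<Rightarrow> real" assume e: "\<forall>j\<in>J. z j = z' j"
  have "g (z(j := s)) = g (z'(j := s))" for s by (rule smooth_fin_dep[OF assms]) (use e in simp)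
  moreover have "coord_deriv j g z = coord_deriv j g z'" if "j \<notin> J"
  proof -
    have "g (z(j := s)) = g z" "g (z'(j := s)) = g z'" for s
      by (rule smooth_fin_dep[OF assms], use that in auto)+
    then show ?thesis by (simp add: coord_deriv_def)
  qed
  ultimately show "coord_deriv j g z = coord_deriv j g z'"
    using e by (cases "j \<in> J") (auto simp: coord_deriv_def)
next
  have all: "\<forall>js. continuous_on UNIV (foldr coord_deriv js g) \<and>
        (\<forall>j z. (\<lambda>s. foldr coord_deriv js g (z(j := s))) differentiable at (z j))"
    using assms unfolding smooth_fin_def by (elim conjE)
  fix js
  have f: "foldr coord_deriv js (coord_deriv j g) = foldr coord_deriv (js @ [j]) g" by simp
  show "continuous_on UNIV (foldr coord_deriv js (coord_deriv j g))"
    unfolding f using all by (rule allE[of _ "js @ [j]"]) simp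
  fix i z
  show "(\<lambda>s. foldr coord_deriv js (coord_deriv j g) (z(i := s))) differentiable at (z i)"
    unfolding f using all by (rule allE[of _ "js @ [j]"]) simp
qed

lemma smooth_fin_coord_deriv_outside:
  assumes "smooth_fin J g" "j \<notin> J" shows "coord_deriv j g = (\<lambda>z. 0)"
proof
  fix z
  have "g (z(j := s)) = g z" for s by (rule smooth_fin_dep[OF assms(1)]) (use assms(2) in auto)
  then show "coord_deriv j g z = 0" by (simp add: coord_deriv_def)
qed

text \<open>The analogue of \<open>reg_coinduct\<close> for iterated partial derivatives.\<close>

lemma smooth_fin_coinduct:
  assumes X: "X g" and "finite J"
    and step: "\<And>g. X g \<Longrightarrow> (\<forall>z z'. (\<forall>j\<in>J. z j = z' j) \<longrightarrow> g z = g z') \<and> continuous_on UNIV g \<and>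
      (\<forall>j z. (\<lambda>s. g (z(j := s))) differentiable at (z j)) \<and> (\<forall>j. X (coord_deriv j g))"
  shows "smooth_fin J g"
proof -
  have "X (foldr coord_deriv js g)" for js
    by (induction js) (use X step in auto)
  then show ?thesis using step X assms(2) unfolding smooth_fin_def by blast
qed

lemma smooth_fin_mono:
  assumes "smooth_fin J g" "J \<subseteq> J'" "finite J'" shows "smooth_fin J' g"
  using assms by (simp add: smooth_fin_def subset_iff)

lemma coord_deriv_eqI:
  "((\<lambda>s. g (z(j := s))) has_field_derivative d) (at (z j)) \<Longrightarrow> coord_deriv j g z = d"
  by (simp add: coord_deriv_def DERIV_imp_deriv)

lemma smooth_fin_DERIV':
  "smooth_fin J g \<Longrightarrow> ((\<lambda>s. g (z(j := s))) has_field_derivative coord_deriv j g z) (at (z j))"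
  using smooth_fin_DERIV[of J g z j "z j"] by simp

lemma smooth_fin_coord:
  shows "smooth_fin {i} (\<lambda>z. z i)"
proof (rule smooth_fin_coinduct[of "\<lambda>g. g = (\<lambda>z. z i) \<or> (\<exists>c. g = (\<lambda>z. c))"])
  fix g :: "('a \<Rightarrow> real) \<Rightarrow> real" assume "g = (\<lambda>z. z i) \<or> (\<exists>c. g = (\<lambda>z. c))"
  moreover have "coord_deriv j (\<lambda>z. z i) = (\<lambda>z. if j = i then 1 else 0)" for j
    by (auto simp: fun_eq_iff coord_deriv_def)
  moreover have "coord_deriv j (\<lambda>z::'a \<Rightarrow> real. c) = (\<lambda>z. 0)" for j c
    by (auto simp: fun_eq_iff coord_deriv_def)
  moreover have "(\<lambda>s. (z(j := s)) i) differentiable at (z j)" for j and z :: "'a \<Rightarrow> real"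
    by (cases "j = i") auto
  ultimately show "(\<forall>z z'. (\<forall>j\<in>{i}. z j = z' j) \<longrightarrow> g z = g z') \<and> continuous_on UNIV g \<and>
      (\<forall>j z. (\<lambda>s. g (z(j := s))) differentiable at (z j)) \<and>
      (\<forall>j. coord_deriv j g = (\<lambda>z. z i) \<or> (\<exists>c. coord_deriv j g = (\<lambda>z. c)))"
    by (elim disjE exE) auto
qed auto

lemma smooth_fin_const: "finite J \<Longrightarrow> smooth_fin J (\<lambda>z. c)"
proof (rule smooth_fin_coinduct[of "\<lambda>g. \<exists>c. g = (\<lambda>z. c)"])
  fix g :: "('a \<Rightarrow> real) \<Rightarrow> real" assume "\<exists>c. g = (\<lambda>z. c)"
  moreover have "coord_deriv j (\<lambda>z::'a \<Rightarrow> real. c) = (\<lambda>z. 0)" for j c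
    by (auto simp: fun_eq_iff coord_deriv_def)
  ultimately show "(\<forall>z z'. (\<forall>j\<in>J. z j = z' j) \<longrightarrow> g z = g z') \<and> continuous_on UNIV g \<and>
      (\<forall>j z. (\<lambda>s. g (z(j := s))) differentiable at (z j)) \<and> (\<forall>j. \<exists>c. coord_deriv j g = (\<lambda>z. c))"
    by auto
qed auto

inductive sfalg :: "'j set \<Rightarrow> (('j \<Rightarrow> real) \<Rightarrow> real) \<Rightarrow> bool" for J where
  base: "smooth_fin J g \<Longrightarrow> sfalg J g"
| add: "sfalg J a \<Longrightarrow> sfalg J b \<Longrightarrow> sfalg J (\<lambda>z. a z + b z)"
| mult: "sfalg J a \<Longrightarrow> sfalg J b \<Longrightarrow> sfalg J (\<lambda>z. a z * b z)"

lemma sfalg_step: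
  assumes "sfalg J g"
  shows "(\<forall>z z'. (\<forall>j\<in>J. z j = z' j) \<longrightarrow> g z = g z') \<and> continuous_on UNIV g \<and>
      (\<forall>j z. (\<lambda>s. g (z(j := s))) differentiable at (z j)) \<and> (\<forall>j. sfalg J (coord_deriv j g))"
  using assms
proof induction
  case (base g)
  show ?case
  proof (intro conjI allI impI)
    show "g z = g z'" if "\<forall>j\<in>J. z j = z' j" for z z'
      by (rule smooth_fin_dep[OF base]) (use that in simp)
  qed (intro smooth_fin_continuous[OF base] smooth_fin_differentiable[OF base]
      sfalg.base smooth_fin_coord_deriv[OF base])+
next
  case (add a b)
  have D: "((\<lambda>s. c (z(j := s))) has_field_derivative coord_deriv j c z) (at (z j))"
    if "\<forall>j z. (\<lambda>s. c (z(j := s))) differentiable at (z j)" for c :: "('a \<Rightarrow> real) \<Rightarrow> real" and j z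
    using that by (simp add: coord_deriv_def DERIV_deriv_iff_real_differentiable)
  have "coord_deriv j (\<lambda>z. a z + b z) = (\<lambda>z. coord_deriv j a z + coord_deriv j b z)" for j
    by (rule ext, rule coord_deriv_eqI, rule DERIV_add; rule D) (use add.IH in blast)+
  then have "sfalg J (coord_deriv j (\<lambda>z. a z + b z))" for j
    using add.IH by (auto intro!: sfalg.add)
  moreover have "\<forall>z z'. (\<forall>j\<in>J. z j = z' j) \<longrightarrow> a z + b z = a z' + b z'"
    using add.IH by metis
  moreover have "(\<lambda>s. a (z(j := s)) + b (z(j := s))) differentiable at (z j)" for j z
    by (intro differentiable_add) (use add.IH in blast)+
  moreover have "continuous_on UNIV (\<lambda>z. a z + b z)" using add.IH by (intro continuous_on_add) blast+
  ultimately show ?case by blast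
next
  case (mult a b)
  have D: "((\<lambda>s. c (z(j := s))) has_field_derivative coord_deriv j c z) (at (z j))"
    if "\<forall>j z. (\<lambda>s. c (z(j := s))) differentiable at (z j)" for c :: "('a \<Rightarrow> real) \<Rightarrow> real" and j z
    using that by (simp add: coord_deriv_def DERIV_deriv_iff_real_differentiable)
  have "((\<lambda>s. a (z(j := s)) * b (z(j := s))) has_field_derivative
      coord_deriv j a z * b z + coord_deriv j b z * a z) (at (z j))" for j z
    using DERIV_mult[OF D[of a z j] D[of b z j]] mult.IH by simp
  then have "coord_deriv j (\<lambda>z. a z * b z) = (\<lambda>z. coord_deriv j a z * b z + coord_deriv j b z * a z)" for j
    by (auto simp: fun_eq_iff intro!: coord_deriv_eqI)
  then have "sfalg J (coord_deriv j (\<lambda>z. a z * b z))" for j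
    using mult by (auto intro!: sfalg.add sfalg.mult)
  moreover have "\<forall>z z'. (\<forall>j\<in>J. z j = z' j) \<longrightarrow> a z * b z = a z' * b z'"
    using mult.IH by metis
  moreover have "(\<lambda>s. a (z(j := s)) * b (z(j := s))) differentiable at (z j)" for j z
    by (intro differentiable_mult) (use mult.IH in blast)+
  moreover have "continuous_on UNIV (\<lambda>z. a z * b z)" using mult.IH by (intro continuous_on_mult) blast+
  ultimately show ?case by blast
qed

lemma smooth_fin_add:
  assumes "smooth_fin J a" "smooth_fin J b" shows "smooth_fin J (\<lambda>z. a z + b z)"
  by (rule smooth_fin_coinduct[of "sfalg J"])
    (intro sfalg.add sfalg.base assms, rule smooth_fin_finite[OF assms(1)], rule sfalg_step)

lemma smooth_fin_mult:
  assumes "smooth_fin J a" "smooth_fin J b" shows "smooth_fin J (\<lambda>z. a z * b z)"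
  by (rule smooth_fin_coinduct[of "sfalg J"])
    (intro sfalg.mult sfalg.base assms, rule smooth_fin_finite[OF assms(1)], rule sfalg_step)

text \<open>The coordinates in \<open>A\<close> are changed one at a time and the mean value theorem
  is applied to each change. All intermediate points lie coordinatewise between \<open>z\<close> and
  \<open>z'\<close>, where the partial derivatives are within \<open>e\<close> of their value at
  \<open>z\<close>.\<close>

lemma smooth_fin_increment:
  assumes g: "smooth_fin J g" and dJ: "finite A" "A \<subseteq> J"
    and close: "\<And>y j. j \<in> J \<Longrightarrow> (\<forall>i\<in>J. \<bar>y i - z i\<bar> \<le> \<bar>z' i - z i\<bar>) \<Longrightarrow>
      \<bar>coord_deriv j g y - coord_deriv j g z\<bar> \<le> e"
  shows "\<bar>g (\<lambda>i. if i \<in> A then z' i else z i) - g z - (\<Sum>j\<in>A. coord_deriv j g z * (z' j - z j))\<bar>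
      \<le> e * (\<Sum>j\<in>A. \<bar>z' j - z j\<bar>)"
  using dJ
proof (induction A rule: finite_induct)
  case empty
  then show ?case by simp
next
  case (insert k A)
  define w where "w = (\<lambda>i. if i \<in> A then z' i else z i)"
  have w1: "(\<lambda>i. if i \<in> insert k A then z' i else z i) = w(k := z' k)"
    and w0: "w(k := z k) = w" using insert(2) by (auto simp: w_def fun_eq_iff)
  have mvt: "\<exists>t. a < t \<and> t < b \<and> g (w(k := b)) - g (w(k := a)) = (b - a) * coord_deriv k g (w(k := t))"
    if "a < b" for a b
    by (rule MVT2[OF that smooth_fin_DERIV[OF g]])
  have "\<exists>t. min (z k) (z' k) \<le> t \<and> t \<le> max (z k) (z' k) \<and>
    g (w(k := z' k)) - g (w(k := z k)) = (z' k - z k) * coord_deriv k g (w(k := t))"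
  proof -
    consider "z k < z' k" | "z k = z' k" | "z k > z' k" by linarith
    then show ?thesis
    proof cases
      case 1
      then obtain t where "z k < t" "t < z' k"
        "g (w(k := z' k)) - g (w(k := z k)) = (z' k - z k) * coord_deriv k g (w(k := t))" using mvt by blast
      then show ?thesis by (intro exI[of _ t]) simp
    next
      case 2
      then show ?thesis by (intro exI[of _ "z k"]) simp
    next
      case 3
      then obtain t where "z' k < t" "t < z k" 
        "g (w(k := z k)) - g (w(k := z' k)) = (z k - z' k) * coord_deriv k g (w(k := t))" using mvt by blast
      then show ?thesis by (intro exI[of _ t]) (simp add: algebra_simps)
    qed
  qed
  then obtain t where t: "min (z k) (z' k) \<le> t" "t \<le> max (z k) (z' k)"
    "g (w(k := z' k)) - g w = (z' k - z k) * coord_deriv k g (w(k := t))" unfolding w0 by blast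
  have "\<bar>coord_deriv k g (w(k := t)) - coord_deriv k g z\<bar> \<le> e"
    by (rule close) (use insert.prems t(1,2) in \<open>auto simp: w_def\<close>)
  then have "\<bar>(z' k - z k) * (coord_deriv k g (w(k := t)) - coord_deriv k g z)\<bar> \<le> e * \<bar>z' k - z k\<bar>"
    unfolding abs_mult by (subst mult.commute) (rule mult_right_mono, simp_all)
  moreover have "\<bar>g w - g z - (\<Sum>j\<in>A. coord_deriv j g z * (z' j - z j))\<bar> \<le> e * (\<Sum>j\<in>A. \<bar>z' j - z j\<bar>)"
    using insert w_def by simp
  ultimately have "\<bar>(z' k - z k) * (coord_deriv k g (w(k := t)) - coord_deriv k g z) +
      (g w - g z - (\<Sum>j\<in>A. coord_deriv j g z * (z' j - z j)))\<bar> \<le> e * \<bar>z' k - z k\<bar> + e * (\<Sum>j\<in>A. \<bar>z' j - z j\<bar>)"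
    by linarith
  then show ?case using t(3) insert(1,2) unfolding w1 by (simp add: algebra_simps)
qed

text \<open>A neighbourhood in the product topology contains a box. Coordinates outside
  \<open>J\<close> can be reset to those of \<open>z\<close> without changing \<open>g\<close>, so
  only the finitely many sides indexed by \<open>J\<close> restrict \<open>y\<close>, and the
  smallest of them gives \<open>d\<close>.\<close>

lemma smooth_fin_eventually_close:
  assumes g: "smooth_fin J g" and e: "e > 0"
  obtains d where "d > 0" "\<And>y. (\<forall>i\<in>J. \<bar>y i - z i\<bar> < d) \<Longrightarrow> \<bar>g y - g z\<bar> < e"
proof -
  have "open (g -` {g z - e<..<g z + e})"
    using smooth_fin_continuous[OF g] by (simp add: open_vimage)
  moreover have "z \<in> g -` {g z - e<..<g z + e}" using e by auto
  ultimately have "\<exists>X. z \<in> (\<Pi>\<^sub>E i\<in>UNIV. X i) \<and> (\<forall>i. openin euclidean (X i)) \<and>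
      finite {i. X i \<noteq> topspace euclidean} \<and> (\<Pi>\<^sub>E i\<in>UNIV. X i) \<subseteq> g -` {g z - e<..<g z + e}"
    unfolding open_fun_def by (rule product_topology_open_contains_basis)
  then obtain U where U: "z \<in> Pi\<^sub>E UNIV U" "\<And>i. open (U i)"
    "Pi\<^sub>E UNIV U \<subseteq> g -` {g z - e<..<g z + e}" by auto
  have zU: "z i \<in> U i" for i using U(1) by auto
  have "\<exists>d>0. \<forall>y. \<bar>y - z i\<bar> < d \<longrightarrow> y \<in> U i" for i
    using U(2)[of i] zU[of i] unfolding open_dist by (simp add: dist_real_def)
  then obtain d where d: "\<And>i. d i > 0" "\<And>i y. \<bar>y - z i\<bar> < d i \<Longrightarrow> y \<in> U i" by metis
  define D where "D = Min (insert 1 (d ` J))"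
  have fin: "finite J" using g smooth_fin_finite by blast
  have D: "D > 0" "\<And>i. i \<in> J \<Longrightarrow> D \<le> d i" unfolding D_def using fin d(1) by auto
  show thesis
  proof (rule that[OF D(1)])
    fix y assume y: "\<forall>i\<in>J. \<bar>y i - z i\<bar> < D"
    define y' where "y' = (\<lambda>i. if i \<in> J then y i else z i)"
    have "y' i \<in> U i" for i by (rule d(2)) (use y D d(1) in \<open>force simp: y'_def\<close>)
    then have "y' \<in> Pi\<^sub>E UNIV U" by auto
    then have "g y' \<in> {g z - e<..<g z + e}" using U(3) by blast
    then have "\<bar>g y' - g z\<bar> < e" by (auto simp: abs_less_iff)
    moreover have "g y' = g y" by (rule smooth_fin_dep[OF g]) (simp add: y'_def)
    ultimately show "\<bar>g y - g z\<bar> < e" by simp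
  qed
qed

text \<open>Continuous partial derivatives imply total differentiability; stated directly as a chain
  rule, because the space \<open>'j \<Rightarrow> real\<close> carries no norm.\<close>

lemma smooth_fin_has_derivative:
  fixes \<phi> :: "'a::real_normed_vector \<Rightarrow> 'j \<Rightarrow> real"
  assumes g: "smooth_fin J g"
    and \<phi>: "\<And>j. j \<in> J \<Longrightarrow> ((\<lambda>x. \<phi> x j) has_derivative \<phi>' j) (at x)"
  shows "((\<lambda>x. g (\<phi> x)) has_derivative (\<lambda>u. \<Sum>j\<in>J. coord_deriv j g (\<phi> x) * \<phi>' j u)) (at x)"
proof -
  have fin: "finite J" using g smooth_fin_finite by blast
  define l where "l = (\<lambda>y. \<Sum>j\<in>J. coord_deriv j g (\<phi> x) * (\<phi> y j - \<phi> x j))"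
  have l: "(l has_derivative (\<lambda>u. \<Sum>j\<in>J. coord_deriv j g (\<phi> x) * \<phi>' j u)) (at x)"
    unfolding l_def by (auto intro!: derivative_eq_intros \<phi>)
  text \<open>The remainder is \<open>o(\<Sum> \<bar>\<phi> y j - \<phi> x j\<bar>)\<close>, hence \<open>o(\<parallel>y - x\<parallel>)\<close>.\<close>
  obtain C where C: "C > 0" "\<forall>\<^sub>F y in at x. (\<Sum>j\<in>J. \<bar>\<phi> y j - \<phi> x j\<bar>) \<le> C * norm (y - x)"
  proof -
    have "\<exists>C>0. \<forall>\<^sub>F y in at x. \<bar>\<phi> y j - \<phi> x j\<bar> \<le> C * norm (y - x)" if j: "j \<in> J" for j
    proof -
      obtain B where B: "B > 0" "\<And>u. norm (\<phi>' j u) \<le> norm u * B"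
        using bounded_linear.pos_bounded[OF has_derivative_bounded_linear[OF \<phi>[OF j]]] by blast
      have "\<forall>\<^sub>F y in at x. norm (\<phi> y j - \<phi> x j - \<phi>' j (y - x)) \<le> 1 * norm (y - x)"
        using \<phi>[OF j] unfolding has_derivative_within_alt2 by (metis zero_less_one)
      then have "\<forall>\<^sub>F y in at x. \<bar>\<phi> y j - \<phi> x j\<bar> \<le> (B + 1) * norm (y - x)"
      proof eventually_elim
        case (elim y)
        then show ?case using B(2)[of "y - x"] by (simp add: algebra_simps)
      qed
      then show ?thesis using B(1) by (intro exI[of _ "B + 1"]) auto
    qed
    then obtain c where c: "\<And>j. j \<in> J \<Longrightarrow> c j > 0" 
      "\<And>j. j \<in> J \<Longrightarrow> \<forall>\<^sub>F y in at x. \<bar>\<phi> y j - \<phi> x j\<bar> \<le> c j * norm (y - x)" by metis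
    have "\<forall>\<^sub>F y in at x. \<forall>j\<in>J. \<bar>\<phi> y j - \<phi> x j\<bar> \<le> c j * norm (y - x)"
      using c(2) fin by (simp add: eventually_ball_finite_distrib)
    then have "\<forall>\<^sub>F y in at x. (\<Sum>j\<in>J. \<bar>\<phi> y j - \<phi> x j\<bar>) \<le> (sum c J + 1) * norm (y - x)"
    proof eventually_elim
      case (elim y)
      have "(\<Sum>j\<in>J. \<bar>\<phi> y j - \<phi> x j\<bar>) \<le> (\<Sum>j\<in>J. c j * norm (y - x))" using elim by (auto intro: sum_mono)
      also have "\<dots> \<le> (sum c J + 1) * norm (y - x)" by (simp add: sum_distrib_right algebra_simps)
      finally show ?case .
    qed
    moreover have "sum c J + 1 > 0" using c(1) by (metis add_nonneg_pos less_imp_le sum_nonneg zero_less_one)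
    ultimately show ?thesis using that by blast
  qed
  have r: "\<forall>\<^sub>F y in at x. norm (g (\<phi> y) - g (\<phi> x) - l y) \<le> e * norm (y - x)" if e: "e > 0" for e
  proof -
    have "\<exists>d>0. \<forall>y. (\<forall>i\<in>J. \<bar>y i - \<phi> x i\<bar> < d) \<longrightarrow> \<bar>coord_deriv j g y - coord_deriv j g (\<phi> x)\<bar> < e / C" for j
      using smooth_fin_eventually_close[OF smooth_fin_coord_deriv[OF g], of "e / C" "\<phi> x" j] e C(1)
      by (metis divide_pos_pos)
    then obtain d where d: "\<And>j. d j > 0" 
      "\<And>j y. (\<forall>i\<in>J. \<bar>y i - \<phi> x i\<bar> < d j) \<Longrightarrow> \<bar>coord_deriv j g y - coord_deriv j g (\<phi> x)\<bar> < e / C" by metis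
    define D where "D = Min (insert 1 (d ` J))"
    have D: "D > 0" "\<And>i. i \<in> J \<Longrightarrow> D \<le> d i" unfolding D_def using fin d(1) by auto
    have "\<forall>\<^sub>F y in at x. \<bar>\<phi> y j - \<phi> x j\<bar> < D" if "j \<in> J" for j
    proof -
      have "isCont (\<lambda>y. \<phi> y j) x" using \<phi>[OF that] has_derivative_continuous by blast
      then show ?thesis using D(1) unfolding isCont_def tendsto_iff dist_real_def by blast
    qed
    then have "\<forall>\<^sub>F y in at x. \<forall>j\<in>J. \<bar>\<phi> y j - \<phi> x j\<bar> < D"
      using fin by (simp add: eventually_ball_finite_distrib)
    then show ?thesis using C(2)
    proof eventually_elim
      case (elim y)
      have "\<bar>g (\<lambda>i. if i \<in> J then \<phi> y i else \<phi> x i) - g (\<phi> x) - l y\<bar> \<le> e / C * (\<Sum>j\<in>J. \<bar>\<phi> y j - \<phi> x j\<bar>)"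
        unfolding l_def
      proof (rule smooth_fin_increment[OF g fin order_refl])
        fix w j assume j: "j \<in> J" and w: "\<forall>i\<in>J. \<bar>w i - \<phi> x i\<bar> \<le> \<bar>\<phi> y i - \<phi> x i\<bar>"
        show "\<bar>coord_deriv j g w - coord_deriv j g (\<phi> x)\<bar> \<le> e / C"
          by (rule less_imp_le, rule d(2)) (use w elim(1) D(2)[OF j] in fastforce)
      qed
      moreover have "g (\<lambda>i. if i \<in> J then \<phi> y i else \<phi> x i) = g (\<phi> y)"
        by (rule smooth_fin_dep[OF g]) simp
      moreover have "e / C * (\<Sum>j\<in>J. \<bar>\<phi> y j - \<phi> x j\<bar>) \<le> e / C * (C * norm (y - x))"
        using elim(2) e C(1) by (intro mult_left_mono) auto
      ultimately show ?case using C(1) by simp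
    qed
  qed
  have "((\<lambda>y. g (\<phi> y) - g (\<phi> x) - l y) has_derivative (\<lambda>u. 0)) (at x)"
    unfolding has_derivative_within_alt2 using r by (auto simp: l_def)
  from has_derivative_add[OF this l] have "((\<lambda>y. g (\<phi> y) - g (\<phi> x)) has_derivative (\<lambda>u. \<Sum>j\<in>J. coord_deriv j g (\<phi> x) * \<phi>' j u)) (at x)"
    by simp
  from has_derivative_add[OF this has_derivative_const[of "g (\<phi> x)"]] show ?thesis by simp
qed

text \<open>Continuity on a compact set: by Tychonoff the product of intervals over \<open>J\<close>
  and points elsewhere is compact, and coordinates outside \<open>J\<close> may be set to 0.\<close>

lemma smooth_fin_bounded:
  assumes g: "smooth_fin J g"
  obtains B where "\<And>z. (\<forall>j\<in>J. \<bar>z j\<bar> \<le> C) \<Longrightarrow> \<bar>g z\<bar> \<le> B"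
proof -
  define S where "S = Pi\<^sub>E UNIV (\<lambda>j::'a. if j \<in> J then {-C..C} else {0::real})"
  have "compactin (product_topology (\<lambda>_. euclidean) UNIV) S"
    unfolding S_def by (simp add: compactin_PiE)
  then have "compact S" by (simp add: euclidean_product_topology)
  then have "compact (g ` S)"
    by (intro compact_continuous_image continuous_on_subset[OF smooth_fin_continuous[OF g]]) auto
  then have "bounded (g ` S)" by (rule compact_imp_bounded)
  then obtain B where B: "\<forall>y\<in>g ` S. norm y \<le> B" unfolding bounded_iff by (elim exE)
  show thesis
  proof (rule that)
    fix z assume z: "\<forall>j\<in>J. \<bar>z j\<bar> \<le> C"
    have "(\<lambda>j. if j \<in> J then z j else 0) \<in> S" unfolding S_def by (rule PiE_I) (use z in \<open>auto simp: abs_le_iff minus_le_iff\<close>)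
    then have "\<bar>g (\<lambda>j. if j \<in> J then z j else 0)\<bar> \<le> B" using B by (simp add: ball_simps)
    moreover have "g (\<lambda>j. if j \<in> J then z j else 0) = g z" by (rule smooth_fin_dep[OF g]) simp
    ultimately show "\<bar>g z\<bar> \<le> B" by simp
  qed
qed

text \<open>The derivative of a composition with \<open>g\<close> is a sum of products of
  compositions with the partial derivatives of \<open>g\<close> and regular families. The class
  contains these, so it is invariant under directional derivatives.\<close>

inductive regalg :: "'j set \<Rightarrow> ('a::real_normed_vector, real) fam \<Rightarrow> bool" for J where
  base: "reg f \<Longrightarrow> regalg J f"
| comp: "smooth_fin J g \<Longrightarrow> (\<And>j. j \<in> J \<Longrightarrow> reg (\<lambda>N h x. \<phi> N h x j)) \<Longrightarrow> regalg J (\<lambda>N h x. g (\<phi> N h x))"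
| add: "regalg J a \<Longrightarrow> regalg J b \<Longrightarrow> regalg J (\<lambda>N h x. a N h x + b N h x)"
| mult: "regalg J a \<Longrightarrow> regalg J b \<Longrightarrow> regalg J (\<lambda>N h x. a N h x * b N h x)"

lemma regalg_sum: "finite I \<Longrightarrow> (\<And>i. i \<in> I \<Longrightarrow> regalg J (a i)) \<Longrightarrow> regalg J (\<lambda>N h x. \<Sum>i\<in>I. a i N h x)"
proof (induction I rule: finite_induct)
  case empty
  then show ?case by (simp add: regalg.base)
next
  case (insert i I)
  then show ?case by (simp add: regalg.add)
qed

lemma dir_smooth_fin:
  assumes "smooth_fin J g" "\<And>j. j \<in> J \<Longrightarrow> (\<lambda>x. \<phi> x j) differentiable at x"
  shows "dir e (\<lambda>x. g (\<phi> x)) x = (\<Sum>j\<in>J. coord_deriv j g (\<phi> x) * dir e (\<lambda>x. \<phi> x j) x)"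
    and "(\<lambda>x. g (\<phi> x)) differentiable at x"
proof -
  have *: "((\<lambda>x. g (\<phi> x)) has_derivative (\<lambda>u. \<Sum>j\<in>J. coord_deriv j g (\<phi> x) * dir u (\<lambda>x. \<phi> x j) x)) (at x)"
    by (rule smooth_fin_has_derivative[OF assms(1) has_derivative_dir[OF assms(2)]])
  show "dir e (\<lambda>x. g (\<phi> x)) x = (\<Sum>j\<in>J. coord_deriv j g (\<phi> x) * dir e (\<lambda>x. \<phi> x j) x)"
    by (rule dir_eqI[OF *])
  show "(\<lambda>x. g (\<phi> x)) differentiable at x" by (rule differentiableI[OF *])
qed

lemma bdd_smooth_fin:
  fixes \<phi> :: "nat \<Rightarrow> real \<Rightarrow> 'b::real_normed_vector \<Rightarrow> 'j \<Rightarrow> real"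
  assumes g: "smooth_fin J g" and b: "\<And>j. j \<in> J \<Longrightarrow> bdd (\<lambda>N h x. \<phi> N h x j)"
  shows "bdd (\<lambda>N h x. g (\<phi> N h x))"
  unfolding bdd_def
proof (intro allI impI)
  fix N and K :: "'b set" assume K: "compact K"
  have fin: "finite J" using g smooth_fin_finite by blast
  have "\<forall>j\<in>J. \<exists>C. \<forall>\<^sub>F h in at_right 0. \<forall>x\<in>K. \<bar>\<phi> N h x j\<bar> \<le> C"
    using b K unfolding bdd_def unif_O_def by auto
  from bchoice[OF this] obtain C where
    C: "\<forall>j\<in>J. \<forall>\<^sub>F h in at_right 0. \<forall>x\<in>K. \<bar>\<phi> N h x j\<bar> \<le> C j" by (elim exE)
  have "\<forall>\<^sub>F h in at_right 0. \<forall>j\<in>J. \<forall>x\<in>K. \<bar>\<phi> N h x j\<bar> \<le> C j"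
    using C fin by (simp add: eventually_ball_finite_distrib)
  note ev = this
  define D where "D = Max (insert 0 (C ` J))"
  have D: "\<And>j. j \<in> J \<Longrightarrow> C j \<le> D" unfolding D_def using fin by auto
  obtain B where B: "\<And>z. (\<forall>j\<in>J. \<bar>z j\<bar> \<le> D) \<Longrightarrow> \<bar>g z\<bar> \<le> B" using smooth_fin_bounded[OF g, of D] by blast
  have "\<forall>\<^sub>F h in at_right 0. \<forall>x\<in>K. norm (g (\<phi> N h x)) \<le> B * h ^ 0"
    using ev
  proof (rule eventually_mono, intro ballI)
    fix h x assume h: "\<forall>j\<in>J. \<forall>x\<in>K. \<bar>\<phi> N h x j\<bar> \<le> C j" and x: "x \<in> K"
    have "\<bar>g (\<phi> N h x)\<bar> \<le> B" using h x D by (intro B ballI) (meson order_trans)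
    then show "norm (g (\<phi> N h x)) \<le> B * h ^ 0" by simp
  qed
  then show "unif_O 0 K (\<lambda>h x. g (\<phi> N h x))" unfolding unif_O_def by blast
qed

lemma regalg_step:
  assumes "regalg J w"
  shows "(\<forall>N h x. w N h differentiable at x) \<and> bdd w \<and> (\<forall>e. regalg J (fdir e w))"
  using assms
proof induction
  case (base f)
  then show ?case by (auto intro: reg_differentiable reg_bdd regalg.base reg_fdir)
next
  case (comp g \<phi>)
  have d: "(\<lambda>x. \<phi> N h x j) differentiable at x" if "j \<in> J" for j N h x
    using reg_differentiable[OF comp(2)[OF that]] by simp
  have "fdir e (\<lambda>N h x. g (\<phi> N h x)) = (\<lambda>N h x. \<Sum>j\<in>J. coord_deriv j g (\<phi> N h x) * fdir e (\<lambda>N h x. \<phi> N h x j) N h x)" for e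
    by (intro ext) (simp add: dir_smooth_fin(1)[OF comp(1) d])
  moreover have "regalg J (\<lambda>N h x. \<Sum>j\<in>J. coord_deriv j g (\<phi> N h x) * fdir e (\<lambda>N h x. \<phi> N h x j) N h x)" for e
  proof (rule regalg_sum)
    show "finite J" using comp(1) smooth_fin_finite by blast
    fix j assume j: "j \<in> J"
    show "regalg J (\<lambda>N h x. coord_deriv j g (\<phi> N h x) * fdir e (\<lambda>N h x. \<phi> N h x j) N h x)"
      by (rule regalg.mult, rule regalg.comp[OF smooth_fin_coord_deriv[OF comp(1)] comp(2)], assumption,
          rule regalg.base, rule reg_fdir, rule comp(2)[OF j])
  qed
  moreover have "(\<lambda>x. g (\<phi> N h x)) differentiable at x" for N h x
    by (rule dir_smooth_fin(2)[OF comp(1) d])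
  moreover have "bdd (\<lambda>N h x. g (\<phi> N h x))"
    by (rule bdd_smooth_fin[OF comp(1) reg_bdd[OF comp(2)]])
  ultimately show ?case by simp
next
  case (add a b)
  have "fdir e (\<lambda>N h x. a N h x + b N h x) = (\<lambda>N h x. fdir e a N h x + fdir e b N h x)" for e
    using add.IH by (simp add: fun_eq_iff dir_add)
  moreover have "regalg J (\<lambda>N h x. fdir e a N h x + fdir e b N h x)" for e
    using add.IH by (intro regalg.add) auto
  ultimately show ?case using add.IH by (simp add: bdd_add)
next
  case (mult a b)
  have "fdir e (\<lambda>N h x. a N h x * b N h x) = (\<lambda>N h x. a N h x * fdir e b N h x + fdir e a N h x * b N h x)" for e
    using mult.IH by (simp add: fun_eq_iff dir_bilinear[OF bounded_bilinear_mult])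
  moreover have "regalg J (\<lambda>N h x. a N h x * fdir e b N h x + fdir e a N h x * b N h x)" for e
    by (intro regalg.add regalg.mult mult) (use mult.IH in auto)
  moreover have "bdd (\<lambda>N h x. a N h x * b N h x)"
    using mult.IH by (intro bdd_bilinear[OF bounded_bilinear_mult]) auto
  ultimately show ?case using mult.IH by simp
qed

lemma reg_smooth_fin:
  assumes "smooth_fin J g" "\<And>j. j \<in> J \<Longrightarrow> reg (\<lambda>N h x. \<phi> N h x j)"
  shows "reg (\<lambda>N h x. g (\<phi> N h x))"
  by (rule reg_coinduct[of "regalg J"]) (rule regalg.comp[OF assms], assumption, rule regalg_step)

section \<open>Smooth maps as families that do not depend on the time step\<close>

subsection \<open>Closure properties of smooth maps\<close>

lemma smooth_coinduct:
  assumes X: "X f"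
    and step: "\<And>f. X f \<Longrightarrow> (\<forall>x. f differentiable at x) \<and> (\<forall>e. X (dir e f))"
  shows "smooth f"
proof -
  have "X f \<Longrightarrow> Ck k f" for k f
  proof (induction k arbitrary: f)
    case 0
    then show ?case using step[OF 0]
      by (auto intro!: continuous_at_imp_continuous_on differentiable_imp_continuous_within)
  next
    case (Suc k)
    then have "X (dir e f)" for e using step by blast
    from Suc.IH[OF this] show ?case using step[OF Suc.prems] by (simp add: dir_def[abs_def])
  qed
  then show ?thesis using X by (simp add: smooth_def)
qed

lemma smooth_const: "smooth (\<lambda>x. c)"
  using reg_const[of c] by (simp only: reg_const_fam_iff)

lemma smooth_add: "smooth f \<Longrightarrow> smooth g \<Longrightarrow> smooth (\<lambda>x. f x + g x)"
  using reg_add[of "\<lambda>N h. f" "\<lambda>N h. g"] by (simp only: reg_const_fam_iff)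

lemma smooth_cscaleR: "smooth f \<Longrightarrow> smooth (\<lambda>x. c *\<^sub>R f x)"
  using reg_cscaleR[of "\<lambda>N h. f" c] by (simp only: reg_const_fam_iff)

lemma smooth_diff: "smooth f \<Longrightarrow> smooth g \<Longrightarrow> smooth (\<lambda>x. f x - g x)"
  using reg_diff[of "\<lambda>N h. f" "\<lambda>N h. g"] by (simp only: reg_const_fam_iff)

lemma smooth_sum: "(\<And>i. i \<in> I \<Longrightarrow> smooth (f i)) \<Longrightarrow> smooth (\<lambda>x. \<Sum>i\<in>I. f i x)"
  using reg_sum[of I "\<lambda>i N h. f i"] by (simp only: reg_const_fam_iff)

lemma smooth_bounded_linear: "bounded_linear T \<Longrightarrow> smooth f \<Longrightarrow> smooth (\<lambda>x. T (f x))"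
  using reg_bounded_linear[of T "\<lambda>N h. f"] by (simp only: reg_const_fam_iff)

lemma smooth_comp_linear: "bounded_linear l \<Longrightarrow> smooth f \<Longrightarrow> smooth (\<lambda>x. f (l x))"
  using reg_comp_linear[of l "\<lambda>N h. f"] by (simp only: reg_const_fam_iff)

lemma bounded_linear_nth: "bounded_linear (\<lambda>x::'b::real_normed_vector^'m. x $ i)"
  by (rule bounded_linear_vec_nth)

lemma smooth_nth: "smooth f \<Longrightarrow> smooth (\<lambda>x. f x $ i)"
  by (rule smooth_bounded_linear[OF bounded_linear_nth])

lemma smooth_translate: "smooth f \<Longrightarrow> smooth (\<lambda>x. f (x + c))"
proof (rule smooth_coinduct[of "\<lambda>w. \<exists>f. smooth f \<and> w = (\<lambda>x. f (x + c))"])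
  fix w :: "'a \<Rightarrow> 'b" assume "\<exists>f. smooth f \<and> w = (\<lambda>x. f (x + c))"
  then obtain f where f: "smooth f" and w: "w = (\<lambda>x. f (x + c))" by blast
  have d: "dir e w = (\<lambda>x. dir e f (x + c))" for e
    unfolding w by (rule ext) (rule dir_translate[OF smooth_differentiable[OF f]])
  have "((\<lambda>x. x + c) has_derivative (\<lambda>u. u + 0)) (at x)" for x
    by (intro has_derivative_add has_derivative_ident has_derivative_const)
  from has_derivative_compose[OF this has_derivative_smooth[OF f]]
  have "w differentiable at x" for x unfolding w by (rule differentiableI)
  moreover have "\<exists>f. smooth f \<and> dir e w = (\<lambda>x. f (x + c))" for e
    by (intro exI[of _ "dir e f"] conjI smooth_dir f d)
  ultimately show "(\<forall>x. w differentiable at x) \<and> (\<forall>e. \<exists>f. smooth f \<and> dir e w = (\<lambda>x. f (x + c)))" by simp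
qed (intro exI[of _ f] conjI refl)

lemma nder_translate: "smooth f \<Longrightarrow> nder us (\<lambda>x. f (x + c)) = (\<lambda>x. nder us f (x + c))"
  by (induction us)
    (auto simp: nder_Cons_dir dir_translate smooth_differentiable smooth_nder simp del: nder.simps(2) intro!: ext)

lemma nder_bounded_linear: "bounded_linear T \<Longrightarrow> smooth f \<Longrightarrow> nder us (\<lambda>x. T (f x)) = (\<lambda>x. T (nder us f x))"
  by (induction us)
    (auto simp: nder_Cons_dir dir_bounded_linear smooth_differentiable smooth_nder simp del: nder.simps(2) intro!: ext)

lemma nder_nth: "smooth f \<Longrightarrow> nder us (\<lambda>x. f x $ i) = (\<lambda>x. nder us f x $ i)"
  by (rule nder_bounded_linear[OF bounded_linear_nth])

lemma dir_nth: "f differentiable at x \<Longrightarrow> dir u (\<lambda>x. f x $ i) x = dir u f x $ i"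
  by (rule dir_bounded_linear[OF bounded_linear_nth])

lemma nder_add: "smooth f \<Longrightarrow> smooth g \<Longrightarrow> nder us (\<lambda>x. f x + g x) = (\<lambda>x. nder us f x + nder us g x)"
  by (induction us)
    (auto simp: nder_Cons_dir dir_add smooth_differentiable smooth_nder simp del: nder.simps(2) intro!: ext)

lemma nder_cscaleR: "smooth f \<Longrightarrow> nder us (\<lambda>x. c *\<^sub>R f x) = (\<lambda>x. c *\<^sub>R nder us f x)"
  by (rule nder_bounded_linear[OF bounded_linear_scaleR_right])

lemma dir_cscaleR: "f differentiable at x \<Longrightarrow> dir u (\<lambda>x. c *\<^sub>R f x) x = c *\<^sub>R dir u f x"
  by (rule dir_bounded_linear[OF bounded_linear_scaleR_right])

lemma nder_zero: "nder us (\<lambda>x. 0) = (\<lambda>x. 0)"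
  by (induction us) auto

lemma nder_sum: "finite I \<Longrightarrow> (\<And>i. i \<in> I \<Longrightarrow> smooth (f i)) \<Longrightarrow>
    nder us (\<lambda>x. \<Sum>i\<in>I. f i x) = (\<lambda>x. \<Sum>i\<in>I. nder us (f i) x)"
  by (induction I rule: finite_induct) (simp_all add: nder_zero nder_add smooth_sum)

lemma dir_sum: "finite I \<Longrightarrow> (\<And>i. i \<in> I \<Longrightarrow> smooth (f i)) \<Longrightarrow>
    dir u (\<lambda>x. \<Sum>i\<in>I. f i x) x = (\<Sum>i\<in>I. dir u (f i) x)"
  using nder_sum[of I f "[u]"] by (simp add: dir_def fun_eq_iff)

lemma vec_eq_sum_axis: "(x :: real^'m) = (\<Sum>i\<in>UNIV. (x $ i) *\<^sub>R axis i 1)"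
  by (simp add: vec_eq_iff axis_def if_distrib cong: if_cong)

lemma reg_vecI:
  fixes u :: "('a::real_normed_vector, real^'m) fam"
  assumes "\<And>i. reg (\<lambda>N h x. u N h x $ i)"
  shows "reg u"
proof -
  have "u = (\<lambda>N h x. \<Sum>i\<in>UNIV. (u N h x $ i) *\<^sub>R axis i 1)"
    by (intro ext) (rule vec_eq_sum_axis)
  moreover have "reg (\<lambda>N h x. \<Sum>i\<in>UNIV. (u N h x $ i) *\<^sub>R (axis i 1 :: real^'m))"
    by (intro reg_sum reg_scaleR assms reg_const)
  ultimately show ?thesis by simp
qed

lemma smooth_vecI:
  fixes f :: "'a::real_normed_vector \<Rightarrow> real^'m"
  assumes "\<And>i. smooth (\<lambda>x. f x $ i)" shows "smooth f"
  using reg_vecI[of "\<lambda>N h. f"] assms by (simp only: reg_const_fam_iff)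

section \<open>Schwarz's theorem and Taylor's formula along a line\<close>

subsection \<open>Symmetry of second derivatives and Taylor expansion\<close>

lemma DERIV_line:
  fixes f :: "'a::real_normed_vector \<Rightarrow> real"
  assumes "smooth f"
  shows "((\<lambda>a. f (y + a *\<^sub>R u)) has_field_derivative dir u f (y + a *\<^sub>R u)) (at a)"
proof -
  have "((\<lambda>a. y + a *\<^sub>R u) has_derivative (\<lambda>t. 0 + t *\<^sub>R u)) (at a)"
    by (intro has_derivative_add has_derivative_const bounded_linear_imp_has_derivative
        bounded_linear_scaleR_left)
  from has_derivative_compose[OF this has_derivative_smooth[OF assms]]
  have "((\<lambda>a. f (y + a *\<^sub>R u)) has_derivative (\<lambda>t. dir (t *\<^sub>R u) f (y + a *\<^sub>R u))) (at a)" by simp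
  moreover have "dir (t *\<^sub>R u) f z = dir u f z * t" for t z
    using linear_dir[OF smooth_differentiable[OF assms]] by (simp add: linear_iff)
  ultimately show ?thesis by (simp add: has_field_derivative_def)
qed

text \<open>The left side is symmetric in \<open>u\<close> and \<open>v\<close>, whereas the mean
  value theorem, used first along \<open>u\<close> and then along \<open>v\<close>, expresses it by
  one mixed derivative near \<open>x\<close>. Exchanging the roles of \<open>u\<close> and
  \<open>v\<close> gives the other one.\<close>

lemma second_difference:
  fixes f :: "'a::real_normed_vector \<Rightarrow> real"
  assumes f: "smooth f" and s: "s > 0"
  shows "\<exists>a b. 0 < a \<and> a < s \<and> 0 < b \<and> b < s \<and>
    f (x + s *\<^sub>R u + s *\<^sub>R v) - f (x + s *\<^sub>R u) - f (x + s *\<^sub>R v) + f x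
      = s * (s * dir v (dir u f) (x + a *\<^sub>R u + b *\<^sub>R v))"
proof -
  define k where "k = (\<lambda>a. f ((x + s *\<^sub>R v) + a *\<^sub>R u) - f (x + a *\<^sub>R u))"
  have "\<exists>a. 0 < a \<and> a < s \<and> k s - k 0 = (s - 0) * (dir u f ((x + s *\<^sub>R v) + a *\<^sub>R u) - dir u f (x + a *\<^sub>R u))"
    unfolding k_def by (rule MVT2[OF s]) (intro DERIV_diff DERIV_line f)
  then obtain a where a: "0 < a" "a < s"
    "k s - k 0 = s * (dir u f ((x + s *\<^sub>R v) + a *\<^sub>R u) - dir u f (x + a *\<^sub>R u))" by auto
  have "\<exists>b. 0 < b \<and> b < s \<and> dir u f ((x + a *\<^sub>R u) + s *\<^sub>R v) - dir u f ((x + a *\<^sub>R u) + 0 *\<^sub>R v)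
      = (s - 0) * dir v (dir u f) ((x + a *\<^sub>R u) + b *\<^sub>R v)"
    by (rule MVT2[OF s]) (rule DERIV_line[OF smooth_dir[OF f]])
  then obtain b where "0 < b" "b < s" 
    "dir u f ((x + a *\<^sub>R u) + s *\<^sub>R v) - dir u f (x + a *\<^sub>R u) = s * dir v (dir u f) ((x + a *\<^sub>R u) + b *\<^sub>R v)" by auto
  then show ?thesis using a unfolding k_def
    by (intro exI[of _ a] exI[of _ b]) (simp add: algebra_simps)
qed

lemma dir_commute_real:
  fixes f :: "'a::real_normed_vector \<Rightarrow> real"
  assumes f: "smooth f"
  shows "dir u (dir v f) = dir v (dir u f)"
proof (rule ext, rule ccontr)
  fix x assume ne: "dir u (dir v f) x \<noteq> dir v (dir u f) x"
  define e where "e = \<bar>dir u (dir v f) x - dir v (dir u f) x\<bar> / 2"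
  have e: "e > 0" using ne by (simp add: e_def)
  have "isCont (dir u (dir v f)) x" "isCont (dir v (dir u f)) x"
    by (auto intro!: differentiable_imp_continuous_within smooth_differentiable smooth_dir f)
  then obtain d1 d2 where d: "d1 > 0" "d2 > 0"
    "\<And>y. norm (y - x) < d1 \<Longrightarrow> \<bar>dir u (dir v f) y - dir u (dir v f) x\<bar> < e"
    "\<And>y. norm (y - x) < d2 \<Longrightarrow> \<bar>dir v (dir u f) y - dir v (dir u f) x\<bar> < e"
    using e unfolding continuous_at_eps_delta dist_norm real_norm_def by metis
  \<comment> \<open>This scale keeps both intermediate points of the two second differences within
    the continuity radii; the summand 1 avoids a zero denominator and makes the bound
    strict.\<close>
  define s where "s = min d1 d2 / (norm u + norm v + 1)"
  have nn: "norm u + norm v + 1 > 0" by (simp add: add_nonneg_pos)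
  have s: "s > 0" unfolding s_def using d nn by simp
  have small: "norm (a *\<^sub>R u + b *\<^sub>R v) < min d1 d2" if "0 < a" "a < s" "0 < b" "b < s" for a b
  proof -
    have "norm (a *\<^sub>R u + b *\<^sub>R v) \<le> a * norm u + b * norm v"
      using norm_triangle_ineq[of "a *\<^sub>R u" "b *\<^sub>R v"] that by simp
    also have "\<dots> \<le> s * norm u + s * norm v" using that by (intro add_mono mult_right_mono) auto
    also have "\<dots> < s * (norm u + norm v + 1)" using s by (simp add: algebra_simps)
    also have "\<dots> = min d1 d2" using nn by (simp add: s_def)
    finally show ?thesis .
  qed
  obtain a b where ab: "0 < a" "a < s" "0 < b" "b < s"
    "f (x + s *\<^sub>R u + s *\<^sub>R v) - f (x + s *\<^sub>R u) - f (x + s *\<^sub>R v) + f x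
      = s * (s * dir v (dir u f) (x + a *\<^sub>R u + b *\<^sub>R v))"
    using second_difference[OF f s] by blast
  obtain a' b' where ab': "0 < a'" "a' < s" "0 < b'" "b' < s"
    "f (x + s *\<^sub>R v + s *\<^sub>R u) - f (x + s *\<^sub>R v) - f (x + s *\<^sub>R u) + f x
      = s * (s * dir u (dir v f) (x + a' *\<^sub>R v + b' *\<^sub>R u))"
    using second_difference[OF f s] by blast
  have eq: "dir v (dir u f) (x + a *\<^sub>R u + b *\<^sub>R v) = dir u (dir v f) (x + a' *\<^sub>R v + b' *\<^sub>R u)"
    using ab(5) ab'(5) s by (simp add: algebra_simps)
  have 1: "\<bar>dir v (dir u f) (x + a *\<^sub>R u + b *\<^sub>R v) - dir v (dir u f) x\<bar> < e"
    by (rule d(4)) (use small[OF ab(1-4)] in \<open>simp add: add.assoc\<close>)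
  have 2: "\<bar>dir u (dir v f) (x + a' *\<^sub>R v + b' *\<^sub>R u) - dir u (dir v f) x\<bar> < e"
    by (rule d(3)) (use small[OF ab'(3,4,1,2)] in \<open>simp add: add.assoc add.commute\<close>)
  have "\<bar>dir u (dir v f) x - dir v (dir u f) x\<bar> < 2 * e" using 1 2 eq by linarith
  then show False by (simp add: e_def)
qed

lemma dir_commute:
  fixes f :: "'a::real_normed_vector \<Rightarrow> real^'m"
  assumes f: "smooth f"
  shows "dir u (dir v f) = dir v (dir u f)"
proof -
  have "dir u (dir v f) x $ i = dir u (dir v (\<lambda>x. f x $ i)) x" for u v x i
  proof -
    have "dir v (\<lambda>x. f x $ i) = (\<lambda>x. dir v f x $ i)"
      by (rule ext) (rule dir_nth[OF smooth_differentiable[OF f]])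
    then show ?thesis by (simp add: dir_nth[OF smooth_differentiable[OF smooth_dir[OF f]]])
  qed
  then show ?thesis by (simp add: fun_eq_iff vec_eq_iff dir_commute_real[OF smooth_nth[OF f]])
qed

lemma nder_dir_commute:
  fixes f :: "'a::real_normed_vector \<Rightarrow> real^'m"
  shows "smooth f \<Longrightarrow> nder us (dir e f) = dir e (nder us f)"
  by (induction us) (simp_all add: nder_Cons_dir dir_commute[OF smooth_nder] del: nder.simps(2))

lemma nder_dir_commute_real:
  fixes f :: "'a::real_normed_vector \<Rightarrow> real"
  shows "smooth f \<Longrightarrow> nder us (dir e f) = dir e (nder us f)"
  by (induction us) (simp_all add: nder_Cons_dir dir_commute_real[OF smooth_nder] del: nder.simps(2))

lemma smooth_dir_pow: "smooth f \<Longrightarrow> smooth ((dir e ^^ l) f)"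
  by (induction l) (auto intro: smooth_dir)

lemma nder_dir_pow_real:
  fixes f :: "'a::real_normed_vector \<Rightarrow> real"
  shows "smooth f \<Longrightarrow> nder us ((dir e ^^ l) f) = (dir e ^^ l) (nder us f)"
  by (induction l) (simp_all add: nder_dir_commute_real smooth_dir_pow)

lemma taylor_line:
  fixes f :: "'a::real_normed_vector \<Rightarrow> real"
  assumes f: "smooth f" and h: "h > 0" and n: "n > 0"
  shows "\<exists>t. 0 < t \<and> t < h \<and> f (x + h *\<^sub>R e) = (\<Sum>l<n. (dir e ^^ l) f x / fact l * h ^ l)
      + (dir e ^^ n) f (x + t *\<^sub>R e) / fact n * h ^ n"
proof -
  have "\<exists>t. 0 < t \<and> t < h \<and> f (x + h *\<^sub>R e) = (\<Sum>l<n. (dir e ^^ l) f (x + 0 *\<^sub>R e) / fact l * h ^ l)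
      + (dir e ^^ n) f (x + t *\<^sub>R e) / fact n * h ^ n"
    using Maclaurin[OF h n, of "\<lambda>l t. (dir e ^^ l) f (x + t *\<^sub>R e)" "\<lambda>t. f (x + t *\<^sub>R e)"]
      DERIV_line[OF smooth_dir_pow[OF f]] by simp
  then show ?thesis by simp
qed

section \<open>Nonlinear differential operators, their linearisation, and the chain rule in
  time\<close>

subsection \<open>Differential operators\<close>

lemma dir_slice:
  assumes "f differentiable at (x, s)"
  shows "dir a (\<lambda>y. f (y, s)) x = dir (a, 0) f (x, s)" and "(\<lambda>y. f (y, s)) differentiable at x"
proof -
  have "((\<lambda>y. (y, s)) has_derivative (\<lambda>u. (u, 0))) (at x)"
    by (intro has_derivative_Pair has_derivative_ident has_derivative_const)
  note * = has_derivative_compose[OF this has_derivative_dir[OF assms]]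
  show "dir a (\<lambda>y. f (y, s)) x = dir (a, 0) f (x, s)" by (rule dir_eqI[OF *])
  show "(\<lambda>y. f (y, s)) differentiable at x" by (rule differentiableI[OF *])
qed

lemma smooth_slice: 
  assumes "smooth f" shows "smooth (\<lambda>y. f (y, s))"
proof (rule smooth_coinduct[of "\<lambda>w. \<exists>f. smooth f \<and> w = (\<lambda>y. f (y, s))"])
  fix w :: "'a \<Rightarrow> 'c" assume "\<exists>f. smooth f \<and> w = (\<lambda>y. f (y, s))"
  then obtain f where f: "smooth f" and w: "w = (\<lambda>y. f (y, s))" by blast
  have d: "dir e w = (\<lambda>y. dir (e, 0) f (y, s))" for e
    unfolding w by (rule ext) (rule dir_slice[OF smooth_differentiable[OF f]])
  have "w differentiable at x" for x unfolding w by (rule dir_slice[OF smooth_differentiable[OF f]])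
  moreover have "\<exists>f. smooth f \<and> dir e w = (\<lambda>y. f (y, s))" for e
    by (intro exI[of _ "dir (e, 0) f"] conjI smooth_dir f d)
  ultimately show "(\<forall>x. w differentiable at x) \<and> (\<forall>e. \<exists>f. smooth f \<and> dir e w = (\<lambda>y. f (y, s)))" by simp
qed (intro exI[of _ f] conjI refl assms)

abbreviation ax :: "'d::finite list \<Rightarrow> (real^'d) list" where
  "ax \<equiv> map (\<lambda>\<alpha>. axis \<alpha> 1)"

abbreviation axt :: "'d::finite list \<Rightarrow> ((real^'d) \<times> real) list" where
  "axt \<equiv> map (\<lambda>\<alpha>. (axis \<alpha> 1, 0))"

lemma nder_slice:
  assumes "smooth f" shows "nder (ax as) (\<lambda>y. f (y, s)) = (\<lambda>y. nder (axt as) f (y, s))"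
proof (induction as)
  case (Cons a as)
  have "nder (ax (a # as)) (\<lambda>y. f (y, s)) = dir (axis a 1) (\<lambda>y. nder (axt as) f (y, s))"
    unfolding list.map nder_Cons_dir Cons.IH ..
  also have "\<dots> = (\<lambda>y. dir (axis a 1, 0) (nder (axt as) f) (y, s))"
    by (rule ext) (rule dir_slice[OF smooth_differentiable[OF smooth_nder[OF assms]]])
  finally show ?case by (simp only: list.map nder_Cons_dir)
qed simp

lemma jet_slice:
  assumes "smooth U" shows "jet (\<lambda>y. U (y, s)) x (as, i) = nder (axt as) U (x, s) $ i"
  unfolding jet_def prod.case by (simp only: nder_slice[OF assms])

lemma jet_linear:
  assumes "smooth W" "smooth V"
  shows "jet (\<lambda>y. W y + s *\<^sub>R V y) x j = jet W x j + s * jet V x j"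
  by (cases j) (simp add: jet_def nder_add nder_cscaleR smooth_cscaleR assms)

lemma scalar_diffop_cong:
  assumes "scalar_diffop F" "\<And>W x. smooth W \<Longrightarrow> F W x = F' W x"
  shows "scalar_diffop F'"
  using assms unfolding scalar_diffop_def by metis

lemma diffop_cong:
  assumes "diffop F" "\<And>W x. smooth W \<Longrightarrow> F W x = F' W x"
  shows "diffop F'"
  unfolding diffop_def
proof
  fix i have "scalar_diffop (\<lambda>W x. F W x $ i)" using assms(1) by (simp add: diffop_def)
  then show "scalar_diffop (\<lambda>W x. F' W x $ i)" by (rule scalar_diffop_cong) (simp add: assms(2))
qed

lemma scalar_diffop_jet: "scalar_diffop (\<lambda>W x. jet W x j)"
  unfolding scalar_diffop_def using smooth_fin_coord[of j] by blast

lemma scalar_diffop_smooth_fin: "smooth_fin J g \<Longrightarrow> scalar_diffop (\<lambda>W x. g (jet W x))"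
  unfolding scalar_diffop_def by blast

lemma scalar_diffop_const: "scalar_diffop (\<lambda>W x. c)"
  unfolding scalar_diffop_def by (intro exI[of _ "{}"] exI[of _ "\<lambda>z. c"]) (simp add: smooth_fin_const)

lemma scalar_diffop_add:
  assumes "scalar_diffop F" "scalar_diffop G" shows "scalar_diffop (\<lambda>W x. F W x + G W x)"
proof -
  obtain J g where 1: "smooth_fin J g" "\<forall>W x. smooth W \<longrightarrow> F W x = g (jet W x)"
    using assms(1) scalar_diffop_def by blast
  obtain J' g' where 2: "smooth_fin J' g'" "\<forall>W x. smooth W \<longrightarrow> G W x = g' (jet W x)"
    using assms(2) scalar_diffop_def by blast
  have "smooth_fin (J \<union> J') (\<lambda>z. g z + g' z)"
    by (rule smooth_fin_add; rule smooth_fin_mono[OF 1(1)] smooth_fin_mono[OF 2(1)])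
      (use smooth_fin_finite[OF 1(1)] smooth_fin_finite[OF 2(1)] in auto)
  then show ?thesis unfolding scalar_diffop_def using 1(2) 2(2) by force
qed

lemma scalar_diffop_mult:
  assumes "scalar_diffop F" "scalar_diffop G" shows "scalar_diffop (\<lambda>W x. F W x * G W x)"
proof -
  obtain J g where 1: "smooth_fin J g" "\<forall>W x. smooth W \<longrightarrow> F W x = g (jet W x)"
    using assms(1) scalar_diffop_def by blast
  obtain J' g' where 2: "smooth_fin J' g'" "\<forall>W x. smooth W \<longrightarrow> G W x = g' (jet W x)"
    using assms(2) scalar_diffop_def by blast
  have "smooth_fin (J \<union> J') (\<lambda>z. g z * g' z)"
    by (rule smooth_fin_mult; rule smooth_fin_mono[OF 1(1)] smooth_fin_mono[OF 2(1)])
      (use smooth_fin_finite[OF 1(1)] smooth_fin_finite[OF 2(1)] in auto)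
  then show ?thesis unfolding scalar_diffop_def using 1(2) 2(2) by force
qed

lemma scalar_diffop_sum:
  "(\<And>i. i \<in> I \<Longrightarrow> scalar_diffop (F i)) \<Longrightarrow> scalar_diffop (\<lambda>W x. \<Sum>i\<in>I. F i W x)"
proof (induction I rule: infinite_finite_induct)
  case (insert i I)
  then show ?case by (simp add: scalar_diffop_add)
qed (simp_all add: scalar_diffop_const)

lemma scalar_diffop_cmult: "scalar_diffop F \<Longrightarrow> scalar_diffop (\<lambda>W x. c * F W x)"
  by (rule scalar_diffop_mult[OF scalar_diffop_const])

lemma scalar_diffop_reg:
  fixes U :: "((real^'d::finite) \<times> real, real^'n::finite) fam"
  assumes F: "scalar_diffop F" and U: "reg U"
  shows "reg (\<lambda>N h z. F (\<lambda>y. U N h (y, snd z)) (fst z))"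
proof -
  obtain J g where 1: "smooth_fin J g" "\<forall>W x. smooth W \<longrightarrow> F W x = g (jet W x)"
    using F scalar_diffop_def by blast
  have j: "jet (\<lambda>y. U N h (y, snd z)) (fst z) j = nder (axt (fst j)) (U N h) z $ snd j" for N h z j
    using jet_slice[OF reg_smooth[OF U], where s = "snd z" and x = "fst z" and as = "fst j" and i = "snd j"] by simp
  have "reg (\<lambda>N h z. g (jet (\<lambda>y. U N h (y, snd z)) (fst z)))"
    by (rule reg_smooth_fin[OF 1(1)]) (unfold j, intro reg_bounded_linear[OF bounded_linear_nth] reg_nder U)
  then show ?thesis using 1(2) smooth_slice[OF reg_smooth[OF U]] by simp
qed

lemma smooth_fst: "smooth W \<Longrightarrow> smooth (\<lambda>z. W (fst z))"
  by (rule smooth_comp_linear[OF bounded_linear_fst])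

lemma scalar_diffop_smooth:
  assumes F: "scalar_diffop F" and W: "smooth W"
  shows "smooth (F W)"
proof -
  have "reg (\<lambda>N h (z::(real^'a) \<times> real). F (\<lambda>y. W y) (fst z))"
    using scalar_diffop_reg[OF F, of "\<lambda>N h z. W (fst z)"] smooth_fst[OF W] by (simp add: reg_const_fam_iff)
  then have "smooth (\<lambda>z::(real^'a) \<times> real. F W (fst z))" by (simp only: reg_const_fam_iff)
  from smooth_slice[OF this] show ?thesis by simp
qed

lemma diffop_scalar: "diffop F \<Longrightarrow> scalar_diffop (\<lambda>W x. F W x $ i)"
  by (simp add: diffop_def)

lemma diffop_smooth: "diffop F \<Longrightarrow> smooth W \<Longrightarrow> smooth (F W)"
  by (rule smooth_vecI) (rule scalar_diffop_smooth[OF diffop_scalar])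

lemma diffop_reg:
  fixes U :: "((real^'d::finite) \<times> real, real^'n::finite) fam"
  shows "diffop F \<Longrightarrow> reg U \<Longrightarrow> reg (\<lambda>N h z. F (\<lambda>y. U N h (y, snd z)) (fst z))"
  by (rule reg_vecI) (rule scalar_diffop_reg[OF diffop_scalar]; assumption)

text \<open>This is the total derivative on jet space: each jet coordinate is sent to the coordinate
  with one more space index, weighted by the partial derivatives of \<open>g\<close>.\<close>

lemma scalar_diffop_pd:
  assumes F: "scalar_diffop F"
  shows "scalar_diffop (\<lambda>W. pd \<alpha> (F W))"
proof -
  obtain J g where 1: "smooth_fin J g" "\<forall>W x. smooth W \<longrightarrow> F W x = g (jet W x)"
    using F scalar_diffop_def by blast
  show ?thesis
  proof (rule scalar_diffop_cong)
    show "scalar_diffop (\<lambda>W x. \<Sum>j\<in>J. coord_deriv j g (jet W x) * jet W x (\<alpha> # fst j, snd j))"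
      by (intro scalar_diffop_sum scalar_diffop_mult scalar_diffop_jet
          scalar_diffop_smooth_fin[OF smooth_fin_coord_deriv[OF 1(1)]])
    fix W :: "real^'a \<Rightarrow> real^'b" and x assume W: "smooth W"
    have eq: "F W = (\<lambda>x. g (jet W x))" using 1(2) W by (simp add: fun_eq_iff)
    have j: "(\<lambda>x. jet W x j) = (\<lambda>x. nder (ax (fst j)) W x $ snd j)" for j
      by (simp add: jet_def split_beta)
    have d: "(\<lambda>x. jet W x j) differentiable at x" for j x
      unfolding j by (rule smooth_differentiable[OF smooth_nth[OF smooth_nder[OF W]]])
    have "dir e (\<lambda>x. jet W x j) x = dir e (nder (ax (fst j)) W) x $ snd j" for e j x
      unfolding j by (rule dir_nth[OF smooth_differentiable[OF smooth_nder[OF W]]])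
    then have "dir (axis \<alpha> 1) (\<lambda>x. jet W x j) x = jet W x (\<alpha> # fst j, snd j)" for j x
      by (simp only: jet_def prod.case list.map nder_Cons_dir)
    then show "(\<Sum>j\<in>J. coord_deriv j g (jet W x) * jet W x (\<alpha> # fst j, snd j)) = pd \<alpha> (F W) x"
      unfolding pd_dir eq dir_smooth_fin(1)[OF 1(1) d] by simp
  qed
qed

lemma scalar_diffop_jet_comp:
  assumes G: "diffop G" shows "scalar_diffop (\<lambda>W x. jet (G W) x (as, i))"
proof (induction as)
  case Nil
  then show ?case using diffop_scalar[OF G] by (simp add: jet_def)
next
  case (Cons a as)
  show ?case
  proof (rule scalar_diffop_cong[OF scalar_diffop_pd[OF Cons]])
    fix W :: "real^'a \<Rightarrow> real^'b" and x assume W: "smooth W"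
    have "pd a (\<lambda>x. jet (G W) x (as, i)) x = dir (axis a 1) (nder (ax as) (G W)) x $ i"
      unfolding pd_dir jet_def prod.case
      by (rule dir_nth[OF smooth_differentiable[OF smooth_nder[OF diffop_smooth[OF G W]]]])
    then show "pd a (\<lambda>x. jet (G W) x (as, i)) x = jet (G W) x (a # as, i)"
      by (simp only: jet_def prod.case list.map nder_Cons_dir)
  qed
qed

text \<open>The jet of W + s G(W) is affine in s, so the direction G(W) enters the derivative only
  through its jet, and linearly. This formula underlies all later properties of
  \<open>dd\<close>.\<close>

lemma dd_has_derivative:
  assumes "smooth_fin J g" "\<forall>W x. smooth W \<longrightarrow> F W x = g (jet W x)" and W: "smooth W" and V: "smooth (G W)"
  shows "((\<lambda>s. F (\<lambda>y. W y + s *\<^sub>R G W y) x) has_vector_derivative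
      (\<Sum>j\<in>J. coord_deriv j g (jet W x) * jet (G W) x j)) (at 0)"
proof -
  have j: "jet (\<lambda>y. W y + s *\<^sub>R G W y) x = (\<lambda>j. jet W x j + s * jet (G W) x j)" for s
    by (rule ext) (rule jet_linear[OF W V])
  have eq: "F (\<lambda>y. W y + s *\<^sub>R G W y) x = g (\<lambda>j. jet W x j + s * jet (G W) x j)" for s
    using assms(2) smooth_add[OF W smooth_cscaleR[OF V]] unfolding j[symmetric] by blast
  have "((\<lambda>s. g (\<lambda>j. jet W x j + s * jet (G W) x j)) has_derivative
    (\<lambda>u. \<Sum>j\<in>J. coord_deriv j g (\<lambda>j. jet W x j + 0 * jet (G W) x j) * (u * jet (G W) x j))) (at 0)"
    by (rule smooth_fin_has_derivative[OF assms(1)]) (auto intro!: derivative_eq_intros)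
  then show ?thesis unfolding has_vector_derivative_def eq
    by (simp add: sum_distrib_left mult_ac)
qed

lemma dd_formula:
  assumes "smooth_fin J g" "\<forall>W x. smooth W \<longrightarrow> F W x = g (jet W x)" and "smooth W" and "smooth (G W)"
  shows "dd F G W x = (\<Sum>j\<in>J. coord_deriv j g (jet W x) * jet (G W) x j)"
  unfolding dd_def by (rule vector_derivative_at[OF dd_has_derivative[where G = G, OF assms]])

lemma scalar_diffop_dd:
  assumes F: "scalar_diffop F" and G: "diffop G"
  shows "scalar_diffop (dd F G)"
proof -
  obtain J g where 1: "smooth_fin J g" "\<forall>W x. smooth W \<longrightarrow> F W x = g (jet W x)"
    using F scalar_diffop_def by blast
  show ?thesis
  proof (rule scalar_diffop_cong)
    show "scalar_diffop (\<lambda>W x. \<Sum>j\<in>J. coord_deriv j g (jet W x) * jet (G W) x j)"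
    proof (intro scalar_diffop_sum scalar_diffop_mult
          scalar_diffop_smooth_fin[OF smooth_fin_coord_deriv[OF 1(1)]])
      fix j show "scalar_diffop (\<lambda>W x. jet (G W) x j)"
        using scalar_diffop_jet_comp[OF G, of "fst j" "snd j"] by simp
    qed
  qed (rule dd_formula[OF 1, symmetric], assumption, rule diffop_smooth[OF G])
qed

lemma dd_component:
  assumes F: "diffop F" and "smooth W" "smooth (G W)"
  shows "dd F G W x $ i = dd (\<lambda>W x. F W x $ i) G W x"
    and "(\<lambda>s. F (\<lambda>y. W y + s *\<^sub>R G W y) x) differentiable at 0"
proof -
  have "\<forall>i. \<exists>d. ((\<lambda>s. F (\<lambda>y. W y + s *\<^sub>R G W y) x $ i) has_vector_derivative d) (at 0)"
  proof
    fix i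
    obtain J g where 1: "smooth_fin J g" "\<forall>W x. smooth W \<longrightarrow> F W x $ i = g (jet W x)"
      using diffop_scalar[OF F, of i] unfolding scalar_diffop_def by blast
    show "\<exists>d. ((\<lambda>s. F (\<lambda>y. W y + s *\<^sub>R G W y) x $ i) has_vector_derivative d) (at 0)"
      by (rule exI) (rule dd_has_derivative[where G = G, OF 1 assms(2,3)])
  qed
  from choice[OF this] obtain d where
    d: "\<And>i. ((\<lambda>s. F (\<lambda>y. W y + s *\<^sub>R G W y) x $ i) has_vector_derivative d i) (at 0)" by blast
  have "((\<lambda>s. F (\<lambda>y. W y + s *\<^sub>R G W y) x) has_derivative (\<lambda>t. \<chi> i. t *\<^sub>R d i)) (at 0)"
    using d unfolding has_vector_derivative_def
    by (subst has_derivative_componentwise_within) (auto simp: Basis_vec_def inner_axis)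
  moreover have "(\<lambda>t. \<chi> i. t *\<^sub>R d i) = (\<lambda>t. t *\<^sub>R (\<chi> i. d i))" by (simp add: vec_eq_iff fun_eq_iff)
  ultimately have D: "((\<lambda>s. F (\<lambda>y. W y + s *\<^sub>R G W y) x) has_vector_derivative (\<chi> i. d i)) (at 0)"
    by (simp add: has_vector_derivative_def)
  show "dd F G W x $ i = dd (\<lambda>W x. F W x $ i) G W x"
    unfolding dd_def vector_derivative_at[OF D] vector_derivative_at[OF d] by simp
  show "(\<lambda>s. F (\<lambda>y. W y + s *\<^sub>R G W y) x) differentiable at 0"
    using D unfolding has_vector_derivative_def by (rule differentiableI)
qed

lemma diffop_dd:
  assumes F: "diffop F" and G: "diffop G" shows "diffop (dd F G)"
  unfolding diffop_def
proof
  fix i show "scalar_diffop (\<lambda>W x. dd F G W x $ i)"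
    by (rule scalar_diffop_cong[OF scalar_diffop_dd[OF diffop_scalar[OF F, of i] G]])
      (simp add: dd_component[OF F] diffop_smooth[OF G])
qed

text \<open>The chain rule in time: \<open>\<partial>\<^sub>t (F(W)) = dF(W).\<partial>\<^sub>tW\<close>.\<close>

lemma scalar_diffop_dt:
  fixes U :: "(real^'d::finite) \<times> real \<Rightarrow> real^'n::finite"
  assumes F: "scalar_diffop F" and U: "smooth U"
  shows "dir (0, 1) (\<lambda>z. F (\<lambda>y. U (y, snd z)) (fst z)) (x, s)
    = dd F (\<lambda>_ y. dir (0, 1) U (y, s)) (\<lambda>y. U (y, s)) x"
proof -
  obtain J g where 1: "smooth_fin J g" "\<forall>W x. smooth W \<longrightarrow> F W x = g (jet W x)"
    using F scalar_diffop_def by blast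
  have j: "jet (\<lambda>y. U (y, snd z)) (fst z) j = nder (axt (fst j)) U z $ snd j" for z j
    using jet_slice[OF U, of "snd z" "fst z" "fst j" "snd j"] by simp
  have eq: "(\<lambda>z. F (\<lambda>y. U (y, snd z)) (fst z)) = (\<lambda>z. g (jet (\<lambda>y. U (y, snd z)) (fst z)))"
    using 1(2) smooth_slice[OF U] by simp
  have "dir (0, 1) (\<lambda>z. g (jet (\<lambda>y. U (y, snd z)) (fst z))) (x, s) = (\<Sum>j\<in>J. 
      coord_deriv j g (jet (\<lambda>y. U (y, snd (x, s))) (fst (x, s))) * dir (0, 1) (\<lambda>z. jet (\<lambda>y. U (y, snd z)) (fst z) j) (x, s))"
    by (rule dir_smooth_fin(1)[OF 1(1)]) (unfold j, rule smooth_differentiable[OF smooth_nth[OF smooth_nder[OF U]]])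
  also have "\<dots> = (\<Sum>j\<in>J. coord_deriv j g (jet (\<lambda>y. U (y, s)) x) * jet (\<lambda>y. dir (0, 1) U (y, s)) x j)"
  proof (intro sum.cong refl)
    fix j
    \<comment> \<open>The time derivative of the jet of \<open>U\<close> is the jet of the time
      derivative, because space and time derivatives commute.\<close>
    have "dir (0, 1) (\<lambda>z. jet (\<lambda>y. U (y, snd z)) (fst z) j) (x, s) = nder (axt (fst j)) (dir (0, 1) U) (x, s) $ snd j"
      unfolding j dir_nth[OF smooth_differentiable[OF smooth_nder[OF U]]] nder_dir_commute[OF U] ..
    also have "\<dots> = jet (\<lambda>y. dir (0, 1) U (y, s)) x j"
      using jet_slice[OF smooth_dir[OF U, of "(0,1)"], of s x "fst j" "snd j"] by simp
    finally show "coord_deriv j g (jet (\<lambda>y. U (y, snd (x, s))) (fst (x, s))) * dir (0, 1) (\<lambda>z. jet (\<lambda>y. U (y, snd z)) (fst z) j) (x, s)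
      = coord_deriv j g (jet (\<lambda>y. U (y, s)) x) * jet (\<lambda>y. dir (0, 1) U (y, s)) x j" by simp
  qed
  also have "\<dots> = dd F (\<lambda>_ y. dir (0, 1) U (y, s)) (\<lambda>y. U (y, s)) x"
    by (rule dd_formula[OF 1, symmetric]) (intro smooth_slice smooth_dir U)+
  finally show ?thesis unfolding eq .
qed

lemma diffop_dt:
  fixes U :: "(real^'d::finite) \<times> real \<Rightarrow> real^'n::finite"
  assumes F: "diffop F" and U: "smooth U"
  shows "dir (0, 1) (\<lambda>z. F (\<lambda>y. U (y, snd z)) (fst z)) (x, s)
    = dd F (\<lambda>_ y. dir (0, 1) U (y, s)) (\<lambda>y. U (y, s)) x"
proof -
  have "smooth (\<lambda>z. F (\<lambda>y. U (y, snd z)) (fst z))"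
    using diffop_reg[OF F, of "\<lambda>N h. U"] U by (simp add: reg_const_fam_iff)
  then have "dir (0, 1) (\<lambda>z. F (\<lambda>y. U (y, snd z)) (fst z)) (x, s) $ i
      = dir (0, 1) (\<lambda>z. F (\<lambda>y. U (y, snd z)) (fst z) $ i) (x, s)" for i
    by (simp add: dir_nth smooth_differentiable)
  also have "\<dots> i = dd F (\<lambda>_ y. dir (0, 1) U (y, s)) (\<lambda>y. U (y, s)) x $ i" for i
    unfolding scalar_diffop_dt[OF diffop_scalar[OF F] U]
    by (rule dd_component(1)[OF F, symmetric]) (intro smooth_slice smooth_dir U)+
  finally show ?thesis by (simp add: vec_eq_iff)
qed

section \<open>Orders of magnitude in the time step, together with all derivatives, at one
  instant\<close>

subsection \<open>Negligible families\<close>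

text \<open>The derivatives run over space and time but are estimated at the single instant
  \<open>t\<close>, as in \<open>scheme_at\<close>. Time derivatives of a small quantity are
  therefore controlled only through the count \<open>r\<close>.\<close>

definition small :: "nat \<Rightarrow> nat \<Rightarrow> real \<Rightarrow> (real \<Rightarrow> 'a::real_normed_vector \<times> real \<Rightarrow> 'b::real_normed_vector) \<Rightarrow> bool" where
  "small r k t u \<longleftrightarrow> (\<forall>us K. length us \<le> r \<longrightarrow> compact K \<longrightarrow> unif_O k (K \<times> {t}) (\<lambda>h. nder us (u h)))"

text \<open>\<open>neg k t u\<close>: at time \<open>t N\<close>, \<open>u N\<close> is \<open>O(h^k)\<close> together with any number of derivatives, for
  \<open>N\<close> large enough.\<close>

definition neg :: "nat \<Rightarrow> (nat \<Rightarrow> real) \<Rightarrow> ('a::real_normed_vector \<times> real, 'b::real_normed_vector) fam \<Rightarrow> bool" where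
  "neg k t u \<longleftrightarrow> reg u \<and> (\<forall>r. \<forall>\<^sub>F N in sequentially. small r k (t N) (u N))"

lemma smallI:
  "(\<And>us K. length us \<le> r \<Longrightarrow> compact K \<Longrightarrow> unif_O k (K \<times> {t}) (\<lambda>h. nder us (u h))) \<Longrightarrow> small r k t u"
  by (simp add: small_def)

lemma smallD:
  "small r k t u \<Longrightarrow> length us \<le> r \<Longrightarrow> compact K \<Longrightarrow> unif_O k (K \<times> {t}) (\<lambda>h. nder us (u h))"
  by (simp add: small_def)

lemma neg_reg: "neg k t u \<Longrightarrow> reg u"
  by (simp add: neg_def)

lemma small_zero: "small 0 k t u \<longleftrightarrow> (\<forall>K. compact K \<longrightarrow> unif_O k (K \<times> {t}) u)"
  by (simp add: small_def)

text \<open>The last entry of the list is the derivative that acts first, so it can be absorbed into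
  the function. This makes induction on \<open>r\<close> possible.\<close>

lemma small_Suc:
  "small (Suc r) k t u \<longleftrightarrow> small 0 k t u \<and> (\<forall>e. small r k t (\<lambda>h. dir e (u h)))"
proof
  assume s: "small (Suc r) k t u"
  have "small r k t (\<lambda>h. dir e (u h))" for e unfolding small_def
  proof (intro allI impI)
    fix us :: "('a \<times> real) list" and K :: "'a set" assume "length us \<le> r" "compact K"
    then have "unif_O k (K \<times> {t}) (\<lambda>h. nder (us @ [e]) (u h))" using s unfolding small_def by simp
    then show "unif_O k (K \<times> {t}) (\<lambda>h. nder us (dir e (u h)))" by (simp only: nder_snoc)
  qed
  moreover have "small 0 k t u" by (rule smallI) (rule smallD[OF s], auto)
  ultimately show "small 0 k t u \<and> (\<forall>e. small r k t (\<lambda>h. dir e (u h)))" by blast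
next
  assume a: "small 0 k t u \<and> (\<forall>e. small r k t (\<lambda>h. dir e (u h)))"
  show "small (Suc r) k t u" unfolding small_def
  proof (intro allI impI)
    fix us :: "('a \<times> real) list" and K :: "'a set" assume l: "length us \<le> Suc r" "compact K"
    show "unif_O k (K \<times> {t}) (\<lambda>h. nder us (u h))"
    proof (cases us rule: rev_cases)
      case Nil
      then show ?thesis using a l by (simp add: small_zero)
    next
      case (snoc ys e)
      have "small r k t (\<lambda>h. dir e (u h))" using a by (simp only:)
      from smallD[OF this _ l(2), of ys] show ?thesis using snoc l(1) by (simp add: nder_snoc)
    qed
  qed
qed

lemma small_mono: "small r k t u \<Longrightarrow> r' \<le> r \<Longrightarrow> small r' k t u"
  by (simp add: small_def)

lemma small_add:
  assumes "small r k t u" "small r k t v" "\<And>h. smooth (u h)" "\<And>h. smooth (v h)"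
  shows "small r k t (\<lambda>h z. u h z + v h z)"
  using assms unfolding small_def by (simp add: nder_add unif_O_add)

lemma small_linear:
  assumes "bounded_linear T" "small r k t u" "\<And>h. smooth (u h)"
  shows "small r k t (\<lambda>h z. T (u h z))"
  by (rule smallI) (simp add: nder_bounded_linear[OF assms(1,3)] unif_O_linear[OF assms(1) smallD[OF assms(2)]])

text \<open>Leibniz rule and induction on \<open>r\<close>: each derivative falls either on the
  bounded factor, which stays regular, or on the small one, which loses one of its admissible
  derivatives.\<close>

lemma small_bilinear:
  assumes bm: "bounded_bilinear bm" and a: "reg (\<lambda>N. a)" and b: "reg (\<lambda>N. b)" and s: "small r k t b"
  shows "small r k t (\<lambda>h z. bm (a h z) (b h z))"
  using a b s
proof (induction r arbitrary: a b)
  case 0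
  have "unif_O (0 + k) (K \<times> {t}) (\<lambda>h z. bm (a h z) (b h z))" if K: "compact K" for K
  proof (rule unif_O_bilinear[OF bm])
    have "compact (K \<times> {t})" using K by (simp add: compact_Times)
    then show "unif_O 0 (K \<times> {t}) a" using reg_bdd[OF 0(1)] by (simp add: bdd_def)
    show "unif_O k (K \<times> {t}) b" using 0(3) K by (simp add: small_zero)
  qed
  then show ?case by (simp add: small_zero)
next
  case (Suc r)
  have 0: "small 0 k t (\<lambda>h z. bm (a h z) (b h z))"
  proof -
    have "unif_O (0 + k) (K \<times> {t}) (\<lambda>h z. bm (a h z) (b h z))" if K: "compact K" for K
    proof (rule unif_O_bilinear[OF bm])
      have "compact (K \<times> {t})" using K by (simp add: compact_Times)
      then show "unif_O 0 (K \<times> {t}) a" using reg_bdd[OF Suc(2)] by (simp add: bdd_def)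
      show "unif_O k (K \<times> {t}) b" using Suc(4) K by (simp add: small_Suc small_zero)
    qed
    then show ?thesis by (simp add: small_zero)
  qed
  have sm: "smooth (a h)" "smooth (b h)" for h
    using reg_smooth[OF Suc(2)] reg_smooth[OF Suc(3)] by simp_all
  have "small r k t (\<lambda>h. dir e (\<lambda>z. bm (a h z) (b h z)))" for e
  proof -
    have eq: "dir e (\<lambda>z. bm (a h z) (b h z)) = (\<lambda>z. bm (a h z) (dir e (b h) z) + bm (dir e (a h) z) (b h z))" for h
      by (rule ext) (rule dir_bilinear[OF bm smooth_differentiable[OF sm(1)] smooth_differentiable[OF sm(2)]])
    have da: "reg (\<lambda>N h. dir e (a h))" and db: "reg (\<lambda>N h. dir e (b h))"
      using reg_fdir[OF Suc(2)] reg_fdir[OF Suc(3)] by simp_all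
    have 1: "small r k t (\<lambda>h z. bm (a h z) (dir e (b h) z))"
      by (rule Suc.IH[OF Suc(2) db]) (use Suc(4) in \<open>simp only: small_Suc\<close>)
    have 2: "small r k t (\<lambda>h z. bm (dir e (a h) z) (b h z))"
      by (rule Suc.IH[OF da Suc(3)]) (rule small_mono[OF Suc(4)], simp)
    show ?thesis unfolding eq
    proof (rule small_add[OF 1 2])
      show "smooth (\<lambda>z. bm (a h z) (dir e (b h) z))" for h
        using reg_smooth[OF reg_bilinear[OF bm Suc(2) db]] by simp
      show "smooth (\<lambda>z. bm (dir e (a h) z) (b h z))" for h
        using reg_smooth[OF reg_bilinear[OF bm da Suc(3)]] by simp
    qed
  qed
  then show ?case using 0 by (simp add: small_Suc[of r])
qed

lemma neg_bilinear:
  assumes bm: "bounded_bilinear bm" and a: "reg a" and b: "neg k t b"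
  shows "neg k t (\<lambda>N h z. bm (a N h z) (b N h z))"
  unfolding neg_def
proof (intro conjI allI)
  show "reg (\<lambda>N h z. bm (a N h z) (b N h z))" by (rule reg_bilinear[OF bm a neg_reg[OF b]])
  fix r
  have "\<forall>\<^sub>F N in sequentially. small r k (t N) (b N)" using b by (simp add: neg_def)
  then show "\<forall>\<^sub>F N in sequentially. small r k (t N) (\<lambda>h z. bm (a N h z) (b N h z))"
  proof (rule eventually_mono)
    fix N assume s: "small r k (t N) (b N)"
    have "reg (\<lambda>_::nat. a N)" "reg (\<lambda>_::nat. b N)"
      using a neg_reg[OF b] unfolding reg_def bdd_def by simp_all
    from small_bilinear[OF bm this s] show "small r k (t N) (\<lambda>h z. bm (a N h z) (b N h z))" .
  qed
qed

lemma neg_scaleR: "reg a \<Longrightarrow> neg k t b \<Longrightarrow> neg k t (\<lambda>N h z. a N h z *\<^sub>R b N h z)"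
  by (rule neg_bilinear[OF bounded_bilinear_scaleR])

lemma neg_mult: "reg a \<Longrightarrow> neg k t b \<Longrightarrow> neg k t (\<lambda>N h z. a N h z * b N h z :: real)"
  by (rule neg_bilinear[OF bounded_bilinear_mult])

lemma neg_cscaleR: "neg k t b \<Longrightarrow> neg k t (\<lambda>N h z. c *\<^sub>R b N h z)"
  by (rule neg_scaleR[OF reg_const])

lemma neg_add: assumes "neg k t a" "neg k t b" shows "neg k t (\<lambda>N h z. a N h z + b N h z)"
  unfolding neg_def
proof (intro conjI allI)
  show "reg (\<lambda>N h z. a N h z + b N h z)" by (intro reg_add neg_reg[OF assms(1)] neg_reg[OF assms(2)])
  fix r
  have "\<forall>\<^sub>F N in sequentially. small r k (t N) (a N)" "\<forall>\<^sub>F N in sequentially. small r k (t N) (b N)"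
    using assms by (simp_all add: neg_def)
  then show "\<forall>\<^sub>F N in sequentially. small r k (t N) (\<lambda>h z. a N h z + b N h z)"
    by eventually_elim (rule small_add, assumption, assumption,
      rule reg_smooth[OF neg_reg[OF assms(1)]], rule reg_smooth[OF neg_reg[OF assms(2)]])
qed

lemma neg_minus: "neg k t b \<Longrightarrow> neg k t (\<lambda>N h z. - b N h z)"
  using neg_cscaleR[of k t b "-1"] by simp

lemma neg_diff: assumes "neg k t a" "neg k t b" shows "neg k t (\<lambda>N h z. a N h z - b N h z)"
  using neg_add[OF assms(1) neg_minus[OF assms(2)]] by simp

lemma neg_zero [simp]: "neg k t (\<lambda>N h z. 0)"
  unfolding neg_def small_def by (simp add: nder_zero unif_O_def exI[of _ 0])

lemma neg_sum: "(\<And>i. i \<in> I \<Longrightarrow> neg k t (u i)) \<Longrightarrow> neg k t (\<lambda>N h z. \<Sum>i\<in>I. u i N h z)"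
proof (induction I rule: infinite_finite_induct)
  case (insert i I)
  then show ?case by (simp add: neg_add)
qed simp_all

lemma neg_linear: assumes "bounded_linear T" "neg k t u" shows "neg k t (\<lambda>N h z. T (u N h z))"
  unfolding neg_def
proof (intro conjI allI)
  show "reg (\<lambda>N h z. T (u N h z))" by (rule reg_bounded_linear[OF assms(1) neg_reg[OF assms(2)]])
  fix r
  have "\<forall>\<^sub>F N in sequentially. small r k (t N) (u N)" using assms by (simp add: neg_def)
  then show "\<forall>\<^sub>F N in sequentially. small r k (t N) (\<lambda>h z. T (u N h z))"
    by eventually_elim (rule small_linear[OF assms(1)], assumption, rule reg_smooth[OF neg_reg[OF assms(2)]])
qed

lemma neg_vecI:
  fixes u :: "('a::real_normed_vector \<times> real, real^'m) fam"
  assumes "\<And>i. neg k t (\<lambda>N h x. u N h x $ i)"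
  shows "neg k t u"
proof -
  have "u = (\<lambda>N h x. \<Sum>i\<in>UNIV. (u N h x $ i) *\<^sub>R axis i 1)"
    by (intro ext) (rule vec_eq_sum_axis)
  moreover have "neg k t (\<lambda>N h x. \<Sum>i\<in>UNIV. (u N h x $ i) *\<^sub>R (axis i 1 :: real^'m))"
    by (intro neg_sum neg_linear[OF bounded_linear_scaleR_left] assms)
  ultimately show ?thesis by simp
qed

lemma neg_nth: "neg k t u \<Longrightarrow> neg k t (\<lambda>N h x. u N h x $ i)"
  by (rule neg_linear[OF bounded_linear_nth])

text \<open>Differentiating uses up one admissible order, but \<open>neg\<close> allows any number
  of them from some index on, so nothing is lost. This is the purpose of the sequence index: no
  number of derivatives has to be counted in the expansions.\<close>

lemma neg_fdir: assumes "neg k t u" shows "neg k t (fdir e u)"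
  unfolding neg_def
proof (intro conjI allI)
  show "reg (fdir e u)" by (rule reg_fdir[OF neg_reg[OF assms]])
  fix r
  have "\<forall>\<^sub>F N in sequentially. small (Suc r) k (t N) (u N)" using assms unfolding neg_def by blast
  then show "\<forall>\<^sub>F N in sequentially. small r k (t N) (\<lambda>h. dir e (u N h))"
    by eventually_elim (simp only: small_Suc)
qed

lemma neg_nder: "neg k t u \<Longrightarrow> neg k t (\<lambda>N h. nder us (u N h))"
proof (induction us)
  case (Cons e us)
  then have "neg k t (fdir e (\<lambda>N h. nder us (u N h)))" by (intro neg_fdir) simp
  then show ?case by (simp only: nder_Cons_dir)
qed simp

lemma unif_O_le: 
  assumes "unif_O k K u" "j \<le> k" shows "unif_O j K u"
proof -
  obtain C where C: "C \<ge> 0" "\<forall>\<^sub>F h in at_right 0. \<forall>z\<in>K. norm (u h z) \<le> C * h ^ k"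
    using unif_O_bound[OF assms(1)] .
  have "\<forall>\<^sub>F h in at_right 0. \<forall>z\<in>K. norm (u h z) \<le> C * h ^ j"
    using C(2) eventually_at_right_real[OF zero_less_one]
  proof eventually_elim
    case (elim h)
    have "h ^ k \<le> h ^ j" using elim(2) assms(2) by (intro power_decreasing) auto
    then have "C * h ^ k \<le> C * h ^ j" using C(1) by (rule mult_left_mono)
    then show ?case using elim(1) by (meson order_trans)
  qed
  then show ?thesis unfolding unif_O_def by blast
qed

lemma neg_mono: assumes "neg k t u" "j \<le> k" shows "neg j t u"
  unfolding neg_def
proof (intro conjI allI)
  show "reg u" by (rule neg_reg[OF assms(1)])
  fix r
  have "\<forall>\<^sub>F N in sequentially. small r k (t N) (u N)" using assms(1) by (simp add: neg_def)
  then show "\<forall>\<^sub>F N in sequentially. small r j (t N) (u N)"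
    by eventually_elim (rule smallI, rule unif_O_le[OF _ assms(2)], rule smallD)
qed

lemma neg_0: assumes "reg u" shows "neg 0 t u"
  unfolding neg_def
proof (intro conjI allI always_eventually assms)
  fix r N
  have "unif_O 0 (K \<times> {t N}) (\<lambda>h. nder us (u N h))" if "compact K" for us K
    using reg_bdd[OF reg_nder[OF assms]] that unfolding bdd_def by (simp add: compact_Times)
  then show "small r 0 (t N) (u N)" by (simp add: small_def)
qed

lemma unif_O_hpow:
  assumes "\<forall>\<^sub>F h in at_right 0. \<forall>z\<in>K. u' h z = h ^ i *\<^sub>R u h z"
  shows "unif_O (i + k) K u' \<longleftrightarrow> unif_O k K u"
proof -
  have "(\<forall>\<^sub>F h in at_right 0. \<forall>z\<in>K. norm (u' h z) \<le> C * h ^ (i + k)) \<longleftrightarrow>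
    (\<forall>\<^sub>F h in at_right 0. \<forall>z\<in>K. norm (u h z) \<le> C * h ^ k)" for C
  proof (rule eventually_cong[OF eventually_conj[OF assms eventually_at_right_less[of 0]]])
    fix h :: real assume h: "(\<forall>z\<in>K. u' h z = h ^ i *\<^sub>R u h z) \<and> 0 < h"
    have "norm (u' h z) \<le> C * h ^ (i + k) \<longleftrightarrow> norm (u h z) \<le> C * h ^ k" if "z \<in> K" for z
    proof -
      have "norm (u' h z) \<le> C * h ^ (i + k) \<longleftrightarrow> h ^ i * norm (u h z) \<le> h ^ i * (C * h ^ k)"
        using h that by (simp add: power_add mult_ac)
      also have "\<dots> \<longleftrightarrow> norm (u h z) \<le> C * h ^ k" using h by simp
      finally show ?thesis .
    qed
    then show "(\<forall>z\<in>K. norm (u' h z) \<le> C * h ^ (i + k)) \<longleftrightarrow> (\<forall>z\<in>K. norm (u h z) \<le> C * h ^ k)" by blast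
  qed
  then show ?thesis by (simp add: unif_O_def)
qed

lemma small_hpow:
  assumes "\<And>h. smooth (u h)"
  shows "small r (i + k) t (\<lambda>h z. h ^ i *\<^sub>R u h z) \<longleftrightarrow> small r k t u"
  unfolding small_def nder_cscaleR[OF assms]
  using unif_O_hpow[OF always_eventually] by (metis (no_types, lifting))

text \<open>The estimates concern positive \<open>h\<close> only, so a power of \<open>h\<close> can
  also be divided out.\<close>

lemma neg_hpow_iff:
  assumes "reg u" shows "neg (i + k) t (\<lambda>N h z. h ^ i *\<^sub>R u N h z) \<longleftrightarrow> neg k t u"
  unfolding neg_def small_hpow[OF reg_smooth[OF assms]]
  using assms reg_scaleR[OF reg_h assms] by simp

lemma neg_hpow: "neg k t u \<Longrightarrow> neg (i + k) t (\<lambda>N h z. h ^ i *\<^sub>R u N h z)"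
  using neg_hpow_iff[OF neg_reg] by blast

lemma neg_h: "neg k t u \<Longrightarrow> neg (Suc k) t (\<lambda>N h z. h *\<^sub>R u N h z)"
  using neg_hpow[of k t u 1] by simp

lemma neg_h_iff: "reg u \<Longrightarrow> neg (Suc k) t (\<lambda>N h z. h *\<^sub>R u N h z) \<longleftrightarrow> neg k t u"
  using neg_hpow_iff[of u 1 k t] by simp

lemma neg_hpow_reg: "reg u \<Longrightarrow> k \<le> i \<Longrightarrow> neg k t (\<lambda>N h z. h ^ i *\<^sub>R u N h z)"
  using neg_mono[OF neg_hpow[OF neg_0]] by simp

lemma compact_segment_hull:
  fixes e :: "'a::real_normed_vector"
  assumes "compact K" shows "compact ((\<lambda>(z, a). z + a *\<^sub>R e) ` (K \<times> {0..1::real}))"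
proof -
  have "(\<lambda>(z, a). z + a *\<^sub>R e) = (\<lambda>p. fst p + snd p *\<^sub>R e)" by (simp add: fun_eq_iff)
  moreover have "continuous_on (K \<times> {0..1::real}) (\<lambda>p. fst p + snd p *\<^sub>R e)"
    by (intro continuous_intros)
  ultimately show ?thesis using assms
    by (metis compact_continuous_image compact_Times compact_Icc)
qed

lemma bdd_shift:
  assumes "bdd u" shows "bdd (\<lambda>N h z. u N h (z + h *\<^sub>R e))"
  unfolding bdd_def
proof (intro allI impI)
  fix N K assume "compact (K :: 'a set)"
  from compact_segment_hull[OF this] have "unif_O 0 ((\<lambda>(z, a). z + a *\<^sub>R e) ` (K \<times> {0..1::real})) (u N)"
    using assms by (simp add: bdd_def)
  then obtain C where "\<forall>\<^sub>F h in at_right 0. \<forall>z\<in>(\<lambda>(z, a). z + a *\<^sub>R e) ` (K \<times> {0..1::real}). norm (u N h z) \<le> C * h ^ 0"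
    unfolding unif_O_def by blast
  then have "\<forall>\<^sub>F h in at_right 0. \<forall>z\<in>K. norm (u N h (z + h *\<^sub>R e)) \<le> C * h ^ 0"
    using eventually_at_right_real[OF zero_less_one] by eventually_elim force
  then show "unif_O 0 K (\<lambda>h z. u N h (z + h *\<^sub>R e))" unfolding unif_O_def by blast
qed

lemma reg_shift:
  assumes "reg u" shows "reg (\<lambda>N h z. u N h (z + h *\<^sub>R e))"
  unfolding reg_def
proof (intro conjI allI)
  show "smooth (\<lambda>z. u N h (z + h *\<^sub>R e))" for N h by (rule smooth_translate[OF reg_smooth[OF assms]])
  show "bdd (\<lambda>N h. nder us (\<lambda>z. u N h (z + h *\<^sub>R e)))" for us
    unfolding nder_translate[OF reg_smooth[OF assms]] by (rule bdd_shift[OF reg_bdd[OF reg_nder[OF assms]]])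
qed

text \<open>The shift is purely spatial and the instant \<open>t\<close> is kept. For
  \<open>h\<close> below 1 the shifted points remain in a compact set swept out by segments.\<close>

lemma small_shift:
  assumes "\<And>h. smooth (u h)" "small r k t u"
  shows "small r k t (\<lambda>h z. u h (z + h *\<^sub>R (a, 0)))"
  unfolding small_def nder_translate[OF assms(1)]
proof (intro allI impI)
  fix us :: "('a \<times> real) list" and K :: "'a set" assume us: "length us \<le> r" and K: "compact K"
  from us compact_segment_hull[OF K] 
  have "unif_O k (((\<lambda>(z, s). z + s *\<^sub>R a) ` (K \<times> {0..1::real})) \<times> {t}) (\<lambda>h. nder us (u h))"
    using assms(2) unfolding small_def by blast
  then obtain C where "\<forall>\<^sub>F h in at_right 0. \<forall>z\<in>((\<lambda>(z, s). z + s *\<^sub>R a) ` (K \<times> {0..1::real})) \<times> {t}. norm (nder us (u h) z) \<le> C * h ^ k"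
    unfolding unif_O_def by blast
  then have "\<forall>\<^sub>F h in at_right 0. \<forall>z\<in>K \<times> {t}. norm (nder us (u h) (z + h *\<^sub>R (a, 0))) \<le> C * h ^ k"
    using eventually_at_right_real[OF zero_less_one] by eventually_elim force
  then show "unif_O k (K \<times> {t}) (\<lambda>h z. nder us (u h) (z + h *\<^sub>R (a, 0)))" unfolding unif_O_def by blast
qed

lemma neg_shift:
  assumes "neg k t u" shows "neg k t (\<lambda>N h z. u N h (z + h *\<^sub>R (a, 0)))"
  unfolding neg_def
proof (intro conjI allI)
  show "reg (\<lambda>N h z. u N h (z + h *\<^sub>R (a, 0)))" by (rule reg_shift[OF neg_reg[OF assms]])
  fix r
  have "\<forall>\<^sub>F N in sequentially. small r k (t N) (u N)" using assms by (simp add: neg_def)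
  then show "\<forall>\<^sub>F N in sequentially. small r k (t N) (\<lambda>h z. u N h (z + h *\<^sub>R (a, 0)))"
    by eventually_elim (rule small_shift[OF reg_smooth[OF neg_reg[OF assms]]])
qed

lemma reg_dir_pow: "reg u \<Longrightarrow> reg (\<lambda>N h. (dir e ^^ l) (u N h))"
  by (induction l) (auto intro: reg_fdir)

text \<open>Lagrange's remainder bounds the function itself. The derivatives are bounded in the same
  way, since a derivative of the Taylor remainder of a function is the Taylor remainder of its
  derivative.\<close>

lemma neg_taylor:
  fixes u :: "('a::real_normed_vector \<times> real, real) fam"
  assumes u: "reg u" and k: "k > 0"
  shows "neg k t (\<lambda>N h z. u N h (z + h *\<^sub>R e) - (\<Sum>l<k. (h ^ l / fact l) *\<^sub>R (dir e ^^ l) (u N h) z))"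
proof -
  define R where "R = (\<lambda>f h z. f (z + h *\<^sub>R e) - (\<Sum>l<k. (h ^ l / fact l) *\<^sub>R (dir e ^^ l) f (z :: 'a \<times> real) :: real))"
  have uO: "unif_O k K (\<lambda>h. R (v N h) h)" if v: "reg v" and K: "compact K" for v :: "('a \<times> real, real) fam" and N K
  proof -
    have "unif_O 0 ((\<lambda>(z, a). z + a *\<^sub>R e) ` (K \<times> {0..1::real})) (\<lambda>h. (dir e ^^ k) (v N h))"
      using compact_segment_hull[OF K] reg_bdd[OF reg_dir_pow[OF v]] by (simp add: bdd_def)
    then obtain C where C: "\<forall>\<^sub>F h in at_right 0. \<forall>z\<in>(\<lambda>(z, a). z + a *\<^sub>R e) ` (K \<times> {0..1::real}). norm ((dir e ^^ k) (v N h) z) \<le> C * h ^ 0"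
      unfolding unif_O_def by blast
    have "\<forall>\<^sub>F h in at_right 0. \<forall>z\<in>K. norm (R (v N h) h z) \<le> (C / fact k) * h ^ k"
      using C eventually_at_right_real[OF zero_less_one]
    proof eventually_elim
      case (elim h)
      show ?case
      proof
        fix z assume z: "z \<in> K"
        have h: "h > 0" using elim by simp
        obtain s where s: "0 < s" "s < h" "v N h (z + h *\<^sub>R e) = (\<Sum>l<k. (dir e ^^ l) (v N h) z / fact l * h ^ l)
            + (dir e ^^ k) (v N h) (z + s *\<^sub>R e) / fact k * h ^ k"
          using taylor_line[OF reg_smooth[OF v] h k] by blast
        have eq: "R (v N h) h z = (dir e ^^ k) (v N h) (z + s *\<^sub>R e) / fact k * h ^ k"
          unfolding R_def s(3) by (simp add: mult_ac)
        have "z + s *\<^sub>R e \<in> (\<lambda>(z, a). z + a *\<^sub>R e) ` (K \<times> {0..1::real})"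
          using s(1,2) elim(2) z by force
        then have "\<bar>(dir e ^^ k) (v N h) (z + s *\<^sub>R e)\<bar> \<le> C"
            using bspec[OF elim(1)] by simp
        then have "\<bar>(dir e ^^ k) (v N h) (z + s *\<^sub>R e)\<bar> / fact k * h ^ k \<le> C / fact k * h ^ k"
          using h by (intro mult_right_mono divide_right_mono) auto
        then show "norm (R (v N h) h z) \<le> (C / fact k) * h ^ k" unfolding eq using h by (simp add: abs_mult)
      qed
    qed
    then show ?thesis unfolding unif_O_def by blast
  qed
  \<comment> \<open>Forming the remainder commutes with all derivatives, by linearity, invariance
    under translations and symmetry of mixed derivatives.\<close>
  have nd: "nder us (R f h) = R (nder us f) h" if f: "smooth f" for us f h
  proof -
    have s: "smooth (\<lambda>z. \<Sum>l<k. (h ^ l / fact l) *\<^sub>R (dir e ^^ l) f z)"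
      by (intro smooth_sum smooth_cscaleR smooth_dir_pow f)
    have "nder us (\<lambda>z. f (z + h *\<^sub>R e) + (-1) *\<^sub>R (\<Sum>l<k. (h ^ l / fact l) *\<^sub>R (dir e ^^ l) f z))
      = (\<lambda>z. nder us f (z + h *\<^sub>R e) + (-1) *\<^sub>R (\<Sum>l<k. (h ^ l / fact l) *\<^sub>R nder us ((dir e ^^ l) f) z))"
      by (simp only: nder_add[OF smooth_translate[OF f] smooth_cscaleR[OF s]] nder_cscaleR[OF s] nder_translate[OF f]
          nder_sum[OF finite_lessThan smooth_cscaleR[OF smooth_dir_pow[OF f]]] nder_cscaleR[OF smooth_dir_pow[OF f]])
    then show ?thesis unfolding R_def nder_dir_pow_real[OF f, symmetric] by simp
  qed
  have "small r k (t N) (\<lambda>h. R (u N h) h)" for r N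
    unfolding small_def nd[OF reg_smooth[OF u]] 
    by (intro allI impI uO[OF reg_nder[OF u]] compact_Times) auto
  moreover have "reg (\<lambda>N h. R (u N h) h)" unfolding R_def
    by (intro reg_diff reg_shift[OF u] reg_sum reg_scaleR reg_dir_pow u)
      (use reg_scaleR[OF reg_const reg_h] in \<open>simp add: divide_inverse mult.commute\<close>)
  ultimately show ?thesis unfolding neg_def R_def by simp
qed

text \<open>By \<open>dd_formula\<close> the result is linear in the jet of \<open>V\<close>, with
  regular coefficients, and jets of negligible families are negligible to the same order.\<close>

lemma scalar_diffop_dd_neg:
  fixes U V :: "((real^'d::finite) \<times> real, real^'n::finite) fam"
  assumes F: "scalar_diffop F" and U: "reg U" and V: "neg k t V"
  shows "neg k t (\<lambda>N h z. dd F (\<lambda>_ y. V N h (y, snd z)) (\<lambda>y. U N h (y, snd z)) (fst z))"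
proof -
  obtain J g where 1: "smooth_fin J g" "\<forall>W x. smooth W \<longrightarrow> F W x = g (jet W x)"
    using F scalar_diffop_def by blast
  note V' = neg_reg[OF V]
  have j: "jet (\<lambda>y. X N h (y, snd z)) (fst z) j = nder (axt (fst j)) (X N h) z $ snd j"
    if "reg X" for N h z j and X :: "((real^'d::finite) \<times> real, real^'n::finite) fam"
    using jet_slice[OF reg_smooth[OF that], where s = "snd z" and x = "fst z" and as = "fst j" and i = "snd j"] by simp
  have eq: "dd F (\<lambda>_ y. V N h (y, snd z)) (\<lambda>y. U N h (y, snd z)) (fst z) =
     (\<Sum>j\<in>J. coord_deriv j g (jet (\<lambda>y. U N h (y, snd z)) (fst z)) * jet (\<lambda>y. V N h (y, snd z)) (fst z) j)" for N h z
    by (rule dd_formula[OF 1]) (intro smooth_slice reg_smooth[OF U] reg_smooth[OF V'])+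
  show ?thesis unfolding eq
  proof (intro neg_sum neg_mult)
    fix i
    show "reg (\<lambda>N h z. coord_deriv i g (jet (\<lambda>y. U N h (y, snd z)) (fst z)))"
      by (rule reg_smooth_fin[OF smooth_fin_coord_deriv[OF 1(1)]])
        (unfold j[OF U], intro reg_bounded_linear[OF bounded_linear_nth] reg_nder U)
    show "neg k t (\<lambda>N h z. jet (\<lambda>y. V N h (y, snd z)) (fst z) i)"
      unfolding j[OF V'] by (intro neg_nth neg_nder V)
  qed
qed

lemma diffop_dd_neg:
  fixes U V :: "((real^'d::finite) \<times> real, real^'n::finite) fam"
  assumes F: "diffop F" and U: "reg U" and V: "neg k t V"
  shows "neg k t (\<lambda>N h z. dd F (\<lambda>_ y. V N h (y, snd z)) (\<lambda>y. U N h (y, snd z)) (fst z))"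
proof (rule neg_vecI)
  fix i
  have eq: "dd F (\<lambda>_ y. V N h (y, snd z)) (\<lambda>y. U N h (y, snd z)) (fst z) $ i =
      dd (\<lambda>W x. F W x $ i) (\<lambda>_ y. V N h (y, snd z)) (\<lambda>y. U N h (y, snd z)) (fst z)" for N h z
    by (rule dd_component[OF F]) (intro smooth_slice reg_smooth[OF U] reg_smooth[OF neg_reg[OF V]])+
  show "neg k t (\<lambda>N h z. dd F (\<lambda>_ y. V N h (y, snd z)) (\<lambda>y. U N h (y, snd z)) (fst z) $ i)"
    unfolding eq by (rule scalar_diffop_dd_neg[OF diffop_scalar[OF F] U V])
qed

section \<open>Closure of vector-valued operators, and linearity of dF.G in F and in G\<close>

subsection \<open>Calculus of vector-valued differential operators\<close>

lemma diffop_add: "diffop F \<Longrightarrow> diffop G \<Longrightarrow> diffop (\<lambda>W x. F W x + G W x)"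
  by (simp add: diffop_def scalar_diffop_add)

lemma diffop_zero: "diffop (\<lambda>W x. 0)"
  by (simp add: diffop_def scalar_diffop_const)

lemma diffop_sum: "(\<And>i. i \<in> I \<Longrightarrow> diffop (F i)) \<Longrightarrow> diffop (\<lambda>W x. \<Sum>i\<in>I. F i W x)"
proof (induction I rule: infinite_finite_induct)
  case (insert i I)
  then show ?case by (simp add: diffop_add)
qed (simp_all add: diffop_zero)

lemma diffop_linear:
  fixes T :: "real^'m \<Rightarrow> real^'k"
  assumes T: "bounded_linear T" and F: "diffop F"
  shows "diffop (\<lambda>W x. T (F W x))"
proof -
  interpret T: bounded_linear T by (rule T)
  have "T (F W x) $ i = (\<Sum>j\<in>UNIV. T (axis j 1) $ i * F W x $ j)" for W x i
    by (subst (1) vec_eq_sum_axis[of "F W x"]) (simp add: T.sum T.scaleR mult.commute)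
  then show ?thesis unfolding diffop_def
    by (auto intro!: scalar_diffop_sum scalar_diffop_cmult diffop_scalar[OF F])
qed

lemma diffop_cscaleR: "diffop F \<Longrightarrow> diffop (\<lambda>W x. c *\<^sub>R F W x)"
  by (rule diffop_linear[OF bounded_linear_scaleR_right])

lemma diffop_minus: "diffop F \<Longrightarrow> diffop (\<lambda>W x. - F W x)"
  by (rule diffop_linear[OF bounded_linear_minus[OF bounded_linear_ident]])

lemma diffop_diff: "diffop F \<Longrightarrow> diffop G \<Longrightarrow> diffop (\<lambda>W x. F W x - G W x)"
  using diffop_add[OF _ diffop_minus] by simp

lemma diffop_id: "diffop (\<lambda>W. W)"
  unfolding diffop_def
proof
  fix i show "scalar_diffop (\<lambda>W x. W x $ i)"
    by (rule scalar_diffop_cong[OF scalar_diffop_jet[of "([], i)"]]) (simp add: jet_def)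
qed

lemma diffop_pd:
  fixes F :: "(real^'d::finite \<Rightarrow> real^'n::finite) \<Rightarrow> real^'d \<Rightarrow> real^'m::finite"
  assumes F: "diffop F" shows "diffop (\<lambda>W. pd \<alpha> (F W))"
  unfolding diffop_def
proof
  fix i show "scalar_diffop (\<lambda>W x. pd \<alpha> (F W) x $ i)"
    by (rule scalar_diffop_cong[OF scalar_diffop_pd[OF diffop_scalar[OF F, of i]]])
      (simp add: pd_dir dir_nth smooth_differentiable diffop_smooth[OF F])
qed

text \<open>Bridges the two notions of smoothness, Frechet on \<open>real^'n\<close> and
  coordinatewise on jets; it makes \<Phi>(W) a differential operator of order zero.\<close>

lemma smooth_fin_comp_vec:
  fixes \<psi> :: "real^'n::finite \<Rightarrow> real" and \<iota> :: "'n \<Rightarrow> 'j"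
  assumes "smooth \<psi>" "inj \<iota>"
  shows "smooth_fin (range \<iota>) (\<lambda>z. \<psi> (\<chi> i. z (\<iota> i)))"
proof (rule smooth_fin_coinduct[of "\<lambda>g. \<exists>\<psi>. smooth \<psi> \<and> g = (\<lambda>z. \<psi> (\<chi> i. z (\<iota> i)))"])
  show "\<exists>\<psi>'. smooth \<psi>' \<and> (\<lambda>z. \<psi> (\<chi> i. z (\<iota> i))) = (\<lambda>z. \<psi>' (\<chi> i. z (\<iota> i)))"
    by (intro exI[of _ \<psi>] conjI assms refl)
  show "finite (range \<iota>)" by simp
  fix g :: "('j \<Rightarrow> real) \<Rightarrow> real" assume "\<exists>\<psi>. smooth \<psi> \<and> g = (\<lambda>z. \<psi> (\<chi> i. z (\<iota> i)))"
  then obtain \<psi> where \<psi>: "smooth \<psi>" and g: "g = (\<lambda>z. \<psi> (\<chi> i. z (\<iota> i)))" by blast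
  have dep: "g z = g z'" if "\<forall>j\<in>range \<iota>. z j = z' j" for z z' unfolding g using that by simp
  have cont: "continuous_on UNIV g" unfolding g
    by (rule continuous_on_compose2[OF smooth_continuous[OF \<psi>]])
      (intro continuous_on_vec_lambda continuous_on_product_coordinates, rule subset_UNIV)
  have D: "((\<lambda>s. g (z(\<iota> i := s))) has_field_derivative dir (axis i 1) \<psi> (\<chi> i. z (\<iota> i))) (at (z (\<iota> i)))" for z i
  proof -
    have "(\<chi> k. (z(\<iota> i := s)) (\<iota> k)) = (\<chi> k. if k = i then 0 else z (\<iota> k)) + s *\<^sub>R axis i 1" for s
      using assms(2) by (auto simp: vec_eq_iff axis_def inj_eq)
    moreover have "(\<chi> k. z (\<iota> k)) = (\<chi> k. if k = i then 0 else z (\<iota> k)) + z (\<iota> i) *\<^sub>R axis i 1"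
      by (auto simp: vec_eq_iff axis_def)
    ultimately show ?thesis unfolding g using DERIV_line[OF \<psi>] by simp
  qed
  have out: "g (z(j := s)) = g z" if "j \<notin> range \<iota>" for j z s by (rule dep) (use that in auto)
  have diff: "(\<lambda>s. g (z(j := s))) differentiable at (z j)" for j z
  proof (cases "j \<in> range \<iota>")
    case True
    then obtain i where "j = \<iota> i" by blast
    then show ?thesis using D[of z i] by (auto simp: has_field_derivative_def intro: differentiableI)
  next
    case False
    then show ?thesis using out by simp
  qed
  have "\<exists>\<psi>. smooth \<psi> \<and> coord_deriv j g = (\<lambda>z. \<psi> (\<chi> i. z (\<iota> i)))" for j
  proof (cases "j \<in> range \<iota>")
    case True
    then obtain i where j: "j = \<iota> i" by blast
    have "coord_deriv j g = (\<lambda>z. dir (axis i 1) \<psi> (\<chi> i. z (\<iota> i)))"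
      unfolding j by (rule ext, rule coord_deriv_eqI, rule D)
    then show ?thesis by (intro exI[of _ "dir (axis i 1) \<psi>"] conjI smooth_dir[OF \<psi>])
  next
    case False
    have "coord_deriv j g = (\<lambda>z. 0)" unfolding coord_deriv_def out[OF False] by simp
    then show ?thesis by (intro exI[of _ "\<lambda>x. 0"] conjI smooth_const)
  qed
  then show "(\<forall>z z'. (\<forall>j\<in>range \<iota>. z j = z' j) \<longrightarrow> g z = g z') \<and> continuous_on UNIV g \<and>
      (\<forall>j z. (\<lambda>s. g (z(j := s))) differentiable at (z j)) \<and>
      (\<forall>j. \<exists>\<psi>. smooth \<psi> \<and> coord_deriv j g = (\<lambda>z. \<psi> (\<chi> i. z (\<iota> i))))"
    using dep cont diff by simp
qed

lemma diffop_comp: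
  fixes \<Phi> :: "real^'n::finite \<Rightarrow> real^'p::finite"
  assumes "smooth \<Phi>"
  shows "diffop (\<lambda>(W :: real^'d::finite \<Rightarrow> real^'n) x. \<Phi> (W x))"
  unfolding diffop_def
proof
  fix i
  have "smooth_fin (range (\<lambda>k. ([] :: 'd list, k))) (\<lambda>z. \<Phi> (\<chi> k. z ([], k)) $ i)"
    by (rule smooth_fin_comp_vec[OF smooth_nth[OF assms]]) (simp add: inj_def)
  from scalar_diffop_smooth_fin[OF this]
  show "scalar_diffop (\<lambda>(W :: real^'d::finite \<Rightarrow> real^'n) x. \<Phi> (W x) $ i)"
    by (rule scalar_diffop_cong) (simp add: jet_def)
qed

lemma dd_has_vector_derivative:
  assumes F: "diffop F" and "smooth W" "smooth (G W)"
  shows "((\<lambda>s. F (\<lambda>y. W y + s *\<^sub>R G W y) x) has_vector_derivative dd F G W x) (at 0)"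
  using dd_component(2)[where G = G, OF assms] unfolding dd_def vector_derivative_works[symmetric] .

lemma dd_eqI: "((\<lambda>s. F (\<lambda>y. W y + s *\<^sub>R G W y) x) has_vector_derivative d) (at 0) \<Longrightarrow> dd F G W x = d"
  unfolding dd_def by (rule vector_derivative_at)

lemma dd_add:
  assumes "diffop F" "diffop F'" "smooth W" "smooth (G W)"
  shows "dd (\<lambda>W x. F W x + F' W x) G W x = dd F G W x + dd F' G W x"
  by (rule dd_eqI) (intro has_vector_derivative_add dd_has_vector_derivative assms)

lemma dd_linear:
  assumes "bounded_linear T" "diffop F" "smooth W" "smooth (G W)"
  shows "dd (\<lambda>W x. T (F W x)) G W x = T (dd F G W x)"
  by (rule dd_eqI) (rule bounded_linear.has_vector_derivative[OF assms(1) dd_has_vector_derivative[where G = G, OF assms(2-4)]])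

lemma dd_zero: "dd (\<lambda>W x. 0) G W x = 0"
  unfolding dd_def by simp

lemma dd_id: "dd (\<lambda>W. W) G W x = G W x"
  by (rule dd_eqI) (auto intro!: derivative_eq_intros)

lemma dd_cong:
  assumes "\<And>W x. smooth W \<Longrightarrow> F W x = F' W x" "smooth W" "G W = G' W" "smooth (G W)"
  shows "dd F G W x = dd F' G' W x"
  using assms(1)[OF smooth_add[OF assms(2) smooth_cscaleR[OF assms(4)]]] assms(3) unfolding dd_def by simp

text \<open>Linearity in the direction is what later splits the time derivative of W into the terms
  \<Gamma>_k and a remainder.\<close>

lemma dd_direction_lincomb:
  assumes F: "diffop F" and "smooth W" and G: "\<And>k. k \<in> I \<Longrightarrow> smooth (G k)" and I: "finite I"
  shows "dd F (\<lambda>_ y. \<Sum>k\<in>I. c k *\<^sub>R G k y) W x = (\<Sum>k\<in>I. c k *\<^sub>R dd F (\<lambda>_. G k) W x)"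
proof -
  have sm: "smooth (\<lambda>y. \<Sum>k\<in>I. c k *\<^sub>R G k y)" by (intro smooth_sum smooth_cscaleR G)
  have "dd F (\<lambda>_ y. \<Sum>k\<in>I. c k *\<^sub>R G k y) W x $ i = (\<Sum>k\<in>I. c k * dd F (\<lambda>_. G k) W x $ i)" for i
  proof -
    obtain J g where 1: "smooth_fin J g" "\<forall>W x. smooth W \<longrightarrow> F W x $ i = g (jet W x)"
      using diffop_scalar[OF F, of i] unfolding scalar_diffop_def by blast
    have a: "dd F (\<lambda>_. V) W x $ i = (\<Sum>j\<in>J. coord_deriv j g (jet W x) * jet V x j)" if "smooth V" for V
      unfolding dd_component(1)[where G = "\<lambda>_. V", OF F assms(2) that]
      by (rule dd_formula[where G = "\<lambda>_. V", OF 1 assms(2) that])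
    have j: "jet (\<lambda>y. \<Sum>k\<in>I. c k *\<^sub>R G k y) x j = (\<Sum>k\<in>I. c k * jet (G k) x j)" for j
      unfolding jet_def using G by (cases j) (simp add: nder_sum[OF I] smooth_cscaleR nder_cscaleR)
    have "dd F (\<lambda>_ y. \<Sum>k\<in>I. c k *\<^sub>R G k y) W x $ i
        = (\<Sum>j\<in>J. \<Sum>k\<in>I. c k * (coord_deriv j g (jet W x) * jet (G k) x j))"
      unfolding a[OF sm] j by (simp add: sum_distrib_left mult_ac)
    also have "\<dots> = (\<Sum>k\<in>I. c k * dd F (\<lambda>_. G k) W x $ i)"
      by (subst sum.swap) (simp add: a[OF G] sum_distrib_left)
    finally show ?thesis .
  qed
  then show ?thesis by (simp add: vec_eq_iff)
qed

lemma dd_cscaleR_direction: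
  assumes "diffop F" "smooth W" "smooth (G W)"
  shows "dd F (\<lambda>W y. c *\<^sub>R G W y) W x = c *\<^sub>R dd F G W x"
  using dd_direction_lincomb[OF assms(1,2), of "{()}" "\<lambda>_. G W" "\<lambda>_. c"] assms(3) unfolding dd_def by simp

lemma bounded_linear_imp_smooth:
  assumes "bounded_linear T" shows "smooth T"
proof (rule smooth_coinduct[of "\<lambda>f. f = T \<or> (\<exists>c. f = (\<lambda>z. c))"])
  fix f assume f: "f = T \<or> (\<exists>c. f = (\<lambda>z. c))"
  have "(T has_derivative T) (at x)" for x using assms by (rule bounded_linear_imp_has_derivative)
  then have "T differentiable at x" "dir e T = (\<lambda>z. T e)" for x e
    by (auto intro: differentiableI dir_eqI simp: fun_eq_iff)
  then show "(\<forall>x. f differentiable at x) \<and> (\<forall>e. dir e f = T \<or> (\<exists>c. dir e f = (\<lambda>z. c)))"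
    using f by (elim disjE exE) auto
qed simp

text \<open>On the surface U(x, s) = W(x) + s G(W)(x), the derivative in the direction G(W) is the
  s-derivative at s = 0, so the claim is the symmetry of a mixed second derivative in x and
  s.\<close>

lemma dd_pd:
  fixes F :: "(real^'d::finite \<Rightarrow> real^'n::finite) \<Rightarrow> real^'d \<Rightarrow> real^'m::finite"
  assumes F: "diffop F" and W: "smooth W" and V: "smooth (G W)"
  shows "dd (\<lambda>W. pd \<alpha> (F W)) G W x = pd \<alpha> (dd F G W) x"
proof -
  define U where "U = (\<lambda>z. W (fst z) + snd z *\<^sub>R G W (fst z))"
  have snd: "smooth (\<lambda>z::(real^'d) \<times> real. snd z)"
    by (rule bounded_linear_imp_smooth[OF bounded_linear_snd])
  have "reg (\<lambda>N h (z::(real^'d) \<times> real). W (fst z) + snd z *\<^sub>R G W (fst z))"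
    by (intro reg_add reg_scaleR) (simp_all add: reg_const_fam_iff smooth_fst W V snd)
  then have U: "smooth U" by (simp only: reg_const_fam_iff U_def)
  have Us: "(\<lambda>y. U (y, s)) = (\<lambda>y. W y + s *\<^sub>R G W y)" for s by (simp add: U_def)
  have dU: "dir (0, 1) U (y, s) = G W y" for y s
  proof (rule dir_eqI[THEN trans])
    show "(U has_derivative (\<lambda>u. dir (fst u) W (fst (y, s)) + (snd (y, s) *\<^sub>R dir (fst u) (G W) (fst (y, s)) + snd u *\<^sub>R G W (fst (y, s))))) (at (y, s))"
      unfolding U_def
      by (intro has_derivative_add has_derivative_scaleR has_derivative_compose[OF bounded_linear_imp_has_derivative[OF bounded_linear_fst] has_derivative_smooth]
          bounded_linear_imp_has_derivative[OF bounded_linear_snd] W V)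
    show "dir (fst (0, 1)) W (fst (y, s)) + (snd (y, s) *\<^sub>R dir (fst (0, 1)) (G W) (fst (y, s)) + snd (0, 1) *\<^sub>R G W (fst (y, s))) = G W y"
      using linear_0[OF linear_dir[OF smooth_differentiable[OF W]]] linear_0[OF linear_dir[OF smooth_differentiable[OF V]]] by simp
  qed
  define \<phi> where "\<phi> = (\<lambda>z. F (\<lambda>y. U (y, snd z)) (fst z))"
  have \<phi>: "smooth \<phi>"
    using diffop_reg[OF F, of "\<lambda>N h. U"] U by (simp add: reg_const_fam_iff \<phi>_def)
  have dt: "dir (0, 1) (\<lambda>z. H (\<lambda>y. U (y, snd z)) (fst z)) (x, 0) = dd H G W x"
    if "diffop H" for H :: "(real^'d::finite \<Rightarrow> real^'n::finite) \<Rightarrow> real^'d \<Rightarrow> real^'m::finite" and x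
  proof -
    have "dir (0, 1) (\<lambda>z. H (\<lambda>y. U (y, snd z)) (fst z)) (x, 0)
        = dd H (\<lambda>_ y. dir (0, 1) U (y, 0)) (\<lambda>y. U (y, 0)) x" by (rule diffop_dt[OF that U])
    then show ?thesis unfolding Us dU by (simp add: dd_def)
  qed
  have pd\<phi>: "(\<lambda>z. pd \<alpha> (F (\<lambda>y. U (y, snd z))) (fst z)) = dir (axis \<alpha> 1, 0) \<phi>"
  proof
    fix z
    have "pd \<alpha> (F (\<lambda>y. U (y, snd z))) (fst z) = dir (axis \<alpha> 1) (\<lambda>x. \<phi> (x, snd z)) (fst z)"
      by (simp add: pd_dir \<phi>_def)
    also have "\<dots> = dir (axis \<alpha> 1, 0) \<phi> z" using dir_slice(1)[OF smooth_differentiable[OF \<phi>]] by simp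
    finally show "pd \<alpha> (F (\<lambda>y. U (y, snd z))) (fst z) = dir (axis \<alpha> 1, 0) \<phi> z" .
  qed
  have "dd (\<lambda>W. pd \<alpha> (F W)) G W x = dir (0, 1) (dir (axis \<alpha> 1, 0) \<phi>) (x, 0)"
    using dt[OF diffop_pd[OF F, of \<alpha>]] unfolding pd\<phi> by simp
  also have "\<dots> = dir (axis \<alpha> 1, 0) (dir (0, 1) \<phi>) (x, 0)" by (simp add: dir_commute[OF \<phi>])
  also have "\<dots> = dir (axis \<alpha> 1) (\<lambda>y. dir (0, 1) \<phi> (y, 0)) x"
    by (rule dir_slice(1)[OF smooth_differentiable[OF smooth_dir[OF \<phi>]], symmetric])
  also have "(\<lambda>y. dir (0, 1) \<phi> (y, 0)) = dd F G W" unfolding \<phi>_def by (rule ext) (rule dt[OF F])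
  finally show ?thesis by (simp add: pd_dir)
qed

section \<open>Block decomposition of the moments and of Lambda\<close>

subsection \<open>Blocks\<close>

lemma cpart_join [simp]: "cpart (join w y) = w"
  and npart_join [simp]: "npart (join w y) = y"
  and join_parts [simp]: "join (cpart m) (npart m) = m"
  by (auto simp: cpart_def npart_def join_def vec_eq_iff split: sum.splits)

lemma join_add: "join (a + a') (b + b') = join a b + join a' b'"
  and join_diff: "join (a - a') (b - b') = join a b - join a' b'"
  and join_scaleR: "join (c *\<^sub>R a) (c *\<^sub>R b) = c *\<^sub>R join a b"
  and join_minus: "join (- a) (- b) = - join a b"
  and join_zero [simp]: "join 0 0 = 0"
  by (auto simp: join_def vec_eq_iff split: sum.splits)

lemma bounded_linear_cpart: "bounded_linear cpart"
  by (rule linear_conv_bounded_linear[THEN iffD1]) (simp add: linear_iff cpart_def vec_eq_iff)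

lemma bounded_linear_npart: "bounded_linear npart"
  by (rule linear_conv_bounded_linear[THEN iffD1]) (simp add: linear_iff npart_def vec_eq_iff)

lemma bounded_linear_join1: "bounded_linear (\<lambda>w. join w 0)"
  by (rule linear_conv_bounded_linear[THEN iffD1])
    (auto simp: linear_iff join_def vec_eq_iff split: sum.splits)

lemma bounded_linear_join2: "bounded_linear (\<lambda>y. join 0 y)"
  by (rule linear_conv_bounded_linear[THEN iffD1])
    (auto simp: linear_iff join_def vec_eq_iff split: sum.splits)

lemma join_split: "join w y = join w 0 + join 0 y"
  using join_add[of w 0 0 y] by simp

lemmas cpart_simps = bounded_linear.linear[OF bounded_linear_cpart, THEN linear_add]
    bounded_linear.linear[OF bounded_linear_cpart, THEN linear_diff]
    bounded_linear.linear[OF bounded_linear_cpart, THEN linear_scale]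
    bounded_linear.linear[OF bounded_linear_cpart, THEN linear_neg]
    bounded_linear.linear[OF bounded_linear_cpart, THEN linear_0]

lemmas npart_simps = bounded_linear.linear[OF bounded_linear_npart, THEN linear_add]
    bounded_linear.linear[OF bounded_linear_npart, THEN linear_diff]
    bounded_linear.linear[OF bounded_linear_npart, THEN linear_scale]
    bounded_linear.linear[OF bounded_linear_npart, THEN linear_neg]
    bounded_linear.linear[OF bounded_linear_npart, THEN linear_0]

lemma reg_join: "reg a \<Longrightarrow> reg b \<Longrightarrow> reg (\<lambda>N h z. join (a N h z) (b N h z))"
  by (subst join_split)
    (intro reg_add reg_bounded_linear[OF bounded_linear_join1] reg_bounded_linear[OF bounded_linear_join2])

lemma smooth_join: "smooth a \<Longrightarrow> smooth b \<Longrightarrow> smooth (\<lambda>z. join (a z) (b z))"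
  using reg_join[of "\<lambda>N h. a" "\<lambda>N h. b"] by (simp only: reg_const_fam_iff)

lemma diffop_join: "diffop F \<Longrightarrow> diffop G \<Longrightarrow> diffop (\<lambda>W x. join (F W x) (G W x))"
  by (subst join_split)
    (intro diffop_add diffop_linear[OF bounded_linear_join1] diffop_linear[OF bounded_linear_join2])

lemma dd_join:
  assumes "diffop F" "diffop F'" "smooth W" "smooth (G W)"
  shows "dd (\<lambda>W x. join (F W x) (F' W x)) G W x = join (dd F G W x) (dd F' G W x)"
proof -
  have "dd (\<lambda>W x. join (F W x) (F' W x)) G W x = dd (\<lambda>W x. join (F W x) 0 + join 0 (F' W x)) G W x"
    by (simp add: join_split[symmetric])
  also have "\<dots> = dd (\<lambda>W x. join (F W x) 0) G W x + dd (\<lambda>W x. join 0 (F' W x)) G W x"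
    by (intro dd_add diffop_linear[OF bounded_linear_join1] diffop_linear[OF bounded_linear_join2] assms)
  also have "\<dots> = join (dd F G W x) 0 + join 0 (dd F' G W x)"
    by (simp add: dd_linear[where G = G, OF bounded_linear_join1 assms(1,3,4)] dd_linear[where G = G, OF bounded_linear_join2 assms(2,3,4)])
  finally show ?thesis by (simp add: join_split[symmetric])
qed

lemma pd_linear: "bounded_linear T \<Longrightarrow> smooth f \<Longrightarrow> pd \<alpha> (\<lambda>x. T (f x)) x = T (pd \<alpha> f x)"
  by (simp add: pd_dir dir_bounded_linear smooth_differentiable)

lemma pd_add: "smooth f \<Longrightarrow> smooth g \<Longrightarrow> pd \<alpha> (\<lambda>x. f x + g x) x = pd \<alpha> f x + pd \<alpha> g x"
  by (simp add: pd_dir dir_add smooth_differentiable)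

lemma smooth_pd: "smooth f \<Longrightarrow> smooth (pd \<alpha> f)"
  by (simp add: pd_dir smooth_dir)

lemma bounded_linear_matrix: "bounded_linear (\<lambda>x. (Q :: real^'a^'b) *v x)"
  by (rule matrix_vector_mul_bounded_linear)

lemma smooth_Lam: "smooth m \<Longrightarrow> smooth (Lam v M m)"
  unfolding Lam_def[abs_def]
  by (intro smooth_sum smooth_bounded_linear[OF bounded_linear_matrix] smooth_pd)

lemma Lam_add: "smooth f \<Longrightarrow> smooth g \<Longrightarrow> Lam v M (\<lambda>x. f x + g x) x = Lam v M f x + Lam v M g x"
  by (simp add: Lam_def pd_add matrix_vector_right_distrib sum.distrib)

lemma Lam_cscaleR: "smooth f \<Longrightarrow> Lam v M (\<lambda>x. c *\<^sub>R f x) x = c *\<^sub>R Lam v M f x"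
  by (simp add: Lam_def pd_linear[OF bounded_linear_scaleR_right] scaleR_sum_right matrix_vector_mult_scaleR)

lemma diffop_Lam: "diffop F \<Longrightarrow> diffop (\<lambda>W. Lam v M (F W))"
  unfolding Lam_def[abs_def]
  by (intro diffop_sum diffop_linear[OF bounded_linear_matrix] diffop_pd)

lemma dd_sum:
  assumes "finite I" "\<And>i. i \<in> I \<Longrightarrow> diffop (F i)" "smooth W" "smooth (G W)"
  shows "dd (\<lambda>W x. \<Sum>i\<in>I. F i W x) G W x = (\<Sum>i\<in>I. dd (F i) G W x)"
  using assms(1,2)
proof (induction I rule: finite_induct)
  case (insert i I)
  have "dd (\<lambda>W x. F i W x + (\<Sum>i\<in>I. F i W x)) G W x = dd (F i) G W x + dd (\<lambda>W x. \<Sum>i\<in>I. F i W x) G W x"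
    by (intro dd_add diffop_sum assms(3,4)) (simp_all add: insert.prems)
  then show ?case using insert by simp
qed (simp add: dd_zero)

lemma dd_Lam:
  assumes F: "diffop F" and W: "smooth W" and V: "smooth (G W)"
  shows "dd (\<lambda>W. Lam v M (F W)) G W x = Lam v M (dd F G W) x"
proof -
  have "dd (\<lambda>W x. \<Sum>\<alpha>\<in>UNIV. (M ** diag (\<lambda>j. v j $ \<alpha>) ** matrix_inv M) *v pd \<alpha> (F W) x) G W x
    = (\<Sum>\<alpha>\<in>UNIV. dd (\<lambda>W x. (M ** diag (\<lambda>j. v j $ \<alpha>) ** matrix_inv M) *v pd \<alpha> (F W) x) G W x)"
    by (intro dd_sum diffop_linear[OF bounded_linear_matrix] diffop_pd assms) simp
  also have "\<dots> = (\<Sum>\<alpha>\<in>UNIV. (M ** diag (\<lambda>j. v j $ \<alpha>) ** matrix_inv M) *v pd \<alpha> (dd F G W) x)"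
    by (simp add: dd_linear[where G = G, OF bounded_linear_matrix diffop_pd[OF F] W V] dd_pd[where G = G, OF F W V])
  finally show ?thesis unfolding Lam_def[abs_def] .
qed

lemma Lam_blocks:
  assumes "smooth w" "smooth y"
  shows "Lam v M (\<lambda>x. join (w x) (y x)) x =
    join (blkA (Lam v M) w x + blkB (Lam v M) y x) (blkC (Lam v M) w x + blkD (Lam v M) y x)"
proof -
  have "Lam v M (\<lambda>x. join (w x) (y x)) x = Lam v M (\<lambda>x. join (w x) 0) x + Lam v M (\<lambda>x. join 0 (y x)) x"
    by (subst join_split) (rule Lam_add; intro smooth_join assms smooth_const)
  then show ?thesis unfolding blkA_def blkB_def blkC_def blkD_def
    by (simp add: join_add)
qed

lemma blk_smooth:
  "smooth a \<Longrightarrow> smooth (blkA (Lam v M) a)" "smooth b \<Longrightarrow> smooth (blkB (Lam v M) b)"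
  "smooth a \<Longrightarrow> smooth (blkC (Lam v M) a)" "smooth b \<Longrightarrow> smooth (blkD (Lam v M) b)"
  unfolding blkA_def[abs_def] blkB_def[abs_def] blkC_def[abs_def] blkD_def[abs_def]
  by (intro smooth_bounded_linear[OF bounded_linear_cpart] smooth_bounded_linear[OF bounded_linear_npart]
      smooth_Lam smooth_join smooth_const, assumption)+

text \<open>Blocks of a square: Lambda is applied to the vector (B y, D y) obtained by applying it
  to (0, y).\<close>

lemma blk2:
  assumes y: "smooth y"
  shows "blkB (Lam v M \<circ> Lam v M) y x = blkA (Lam v M) (blkB (Lam v M) y) x + blkB (Lam v M) (blkD (Lam v M) y) x"
    and "blkD (Lam v M \<circ> Lam v M) y x = blkC (Lam v M) (blkB (Lam v M) y) x + blkD (Lam v M) (blkD (Lam v M) y) x"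
proof -
  have e: "Lam v M (\<lambda>x. join 0 (y x)) = (\<lambda>x. join (blkB (Lam v M) y x) (blkD (Lam v M) y x))"
    by (simp add: blkB_def blkD_def fun_eq_iff)
  have "Lam v M (Lam v M (\<lambda>x. join 0 (y x))) x =
    join (blkA (Lam v M) (blkB (Lam v M) y) x + blkB (Lam v M) (blkD (Lam v M) y) x)
      (blkC (Lam v M) (blkB (Lam v M) y) x + blkD (Lam v M) (blkD (Lam v M) y) x)"
    unfolding e by (rule Lam_blocks) (intro blk_smooth y)+
  then show "blkB (Lam v M \<circ> Lam v M) y x = blkA (Lam v M) (blkB (Lam v M) y) x + blkB (Lam v M) (blkD (Lam v M) y) x"
    "blkD (Lam v M \<circ> Lam v M) y x = blkC (Lam v M) (blkB (Lam v M) y) x + blkD (Lam v M) (blkD (Lam v M) y) x"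
    by (simp_all add: blkB_def blkD_def)
qed

lemma join1_lin: "join (a + b) 0 = join a 0 + join b 0" "join (c *\<^sub>R a) 0 = c *\<^sub>R join a 0"
  and join2_lin: "join 0 (y + z) = join 0 y + join 0 z" "join 0 (c *\<^sub>R y) = c *\<^sub>R join 0 y"
  by (auto simp: join_def vec_eq_iff split: sum.splits)

lemma blk_add:
  "smooth a \<Longrightarrow> smooth b \<Longrightarrow> blkA (Lam v M) (\<lambda>x. a x + b x) x = blkA (Lam v M) a x + blkA (Lam v M) b x"
  "smooth p \<Longrightarrow> smooth q \<Longrightarrow> blkB (Lam v M) (\<lambda>x. p x + q x) x = blkB (Lam v M) p x + blkB (Lam v M) q x"
  "smooth a \<Longrightarrow> smooth b \<Longrightarrow> blkC (Lam v M) (\<lambda>x. a x + b x) x = blkC (Lam v M) a x + blkC (Lam v M) b x"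
  "smooth p \<Longrightarrow> smooth q \<Longrightarrow> blkD (Lam v M) (\<lambda>x. p x + q x) x = blkD (Lam v M) p x + blkD (Lam v M) q x"
  unfolding blkA_def blkB_def blkC_def blkD_def
  by (simp_all add: join1_lin join2_lin Lam_add smooth_join smooth_const cpart_simps npart_simps)

lemma blk_cscaleR:
  "smooth a \<Longrightarrow> blkA (Lam v M) (\<lambda>x. c *\<^sub>R a x) x = c *\<^sub>R blkA (Lam v M) a x"
  "smooth p \<Longrightarrow> blkB (Lam v M) (\<lambda>x. c *\<^sub>R p x) x = c *\<^sub>R blkB (Lam v M) p x"
  "smooth a \<Longrightarrow> blkC (Lam v M) (\<lambda>x. c *\<^sub>R a x) x = c *\<^sub>R blkC (Lam v M) a x"
  "smooth p \<Longrightarrow> blkD (Lam v M) (\<lambda>x. c *\<^sub>R p x) x = c *\<^sub>R blkD (Lam v M) p x"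
  unfolding blkA_def blkB_def blkC_def blkD_def
  by (simp_all add: join1_lin join2_lin Lam_cscaleR smooth_join smooth_const cpart_simps npart_simps)

lemma diffop_blk:
  "diffop F \<Longrightarrow> diffop (\<lambda>W. blkA (Lam v M) (F W))" "diffop G \<Longrightarrow> diffop (\<lambda>W. blkB (Lam v M) (G W))"
  "diffop F \<Longrightarrow> diffop (\<lambda>W. blkC (Lam v M) (F W))" "diffop G \<Longrightarrow> diffop (\<lambda>W. blkD (Lam v M) (G W))"
  unfolding blkA_def[abs_def] blkB_def[abs_def] blkC_def[abs_def] blkD_def[abs_def]
  by (intro diffop_linear[OF bounded_linear_cpart] diffop_linear[OF bounded_linear_npart]
      diffop_Lam diffop_join diffop_zero, assumption)+

lemma dd_blk:
  assumes F: "diffop F" and F': "diffop F'" and W: "smooth W" and V: "smooth (G W)"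
  shows "dd (\<lambda>W. blkA (Lam v M) (F W)) G W x = blkA (Lam v M) (dd F G W) x"
    and "dd (\<lambda>W. blkB (Lam v M) (F' W)) G W x = blkB (Lam v M) (dd F' G W) x"
    and "dd (\<lambda>W. blkC (Lam v M) (F W)) G W x = blkC (Lam v M) (dd F G W) x"
    and "dd (\<lambda>W. blkD (Lam v M) (F' W)) G W x = blkD (Lam v M) (dd F' G W) x"
proof -
  note d = diffop_join[OF F diffop_zero] diffop_join[OF diffop_zero F']
  have j: "dd (\<lambda>W x. join (F W x) 0) G W = (\<lambda>x. join (dd F G W x) 0)"
    "dd (\<lambda>W x. join 0 (F' W x)) G W = (\<lambda>x. join 0 (dd F' G W x))"
    by (simp_all add: fun_eq_iff dd_linear[where G = G, OF bounded_linear_join1 F W V] dd_linear[where G = G, OF bounded_linear_join2 F' W V])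
  show "dd (\<lambda>W. blkA (Lam v M) (F W)) G W x = blkA (Lam v M) (dd F G W) x"
    "dd (\<lambda>W. blkB (Lam v M) (F' W)) G W x = blkB (Lam v M) (dd F' G W) x"
    "dd (\<lambda>W. blkC (Lam v M) (F W)) G W x = blkC (Lam v M) (dd F G W) x"
    "dd (\<lambda>W. blkD (Lam v M) (F' W)) G W x = blkD (Lam v M) (dd F' G W) x"
    unfolding blkA_def[abs_def] blkB_def[abs_def] blkC_def[abs_def] blkD_def[abs_def]
    by (simp_all add: dd_linear[where G = G, OF bounded_linear_cpart diffop_Lam[OF d(1)] W V] dd_linear[where G = G, OF bounded_linear_cpart diffop_Lam[OF d(2)] W V]
        dd_linear[where G = G, OF bounded_linear_npart diffop_Lam[OF d(1)] W V] dd_linear[where G = G, OF bounded_linear_npart diffop_Lam[OF d(2)] W V]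
        dd_Lam[where G = G, OF d(1) W V] dd_Lam[where G = G, OF d(2) W V] j)
qed

section \<open>Truncated exponentials of commuting operators on a filtered vector space\<close>

subsection \<open>The tanh argument\<close>

text \<open>With pointwise operations, both the families in \<open>h\<close> and the series of
  differential operators become vectors, so that one abstract argument serves the Taylor and the
  Chapman-Enskog expansion.\<close>

instantiation "fun" :: (type, real_vector) real_vector
begin

definition scaleR_fun :: "real \<Rightarrow> ('a \<Rightarrow> 'b) \<Rightarrow> 'a \<Rightarrow> 'b" where
  "scaleR_fun c f = (\<lambda>x. c *\<^sub>R f x)"

instance
  by standard (simp_all add: scaleR_fun_def fun_eq_iff scaleR_add_left scaleR_add_right)

end

lemma scaleR_fun_apply [simp]: "(c *\<^sub>R f) x = c *\<^sub>R f x"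
  by (simp add: scaleR_fun_def)

text \<open>Linear functionals separate points. An identity between linear combinations thus turns
  into one between real numbers, which real arithmetic decides.\<close>

lemma eq_by_functionals:
  fixes x y :: "'v::real_vector"
  assumes "\<And>f :: 'v \<Rightarrow> real. linear f \<Longrightarrow> f x = f y" shows "x = y"
proof (rule ccontr)
  assume "x \<noteq> y"
  then have "independent {x - y}" by simp
  then obtain f :: "'v \<Rightarrow> real" where "linear f" "f (x - y) = 1"
    using linear_independent_extend[of "{x - y}" "\<lambda>_. 1"] by auto
  then show False using assms[of f] by (simp add: linear_diff)
qed

text \<open>The exponential series cut after degree 4, as five applications of an operator that
  raises the order produce a neglected term.\<close>

definition exp4 :: "('v \<Rightarrow> 'v) \<Rightarrow> 'v \<Rightarrow> 'v::real_vector" where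
  "exp4 A u = (\<Sum>l\<le>4. (1 / fact l) *\<^sub>R (A ^^ l) u)"

text \<open>\<open>F k\<close> is the space of terms of order \<open>k\<close> in the time step and \<open>G\<close> the space of terms
  that are neglected.\<close>

locale filtered =
  fixes F :: "nat \<Rightarrow> 'v::real_vector set" and G :: "'v set"
  assumes subspace_F: "subspace (F k)" and subspace_G: "subspace G"
    and F_le: "F k \<subseteq> F 0" and G_le: "G \<subseteq> F 0" and F_G: "5 \<le> k \<Longrightarrow> F k \<subseteq> G"
begin

text \<open>Linearity is asked on \<open>F 0\<close> only, because derivatives are linear only where
  they exist. Invariance of \<open>G\<close> is a separate condition, as \<open>G\<close> need not
  be a member of the filtration.\<close>

definition raises :: "('v \<Rightarrow> 'v) \<Rightarrow> bool" where
  "raises A \<longleftrightarrow> (\<forall>u\<in>F 0. \<forall>v\<in>F 0. A (u + v) = A u + A v) \<and> (\<forall>c. \<forall>u\<in>F 0. A (c *\<^sub>R u) = c *\<^sub>R A u) \<and>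
    (\<forall>k. \<forall>u\<in>F k. A u \<in> F (Suc k)) \<and> (\<forall>u\<in>G. A u \<in> G)"

lemma raises_plus: "raises A \<Longrightarrow> u \<in> F 0 \<Longrightarrow> v \<in> F 0 \<Longrightarrow> A (u + v) = A u + A v"
  and raises_scale: "raises A \<Longrightarrow> u \<in> F 0 \<Longrightarrow> A (c *\<^sub>R u) = c *\<^sub>R A u"
  by (auto simp: raises_def)

lemma raises_sub: "raises A \<Longrightarrow> u \<in> F 0 \<Longrightarrow> v \<in> F 0 \<Longrightarrow> A (u - v) = A u - A v"
  using raises_plus[of A u "(-1) *\<^sub>R v"] raises_scale[of A v "-1"] subspace_scale[OF subspace_F, of v 0 "-1"] by simp

lemmas raises_linear = raises_plus raises_scale raises_sub

lemma raises_F: "raises A \<Longrightarrow> u \<in> F k \<Longrightarrow> A u \<in> F (Suc k)"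
  and raises_G: "raises A \<Longrightarrow> u \<in> G \<Longrightarrow> A u \<in> G"
  unfolding raises_def by auto

lemma raises_F0: "raises A \<Longrightarrow> u \<in> F 0 \<Longrightarrow> A u \<in> F 0"
  using raises_F[of A u 0] F_le by blast

lemma raises_pow: "raises A \<Longrightarrow> u \<in> F k \<Longrightarrow> (A ^^ l) u \<in> F (l + k)"
  by (induction l) (auto intro: raises_F)

lemma raises_pow0: "raises A \<Longrightarrow> u \<in> F 0 \<Longrightarrow> (A ^^ l) u \<in> F 0"
  using raises_pow[of A u 0 l] F_le by auto

lemma raises_powG: "raises A \<Longrightarrow> u \<in> G \<Longrightarrow> (A ^^ l) u \<in> G"
  by (induction l) (auto intro: raises_G)

lemma raises_pow_linear:
  assumes "raises A" "u \<in> F 0"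
  shows "v \<in> F 0 \<Longrightarrow> (A ^^ l) (u + v) = (A ^^ l) u + (A ^^ l) v" "(A ^^ l) (c *\<^sub>R u) = c *\<^sub>R (A ^^ l) u"
    "v \<in> F 0 \<Longrightarrow> (A ^^ l) (u - v) = (A ^^ l) u - (A ^^ l) v"
  by (induction l) (simp_all add: raises_linear[OF assms(1)] raises_pow0 assms)

lemma raises_pow_sum:
  assumes "raises A" "finite I" "\<And>i. i \<in> I \<Longrightarrow> u i \<in> F 0"
  shows "(A ^^ l) (\<Sum>i\<in>I. c i *\<^sub>R u i) = (\<Sum>i\<in>I. c i *\<^sub>R (A ^^ l) (u i))"
  using assms(2,3)
proof (induction I rule: finite_induct)
  case empty
  have "0 \<in> F 0" using subspace_0[OF subspace_F] .
  from raises_pow_linear(2)[OF assms(1) this, of l 0] show ?case by simp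
next
  case (insert i I)
  then have "(\<Sum>i\<in>I. c i *\<^sub>R u i) \<in> F 0" "c i *\<^sub>R u i \<in> F 0"
    by (auto intro!: subspace_sum[OF subspace_F] subspace_scale[OF subspace_F])
  then show ?case using insert raises_pow_linear[OF assms(1)] by simp
qed

lemma exp4_F0: "raises A \<Longrightarrow> u \<in> F 0 \<Longrightarrow> exp4 A u \<in> F 0"
  unfolding exp4_def by (intro subspace_sum[OF subspace_F] subspace_scale[OF subspace_F] raises_pow0)

lemma exp4_G: "raises A \<Longrightarrow> u \<in> G \<Longrightarrow> exp4 A u \<in> G"
  unfolding exp4_def by (intro subspace_sum[OF subspace_G] subspace_scale[OF subspace_G] raises_powG)

lemma exp4_diff: "raises A \<Longrightarrow> u \<in> F 0 \<Longrightarrow> v \<in> F 0 \<Longrightarrow> exp4 A (u - v) = exp4 A u - exp4 A v"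
  unfolding exp4_def by (simp add: raises_pow_linear scaleR_diff_right sum_subtractf)

lemma raises_add:
  assumes A: "raises A" and B: "raises B" shows "raises (\<lambda>u. A u + B u)"
  unfolding raises_def
proof (intro conjI ballI allI)
  show "A (u + v) + B (u + v) = A u + B u + (A v + B v)" if "u \<in> F 0" "v \<in> F 0" for u v
    by (simp add: raises_plus[OF A] raises_plus[OF B] that)
  show "A (c *\<^sub>R u) + B (c *\<^sub>R u) = c *\<^sub>R (A u + B u)" if "u \<in> F 0" for c u
    by (simp add: raises_scale[OF A] raises_scale[OF B] that scaleR_add_right)
  show "A u + B u \<in> F (Suc k)" if "u \<in> F k" for k u
    by (rule subspace_add[OF subspace_F raises_F[OF A that] raises_F[OF B that]])
  show "A u + B u \<in> G" if "u \<in> G" for u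
    by (rule subspace_add[OF subspace_G raises_G[OF A that] raises_G[OF B that]])
qed

lemma raises_minus:
  assumes A: "raises A" shows "raises (\<lambda>u. - A u)"
  unfolding raises_def
proof (intro conjI ballI allI)
  show "- A (u + v) = - A u + - A v" if "u \<in> F 0" "v \<in> F 0" for u v
    by (simp add: raises_plus[OF A] that)
  show "- A (c *\<^sub>R u) = c *\<^sub>R (- A u)" if "u \<in> F 0" for c u
    by (simp add: raises_scale[OF A] that)
  show "- A u \<in> F (Suc k)" if "u \<in> F k" for k u
    by (rule subspace_neg[OF subspace_F raises_F[OF A that]])
  show "- A u \<in> G" if "u \<in> G" for u
    by (rule subspace_neg[OF subspace_G raises_G[OF A that]])
qed

lemma binomial_ops:
  assumes A: "raises A" and B: "raises B" and comm: "\<And>u. u \<in> F 0 \<Longrightarrow> B (A u) = A (B u)" and m: "m \<in> F 0"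
  shows "((\<lambda>u. A u + B u) ^^ n) m = (\<Sum>k\<le>n. of_nat (n choose k) *\<^sub>R (A ^^ (n - k)) ((B ^^ k) m))"
proof (induction n)
  case (Suc n)
  define w where "w = (\<lambda>a b. (A ^^ a) ((B ^^ b) m))"
  have w0: "w a b \<in> F 0" for a b unfolding w_def by (intro raises_pow0 A B m)
  have Aw: "A (w a b) = w (Suc a) b" for a b by (simp add: w_def)
  have "B ((A ^^ a) u) = (A ^^ a) (B u)" if "u \<in> F 0" for a u
    by (induction a) (simp_all add: comm raises_pow0 A that)
  then have Bw: "B (w a b) = w a (Suc b)" for a b
    by (simp add: w_def raises_pow0 B m)
  have S: "((\<lambda>u. A u + B u) ^^ n) m = (\<Sum>k\<le>n. of_nat (n choose k) *\<^sub>R w (n - k) k)"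
    using Suc by (simp add: w_def)
  have "((\<lambda>u. A u + B u) ^^ Suc n) m
      = (\<Sum>k\<le>n. of_nat (n choose k) *\<^sub>R w (Suc n - k) k) + (\<Sum>k\<le>n. of_nat (n choose k) *\<^sub>R w (n - k) (Suc k))"
    using raises_pow_sum[OF A finite_atMost, where l = 1] raises_pow_sum[OF B finite_atMost, where l = 1]
    by (simp add: S w0 Aw Bw Suc_diff_le)
  also have "(\<Sum>k\<le>n. of_nat (n choose k) *\<^sub>R w (Suc n - k) k)
      = w (Suc n) 0 + (\<Sum>k\<le>n. of_nat (n choose Suc k) *\<^sub>R w (n - k) (Suc k))"
  proof -
    have "(\<Sum>k\<le>n. of_nat (n choose k) *\<^sub>R w (Suc n - k) k) = (\<Sum>k\<le>Suc n. of_nat (n choose k) *\<^sub>R w (Suc n - k) k)"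
      by simp
    also have "\<dots> = w (Suc n) 0 + (\<Sum>k\<le>n. of_nat (n choose Suc k) *\<^sub>R w (n - k) (Suc k))"
      by (subst sum.atMost_Suc_shift) simp
    finally show ?thesis .
  qed
  also have "w (Suc n) 0 + (\<Sum>k\<le>n. of_nat (n choose Suc k) *\<^sub>R w (n - k) (Suc k))
      + (\<Sum>k\<le>n. of_nat (n choose k) *\<^sub>R w (n - k) (Suc k))
    = (\<Sum>k\<le>Suc n. of_nat (Suc n choose k) *\<^sub>R w (Suc n - k) k)"
    by (subst sum.atMost_Suc_shift) (simp add: sum.distrib[symmetric] scaleR_add_left[symmetric] add.commute)
  finally show ?case by (simp add: w_def)
qed simp

text \<open>The product of the truncated series is a sum over the square a, b \<le> 4, the truncated
  exponential of the sum is its part with a + b \<le> 4 (binomial theorem), and each remaining term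
  has order at least 5.\<close>

lemma exp4_mult:
  assumes A: "raises A" and B: "raises B" and comm: "\<And>u. u \<in> F 0 \<Longrightarrow> B (A u) = A (B u)" and m: "m \<in> F 0"
  shows "exp4 B (exp4 A m) - exp4 (\<lambda>u. A u + B u) m \<in> G"
proof -
  define w where "w = (\<lambda>(a, b). (1 / (fact a * fact b)) *\<^sub>R (A ^^ a) ((B ^^ b) m))"
  have comm1: "B ((A ^^ a) u) = (A ^^ a) (B u)" if "u \<in> F 0" for a u
    by (induction a) (simp_all add: comm raises_pow0 A that)
  have comm2: "(B ^^ b) ((A ^^ a) m) = (A ^^ a) ((B ^^ b) m)" for a b
    by (induction b) (simp_all add: comm1 raises_pow0 A B m)
  have "exp4 B (exp4 A m) = (\<Sum>b\<le>4. \<Sum>a\<le>4. w (a, b))"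
    unfolding exp4_def
    by (simp add: raises_pow_sum[OF B finite_atMost] raises_pow0[OF A m] scaleR_sum_right comm2 w_def mult.commute)
  also have "\<dots> = sum w ({..4} \<times> {..4})"
    by (subst sum.swap) (simp add: sum.cartesian_product)
  finally have 1: "exp4 B (exp4 A m) = sum w ({..4} \<times> {..4})" .
  have "exp4 (\<lambda>u. A u + B u) m = (\<Sum>n\<le>4. \<Sum>k\<le>n. w (n - k, k))"
    unfolding exp4_def
  proof (rule sum.cong[OF refl])
    fix n
    have "((\<lambda>u. A u + B u) ^^ n) m = (\<Sum>k\<le>n. of_nat (n choose k) *\<^sub>R (A ^^ (n - k)) ((B ^^ k) m))"
      by (rule binomial_ops[OF assms])
    then show "(1 / fact n) *\<^sub>R ((\<lambda>u. A u + B u) ^^ n) m = (\<Sum>k\<le>n. w (n - k, k))"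
      by (simp add: w_def scaleR_sum_right binomial_fact mult.commute)
  qed
  also have "\<dots> = sum w {(a, b). a + b \<le> (4::nat)}"
    by (subst sum.Sigma, simp, simp)
      (rule sum.reindex_bij_witness[where i = "\<lambda>(a, b). (a + b, b)" and j = "\<lambda>(n, k). (n - k, k)"], auto)
  finally have 2: "exp4 (\<lambda>u. A u + B u) m = sum w {(a, b). a + b \<le> (4::nat)}" .
  have "exp4 B (exp4 A m) - exp4 (\<lambda>u. A u + B u) m = sum w (({..4} \<times> {..4}) - {(a, b). a + b \<le> (4::nat)})"
    unfolding 1 2 by (rule sum_diff[symmetric]) auto
  also have "\<dots> \<in> G"
  proof (rule subspace_sum[OF subspace_G])
    fix p assume "p \<in> ({..4} \<times> {..4}) - {(a, b). a + b \<le> (4::nat)}"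
    then obtain a b where p: "p = (a, b)" "5 \<le> a + b" by (cases p) auto
    have "(A ^^ a) ((B ^^ b) m) \<in> F (a + (b + 0))" by (intro raises_pow A B m)
    then have "(A ^^ a) ((B ^^ b) m) \<in> G" using F_G[OF p(2)] by auto
    then show "w p \<in> G" unfolding p w_def by (simp add: subspace_scale[OF subspace_G])
  qed
  finally show ?thesis .
qed

lemma exp4_zero: "exp4 (\<lambda>u. 0) m = m"
  by (simp add: exp4_def eval_nat_numeral)

text \<open>One direction applies the exponential of \<open>- Q\<close>, the other the exponential
  of \<open>Q\<close>; \<open>exp4_mult\<close> merges the exponentials and \<open>G\<close> is
  invariant under both.\<close>

lemma exp_diff_iff:
  assumes P: "raises P" and Q: "raises Q" and comm: "\<And>u. u \<in> F 0 \<Longrightarrow> Q (P u) = P (Q u)"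
    and m: "m \<in> F 0" "m' \<in> F 0"
  shows "exp4 P m - exp4 Q m' \<in> G \<longleftrightarrow> exp4 (\<lambda>u. P u - Q u) m - m' \<in> G"
proof
  have Q': "raises (\<lambda>u. - Q u)" by (rule raises_minus[OF Q])
  have 1: "exp4 (\<lambda>u. - Q u) (exp4 P m) - exp4 (\<lambda>u. P u - Q u) m \<in> G"
    using exp4_mult[OF P Q' _ m(1)] comm raises_scale[OF P, where c = "-1"] raises_F0[OF Q] by simp
  have 2: "exp4 (\<lambda>u. - Q u) (exp4 Q m') - m' \<in> G"
    using exp4_mult[OF Q Q' _ m(2)] raises_scale[OF Q, where c = "-1"] raises_F0[OF Q] by (simp add: exp4_zero)
  assume "exp4 P m - exp4 Q m' \<in> G"
  then have "exp4 (\<lambda>u. - Q u) (exp4 P m - exp4 Q m') \<in> G" by (rule exp4_G[OF Q'])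
  then have 3: "exp4 (\<lambda>u. - Q u) (exp4 P m) - exp4 (\<lambda>u. - Q u) (exp4 Q m') \<in> G"
    by (simp add: exp4_diff[OF Q'] exp4_F0 P Q m)
  show "exp4 (\<lambda>u. P u - Q u) m - m' \<in> G"
    using subspace_add[OF subspace_G subspace_diff[OF subspace_G 3 1] 2] by simp
next
  have R: "raises (\<lambda>u. P u - Q u)" using raises_add[OF P raises_minus[OF Q]] by simp
  have 1: "exp4 Q (exp4 (\<lambda>u. P u - Q u) m) - exp4 P m \<in> G"
    using exp4_mult[OF R Q _ m(1)] by (simp add: raises_sub[OF Q] raises_F0[OF P] raises_F0[OF Q] comm)
  assume "exp4 (\<lambda>u. P u - Q u) m - m' \<in> G"
  then have "exp4 Q (exp4 (\<lambda>u. P u - Q u) m - m') \<in> G" by (rule exp4_G[OF Q])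
  then have 2: "exp4 Q (exp4 (\<lambda>u. P u - Q u) m) - exp4 Q m' \<in> G"
    by (simp add: exp4_diff[OF Q] exp4_F0 R m)
  show "exp4 P m - exp4 Q m' \<in> G"
    using subspace_diff[OF subspace_G 2 1] by simp
qed

text \<open>If \<open>exp(R) m = m'\<close>, then \<open>m' - m = 2 tanh(R/2) ((m + m')/2)\<close>, and conversely.
  Only the expansion \<open>x coth x = 1 + x\<^sup>2/3 + O(x\<^sup>4)\<close> is needed here.\<close>

lemma exp4_iff_tanh:
  assumes R: "raises R" and m: "m \<in> F 0" "m' \<in> F 0"
  shows "exp4 R m - m' \<in> G \<Longrightarrow>
      R ((1/2) *\<^sub>R (m + m')) - (m' - m) - (1/12) *\<^sub>R R (R (m' - m)) \<in> G"
    and "m' - m \<in> F 1 \<Longrightarrow> R ((1/2) *\<^sub>R (m + m')) - (m' - m) - (1/12) *\<^sub>R R (R (m' - m)) \<in> G \<Longrightarrow>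
      exp4 R m - m' \<in> G"
proof -
  note sub = subspace_add[OF subspace_F] subspace_diff[OF subspace_F] subspace_scale[OF subspace_F]
  note lin = raises_linear[OF R] raises_F0[OF R] sub
  have e: "exp4 R u = u + R u + (1/2) *\<^sub>R R (R u) + (1/6) *\<^sub>R R (R (R u)) + (1/24) *\<^sub>R R (R (R (R u)))" for u
    by (simp add: exp4_def eval_nat_numeral)
  define d where "d = m' - m"
  have d: "d \<in> F 0" and m': "m' = m + d" using m sub unfolding d_def by auto
  define Z where "Z = R ((1/2) *\<^sub>R (m + m')) - (m' - m) - (1/12) *\<^sub>R R (R (m' - m))"
  have Z: "Z = R m + (1/2) *\<^sub>R R d - d - (1/12) *\<^sub>R R (R d)"
  proof -
    have "(1/2) *\<^sub>R (m + m') = m + (1/2) *\<^sub>R d" unfolding m' by (simp add: scaleR_add_right scaleR_add_left[symmetric])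
    then show ?thesis unfolding Z_def by (simp add: m' lin m d)
  qed
  note Gs = subspace_add[OF subspace_G] subspace_diff[OF subspace_G] subspace_scale[OF subspace_G] raises_G[OF R]
  {
    define y where "y = exp4 R m - m'"
    have dy: "d = R m + (1/2) *\<^sub>R R (R m) + (1/6) *\<^sub>R R (R (R m)) + (1/24) *\<^sub>R R (R (R (R m))) - y"
      unfolding y_def e m' by simp
    assume "exp4 R m - m' \<in> G"
    then have yG: "y \<in> G" by (simp add: y_def)
    then have y: "y \<in> F 0" using G_le by auto
    have R5: "R (R (R (R (R m)))) \<in> G"
      using raises_pow[OF R m(1), of 5] F_G[of 5] by (auto simp: eval_nat_numeral)
    \<comment> \<open>With d = (exp(R) - 1) m - y inserted, the coefficients of R to R^4 cancel.
      What is left is R^5 m and R^6 m, whose coefficients come from the truncation, and terms in the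
      error y.\<close>
    have "Z = (1/144) *\<^sub>R R (R (R (R (R m)))) - (1/288) *\<^sub>R R (R (R (R (R (R m)))))
        + y - (1/2) *\<^sub>R R y + (1/12) *\<^sub>R R (R y)"
      unfolding Z dy
      by (rule eq_by_functionals) (simp add: lin m y linear_add linear_diff linear_scale)
    also have "\<dots> \<in> G" by (intro Gs yG R5)
    finally show "R ((1/2) *\<^sub>R (m + m')) - (m' - m) - (1/12) *\<^sub>R R (R (m' - m)) \<in> G" by (simp add: Z_def)
  }
  {
    assume "m' - m \<in> F 1" and ZG: "R ((1/2) *\<^sub>R (m + m')) - (m' - m) - (1/12) *\<^sub>R R (R (m' - m)) \<in> G"
    then have d1: "d \<in> F 1" and ZG: "Z \<in> G" by (simp_all add: d_def Z_def)
    then have Z0: "Z \<in> F 0" using G_le by auto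
    have Rm: "R m = d - (1/2) *\<^sub>R R d + (1/12) *\<^sub>R R (R d) + Z" unfolding Z by simp
    have R4: "R (R (R (R d))) \<in> G"
      using raises_pow[OF R d1, of 4] F_G[of 5] by (auto simp: eval_nat_numeral)
    \<comment> \<open>The converse inserts R m = (1 - R/2 + R^2/12) d + Z. The first uncancelled
      power is R^4 d, which is negligible only because d itself has order 1.\<close>
    have "exp4 R m - m' = Z + (1/2) *\<^sub>R R Z + (1/6) *\<^sub>R R (R Z) + (1/24) *\<^sub>R R (R (R Z))
        - (1/144) *\<^sub>R R (R (R (R d))) + (1/288) *\<^sub>R R (R (R (R (R d))))"
      unfolding e m' Rm
      by (rule eq_by_functionals) (simp add: lin d Z0 linear_add linear_diff linear_scale)
    also have "\<dots> \<in> G" by (intro Gs ZG R4)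
    finally show "exp4 R m - m' \<in> G" .
  }
qed

end

section \<open>Formal power series whose coefficients are differential operators\<close>

subsection \<open>Series of differential operators\<close>

text \<open>This is minus the time derivative multiplied by \<epsilon>: with the evolution equation,
  the time derivative acts on F(W) as minus the sum of the \<epsilon>^(k-1) dF.\<Gamma>_k. It is
  truncated at \<open>k = 4\<close> because only four \<Gamma>_k occur.\<close>

definition Tser :: "(nat \<Rightarrow> (real^'d::finite \<Rightarrow> real^'n::finite) \<Rightarrow> real^'d \<Rightarrow> real^'n)
    \<Rightarrow> (nat \<Rightarrow> (real^'d \<Rightarrow> real^'n) \<Rightarrow> real^'d \<Rightarrow> real^'m::finite)
    \<Rightarrow> nat \<Rightarrow> (real^'d \<Rightarrow> real^'n) \<Rightarrow> real^'d \<Rightarrow> real^'m" where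
  "Tser \<Gamma> u N W x = (\<Sum>k\<in>{1..min 4 N}. dd (u (N - k)) (\<Gamma> k) W x)"

definition shift :: "(('x \<Rightarrow> 'b) \<Rightarrow> 'x \<Rightarrow> 'c::zero) \<Rightarrow> (nat \<Rightarrow> 'w \<Rightarrow> 'x \<Rightarrow> 'b) \<Rightarrow> nat \<Rightarrow> 'w \<Rightarrow> 'x \<Rightarrow> 'c" where
  "shift L u N W x = (if N = 0 then 0 else L (u (N - 1) W) x)"

text \<open>The operator R = \<epsilon> (d/dt + Lambda) on series, with
  \<open>\<tau>\<^sub>0\<close> normalised to 1; both parts raise the order by at least one.\<close>

definition Rser :: "('q::finite \<Rightarrow> real^'d::finite) \<Rightarrow> real^'q^('n::finite + 'p::finite)
    \<Rightarrow> (nat \<Rightarrow> (real^'d \<Rightarrow> real^'n) \<Rightarrow> real^'d \<Rightarrow> real^'n)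
    \<Rightarrow> (nat \<Rightarrow> (real^'d \<Rightarrow> real^'n) \<Rightarrow> real^'d \<Rightarrow> real^('n + 'p))
    \<Rightarrow> nat \<Rightarrow> (real^'d \<Rightarrow> real^'n) \<Rightarrow> real^'d \<Rightarrow> real^('n + 'p)" where
  "Rser v M \<Gamma> u N W x = shift (Lam v M) u N W x - Tser \<Gamma> u N W x"

definition trunc :: "nat \<Rightarrow> (nat \<Rightarrow> 'w \<Rightarrow> 'x \<Rightarrow> 'b::zero) \<Rightarrow> nat \<Rightarrow> 'w \<Rightarrow> 'x \<Rightarrow> 'b" where
  "trunc K \<Psi> N W x = (if 1 \<le> N \<and> N \<le> K then \<Psi> N W x else 0)"

text \<open>The mean of m and m'. With Y = \<Phi>(W) + S^-1 \<psi> and Y' = Y - \<psi>, half of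
  \<psi> is subtracted from S^-1 \<psi>, and this produces \<Sigma>.\<close>

definition gser :: "(real^'n::finite \<Rightarrow> real^'p::finite) \<Rightarrow> real^'p^'p
    \<Rightarrow> (nat \<Rightarrow> (real^'d::finite \<Rightarrow> real^'n) \<Rightarrow> real^'d \<Rightarrow> real^'p)
    \<Rightarrow> nat \<Rightarrow> (real^'d \<Rightarrow> real^'n) \<Rightarrow> real^'d \<Rightarrow> real^('n + 'p)" where
  "gser \<Phi> \<Sigma> \<psi> N W x =
     join (if N = 0 then W x else 0) ((if N = 0 then \<Phi> (W x) else 0) + \<Sigma> *v \<psi> N W x)"

definition user :: "(nat \<Rightarrow> (real^'d::finite \<Rightarrow> real^'n) \<Rightarrow> real^'d \<Rightarrow> real^'p)
    \<Rightarrow> nat \<Rightarrow> (real^'d \<Rightarrow> real^'n::finite) \<Rightarrow> real^'d \<Rightarrow> real^('n + 'p::finite)" where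
  "user \<psi> N W x = join 0 (\<psi> N W x)"

text \<open>\<open>Zser\<close> is \<open>R g - u - R\<^sup>2 u/12\<close> with \<open>g = (W, \<Phi>(W) + \<Sigma>\<psi>)\<close>, \<open>u = -(0, \<psi>)\<close>, order by order.\<close>

definition Zser :: "('q::finite \<Rightarrow> real^'d::finite) \<Rightarrow> real^'q^('n::finite + 'p::finite)
    \<Rightarrow> (real^'n \<Rightarrow> real^'p) \<Rightarrow> real^'p^'p
    \<Rightarrow> (nat \<Rightarrow> (real^'d \<Rightarrow> real^'n) \<Rightarrow> real^'d \<Rightarrow> real^'n)
    \<Rightarrow> (nat \<Rightarrow> (real^'d \<Rightarrow> real^'n) \<Rightarrow> real^'d \<Rightarrow> real^'p)
    \<Rightarrow> nat \<Rightarrow> (real^'d \<Rightarrow> real^'n) \<Rightarrow> real^'d \<Rightarrow> real^('n + 'p)" where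
  "Zser v M \<Phi> \<Sigma> \<Gamma> \<psi> N W x = Rser v M \<Gamma> (gser \<Phi> \<Sigma> \<psi>) N W x + user \<psi> N W x
     + (1/12) *\<^sub>R Rser v M \<Gamma> (Rser v M \<Gamma> (user \<psi>)) N W x"

lemma diffop_if: "(b \<Longrightarrow> diffop F) \<Longrightarrow> (\<not> b \<Longrightarrow> diffop G) \<Longrightarrow> diffop (\<lambda>W x. if b then F W x else G W x)"
  by (cases b) simp_all

lemma diffop_Tser: "(\<And>N. diffop (u N)) \<Longrightarrow> (\<And>k. k \<in> {1..4} \<Longrightarrow> diffop (\<Gamma> k)) \<Longrightarrow> diffop (Tser \<Gamma> u N)"
  unfolding Tser_def[abs_def] by (intro diffop_sum diffop_dd) auto

lemma diffop_shift:
  fixes u :: "nat \<Rightarrow> (real^'d::finite \<Rightarrow> real^'n::finite) \<Rightarrow> real^'d \<Rightarrow> real^'m::finite"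
    and L :: "(real^'d \<Rightarrow> real^'m) \<Rightarrow> real^'d \<Rightarrow> real^'k::finite"
  assumes L: "\<And>F :: (real^'d \<Rightarrow> real^'n) \<Rightarrow> real^'d \<Rightarrow> real^'m. diffop F \<Longrightarrow> diffop (\<lambda>W. L (F W))"
    and u: "\<And>N. diffop (u N)"
  shows "diffop (shift L u N)"
proof (cases N)
  case 0
  then show ?thesis unfolding shift_def[abs_def] by (simp add: diffop_zero)
next
  case (Suc n)
  then show ?thesis unfolding shift_def[abs_def] using L[OF u, of n] by simp
qed

lemma diffop_Rser:
  "(\<And>N. diffop (u N)) \<Longrightarrow> (\<And>k. k \<in> {1..4} \<Longrightarrow> diffop (\<Gamma> k)) \<Longrightarrow> diffop (Rser v M \<Gamma> u N)"
  unfolding Rser_def[abs_def] by (intro diffop_diff diffop_shift diffop_Lam diffop_Tser)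

lemma diffop_trunc: "(\<And>k. k \<in> {1..K} \<Longrightarrow> diffop (\<Psi> k)) \<Longrightarrow> diffop (trunc K \<Psi> N)"
  unfolding trunc_def[abs_def] by (intro diffop_if diffop_zero) (auto simp: eta_contract_eq)

lemma diffop_gser: "smooth \<Phi> \<Longrightarrow> (\<And>N. diffop (\<psi> N)) \<Longrightarrow> diffop (gser \<Phi> \<Sigma> \<psi> N)"
  unfolding gser_def[abs_def]
  by (intro diffop_join diffop_if diffop_add diffop_linear[OF bounded_linear_matrix] diffop_id diffop_zero diffop_comp)

lemma diffop_user: "(\<And>N. diffop (\<psi> N)) \<Longrightarrow> diffop (user \<psi> N)"
  unfolding user_def[abs_def] by (intro diffop_join diffop_zero)

lemma Tser_cong:
  assumes "\<And>N W x. smooth W \<Longrightarrow> u N W x = u' N W x" "smooth W" "\<And>k. k \<in> {1..4} \<Longrightarrow> smooth (\<Gamma> k W)"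
  shows "Tser \<Gamma> u N W x = Tser \<Gamma> u' N W x"
  unfolding Tser_def by (intro sum.cong refl dd_cong assms) auto

lemma Rser_cong:
  assumes "\<And>N W x. smooth W \<Longrightarrow> u N W x = u' N W x" "smooth W" "\<And>k. k \<in> {1..4} \<Longrightarrow> smooth (\<Gamma> k W)"
  shows "Rser v M \<Gamma> u N W x = Rser v M \<Gamma> u' N W x"
proof -
  have "u (N - 1) W = u' (N - 1) W" using assms(1,2) by (simp add: fun_eq_iff)
  then show ?thesis unfolding Rser_def shift_def using Tser_cong[where \<Gamma> = \<Gamma>, OF assms] by simp
qed

lemma Rser_join:
  assumes a: "\<And>N. diffop (a N)" and b: "\<And>N. diffop (b N)" and W: "smooth W"
    and \<Gamma>: "\<And>k. k \<in> {1..4} \<Longrightarrow> smooth (\<Gamma> k W)"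
  shows "Rser v M \<Gamma> (\<lambda>N W x. join (a N W x) (b N W x)) N W x =
    join (shift (blkA (Lam v M)) a N W x + shift (blkB (Lam v M)) b N W x - Tser \<Gamma> a N W x)
      (shift (blkC (Lam v M)) a N W x + shift (blkD (Lam v M)) b N W x - Tser \<Gamma> b N W x)"
proof -
  have "Tser \<Gamma> (\<lambda>N W x. join (a N W x) (b N W x)) N W x = (\<Sum>k\<in>{1..min 4 N}. join (dd (a (N - k)) (\<Gamma> k) W x) (dd (b (N - k)) (\<Gamma> k) W x))"
    unfolding Tser_def by (intro sum.cong refl dd_join a b W \<Gamma>) auto
  also have "\<dots> = join (Tser \<Gamma> a N W x) (Tser \<Gamma> b N W x)"
    unfolding Tser_def by (induction "{1..min 4 N}" rule: infinite_finite_induct) (auto simp: join_def vec_eq_iff sum_component split: sum.splits)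
  finally have T: "Tser \<Gamma> (\<lambda>N W x. join (a N W x) (b N W x)) N W x = join (Tser \<Gamma> a N W x) (Tser \<Gamma> b N W x)" .
  have "shift (Lam v M) (\<lambda>N W x. join (a N W x) (b N W x)) N W x = 
    join (shift (blkA (Lam v M)) a N W x + shift (blkB (Lam v M)) b N W x)
      (shift (blkC (Lam v M)) a N W x + shift (blkD (Lam v M)) b N W x)"
    unfolding shift_def by (simp add: Lam_blocks diffop_smooth[OF a W] diffop_smooth[OF b W])
  then show ?thesis unfolding Rser_def T by (simp add: join_diff)
qed

text \<open>The time derivative commutes with linear space operators of constant coefficients;
  \<open>L\<close> will be Lambda or one of its blocks.\<close>

lemma Tser_shift:
  assumes L: "\<And>F G x. diffop F \<Longrightarrow> smooth (G W) \<Longrightarrow> dd (\<lambda>W. L (F W)) G W x = L (dd F G W) x"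
    and L_sum: "\<And>(I :: nat set) f x. finite I \<Longrightarrow> (\<And>i. i \<in> I \<Longrightarrow> smooth (f i)) \<Longrightarrow> L (\<lambda>x. \<Sum>i\<in>I. f i x) x = (\<Sum>i\<in>I. L (f i) x)"
    and u: "\<And>N. diffop (u N)" and W: "smooth W" and \<Gamma>: "\<And>k. k \<in> {1..4} \<Longrightarrow> diffop (\<Gamma> k)"
  shows "Tser \<Gamma> (shift L u) N W x = shift L (Tser \<Gamma> u) N W x"
proof (cases N)
  case 0
  then show ?thesis by (simp add: Tser_def shift_def)
next
  case (Suc n)
  \<comment> \<open>On the left the sum has one possible extra term, \<open>k = N\<close>. It
    differentiates the coefficient of order 0 of a shifted series, which is 0.\<close>
  have "Tser \<Gamma> (shift L u) N W x = (\<Sum>k\<in>{1..min 4 n}. dd (shift L u (N - k)) (\<Gamma> k) W x)"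
    unfolding Tser_def
  proof (rule sum.mono_neutral_right)
    show "\<forall>k\<in>{1..min 4 N} - {1..min 4 n}. dd (shift L u (N - k)) (\<Gamma> k) W x = 0"
    proof
      fix k assume "k \<in> {1..min 4 N} - {1..min 4 n}"
      then have "N - k = 0" using Suc by auto
      then have "shift L u (N - k) = (\<lambda>W x. 0)" by (simp add: shift_def fun_eq_iff)
      then show "dd (shift L u (N - k)) (\<Gamma> k) W x = 0" by (simp add: dd_zero)
    qed
  qed (use Suc in auto)
  also have "\<dots> = (\<Sum>k\<in>{1..min 4 n}. L (dd (u (n - k)) (\<Gamma> k) W) x)"
  proof (rule sum.cong[OF refl])
    fix k assume k: "k \<in> {1..min 4 n}"
    then have "shift L u (N - k) = (\<lambda>W. L (u (n - k) W))" using Suc by (simp add: shift_def fun_eq_iff Suc_diff_le)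
    then show "dd (shift L u (N - k)) (\<Gamma> k) W x = L (dd (u (n - k)) (\<Gamma> k) W) x"
      using L[where G = "\<Gamma> k", OF u diffop_smooth[OF \<Gamma> W]] k by simp
  qed
  also have "\<dots> = L (\<lambda>x. \<Sum>k\<in>{1..min 4 n}. dd (u (n - k)) (\<Gamma> k) W x) x"
    by (rule L_sum[symmetric]) (auto intro!: diffop_smooth[OF diffop_dd[OF u \<Gamma>] W])
  finally show ?thesis using Suc by (simp add: shift_def Tser_def[abs_def])
qed

section \<open>The triangular system that determines all coefficients\<close>

subsection \<open>The recursion for the coefficients\<close>

lemma blk_zero [simp]:
  "blkA (Lam v M) (\<lambda>x. 0) x = 0" "blkB (Lam v M) (\<lambda>x. 0) x = 0"
  "blkC (Lam v M) (\<lambda>x. 0) x = 0" "blkD (Lam v M) (\<lambda>x. 0) x = 0"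
  using blk_cscaleR[of "\<lambda>x. 0" v M 0 x] by (simp_all add: smooth_const)

lemma blk_sum:
  assumes "finite I" 
  shows "(\<And>i. i \<in> I \<Longrightarrow> smooth (f i)) \<Longrightarrow> blkB (Lam v M) (\<lambda>x. \<Sum>i\<in>I. f i x) x = (\<Sum>i\<in>I. blkB (Lam v M) (f i) x)"
    and "(\<And>i. i \<in> I \<Longrightarrow> smooth (f i)) \<Longrightarrow> blkD (Lam v M) (\<lambda>x. \<Sum>i\<in>I. f i x) x = (\<Sum>i\<in>I. blkD (Lam v M) (f i) x)"
  using assms by (induction I rule: finite_induct) (simp_all add: blk_add smooth_sum)

lemma Tser_add:
  assumes "\<And>N. diffop (a N)" "\<And>N. diffop (b N)" "smooth W" "\<And>k. k \<in> {1..4} \<Longrightarrow> smooth (\<Gamma> k W)"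
  shows "Tser \<Gamma> (\<lambda>N W x. a N W x + b N W x) N W x = Tser \<Gamma> a N W x + Tser \<Gamma> b N W x"
  unfolding Tser_def sum.distrib[symmetric] by (intro sum.cong refl dd_add assms) auto

lemma Tser_linear:
  assumes "bounded_linear T" "\<And>N. diffop (a N)" "smooth W" "\<And>k. k \<in> {1..4} \<Longrightarrow> smooth (\<Gamma> k W)"
  shows "Tser \<Gamma> (\<lambda>N W x. T (a N W x)) N W x = T (Tser \<Gamma> a N W x)"
proof -
  have "Tser \<Gamma> (\<lambda>N W x. T (a N W x)) N W x = (\<Sum>k\<in>{1..min 4 N}. T (dd (a (N - k)) (\<Gamma> k) W x))"
    unfolding Tser_def by (intro sum.cong refl dd_linear assms) auto
  then show ?thesis unfolding Tser_def by (simp add: linear_sum[OF bounded_linear.linear[OF assms(1)]])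
qed

lemma Tser_order0: "Tser \<Gamma> (\<lambda>N W x. if N = 0 then F W x else 0) N W x = (if N \<in> {1..4} then dd F (\<Gamma> N) W x else 0)"
proof -
  have "Tser \<Gamma> (\<lambda>N W x. if N = 0 then F W x else 0) N W x = (\<Sum>k\<in>{1..min 4 N}. if k = N then dd F (\<Gamma> N) W x else 0)"
    unfolding Tser_def by (rule sum.cong) (auto simp: dd_zero)
  then show ?thesis by auto
qed

lemma Tser_zero: "Tser \<Gamma> (\<lambda>N W x. 0) N W x = 0"
  by (simp add: Tser_def dd_zero)

locale lbm =
  fixes v :: "'q::finite \<Rightarrow> real^'d::finite"
    and M :: "real^'q^('n::finite + 'p::finite)"
    and \<Phi> :: "real^'n \<Rightarrow> real^'p"
    and S :: "real^'p^'p"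
  assumes inv_M: "invertible M" and smooth_\<Phi>: "smooth \<Phi>" and inv_S: "invertible S"
begin

abbreviation "A \<equiv> blkA (Lam v M)"
abbreviation "B \<equiv> blkB (Lam v M)"
abbreviation "C \<equiv> blkC (Lam v M)"
abbreviation "D \<equiv> blkD (Lam v M)"
abbreviation "\<Sigma> \<equiv> matrix_inv S - (1/2) *\<^sub>R mat 1"
abbreviation \<Phi>W :: "(real^'d \<Rightarrow> real^'n) \<Rightarrow> real^'d \<Rightarrow> real^'p" where "\<Phi>W \<equiv> \<lambda>W x. \<Phi> (W x)"
abbreviation "Z \<equiv> Zser v M \<Phi> \<Sigma>"

text \<open>The conserved part of \<open>Z \<Gamma> \<psi> N\<close> is \<open>recC - \<Gamma>\<^sub>N\<close>, the nonconserved part \<open>\<psi>\<^sub>N - recN\<close>.\<close>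

definition recC :: "(nat \<Rightarrow> (real^'d \<Rightarrow> real^'n) \<Rightarrow> real^'d \<Rightarrow> real^'n)
    \<Rightarrow> (nat \<Rightarrow> (real^'d \<Rightarrow> real^'n) \<Rightarrow> real^'d \<Rightarrow> real^'p)
    \<Rightarrow> nat \<Rightarrow> (real^'d \<Rightarrow> real^'n) \<Rightarrow> real^'d \<Rightarrow> real^'n" where
  "recC \<Gamma> \<psi> N W x = (if N = 1 then A W x + B (\<Phi>W W) x else 0) + shift B (\<lambda>N W x. \<Sigma> *v \<psi> N W x) N W x
     + (1/12) *\<^sub>R (shift A (shift B \<psi>) N W x + shift B (shift D \<psi>) N W x - 2 *\<^sub>R shift B (Tser \<Gamma> \<psi>) N W x)"

definition recN :: "(nat \<Rightarrow> (real^'d \<Rightarrow> real^'n) \<Rightarrow> real^'d \<Rightarrow> real^'n)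
    \<Rightarrow> (nat \<Rightarrow> (real^'d \<Rightarrow> real^'n) \<Rightarrow> real^'d \<Rightarrow> real^'p)
    \<Rightarrow> nat \<Rightarrow> (real^'d \<Rightarrow> real^'n) \<Rightarrow> real^'d \<Rightarrow> real^'p" where
  "recN \<Gamma> \<psi> N W x = dd \<Phi>W (\<Gamma> N) W x + \<Sigma> *v Tser \<Gamma> \<psi> N W x
     - (if N = 1 then C W x + D (\<Phi>W W) x else 0) - shift D (\<lambda>N W x. \<Sigma> *v \<psi> N W x) N W x
     - (1/12) *\<^sub>R (shift C (shift B \<psi>) N W x + shift D (shift D \<psi>) N W x
         + Tser \<Gamma> (Tser \<Gamma> \<psi>) N W x - 2 *\<^sub>R shift D (Tser \<Gamma> \<psi>) N W x)"

lemma diffop_\<Phi>W: "diffop \<Phi>W"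
  by (rule diffop_comp[OF smooth_\<Phi>])

text \<open>All blocks of R g and R^2 (0, \<psi>) are computed. The term \<Gamma>_N comes from
  differentiating the W component of g in time, the term \<psi>_N from the undifferentiated (0,
  \<psi>).\<close>

lemma Z_join:
  assumes \<psi>: "\<And>N. diffop (\<psi> N)" and \<psi>0: "\<psi> 0 = (\<lambda>W x. 0)" and W: "smooth W"
    and \<Gamma>: "\<And>k. k \<in> {1..4} \<Longrightarrow> diffop (\<Gamma> k)"
    and N: "N \<in> {1..4}"
  shows "Z \<Gamma> \<psi> N W x = join (recC \<Gamma> \<psi> N W x - \<Gamma> N W x) (\<psi> N W x - recN \<Gamma> \<psi> N W x)"
proof -
  have \<Gamma>s: "\<And>k. k \<in> {1..4} \<Longrightarrow> smooth (\<Gamma> k W)" if "smooth W" for W using diffop_smooth[OF \<Gamma> that] .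
  define e0 :: "nat \<Rightarrow> (real^'d \<Rightarrow> real^'n) \<Rightarrow> real^'d \<Rightarrow> real^'n" where "e0 = (\<lambda>N W x. if N = 0 then W x else 0)"
  define f0 :: "nat \<Rightarrow> (real^'d \<Rightarrow> real^'n) \<Rightarrow> real^'d \<Rightarrow> real^'p" where "f0 = (\<lambda>N W x. if N = 0 then \<Phi> (W x) else 0)"
  define s where "s = (\<lambda>N W x. \<Sigma> *v \<psi> N W x)"
  have d_e0: "diffop (e0 N)" and d_f0: "diffop (f0 N)" and d_s: "diffop (s N)" for N
    unfolding e0_def f0_def s_def
    by (intro diffop_if diffop_id diffop_zero diffop_\<Phi>W diffop_linear[OF bounded_linear_matrix] \<psi>)+
  note sm = diffop_smooth[OF _ W]
  have g: "gser \<Phi> \<Sigma> \<psi> = (\<lambda>N W x. join (e0 N W x) (f0 N W x + s N W x))"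
    by (intro ext) (simp add: gser_def e0_def f0_def s_def)
  have Ae0: "shift A e0 N W x = (if N = 1 then A W x else 0)" and Ce0: "shift C e0 N W x = (if N = 1 then C W x else 0)"
    by (auto simp: shift_def e0_def)
  have Bf0: "shift B (\<lambda>N W x. f0 N W x + s N W x) N W x = (if N = 1 then B (\<Phi>W W) x else 0) + shift B s N W x"
    and Df0: "shift D (\<lambda>N W x. f0 N W x + s N W x) N W x = (if N = 1 then D (\<Phi>W W) x else 0) + shift D s N W x"
    using blk_add(2,4)[OF sm[OF d_f0[of "N-1"]] sm[OF d_s[of "N-1"]]] N by (auto simp: shift_def f0_def)
  have Te0: "Tser \<Gamma> e0 N W x = \<Gamma> N W x"
    unfolding e0_def Tser_order0 using N by (simp add: dd_id)
  have Tf0: "Tser \<Gamma> (\<lambda>N W x. f0 N W x + s N W x) N W x = dd \<Phi>W (\<Gamma> N) W x + \<Sigma> *v Tser \<Gamma> \<psi> N W x"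
  proof -
    have "Tser \<Gamma> s N W x = \<Sigma> *v Tser \<Gamma> \<psi> N W x"
      unfolding s_def by (rule Tser_linear[where \<Gamma> = \<Gamma> and a = \<psi>, OF bounded_linear_matrix \<psi> W \<Gamma>s[OF W]])
    moreover have "Tser \<Gamma> f0 N W x = dd \<Phi>W (\<Gamma> N) W x"
      unfolding f0_def Tser_order0 using N by simp
    ultimately show ?thesis
      using Tser_add[where a = f0 and b = s and \<Gamma> = \<Gamma>, OF d_f0 d_s W \<Gamma>s[OF W]] by simp
  qed
  have Rg: "Rser v M \<Gamma> (gser \<Phi> \<Sigma> \<psi>) N W x =
    join ((if N = 1 then A W x + B (\<Phi>W W) x else 0) + shift B s N W x - \<Gamma> N W x)
      ((if N = 1 then C W x + D (\<Phi>W W) x else 0) + shift D s N W x - (dd \<Phi>W (\<Gamma> N) W x + \<Sigma> *v Tser \<Gamma> \<psi> N W x))"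
    unfolding g
    by (subst Rser_join[where a = e0 and \<Gamma> = \<Gamma>, OF d_e0 diffop_add[OF d_f0 d_s] W \<Gamma>s[OF W]], assumption)
      (unfold Ae0 Ce0 Bf0 Df0 Te0 Tf0, cases "N = 1", simp_all add: add.assoc)
  have d_Bp: "diffop (shift B \<psi> N)" and d_Dp: "diffop (shift D \<psi> N)" and d_T: "diffop (Tser \<Gamma> \<psi> N)" for N
    by (intro diffop_shift diffop_blk diffop_Tser \<psi> \<Gamma>, assumption)+
  have Ru: "Rser v M \<Gamma> (user \<psi>) N W x = join (shift B \<psi> N W x) (shift D \<psi> N W x + (-1) *\<^sub>R Tser \<Gamma> \<psi> N W x)"
    if W: "smooth W" for N W x
    unfolding user_def[abs_def]
    by (subst Rser_join[where \<Gamma> = \<Gamma> and b = \<psi>, OF diffop_zero \<psi> W \<Gamma>s[OF W]], assumption)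
      (simp add: Tser_zero shift_def)
  have T1: "Tser \<Gamma> (shift B \<psi>) N W x = shift B (Tser \<Gamma> \<psi>) N W x"
    "Tser \<Gamma> (shift D \<psi>) N W x = shift D (Tser \<Gamma> \<psi>) N W x"
    by (rule Tser_shift[OF dd_blk(2)[OF diffop_zero _ W] blk_sum(1) \<psi> W \<Gamma>], assumption+)
      (rule Tser_shift[OF dd_blk(4)[OF diffop_zero _ W] blk_sum(2) \<psi> W \<Gamma>], assumption+)
  have shp: "shift L f N W x = L (f (N - 1) W) x"
    for L :: "(real^'d \<Rightarrow> 'b) \<Rightarrow> real^'d \<Rightarrow> 'c::zero" and f
    using N by (simp add: shift_def)
  have sh: "shift B (\<lambda>N W x. shift D \<psi> N W x + (-1) *\<^sub>R Tser \<Gamma> \<psi> N W x) N W x = shift B (shift D \<psi>) N W x - shift B (Tser \<Gamma> \<psi>) N W x"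
    "shift D (\<lambda>N W x. shift D \<psi> N W x + (-1) *\<^sub>R Tser \<Gamma> \<psi> N W x) N W x = shift D (shift D \<psi>) N W x - shift D (Tser \<Gamma> \<psi>) N W x"
    unfolding shp blk_add(2,4)[OF sm[OF d_Dp[of "N-1"]] smooth_cscaleR[where c = "-1", OF sm[OF d_T[of "N-1"]]], of v M x]
      blk_cscaleR(2,4)[OF sm[OF d_T[of "N-1"]], of v M "-1" x] by simp_all
  have T2: "Tser \<Gamma> (\<lambda>N W x. shift D \<psi> N W x + (-1) *\<^sub>R Tser \<Gamma> \<psi> N W x) N W x = shift D (Tser \<Gamma> \<psi>) N W x - Tser \<Gamma> (Tser \<Gamma> \<psi>) N W x"
  proof -
    have "Tser \<Gamma> (\<lambda>N W x. shift D \<psi> N W x + (-1) *\<^sub>R Tser \<Gamma> \<psi> N W x) N W x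
        = Tser \<Gamma> (shift D \<psi>) N W x + Tser \<Gamma> (\<lambda>N W x. (-1) *\<^sub>R Tser \<Gamma> \<psi> N W x) N W x"
      by (rule Tser_add[where \<Gamma> = \<Gamma>, OF d_Dp diffop_cscaleR[OF d_T] W \<Gamma>s[OF W]])
    also have "Tser \<Gamma> (\<lambda>N W x. (-1) *\<^sub>R Tser \<Gamma> \<psi> N W x) N W x = (-1) *\<^sub>R Tser \<Gamma> (Tser \<Gamma> \<psi>) N W x"
      by (rule Tser_linear[where \<Gamma> = \<Gamma>, OF bounded_linear_scaleR_right d_T W \<Gamma>s[OF W]])
    finally show ?thesis unfolding T1 by simp
  qed
  have "Rser v M \<Gamma> (Rser v M \<Gamma> (user \<psi>)) N W x = Rser v M \<Gamma> (\<lambda>N W x. join (shift B \<psi> N W x) (shift D \<psi> N W x + (-1) *\<^sub>R Tser \<Gamma> \<psi> N W x)) N W x"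
    by (rule Rser_cong[where \<Gamma> = \<Gamma>, OF Ru W \<Gamma>s[OF W]])
  \<comment> \<open>Time derivation commutes with B and D, so the two cross terms of the square
    coincide; hence the factor 2.\<close>
  also have "\<dots> = join (shift A (shift B \<psi>) N W x + shift B (shift D \<psi>) N W x - 2 *\<^sub>R shift B (Tser \<Gamma> \<psi>) N W x)
     (shift C (shift B \<psi>) N W x + shift D (shift D \<psi>) N W x + Tser \<Gamma> (Tser \<Gamma> \<psi>) N W x - 2 *\<^sub>R shift D (Tser \<Gamma> \<psi>) N W x)"
    by (subst Rser_join[where \<Gamma> = \<Gamma> and a = "shift B \<psi>", OF d_Bp diffop_add[OF d_Dp diffop_cscaleR[OF d_T]] W \<Gamma>s[OF W]], assumption)
      (unfold sh T1 T2 scaleR_2, rule arg_cong2[where f = join]; simp)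
  finally have RR: "Rser v M \<Gamma> (Rser v M \<Gamma> (user \<psi>)) N W x = 
    join (shift A (shift B \<psi>) N W x + shift B (shift D \<psi>) N W x - 2 *\<^sub>R shift B (Tser \<Gamma> \<psi>) N W x)
     (shift C (shift B \<psi>) N W x + shift D (shift D \<psi>) N W x + Tser \<Gamma> (Tser \<Gamma> \<psi>) N W x - 2 *\<^sub>R shift D (Tser \<Gamma> \<psi>) N W x)" .
  show ?thesis
    unfolding Zser_def Rg RR recC_def recN_def user_def join_scaleR[symmetric] join_add[symmetric] s_def[symmetric]
    by (simp add: algebra_simps)
qed

lemma Z_0: 
  assumes \<psi>0: "\<psi> 0 = (\<lambda>W x. 0)" shows "Z \<Gamma> \<psi> 0 W x = 0"
  by (simp add: Zser_def Rser_def shift_def Tser_def user_def assms)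

lemma Tser_cong2:
  assumes "\<And>j W x. j < N \<Longrightarrow> smooth W \<Longrightarrow> u j W x = u' j W x" and W: "smooth W"
    and "\<And>k W x. k \<in> {1..4} \<Longrightarrow> k \<le> N \<Longrightarrow> smooth W \<Longrightarrow> \<Gamma> k W x = \<Gamma>' k W x"
    and "\<And>k. k \<in> {1..4} \<Longrightarrow> smooth (\<Gamma> k W)"
  shows "Tser \<Gamma> u N W x = Tser \<Gamma>' u' N W x"
  unfolding Tser_def
proof (rule sum.cong[OF refl])
  fix k assume k: "k \<in> {1..min 4 N}"
  show "dd (u (N - k)) (\<Gamma> k) W x = dd (u' (N - k)) (\<Gamma>' k) W x"
  proof (rule dd_cong)
    show "\<Gamma> k W = \<Gamma>' k W" using assms(3)[OF _ _ W] k by (simp add: fun_eq_iff)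
  qed (use assms(1,4) W k in auto)
qed

text \<open>Triangularity: each operator in the recursion lowers the index, either by
  \<open>shift\<close> or because \<open>Tser\<close> starts at \<open>k = 1\<close>. Only the term
  d\<Phi>.\<Gamma>_N in \<open>recN\<close> and the direction \<Gamma>_N paired with \<psi>_0 reach
  the index \<open>N\<close>, so \<open>recN\<close> needs agreement of \<Gamma> at \<open>N\<close>
  too.\<close>

lemma rec_cong:
  assumes \<psi>: "\<And>j W x. j < N \<Longrightarrow> smooth W \<Longrightarrow> \<psi> j W x = \<psi>' j W x" and W: "smooth W"
    and \<Gamma>: "\<And>k. k \<in> {1..4} \<Longrightarrow> diffop (\<Gamma> k)"
    and eq: "\<And>k W x. k \<in> {1..4} \<Longrightarrow> k < N \<Longrightarrow> smooth W \<Longrightarrow> \<Gamma> k W x = \<Gamma>' k W x"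
  shows "recC \<Gamma> \<psi> N W x = recC \<Gamma>' \<psi>' N W x"
    and "N \<in> {1..4} \<Longrightarrow> (\<And>W x. smooth W \<Longrightarrow> \<Gamma> N W x = \<Gamma>' N W x) \<Longrightarrow> recN \<Gamma> \<psi> N W x = recN \<Gamma>' \<psi>' N W x"
proof -
  have sh: "shift L u N W x = shift L u' N W x"
    if "\<And>W x. N \<noteq> 0 \<Longrightarrow> smooth W \<Longrightarrow> u (N - 1) W x = u' (N - 1) W x"
    for L :: "(real^'d \<Rightarrow> 'b) \<Rightarrow> real^'d \<Rightarrow> 'c::zero" and u u'
  proof (cases "N = 0")
    case False
    then have "u (N - 1) W = u' (N - 1) W" using that[OF _ W] by (intro ext) simp
    then show ?thesis by (simp add: shift_def)
  qed (simp add: shift_def)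
  have sh2: "shift L (shift L' \<psi>) N W x = shift L (shift L' \<psi>') N W x"
    for L :: "(real^'d \<Rightarrow> 'b::zero) \<Rightarrow> real^'d \<Rightarrow> 'c::zero" and L'
  proof (rule sh)
    fix W :: "real^'d \<Rightarrow> real^'n" and x assume N: "N \<noteq> 0" and W: "smooth W"
    have "N - 1 \<noteq> 0 \<Longrightarrow> \<psi> (N - 1 - 1) W = \<psi>' (N - 1 - 1) W" using \<psi>[OF _ W] N by (intro ext) simp
    then show "shift L' \<psi> (N - 1) W x = shift L' \<psi>' (N - 1) W x" by (simp add: shift_def)
  qed
  have s: "shift L (\<lambda>N W x. \<Sigma> *v \<psi> N W x) N W x = shift L (\<lambda>N W x. \<Sigma> *v \<psi>' N W x) N W x"
    for L :: "(real^'d \<Rightarrow> real^'p) \<Rightarrow> real^'d \<Rightarrow> 'c::zero"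
    by (rule sh) (simp add: \<psi>)
  have t: "shift L (Tser \<Gamma> \<psi>) N W x = shift L (Tser \<Gamma>' \<psi>') N W x"
    for L :: "(real^'d \<Rightarrow> real^'p) \<Rightarrow> real^'d \<Rightarrow> 'c::zero"
    by (rule sh) (rule Tser_cong2[where \<Gamma> = \<Gamma>], auto intro: \<psi> eq diffop_smooth[OF \<Gamma>])
  show "recC \<Gamma> \<psi> N W x = recC \<Gamma>' \<psi>' N W x"
    unfolding recC_def s t sh2 ..
  assume N: "N \<in> {1..4}" and eqN: "\<And>W x. smooth W \<Longrightarrow> \<Gamma> N W x = \<Gamma>' N W x"
  have eq': "\<And>k W x. k \<in> {1..4} \<Longrightarrow> k \<le> N \<Longrightarrow> smooth W \<Longrightarrow> \<Gamma> k W x = \<Gamma>' k W x"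
    using eq eqN by (metis nat_less_le)
  have T: "Tser \<Gamma> \<psi> j W x = Tser \<Gamma>' \<psi>' j W x" if "j \<le> N" "smooth W" for j W x
    by (rule Tser_cong2[where \<Gamma> = \<Gamma>]) (use that \<psi> eq' diffop_smooth[OF \<Gamma>] in auto)
  have TT: "Tser \<Gamma> (Tser \<Gamma> \<psi>) N W x = Tser \<Gamma>' (Tser \<Gamma>' \<psi>') N W x"
    by (rule Tser_cong2[where \<Gamma> = \<Gamma>]) (use T W eq' diffop_smooth[OF \<Gamma>] in auto)
  have d: "dd \<Phi>W (\<Gamma> N) W x = dd \<Phi>W (\<Gamma>' N) W x"
    by (rule dd_cong) (use eqN[OF W] W diffop_smooth[OF \<Gamma>[OF N] W] in \<open>simp_all add: fun_eq_iff\<close>)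
  show "recN \<Gamma> \<psi> N W x = recN \<Gamma>' \<psi>' N W x"
    unfolding recN_def s t sh2 TT d T[OF order_refl W] ..
qed

lemma diffop_rec:
  assumes \<psi>: "\<And>N. diffop (\<psi> N)" and \<Gamma>: "\<And>k. k \<in> {1..4} \<Longrightarrow> diffop (\<Gamma> k)"
  shows "diffop (recC \<Gamma> \<psi> N)" and "N \<in> {1..4} \<Longrightarrow> diffop (recN \<Gamma> \<psi> N)"
proof -
  show "diffop (recC \<Gamma> \<psi> N)"
    unfolding recC_def[abs_def]
    by (intro diffop_add diffop_diff diffop_if diffop_zero diffop_blk diffop_shift diffop_cscaleR diffop_Tser
        diffop_id diffop_\<Phi>W diffop_linear[OF bounded_linear_matrix] \<psi> \<Gamma>; assumption)
  assume N: "N \<in> {1..4}"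
  show "diffop (recN \<Gamma> \<psi> N)"
    unfolding recN_def[abs_def]
    by (intro diffop_add diffop_diff diffop_if diffop_zero diffop_blk diffop_shift diffop_cscaleR diffop_Tser diffop_dd
        diffop_id diffop_\<Phi>W diffop_linear[OF bounded_linear_matrix] \<psi> \<Gamma> N; assumption)
qed

text \<open>Order by order; an extension at index n + 1 leaves the equations at smaller indices
  intact, by \<open>rec_cong\<close>.\<close>

lemma rec_exists:
  obtains \<Gamma> \<psi> where "\<And>k. diffop (\<Gamma> k)" "\<And>k. diffop (\<psi> k)" "\<psi> 0 = (\<lambda>W x. 0)"
    "\<And>N W x. N \<in> {1..4} \<Longrightarrow> smooth W \<Longrightarrow> \<Gamma> N W x = recC \<Gamma> \<psi> N W x"
    "\<And>N W x. N \<in> {1..4} \<Longrightarrow> smooth W \<Longrightarrow> \<psi> N W x = recN \<Gamma> \<psi> N W x"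
proof -
  have "\<exists>\<Gamma> \<psi>. (\<forall>k. diffop (\<Gamma> k)) \<and> (\<forall>k. diffop (\<psi> k)) \<and> \<psi> 0 = (\<lambda>W x. 0) \<and>
    (\<forall>N W x. N \<in> {1..n} \<longrightarrow> smooth W \<longrightarrow> \<Gamma> N W x = recC \<Gamma> \<psi> N W x \<and> \<psi> N W x = recN \<Gamma> \<psi> N W x)"
    if "n \<le> 4" for n
    using that
  proof (induction n)
    case 0
    show ?case by (intro exI[of _ "\<lambda>k W x. 0"]) (simp add: diffop_zero)
  next
    case (Suc n)
    have "\<exists>\<Gamma> \<psi>. (\<forall>k. diffop (\<Gamma> k)) \<and> (\<forall>k. diffop (\<psi> k)) \<and> \<psi> 0 = (\<lambda>W x. 0) \<and>
      (\<forall>N W x. N \<in> {1..n} \<longrightarrow> smooth W \<longrightarrow> \<Gamma> N W x = recC \<Gamma> \<psi> N W x \<and> \<psi> N W x = recN \<Gamma> \<psi> N W x)"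
      using Suc.IH Suc.prems by simp
    then obtain \<Gamma> \<psi> where IH0: "\<forall>k. diffop (\<Gamma> k)" "\<forall>k. diffop (\<psi> k)" "\<psi> 0 = (\<lambda>W x. 0)"
      "\<forall>N W x. N \<in> {1..n} \<longrightarrow> smooth W \<longrightarrow> \<Gamma> N W x = recC \<Gamma> \<psi> N W x \<and> \<psi> N W x = recN \<Gamma> \<psi> N W x"
      by (elim exE conjE)
    have IH: "\<And>k. diffop (\<Gamma> k)" "\<And>k. diffop (\<psi> k)" "\<psi> 0 = (\<lambda>W x. 0)"
      "\<And>N W x. N \<in> {1..n} \<Longrightarrow> smooth W \<Longrightarrow> \<Gamma> N W x = recC \<Gamma> \<psi> N W x \<and> \<psi> N W x = recN \<Gamma> \<psi> N W x"
      using IH0(1) IH0(2) IH0(3) IH0(4) by simp_all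
    \<comment> \<open>The order matters: \<Gamma> is extended first, since the nonconserved equation
      of the same order already contains the new \<Gamma>.\<close>
    define \<Gamma>' where "\<Gamma>' = \<Gamma>(Suc n := recC \<Gamma> \<psi> (Suc n))"
    have d\<Gamma>': "diffop (\<Gamma>' k)" for k unfolding \<Gamma>'_def using IH(1) diffop_rec(1)[OF IH(2,1)] by simp
    define \<psi>' where "\<psi>' = \<psi>(Suc n := recN \<Gamma>' \<psi> (Suc n))"
    have d\<psi>': "diffop (\<psi>' k)" for k unfolding \<psi>'_def using IH(2) diffop_rec(2)[OF IH(2) d\<Gamma>', of "Suc n"] Suc.prems by simp
    have "\<Gamma>' N W x = recC \<Gamma>' \<psi>' N W x \<and> \<psi>' N W x = recN \<Gamma>' \<psi>' N W x" if N: "N \<in> {1..Suc n}" and W: "smooth W" for N W x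
    proof (cases "N = Suc n")
      case True
      have 1: "recC \<Gamma> \<psi> N W x = recC \<Gamma>' \<psi>' N W x"
        by (rule rec_cong(1)) (use True W IH(1) in \<open>simp_all add: \<psi>'_def \<Gamma>'_def\<close>)
      have 2: "recN \<Gamma>' \<psi> N W x = recN \<Gamma>' \<psi>' N W x"
        by (rule rec_cong(2)) (use True W d\<Gamma>' Suc.prems in \<open>simp_all add: \<psi>'_def\<close>)
      show ?thesis using 1 2 True by (simp add: \<psi>'_def \<Gamma>'_def)
    next
      case False
      then have n: "N \<in> {1..n}" using N by auto
      have 1: "recC \<Gamma> \<psi> N W x = recC \<Gamma>' \<psi>' N W x"
        by (rule rec_cong(1)) (use n W IH(1) in \<open>auto simp: \<psi>'_def \<Gamma>'_def\<close>)
      have 2: "recN \<Gamma> \<psi> N W x = recN \<Gamma>' \<psi>' N W x"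
        by (rule rec_cong(2)) (use n W IH(1) Suc.prems in \<open>auto simp: \<psi>'_def \<Gamma>'_def\<close>)
      show ?thesis using IH(4)[OF n W, of x] 1 2 False by (simp add: \<psi>'_def \<Gamma>'_def)
    qed
    moreover have "\<psi>' 0 = (\<lambda>W x. 0)" using IH(3) by (simp add: \<psi>'_def)
    ultimately show ?case using d\<Gamma>' d\<psi>' by (intro exI[of _ \<Gamma>'] exI[of _ \<psi>']) simp
  qed
  from this[OF order_refl] show ?thesis using that by metis
qed

lemma rec_unique:
  assumes "\<And>k. k \<in> {1..4} \<Longrightarrow> diffop (\<Gamma> k)" and "\<psi> 0 = (\<lambda>W x. 0)" "\<psi>' 0 = (\<lambda>W x. 0)"
    and "\<And>N W x. N \<in> {1..4} \<Longrightarrow> smooth W \<Longrightarrow> \<Gamma> N W x = recC \<Gamma> \<psi> N W x"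
    and "\<And>N W x. N \<in> {1..3} \<Longrightarrow> smooth W \<Longrightarrow> \<psi> N W x = recN \<Gamma> \<psi> N W x"
    and "\<And>N W x. N \<in> {1..4} \<Longrightarrow> smooth W \<Longrightarrow> \<Gamma>' N W x = recC \<Gamma>' \<psi>' N W x"
    and "\<And>N W x. N \<in> {1..3} \<Longrightarrow> smooth W \<Longrightarrow> \<psi>' N W x = recN \<Gamma>' \<psi>' N W x"
  shows "\<forall>W x. smooth W \<longrightarrow> (N \<in> {1..4} \<longrightarrow> \<Gamma> N W x = \<Gamma>' N W x) \<and> (N \<le> 3 \<longrightarrow> \<psi> N W x = \<psi>' N W x)"
proof (induction N rule: less_induct)
  case (less N)
  show ?case
  proof (cases "N \<in> {1..4}")
    case False
    then show ?thesis using assms(2,3) by (cases "N = 0") auto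
  next
    case N: True
    have p: "\<psi> j W x = \<psi>' j W x" if "j < N" "smooth W" for j W x using less that N by auto
    have g: "\<Gamma> k W x = \<Gamma>' k W x" if "k \<in> {1..4}" "k < N" "smooth W" for k W x using less that by auto
    have G: "\<Gamma> N W x = \<Gamma>' N W x" if W: "smooth W" for W x
      unfolding assms(4)[OF N W] assms(6)[OF N W]
      by (rule rec_cong(1)) (use p g W assms(1) in auto)
    have "\<psi> N W x = \<psi>' N W x" if W: "smooth W" and N3: "N \<in> {1..3}" for W x
      unfolding assms(5)[OF N3 W] assms(7)[OF N3 W]
      by (rule rec_cong(2)) (use p g W assms(1) N G in auto)
    then show ?thesis using G N by auto
  qed
qed

end

section \<open>The Chapman-Enskog identification is equivalent to the recursion\<close>

subsection \<open>The Chapman-Enskog expansion\<close>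

lemma sum_fun_apply: "(\<Sum>i\<in>I. f i) x = (\<Sum>i\<in>I. f i x)"
  by (induction I rule: infinite_finite_induct) simp_all

lemma fun_plus_eq: "(u + w) N = (\<lambda>W x. u N W x + w N W x)"
  and fun_scaleR_eq: "(c *\<^sub>R u) N = (\<lambda>W x. c *\<^sub>R u N W x)"
  by (simp_all add: fun_eq_iff)

lemma Lam_sum:
  assumes "finite I" "\<And>i. i \<in> I \<Longrightarrow> smooth (f i)"
  shows "Lam v M (\<lambda>x. \<Sum>i\<in>I. f i x) x = (\<Sum>i\<in>I. Lam v M (f i) x)"
  using assms
proof (induction I rule: finite_induct)
  case empty
  show ?case using Lam_cscaleR[where f = "\<lambda>x. 0" and v = v and M = M and c = 0] by (simp add: smooth_const)
next
  case (insert i I)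
  then show ?case by (simp add: Lam_add smooth_sum)
qed

lemma matrix_inv_inverse:
  assumes "invertible Q" shows "Q ** matrix_inv Q = mat 1" "matrix_inv Q ** Q = mat 1"
  using someI_ex[of "\<lambda>Q'. Q ** Q' = mat 1 \<and> Q' ** Q = mat 1"] assms
  unfolding matrix_inv_def invertible_def by auto

lemma Rser_minus:
  assumes u: "\<And>N. diffop (u N)" and W: "smooth W" and \<Gamma>: "\<And>k. k \<in> {1..4} \<Longrightarrow> smooth (\<Gamma> k W)"
  shows "Rser v M \<Gamma> (\<lambda>N W x. - u N W x) N W x = - Rser v M \<Gamma> u N W x"
  unfolding Rser_def
  using Tser_linear[where \<Gamma> = \<Gamma> and a = u, OF bounded_linear_minus[OF bounded_linear_ident] u W \<Gamma>]
    Lam_cscaleR[OF diffop_smooth[OF u W], where v = v and M = M and c = "-1"]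
  by (simp add: shift_def)

text \<open>Weighting the coefficient of order N by \<tau>^N is compatible with the operator, as
  Lambda carries one factor \<tau> and \<Gamma>_k carries \<tau>^k. This removes
  \<open>\<tau>\<^sub>0\<close> from the equations.\<close>

lemma Rser_scaled:
  fixes \<Gamma> :: "nat \<Rightarrow> (real^'d::finite \<Rightarrow> real^'n::finite) \<Rightarrow> real^'d \<Rightarrow> real^'n"
    and M :: "real^'q::finite^('n + 'p::finite)"
  assumes u': "\<And>N. diffop (u' N)" and eq: "\<And>N W x. smooth W \<Longrightarrow> u N W x = \<tau> ^ N *\<^sub>R u' N W x"
    and W: "smooth W" and \<Gamma>: "\<And>k. k \<in> {1..4} \<Longrightarrow> diffop (\<Gamma> k)"
  shows "\<tau> *\<^sub>R shift (Lam v M) u N W x - Tser (\<lambda>k W x. \<tau> ^ k *\<^sub>R \<Gamma> k W x) u N W x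
    = \<tau> ^ N *\<^sub>R Rser v M \<Gamma> u' N W x"
proof -
  have "dd (u (N - k)) (\<lambda>W x. \<tau> ^ k *\<^sub>R \<Gamma> k W x) W x = \<tau> ^ N *\<^sub>R dd (u' (N - k)) (\<Gamma> k) W x"
    if k: "k \<in> {1..min 4 N}" for k
  proof -
    have g: "smooth (\<Gamma> k W)" using diffop_smooth[OF \<Gamma> W] k by simp
    have "dd (u (N - k)) (\<lambda>W x. \<tau> ^ k *\<^sub>R \<Gamma> k W x) W x
        = dd (\<lambda>W x. \<tau> ^ (N - k) *\<^sub>R u' (N - k) W x) (\<lambda>W x. \<tau> ^ k *\<^sub>R \<Gamma> k W x) W x"
      by (rule dd_cong) (use eq W smooth_cscaleR[OF g] in simp_all)
    also have "\<dots> = \<tau> ^ (N - k) *\<^sub>R dd (u' (N - k)) (\<lambda>W x. \<tau> ^ k *\<^sub>R \<Gamma> k W x) W x"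
      by (rule dd_linear[where G = "\<lambda>W x. \<tau> ^ k *\<^sub>R \<Gamma> k W x", OF bounded_linear_scaleR_right u' W smooth_cscaleR[OF g]])
    also have "\<dots> = \<tau> ^ (N - k) *\<^sub>R (\<tau> ^ k *\<^sub>R dd (u' (N - k)) (\<Gamma> k) W x)"
      by (simp only: dd_cscaleR_direction[where G = "\<Gamma> k", OF u' W g])
    also have "\<dots> = \<tau> ^ N *\<^sub>R dd (u' (N - k)) (\<Gamma> k) W x" using k by (simp add: power_add[symmetric])
    finally show ?thesis .
  qed
  then have T: "Tser (\<lambda>k W x. \<tau> ^ k *\<^sub>R \<Gamma> k W x) u N W x = \<tau> ^ N *\<^sub>R Tser \<Gamma> u' N W x"
    unfolding Tser_def scaleR_sum_right by (intro sum.cong refl) simp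
  have "\<tau> *\<^sub>R shift (Lam v M) u N W x = \<tau> ^ N *\<^sub>R shift (Lam v M) u' N W x"
  proof (cases N)
    case (Suc n)
    have "u n W = (\<lambda>x. \<tau> ^ n *\<^sub>R u' n W x)" using eq[OF W] by (simp add: fun_eq_iff)
    then show ?thesis using Suc by (simp add: shift_def Lam_cscaleR[OF diffop_smooth[OF u' W]])
  qed (simp add: shift_def)
  then show ?thesis unfolding T Rser_def by (simp add: scaleR_diff_right)
qed

lemma Tser_restrict:
  assumes "smooth W" "\<And>k. k \<in> {1..4} \<Longrightarrow> smooth (\<Gamma> k W)"
  shows "Tser \<Gamma> (\<lambda>N W x. if smooth W then u N W x else 0) N W x = Tser \<Gamma> u N W x"
  by (rule Tser_cong[where \<Gamma> = \<Gamma>]) (use assms in auto)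

lemma shift_restrict:
  assumes "smooth W"
  shows "shift L (\<lambda>N W x. if smooth W then u N W x else 0) N W x = shift L u N W x"
  using assms by (simp add: shift_def)

lemma diffop_restrict: "diffop F \<Longrightarrow> diffop (\<lambda>W x. if smooth W then F W x else 0)"
  by (rule diffop_cong) simp_all

lemma mean_eq: "(1/2) *\<^sub>R (c *\<^sub>R (a + (1/2) *\<^sub>R b) + c *\<^sub>R (a - (1/2) *\<^sub>R b)) = c *\<^sub>R a"
  and diff_eq: "c *\<^sub>R (a - (1/2) *\<^sub>R b) - c *\<^sub>R (a + (1/2) *\<^sub>R b) = c *\<^sub>R - (b :: 'v::real_vector)"
  by (rule eq_by_functionals, simp add: linear_add linear_diff linear_scale linear_neg algebra_simps)+

context lbm
begin

lemma Sinv: "S *v (matrix_inv S *v y) = y"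
  using inv_S by (simp add: matrix_vector_mul_assoc matrix_inv_inverse(1))

lemma Sinv_neg: "S *v (- (c *\<^sub>R (matrix_inv S *v y))) = - (c *\<^sub>R y)"
proof -
  have "S *v ((- c) *\<^sub>R (matrix_inv S *v y)) = (- c) *\<^sub>R y"
    by (simp only: matrix_vector_mult_scaleR Sinv)
  then show ?thesis by simp
qed

lemma Sigma_apply: "\<Sigma> *v y = matrix_inv S *v y - (1/2) *\<^sub>R y"
  by (simp add: matrix_vector_mult_diff_rdistrib scaleR_matrix_vector_assoc[symmetric])

text \<open>The hypothesis on \<open>T\<close> turns \<open>time_step\<close> into the derivation
  along the \<Gamma>_k. It commutes with Lambda, so the two exponentials merge into one, whose tanh
  form is the series \<open>Z\<close> up to the factor \<tau>^N.\<close>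

lemma CE_iff:
  fixes T :: "nat \<Rightarrow> ((real^'d \<Rightarrow> real^'n) \<Rightarrow> real^'d \<Rightarrow> real) \<Rightarrow> (real^'d \<Rightarrow> real^'n) \<Rightarrow> real^'d \<Rightarrow> real"
  assumes \<Gamma>: "\<And>k. k \<in> {1..4} \<Longrightarrow> diffop (\<Gamma> k)" and \<Psi>: "\<And>k. k \<in> {1..3} \<Longrightarrow> diffop (\<Psi> k)"
    and \<tau>: "\<tau> > 0"
    and T: "\<And>k (F :: (real^'d \<Rightarrow> real^'n) \<Rightarrow> real^'d \<Rightarrow> real^('n + 'p)) W x. k \<in> {1..4} \<Longrightarrow> diffop F \<Longrightarrow> smooth W \<Longrightarrow>
      \<tau> *\<^sub>R lift (T k) F W x = - (\<tau> ^ k *\<^sub>R dd F (\<Gamma> k) W x)"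
  shows "(\<forall>W x. smooth W \<longrightarrow>
        (\<forall>N\<le>4. cpart (exp_series (time_step \<tau> T) (ce_m \<Phi> S \<tau> \<Psi>) N W x) =
           cpart (exp_series (space_step \<tau> v M) (ce_mstar \<Phi> S \<tau> \<Psi>) N W x)) \<and>
        (\<forall>N\<le>3. npart (exp_series (time_step \<tau> T) (ce_m \<Phi> S \<tau> \<Psi>) N W x) =
           npart (exp_series (space_step \<tau> v M) (ce_mstar \<Phi> S \<tau> \<Psi>) N W x)))
    \<longleftrightarrow> (\<forall>W x. smooth W \<longrightarrow>
        (\<forall>N\<le>4. cpart (Z \<Gamma> (trunc 3 \<Psi>) N W x) = 0) \<and> (\<forall>N\<le>3. npart (Z \<Gamma> (trunc 3 \<Psi>) N W x) = 0))"
proof -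
  let ?\<psi> = "trunc 3 \<Psi>"
  define \<Gamma>t where "\<Gamma>t = (\<lambda>k W x. \<tau> ^ k *\<^sub>R \<Gamma> k W x)"
  have \<Gamma>t: "\<And>k. k \<in> {1..4} \<Longrightarrow> diffop (\<Gamma>t k)" unfolding \<Gamma>t_def by (intro diffop_cscaleR \<Gamma>)
  note \<Gamma>ts = diffop_smooth[OF \<Gamma>t]
  \<comment> \<open>Differential operators are meaningful on smooth fields only. Forcing the value 0
    on all other fields makes equality of series an equality of functions, as the abstract
    exponentials require; \<open>res\<close> below performs this restriction.\<close>
  define F where "F = (\<lambda>k::nat. {u :: nat \<Rightarrow> (real^'d \<Rightarrow> real^'n) \<Rightarrow> real^'d \<Rightarrow> real^('n + 'p).
     (\<forall>N. diffop (u N)) \<and> (\<forall>N W x. \<not> smooth W \<longrightarrow> u N W x = 0) \<and> (\<forall>N<k. \<forall>W x. u N W x = 0)})"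
  define G where "G = {u \<in> F 0. \<forall>W x. (\<forall>N\<le>4. cpart (u N W x) = 0) \<and> (\<forall>N\<le>3. npart (u N W x) = 0)}"
  define P where "P = (\<lambda>(u :: nat \<Rightarrow> (real^'d \<Rightarrow> real^'n) \<Rightarrow> real^'d \<Rightarrow> real^('n + 'p)) N W x. if smooth W then - Tser \<Gamma>t u N W x else 0)"
  define Q where "Q = (\<lambda>(u :: nat \<Rightarrow> (real^'d \<Rightarrow> real^'n) \<Rightarrow> real^'d \<Rightarrow> real^('n + 'p)) N W x. if smooth W then - (\<tau> *\<^sub>R shift (Lam v M) u N W x) else 0)"
  define res where "res = (\<lambda>(u :: nat \<Rightarrow> (real^'d \<Rightarrow> real^'n) \<Rightarrow> real^'d \<Rightarrow> real^('n + 'p)) N W x. if smooth W then u N W x else 0)"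
  have FI: "u \<in> F k" if "\<And>N. diffop (u N)" "\<And>N W x. \<not> smooth W \<Longrightarrow> u N W x = 0" "\<And>N W x. N < k \<Longrightarrow> u N W x = 0" for u k
    using that by (simp add: F_def)
  have FD: "diffop (u N)" "\<not> smooth W \<Longrightarrow> u N W x = 0" "N < k \<Longrightarrow> u N W x = 0" if "u \<in> F k" for u k N W x
    using that by (auto simp: F_def)
  have subF: "subspace (F k)" for k
  proof (unfold subspace_def, intro conjI ballI allI)
    show "0 \<in> F k" by (rule FI) (simp_all add: zero_fun_def diffop_zero)
    show "u + w \<in> F k" if "u \<in> F k" "w \<in> F k" for u w
      by (rule FI, unfold fun_plus_eq, rule diffop_add) (simp_all add: FD[OF that(1)] FD[OF that(2)])
    show "c *\<^sub>R u \<in> F k" if "u \<in> F k" for c u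
      by (rule FI, unfold fun_scaleR_eq, rule diffop_cscaleR) (simp_all add: FD[OF that])
  qed
  have subG: "subspace G"
    unfolding G_def subspace_def
    using subspace_0[OF subF] subspace_add[OF subF] subspace_scale[OF subF] by (simp add: cpart_simps npart_simps)
  have F_le: "F k \<subseteq> F 0" for k unfolding F_def by auto
  \<comment> \<open>An element of \<open>G\<close> can be nonzero at order 4 in the nonconserved
    block. An operator that raises the order moves it to order 5, hence back into \<open>G\<close>;
    this settles invariance of \<open>G\<close> in \<open>raisesI\<close>.\<close>
  have GF4: "G \<subseteq> F 4"
  proof
    fix u assume u: "u \<in> G"
    have "u N W x = 0" if "N < 4" for N W x
    proof -
      have "cpart (u N W x) = 0" "npart (u N W x) = 0" using u that by (simp_all add: G_def)
      then show ?thesis using join_parts[of "u N W x"] by simp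
    qed
    then show "u \<in> F 4" using u by (auto simp: G_def F_def)
  qed
  have F5G: "F k \<subseteq> G" if "5 \<le> k" for k
    using that F_le[of k] by (auto simp: G_def FD(3) cpart_simps npart_simps)
  interpret filtered F G
    using subF subG F_le F5G GF4 by unfold_locales (auto simp: G_def)
  have zero_ser: "u N = (\<lambda>W x. 0)" if "u \<in> F k" "N < k" for u k N
    using FD(3)[OF that] by (simp add: fun_eq_iff)
  have raisesI: "raises X"
    if "\<And>u w. u \<in> F 0 \<Longrightarrow> w \<in> F 0 \<Longrightarrow> X (u + w) = X u + X w" "\<And>u c. u \<in> F 0 \<Longrightarrow> X (c *\<^sub>R u) = c *\<^sub>R X u"
      "\<And>k u. u \<in> F k \<Longrightarrow> X u \<in> F (Suc k)" for X
    unfolding raises_def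
  proof (intro conjI ballI allI)
    fix u assume "u \<in> G"
    then have "X u \<in> F 5" using that(3)[where u = u and k = 4] GF4 by auto
    then show "X u \<in> G" using F_G[of 5] by auto
  qed (simp_all add: that)
  have rP: "raises P"
  proof (rule raisesI)
    show "P (u + w) = P u + P w" if "u \<in> F 0" "w \<in> F 0" for u w
    proof (intro ext)
      fix N W x
      have "Tser \<Gamma>t (\<lambda>N W x. u N W x + w N W x) N W x = Tser \<Gamma>t u N W x + Tser \<Gamma>t w N W x" if W: "smooth W"
        by (rule Tser_add[where \<Gamma> = \<Gamma>t, OF FD(1)[OF \<open>u \<in> F 0\<close>] FD(1)[OF \<open>w \<in> F 0\<close>] W \<Gamma>ts[OF _ W]])
      then show "P (u + w) N W x = (P u + P w) N W x"
        unfolding P_def fun_plus_eq[abs_def] by simp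
    qed
    show "P (c *\<^sub>R u) = c *\<^sub>R P u" if "u \<in> F 0" for u c
    proof (intro ext)
      fix N W x
      have "Tser \<Gamma>t (\<lambda>N W x. c *\<^sub>R u N W x) N W x = c *\<^sub>R Tser \<Gamma>t u N W x" if W: "smooth W"
        by (rule Tser_linear[where \<Gamma> = \<Gamma>t, OF bounded_linear_scaleR_right FD(1)[OF \<open>u \<in> F 0\<close>] W \<Gamma>ts[OF _ W]])
      then show "P (c *\<^sub>R u) N W x = (c *\<^sub>R P u) N W x"
        unfolding P_def fun_scaleR_eq[abs_def] by simp
    qed
    show "P u \<in> F (Suc k)" if u: "u \<in> F k" for k u
    proof (rule FI)
      show "diffop (P u N)" for N unfolding P_def
        by (intro diffop_restrict diffop_minus diffop_Tser \<Gamma>t FD(1)[OF u])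
      fix N W x assume N: "N < Suc k"
      have "u (N - j) = (\<lambda>W x. 0)" if "j \<in> {1..min 4 N}" for j
        by (rule zero_ser[OF u]) (use N that in auto)
      then have "Tser \<Gamma>t u N W x = 0" unfolding Tser_def by (intro sum.neutral) (simp add: dd_zero)
      then show "P u N W x = 0" by (simp add: P_def)
    qed (simp add: P_def)
  qed
  have rQ: "raises Q"
  proof (rule raisesI)
    show "Q (u + w) = Q u + Q w" if "u \<in> F 0" "w \<in> F 0" for u w
      unfolding Q_def fun_plus_eq[abs_def] 
      by (intro ext) (simp add: shift_def Lam_add diffop_smooth[OF FD(1)[OF that(1)]] diffop_smooth[OF FD(1)[OF that(2)]] scaleR_add_right)
    show "Q (c *\<^sub>R u) = c *\<^sub>R Q u" if "u \<in> F 0" for u c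
      unfolding Q_def fun_scaleR_eq[abs_def]
      by (intro ext) (simp add: shift_def Lam_cscaleR diffop_smooth[OF FD(1)[OF that]])
    show "Q u \<in> F (Suc k)" if u: "u \<in> F k" for k u
    proof (rule FI)
      show "diffop (Q u N)" for N unfolding Q_def
        by (intro diffop_restrict diffop_minus diffop_cscaleR diffop_shift diffop_Lam FD(1)[OF u])
      fix N W x assume N: "N < Suc k"
      have "shift (Lam v M) u N W x = 0"
      proof (cases N)
        case (Suc n)
        then have "u n = (\<lambda>W x. 0)" using zero_ser[OF u] N by simp
        then show ?thesis using Suc Lam_cscaleR[where f = "\<lambda>x. 0" and v = v and M = M and c = 0] by (simp add: shift_def smooth_const)
      qed (simp add: shift_def)
      then show "Q u N W x = 0" by (simp add: Q_def)
    qed (simp add: Q_def)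
  qed
  have comm: "Q (P u) = P (Q u)" if u: "u \<in> F 0" for u
  proof (intro ext)
    fix N W x
    show "Q (P u) N W x = P (Q u) N W x"
    proof (cases "smooth W")
      case W: True
      have s: "shift (Lam v M) (P u) N W x = - shift (Lam v M) (Tser \<Gamma>t u) N W x"
        using Lam_cscaleR[OF diffop_smooth[OF diffop_Tser[OF FD(1)[OF u] \<Gamma>t] W], where v = v and M = M and c = "-1"] W
        by (simp add: shift_def P_def)
      have "Tser \<Gamma>t (Q u) N W x = Tser \<Gamma>t (\<lambda>N W x. (- \<tau>) *\<^sub>R shift (Lam v M) u N W x) N W x"
        by (rule Tser_cong[where \<Gamma> = \<Gamma>t]) (simp_all add: Q_def W \<Gamma>ts)
      also have "\<dots> = (- \<tau>) *\<^sub>R Tser \<Gamma>t (shift (Lam v M) u) N W x"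
        by (rule Tser_linear[where \<Gamma> = \<Gamma>t, OF bounded_linear_scaleR_right diffop_shift[OF diffop_Lam FD(1)[OF u]] W \<Gamma>ts[OF _ W]])
      also have "Tser \<Gamma>t (shift (Lam v M) u) N W x = shift (Lam v M) (Tser \<Gamma>t u) N W x"
        by (rule Tser_shift[OF dd_Lam[OF _ W] Lam_sum FD(1)[OF u] W \<Gamma>t])
      finally show ?thesis using W s by (simp add: Q_def[THEN fun_cong, THEN fun_cong, THEN fun_cong, THEN fun_cong, of "P u"] P_def[THEN fun_cong, THEN fun_cong, THEN fun_cong, THEN fun_cong, of "Q u"])
    qed (simp add: P_def Q_def)
  qed
  have res_F: "res u \<in> F 0" if "\<And>N. diffop (u N)" for u
    by (rule FI) (auto simp: res_def intro: diffop_restrict that)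
  have tpow: "(time_step \<tau> T ^^ l) u N W x = (P ^^ l) (res u) N W x"
    if u: "\<And>N. diffop (u N)" and W: "smooth W" for l u N W x
    using W
  proof (induction l arbitrary: N W x)
    case 0
    then show ?case by (simp add: res_def)
  next
    case (Suc l)
    have d: "diffop ((P ^^ l) (res u) N)" for N
      using FD(1)[OF raises_pow0[OF rP res_F[OF u]]] .
    have d': "diffop ((time_step \<tau> T ^^ l) u N)" for N
      by (rule diffop_cong[OF d]) (simp add: Suc.IH)
    have "\<tau> *\<^sub>R lift (T k) ((time_step \<tau> T ^^ l) u (N - k)) W x = - dd ((P ^^ l) (res u) (N - k)) (\<Gamma>t k) W x"
      if k: "k \<in> {1..min 4 N}" for k
    proof -
      have k4: "k \<in> {1..4}" using k by auto
      have "\<tau> *\<^sub>R lift (T k) ((time_step \<tau> T ^^ l) u (N - k)) W x = - (\<tau> ^ k *\<^sub>R dd ((time_step \<tau> T ^^ l) u (N - k)) (\<Gamma> k) W x)"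
        by (rule T[OF k4 d' Suc.prems])
      also have "dd ((time_step \<tau> T ^^ l) u (N - k)) (\<Gamma> k) W x = dd ((P ^^ l) (res u) (N - k)) (\<Gamma> k) W x"
        by (rule dd_cong) (use Suc diffop_smooth[OF \<Gamma>[OF k4] Suc.prems] in simp_all)
      also have "\<tau> ^ k *\<^sub>R dd ((P ^^ l) (res u) (N - k)) (\<Gamma> k) W x = dd ((P ^^ l) (res u) (N - k)) (\<Gamma>t k) W x"
        unfolding \<Gamma>t_def by (rule dd_cscaleR_direction[where G = "\<Gamma> k", OF d Suc.prems diffop_smooth[OF \<Gamma>[OF k4] Suc.prems], symmetric])
      finally show ?thesis .
    qed
    then have "time_step \<tau> T ((time_step \<tau> T ^^ l) u) N W x = P ((P ^^ l) (res u)) N W x"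
      unfolding time_step_def P_def Tser_def using Suc.prems by (simp add: sum_negf)
    then show ?case by simp
  qed
  have spow: "(space_step \<tau> v M ^^ l) u N W x = (Q ^^ l) (res u) N W x"
    if W: "smooth W" for l u N W x
    using W
  proof (induction l arbitrary: N W x)
    case 0
    then show ?case by (simp add: res_def)
  next
    case (Suc l)
    have "(space_step \<tau> v M ^^ l) u N W = (Q ^^ l) (res u) N W" for N using Suc by (simp add: fun_eq_iff)
    moreover have "space_step \<tau> v M w N W x = Q w' N W x" if "\<And>N. w N W = w' N W" for w w'
      using that Suc.prems by (simp add: space_step_def Q_def shift_def)
    ultimately show ?case unfolding funpow.simps comp_apply by blast
  qed
  \<comment> \<open>The l-th power of an order-raising operator does not contribute below order l,
    so cutting the exponential at degree \<open>N\<close> or at degree 4 gives the same coefficient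
    of order \<open>N\<close>.\<close>
  have e4: "exp4 X u N W x = (\<Sum>l\<le>N. (1 / fact l) *\<^sub>R (X ^^ l) u N W x)"
    if X: "raises X" and u: "u \<in> F 0" and N: "N \<le> 4" for X u N W x
  proof -
    have "exp4 X u N W x = (\<Sum>l\<le>4. (1 / fact l) *\<^sub>R (X ^^ l) u N W x)"
      by (simp add: exp4_def sum_fun_apply)
    also have "\<dots> = (\<Sum>l\<le>N. (1 / fact l) *\<^sub>R (X ^^ l) u N W x)"
    proof (rule sum.mono_neutral_right)
      show "\<forall>l\<in>{..4} - {..N}. (1 / fact l) *\<^sub>R (X ^^ l) u N W x = 0"
      proof
        fix l assume "l \<in> {..4} - {..N}"
        then show "(1 / fact l) *\<^sub>R (X ^^ l) u N W x = 0"
          using FD(3)[OF raises_pow[OF X u, of l], of N W x] by simp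
      qed
    qed (use N in auto)
    finally show ?thesis .
  qed
  define cm where "cm = ce_m \<Phi> S \<tau> \<Psi>"
  define cs where "cs = ce_mstar \<Phi> S \<tau> \<Psi>"
  have d\<psi>: "diffop (?\<psi> N)" for N by (rule diffop_trunc[OF \<Psi>])
  note dg = diffop_gser[where \<Phi> = \<Phi> and \<Sigma> = \<Sigma>, OF smooth_\<Phi> d\<psi>]
  note du = diffop_user[OF d\<psi>]
  have Y: "ce_Y \<Phi> S \<tau> \<Psi> N W x = (if N = 0 then \<Phi> (W x) else 0) + \<tau> ^ N *\<^sub>R (matrix_inv S *v ?\<psi> N W x)" for N W x
    by (simp add: ce_Y_def trunc_def matrix_vector_mult_scaleR)
  \<comment> \<open>From S^-1 \<psi> = \<Sigma> \<psi> + \<psi>/2, and Y' = Y - \<psi> in the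
    companion equation: m and m' are the mean plus and minus one half of (0, \<psi>).\<close>
  have cm: "cm N W x = \<tau> ^ N *\<^sub>R (gser \<Phi> \<Sigma> ?\<psi> N W x + (1/2) *\<^sub>R user ?\<psi> N W x)" for N W x
    unfolding cm_def ce_m_def Y gser_def user_def Sigma_apply
    by (cases "N = 0") (simp_all add: join2_lin[symmetric] join_add[symmetric] join_scaleR[symmetric] trunc_def scaleR_diff_right)
  have cs: "cs N W x = \<tau> ^ N *\<^sub>R (gser \<Phi> \<Sigma> ?\<psi> N W x - (1/2) *\<^sub>R user ?\<psi> N W x)" for N W x
    unfolding cs_def ce_mstar_def Y gser_def user_def Sigma_apply
    by (cases "N = 0") (simp_all add: join2_lin[symmetric] join_diff[symmetric] join_scaleR[symmetric] trunc_def
        scaleR_diff_right matrix_vector_mult_scaleR Sinv Sinv_neg matrix_vector_mult_diff_distrib scaleR_left_diff_distrib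
        scaleR_add_left[symmetric] algebra_simps)
  have dcm: "diffop (cm N)" and dcs: "diffop (cs N)" for N
    unfolding cm[abs_def] cs[abs_def] by (intro diffop_cscaleR diffop_add diffop_diff dg du)+
  have fm: "res cm \<in> F 0" and fs: "res cs \<in> F 0" by (rule res_F, rule dcm, rule res_F, rule dcs)
  define g where "g = (1/2) *\<^sub>R (res cm + res cs)"
  define u where "u = res cs - res cm"
  have g: "g N W x = \<tau> ^ N *\<^sub>R gser \<Phi> \<Sigma> ?\<psi> N W x" and u: "u N W x = \<tau> ^ N *\<^sub>R - user ?\<psi> N W x"
    if "smooth W" for N W x
    unfolding g_def u_def using that
    by (simp_all add: res_def cm cs mean_eq diff_eq)
  have uF1: "u \<in> F 1"
  proof (rule FI)
    have "u \<in> F 0" unfolding u_def by (intro subspace_diff[OF subF] res_F dcs dcm)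
    then show "diffop (u N)" "\<not> smooth W \<Longrightarrow> u N W x = 0" for N W x using FD by blast+
    show "u N W x = 0" if "N < 1" for N W x
      using that by (simp add: u_def res_def cm cs user_def trunc_def)
  qed
  have gF: "g \<in> F 0" unfolding g_def by (intro subspace_scale[OF subF] subspace_add[OF subF] res_F dcs dcm)
  define R where "R = (\<lambda>u. P u - Q u)"
  have rR: "raises R" unfolding R_def using raises_add[OF rP raises_minus[OF rQ]] by simp
  have R_scaled: "R w N W x = \<tau> ^ N *\<^sub>R Rser v M \<Gamma> w' N W x"
    if "\<And>N. diffop (w' N)" "\<And>N W x. smooth W \<Longrightarrow> w N W x = \<tau> ^ N *\<^sub>R w' N W x" "smooth W" for w w' N W x
    using Rser_scaled[where \<Gamma> = \<Gamma> and u = w and v = v and M = M, OF that(1,2,3) \<Gamma>] that(3)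
    by (simp add: R_def P_def Q_def \<Gamma>t_def)
  define Zh where "Zh = R g - u - (1/12) *\<^sub>R R (R u)"
  have Zh: "Zh N W x = \<tau> ^ N *\<^sub>R Z \<Gamma> ?\<psi> N W x" if W: "smooth W" for N W x
  proof -
    have \<Gamma>s: "\<And>k W. k \<in> {1..4} \<Longrightarrow> smooth W \<Longrightarrow> smooth (\<Gamma> k W)" using diffop_smooth[OF \<Gamma>] .
    have 1: "R g N W x = \<tau> ^ N *\<^sub>R Rser v M \<Gamma> (gser \<Phi> \<Sigma> ?\<psi>) N W x" by (rule R_scaled[OF dg g W])
    have Ru: "R u N W x = \<tau> ^ N *\<^sub>R - Rser v M \<Gamma> (user ?\<psi>) N W x" if W: "smooth W" for N W x
    proof -
      have "R u N W x = \<tau> ^ N *\<^sub>R Rser v M \<Gamma> (\<lambda>N W x. - user ?\<psi> N W x) N W x"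
        by (rule R_scaled[OF diffop_minus[OF du] u W])
      also have "Rser v M \<Gamma> (\<lambda>N W x. - user ?\<psi> N W x) N W x = - Rser v M \<Gamma> (user ?\<psi>) N W x"
        by (rule Rser_minus[OF du W]) (rule \<Gamma>s[OF _ W])
      finally show ?thesis .
    qed
    have dR: "diffop (Rser v M \<Gamma> (user ?\<psi>) N)" for N by (rule diffop_Rser[OF du \<Gamma>])
    have "R (R u) N W x = \<tau> ^ N *\<^sub>R - Rser v M \<Gamma> (Rser v M \<Gamma> (user ?\<psi>)) N W x"
    proof -
      have "R (R u) N W x = \<tau> ^ N *\<^sub>R Rser v M \<Gamma> (\<lambda>N W x. - Rser v M \<Gamma> (user ?\<psi>) N W x) N W x"
        by (rule R_scaled[OF diffop_minus[OF dR] Ru W])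
      also have "Rser v M \<Gamma> (\<lambda>N W x. - Rser v M \<Gamma> (user ?\<psi>) N W x) N W x = - Rser v M \<Gamma> (Rser v M \<Gamma> (user ?\<psi>)) N W x"
        by (rule Rser_minus[OF dR W]) (rule \<Gamma>s[OF _ W])
      finally show ?thesis .
    qed
    then show ?thesis unfolding Zh_def Zser_def using 1 u[OF W, of N x]
      by (simp add: scaleR_add_right)
  qed
  have ZhF: "Zh \<in> F 0" unfolding Zh_def
    using F_le[of 1] uF1 by (intro subspace_diff[OF subF] subspace_scale[OF subF] raises_F0[OF rR] gF) auto
  have ser: "exp_series (time_step \<tau> T) cm N W x = exp4 P (res cm) N W x"
    "exp_series (space_step \<tau> v M) cs N W x = exp4 Q (res cs) N W x" if "N \<le> 4" "smooth W" for N W x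
    unfolding exp_series_def
    by (simp_all add: e4[OF rP fm that(1)] e4[OF rQ fs that(1)] tpow[OF dcm that(2)] spow[OF that(2)])
  have G_iff: "w \<in> G \<longleftrightarrow> (\<forall>W x. smooth W \<longrightarrow> (\<forall>N\<le>4. cpart (w N W x) = 0) \<and> (\<forall>N\<le>3. npart (w N W x) = 0))"
    if "w \<in> F 0" for w
  proof
    assume a: "\<forall>W x. smooth W \<longrightarrow> (\<forall>N\<le>4. cpart (w N W x) = 0) \<and> (\<forall>N\<le>3. npart (w N W x) = 0)"
    have "(\<forall>N\<le>4. cpart (w N W x) = 0) \<and> (\<forall>N\<le>3. npart (w N W x) = 0)" for W x
      using a FD(2)[OF that] by (cases "smooth W") (simp_all add: cpart_simps npart_simps)
    then show "w \<in> G" using that by (simp add: G_def)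
  qed (simp add: G_def)
  have E: "exp4 P (res cm) - exp4 Q (res cs) \<in> F 0"
    by (intro subspace_diff[OF subF] exp4_F0 rP rQ res_F dcm dcs)
  have "(\<forall>W x. smooth W \<longrightarrow>
        (\<forall>N\<le>4. cpart (exp_series (time_step \<tau> T) cm N W x) = cpart (exp_series (space_step \<tau> v M) cs N W x)) \<and>
        (\<forall>N\<le>3. npart (exp_series (time_step \<tau> T) cm N W x) = npart (exp_series (space_step \<tau> v M) cs N W x)))
    \<longleftrightarrow> exp4 P (res cm) - exp4 Q (res cs) \<in> G"
    unfolding G_iff[OF E] by (simp add: ser cpart_simps npart_simps)
  also have "\<dots> \<longleftrightarrow> exp4 R (res cm) - res cs \<in> G"
    using exp_diff_iff[OF rP rQ comm fm fs] by (simp add: R_def)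
  \<comment> \<open>Both directions of the tanh lemma are used; the converse rests on
    \<open>uF1\<close>, that is, on m and m' agreeing at order 0.\<close>
  also have "\<dots> \<longleftrightarrow> Zh \<in> G"
    using exp4_iff_tanh[OF rR fm fs] uF1 unfolding Zh_def g_def u_def by blast
  also have "\<dots> \<longleftrightarrow> (\<forall>W x. smooth W \<longrightarrow>
        (\<forall>N\<le>4. cpart (Z \<Gamma> ?\<psi> N W x) = 0) \<and> (\<forall>N\<le>3. npart (Z \<Gamma> ?\<psi> N W x) = 0))"
    unfolding G_iff[OF ZhF] using \<tau> by (simp add: Zh cpart_simps npart_simps)
  finally show ?thesis unfolding cm_def cs_def .
qed

end

lemma scalar_dd_has_vector_derivative:
  assumes F: "scalar_diffop F" and W: "smooth W" and V: "smooth (G W)"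
  shows "((\<lambda>s. F (\<lambda>y. W y + s *\<^sub>R G W y) x) has_vector_derivative dd F G W x) (at 0)"
proof -
  obtain J g where 1: "smooth_fin J g" "\<forall>W x. smooth W \<longrightarrow> F W x = g (jet W x)"
    using F scalar_diffop_def by blast
  show ?thesis unfolding dd_formula[where G = G, OF 1 W V]
    by (rule dd_has_derivative[where G = G, OF 1 W V])
qed

lemma scalar_dd_cmult_direction:
  assumes F: "scalar_diffop F" and W: "smooth W" and V: "smooth (G W)"
  shows "dd F (\<lambda>W y. c *\<^sub>R G W y) W x = c * dd F G W x"
proof -
  obtain J g where 1: "smooth_fin J g" "\<forall>W x. smooth W \<longrightarrow> F W x = g (jet W x)"
    using F scalar_diffop_def by blast
  have j: "jet (\<lambda>y. c *\<^sub>R G W y) x j = c * jet (G W) x j" for j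
    by (cases j) (simp add: jet_def nder_cscaleR[OF V])
  show ?thesis
    unfolding dd_formula[where G = G, OF 1 W V] dd_formula[where G = "\<lambda>W y. c *\<^sub>R G W y", OF 1 W smooth_cscaleR[OF V]] j
    by (simp add: sum_distrib_left mult_ac)
qed

text \<open>Reduced to \<open>dd_pd\<close> by repeating the scalar operator in every component of a
  vector.\<close>

lemma scalar_dd_pd:
  fixes F :: "(real^'d::finite \<Rightarrow> real^'n::finite) \<Rightarrow> real^'d \<Rightarrow> real"
  assumes F: "scalar_diffop F" and W: "smooth W" and V: "smooth (G W)"
  shows "dd (\<lambda>W. pd \<alpha> (F W)) G W x = pd \<alpha> (dd F G W) x"
proof -
  define F' :: "(real^'d \<Rightarrow> real^'n) \<Rightarrow> real^'d \<Rightarrow> real^'n" where "F' = (\<lambda>W x. \<chi> i. F W x)"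
  have F': "diffop F'" using F by (simp add: diffop_def F'_def)
  fix i :: 'n
  have comp: "pd \<alpha> (F W) x = pd \<alpha> (F' W) x $ i" if "smooth W" for W x
    using dir_nth[OF smooth_differentiable[OF diffop_smooth[OF F' that]], of "axis \<alpha> 1" i x]
    by (simp add: pd_dir F'_def)
  have "dd (\<lambda>W. pd \<alpha> (F W)) G W x = dd (\<lambda>W x. pd \<alpha> (F' W) x $ i) G W x"
    by (rule dd_cong) (use comp W V in simp_all)
  also have "\<dots> = dd (\<lambda>W. pd \<alpha> (F' W)) G W x $ i"
    by (rule dd_component(1)[where G = G, OF diffop_pd[OF F'] W V, symmetric])
  also have "\<dots> = pd \<alpha> (dd F' G W) x $ i" by (simp only: dd_pd[where G = G, OF F' W V])
  also have "\<dots> = pd \<alpha> (\<lambda>x. dd F' G W x $ i) x"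
  proof -
    have "dd F' G W = dd F' (\<lambda>_. G W) W" by (simp add: dd_def fun_eq_iff)
    moreover have "smooth (dd F' (\<lambda>_. G W) W)"
    proof (rule smooth_vecI)
      fix i
      obtain J g where 1: "smooth_fin J g" "\<forall>W x. smooth W \<longrightarrow> F' W x $ i = g (jet W x)"
        using diffop_scalar[OF F', of i] unfolding scalar_diffop_def by blast
      have eq: "dd F' (\<lambda>_. G W) W x $ i = (\<Sum>j\<in>J. coord_deriv j g (jet W x) * jet (G W) x j)" for x
        unfolding dd_component(1)[where G = "\<lambda>_. G W", OF F' W V]
        by (rule dd_formula[where G = "\<lambda>_. G W", OF 1 W V])
      have js: "smooth (\<lambda>x. jet V x j)" if "smooth V" for V :: "real^'d \<Rightarrow> real^'n" and j
        by (cases j) (simp add: jet_def smooth_nth smooth_nder that)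
      show "smooth (\<lambda>x. dd F' (\<lambda>_. G W) W x $ i)" unfolding eq
      proof (rule smooth_sum)
        fix j
        have "reg (\<lambda>N h x. coord_deriv j g (jet W x))"
          by (rule reg_smooth_fin[OF smooth_fin_coord_deriv[OF 1(1)]]) (simp add: reg_const_fam_iff js[OF W])
        then have "reg (\<lambda>N h x. coord_deriv j g (jet W x) * jet (G W) x j)"
          by (rule reg_mult) (simp add: reg_const_fam_iff js[OF V])
        then show "smooth (\<lambda>x. coord_deriv j g (jet W x) * jet (G W) x j)" by (simp only: reg_const_fam_iff)
      qed
    qed
    ultimately show ?thesis
      by (simp add: pd_dir dir_nth smooth_differentiable)
  qed
  also have "(\<lambda>x. dd F' G W x $ i) = dd F G W"
    unfolding dd_component(1)[where G = G, OF F' W V] by (simp add: F'_def)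
  finally show ?thesis .
qed

context lbm
begin

text \<open>Read from left to right, \<open>CE_iff\<close> extracts the recursion from any
  Chapman-Enskog expansion.\<close>

lemma CE_rec:
  assumes ce: "chapman_enskog v M \<Phi> S \<tau> \<Gamma> \<Psi>" and \<tau>: "\<tau> > 0"
  shows "\<And>k. k \<in> {1..4} \<Longrightarrow> diffop (\<Gamma> k)" and "\<And>k. k \<in> {1..3} \<Longrightarrow> diffop (\<Psi> k)"
    and "\<And>N W x. N \<in> {1..4} \<Longrightarrow> smooth W \<Longrightarrow> \<Gamma> N W x = recC \<Gamma> (trunc 3 \<Psi>) N W x"
    and "\<And>N W x. N \<in> {1..3} \<Longrightarrow> smooth W \<Longrightarrow> trunc 3 \<Psi> N W x = recN \<Gamma> (trunc 3 \<Psi>) N W x"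
proof -
  show \<Gamma>: "\<And>k. k \<in> {1..4} \<Longrightarrow> diffop (\<Gamma> k)" and \<Psi>: "\<And>k. k \<in> {1..3} \<Longrightarrow> diffop (\<Psi> k)"
    using ce unfolding chapman_enskog_def by blast+
  obtain T where T: "\<forall>k\<in>{1..4}. time_derivation (T k) \<and>
        (\<forall>W x. smooth W \<longrightarrow> lift (T k) (\<lambda>U. U) W x + \<tau> ^ (k - 1) *\<^sub>R \<Gamma> k W x = 0)"
    and E: "\<forall>W x. smooth W \<longrightarrow>
        (\<forall>N\<le>4. cpart (exp_series (time_step \<tau> T) (ce_m \<Phi> S \<tau> \<Psi>) N W x) =
           cpart (exp_series (space_step \<tau> v M) (ce_mstar \<Phi> S \<tau> \<Psi>) N W x)) \<and>
        (\<forall>N\<le>3. npart (exp_series (time_step \<tau> T) (ce_m \<Phi> S \<tau> \<Psi>) N W x) =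
           npart (exp_series (space_step \<tau> v M) (ce_mstar \<Phi> S \<tau> \<Psi>) N W x))"
    using ce unfolding chapman_enskog_def by blast
  \<comment> \<open>The chain rule leaves no freedom: a time derivation is determined by its value
    on W, which the definition of \<Gamma>_k prescribes.\<close>
  have can: "\<tau> *\<^sub>R lift (T k) F W x = - (\<tau> ^ k *\<^sub>R dd F (\<Gamma> k) W x)"
    if k: "k \<in> {1..4}" and F: "diffop F" and W: "smooth W"
    for k and F :: "(real^'d \<Rightarrow> real^'n) \<Rightarrow> real^'d \<Rightarrow> real^('n + 'p)" and W x
  proof -
    have g: "smooth (\<Gamma> k W)" by (rule diffop_smooth[OF \<Gamma>[OF k] W])
    have td: "time_derivation (T k)" and l: "\<And>W x. smooth W \<Longrightarrow> lift (T k) (\<lambda>U. U) W x + \<tau> ^ (k - 1) *\<^sub>R \<Gamma> k W x = 0"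
      using T k by auto
    have lid: "lift (T k) (\<lambda>U. U) W = (\<lambda>y. (- (\<tau> ^ (k - 1))) *\<^sub>R \<Gamma> k W y)"
      using l[OF W] by (simp add: fun_eq_iff eq_neg_iff_add_eq_0)
    have "lift (T k) F W x $ i = - (\<tau> ^ (k - 1)) * dd F (\<Gamma> k) W x $ i" for i
    proof -
      have "lift (T k) F W x $ i = dd (\<lambda>U y. F U y $ i) (lift (T k) (\<lambda>U. U)) W x"
        using td diffop_scalar[OF F, of i] W unfolding time_derivation_def by (simp add: lift_def)
      also have "\<dots> = dd (\<lambda>U y. F U y $ i) (\<lambda>W y. (- (\<tau> ^ (k - 1))) *\<^sub>R \<Gamma> k W y) W x"
        by (rule dd_cong, rule refl, rule W, rule lid, unfold lid, rule smooth_cscaleR[OF g])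
      also have "\<dots> = - (\<tau> ^ (k - 1)) * dd (\<lambda>U y. F U y $ i) (\<Gamma> k) W x"
        by (rule scalar_dd_cmult_direction[where G = "\<Gamma> k", OF diffop_scalar[OF F] W g])
      finally show ?thesis by (simp only: dd_component(1)[where G = "\<Gamma> k", OF F W g])
    qed
    moreover have "\<tau> ^ k = \<tau> * \<tau> ^ (k - 1)" using k by (cases k) auto
    ultimately show ?thesis by (simp add: vec_eq_iff)
  qed
  have Z: "(\<forall>W x. smooth W \<longrightarrow> (\<forall>N\<le>4. cpart (Z \<Gamma> (trunc 3 \<Psi>) N W x) = 0) \<and> (\<forall>N\<le>3. npart (Z \<Gamma> (trunc 3 \<Psi>) N W x) = 0))"
    by (rule CE_iff[where \<Gamma> = \<Gamma> and \<Psi> = \<Psi> and T = T, OF \<Gamma> \<Psi> \<tau> can, THEN iffD1, OF _ _ _ _ _ E])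
  have d\<psi>: "diffop (trunc 3 \<Psi> N)" for N by (rule diffop_trunc[OF \<Psi>])
  have z0: "trunc 3 \<Psi> 0 = (\<lambda>W x. 0)" by (simp add: trunc_def fun_eq_iff)
  show "\<Gamma> N W x = recC \<Gamma> (trunc 3 \<Psi>) N W x" if N: "N \<in> {1..4}" and W: "smooth W" for N W x
  proof -
    have "cpart (Z \<Gamma> (trunc 3 \<Psi>) N W x) = 0" using Z N W by auto
    then show ?thesis using Z_join[where \<Gamma> = \<Gamma> and \<psi> = "trunc 3 \<Psi>", OF d\<psi> z0 W \<Gamma> N, of x] by simp
  qed
  show "trunc 3 \<Psi> N W x = recN \<Gamma> (trunc 3 \<Psi>) N W x" if N: "N \<in> {1..3}" and W: "smooth W" for N W x
  proof -
    have "npart (Z \<Gamma> (trunc 3 \<Psi>) N W x) = 0" using Z N W by auto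
    moreover have "N \<in> {1..4}" using N by simp
    ultimately show ?thesis using Z_join[where \<Gamma> = \<Gamma> and \<psi> = "trunc 3 \<Psi>", OF d\<psi> z0 W \<Gamma>, of N x] by simp
  qed
qed

text \<open>From a solution of the recursion the time derivations are defined by the chain rule
  itself; they commute with space derivatives by \<open>scalar_dd_pd\<close>. No commutation among
  them arises.\<close>

lemma CE_exists:
  assumes \<tau>: "\<tau> > 0"
  shows "\<exists>\<Gamma> \<Psi>. chapman_enskog v M \<Phi> S \<tau> \<Gamma> \<Psi>"
proof -
  obtain \<Gamma> \<psi> where \<Gamma>: "\<And>k. diffop (\<Gamma> k)" and \<psi>: "\<And>k. diffop (\<psi> k)" and \<psi>0: "\<psi> 0 = (\<lambda>W x. 0)"
    and rC: "\<And>N W x. N \<in> {1..4} \<Longrightarrow> smooth W \<Longrightarrow> \<Gamma> N W x = recC \<Gamma> \<psi> N W x"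
    and rN: "\<And>N W x. N \<in> {1..4} \<Longrightarrow> smooth W \<Longrightarrow> \<psi> N W x = recN \<Gamma> \<psi> N W x"
    using rec_exists by blast
  define T where "T = (\<lambda>k (F :: (real^'d \<Rightarrow> real^'n) \<Rightarrow> real^'d \<Rightarrow> real) W x. - (\<tau> ^ (k - 1)) * dd F (\<Gamma> k) W x)"
  have lift_T: "lift (T k) F W x = - (\<tau> ^ (k - 1)) *\<^sub>R dd F (\<Gamma> k) W x" if F: "diffop F" and W: "smooth W"
    for F :: "(real^'d \<Rightarrow> real^'n) \<Rightarrow> real^'d \<Rightarrow> real^'m" and k W x
    by (simp add: vec_eq_iff lift_def T_def dd_component(1)[where G = "\<Gamma> k", OF F W diffop_smooth[OF \<Gamma> W]])
  have lid: "lift (T k) (\<lambda>U. U) W = (\<lambda>y. (- (\<tau> ^ (k - 1))) *\<^sub>R \<Gamma> k W y)" if "smooth W" for k W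
    using lift_T[OF diffop_id that, of k] by (simp add: fun_eq_iff dd_id)
  have td: "time_derivation (T k)" for k
    unfolding time_derivation_def
  proof (intro conjI allI impI)
    fix F :: "(real^'d \<Rightarrow> real^'n) \<Rightarrow> real^'d \<Rightarrow> real" assume F: "scalar_diffop F"
    show "scalar_diffop (T k F)" unfolding T_def by (intro scalar_diffop_cmult scalar_diffop_dd F \<Gamma>)
    fix W :: "real^'d \<Rightarrow> real^'n" and x assume W: "smooth W"
    note g = diffop_smooth[OF \<Gamma> W, of k]
    have sd: "smooth (dd F (\<Gamma> k) W)" by (rule scalar_diffop_smooth[OF scalar_diffop_dd[OF F \<Gamma>] W])
    show "T k F W x = dd F (lift (T k) (\<lambda>U. U)) W x"
    proof -
      have "dd F (lift (T k) (\<lambda>U. U)) W x = dd F (\<lambda>W y. (- (\<tau> ^ (k - 1))) *\<^sub>R \<Gamma> k W y) W x"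
        by (rule dd_cong, rule refl, rule W, rule lid[OF W], unfold lid[OF W], rule smooth_cscaleR[OF g])
      then show ?thesis unfolding T_def
        by (simp only: scalar_dd_cmult_direction[where G = "\<Gamma> k", OF F W g])
    qed
    show "T k (\<lambda>U. pd \<alpha> (F U)) W x = pd \<alpha> (T k F W) x" for \<alpha>
      unfolding T_def scalar_dd_pd[where G = "\<Gamma> k", OF F W g]
      using pd_linear[OF bounded_linear_mult_right sd, of \<alpha> "- (\<tau> ^ (k - 1))" x] by simp
    fix H :: "(real^'d \<Rightarrow> real^'n) \<Rightarrow> real^'d \<Rightarrow> real" and a b assume H: "scalar_diffop H"
    have "dd (\<lambda>U y. a * F U y + b * H U y) (\<Gamma> k) W x = a * dd F (\<Gamma> k) W x + b * dd H (\<Gamma> k) W x"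
      by (rule dd_eqI) (intro has_vector_derivative_add has_vector_derivative_mult_right
          scalar_dd_has_vector_derivative F H W g)
    then show "T k (\<lambda>U y. a * F U y + b * H U y) W x = a * T k F W x + b * T k H W x"
      by (simp add: T_def algebra_simps)
  qed
  have can: "\<tau> *\<^sub>R lift (T k) F W x = - (\<tau> ^ k *\<^sub>R dd F (\<Gamma> k) W x)"
    if k: "k \<in> {1..4}" and F: "diffop F" and W: "smooth W"
    for k and F :: "(real^'d \<Rightarrow> real^'n) \<Rightarrow> real^'d \<Rightarrow> real^('n + 'p)" and W x
  proof -
    have "\<tau> ^ k = \<tau> * \<tau> ^ (k - 1)" using k by (cases k) auto
    then show ?thesis by (simp add: lift_T[OF F W])
  qed
  have z0: "trunc 3 \<psi> 0 = (\<lambda>W x. 0)" by (simp add: trunc_def fun_eq_iff)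
  have d\<psi>: "diffop (trunc 3 \<psi> N)" for N by (rule diffop_trunc[OF \<psi>])
  have eq: "trunc 3 \<psi> j W x = \<psi> j W x" if "j < 4" for j W x
    using that \<psi>0 by (cases "j = 0") (auto simp: trunc_def)
  have Z0: "cpart (Z \<Gamma> (trunc 3 \<psi>) N W x) = 0 \<and> (N \<le> 3 \<longrightarrow> npart (Z \<Gamma> (trunc 3 \<psi>) N W x) = 0)"
    if N: "N \<le> 4" and W: "smooth W" for N W x
  proof (cases "N = 0")
    case True
    then show ?thesis using Z_0[where \<psi> = "trunc 3 \<psi>", OF z0] by (simp add: cpart_simps npart_simps)
  next
    case False
    then have N': "N \<in> {1..4}" using N by auto
    have "recC \<Gamma> (trunc 3 \<psi>) N W x = recC \<Gamma> \<psi> N W x"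
      by (rule rec_cong(1)) (use eq W N \<Gamma> in simp_all)
    moreover have "recN \<Gamma> (trunc 3 \<psi>) N W x = recN \<Gamma> \<psi> N W x"
      by (rule rec_cong(2)) (use eq W N' \<Gamma> in simp_all)
    ultimately show ?thesis unfolding Z_join[where \<Gamma> = \<Gamma> and \<psi> = "trunc 3 \<psi>", OF d\<psi> z0 W \<Gamma> N']
      using rC[OF N' W, of x] rN[OF N' W, of x] eq[of N W x] by (auto simp: npart_simps)
  qed
  have E: "\<forall>W x. smooth W \<longrightarrow>
        (\<forall>N\<le>4. cpart (exp_series (time_step \<tau> T) (ce_m \<Phi> S \<tau> \<psi>) N W x) =
           cpart (exp_series (space_step \<tau> v M) (ce_mstar \<Phi> S \<tau> \<psi>) N W x)) \<and>
        (\<forall>N\<le>3. npart (exp_series (time_step \<tau> T) (ce_m \<Phi> S \<tau> \<psi>) N W x) =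
           npart (exp_series (space_step \<tau> v M) (ce_mstar \<Phi> S \<tau> \<psi>) N W x))"
    by (rule CE_iff[where \<Gamma> = \<Gamma> and \<Psi> = \<psi> and T = T, OF \<Gamma> \<psi> \<tau> can, THEN iffD2]) (use Z0 in auto)
  show ?thesis unfolding chapman_enskog_def
    by (intro exI[of _ \<Gamma>] exI[of _ \<psi>] conjI ballI \<Gamma> \<psi> exI[of _ T] td allI impI)
      (use E lid in simp_all)
qed

end

section \<open>The scheme as exp(R) m = m' for families of functions of space and time\<close>

subsection \<open>The scheme acting on families\<close>

text \<open>\<open>slice F U\<close> applies a spatial operator at each time.\<close>

definition slice :: "(('x \<Rightarrow> 'b) \<Rightarrow> 'x \<Rightarrow> 'c) \<Rightarrow> ('x \<times> real, 'b) fam \<Rightarrow> ('x \<times> real, 'c) fam" where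
  "slice F U N h z = F (\<lambda>y. U N h (y, snd z)) (fst z)"

lemma Lam_slice:
  assumes "smooth m"
  shows "Lam v M (\<lambda>y. m (y, s)) x =
    (\<Sum>\<alpha>\<in>UNIV. (M ** diag (\<lambda>j. v j $ \<alpha>) ** matrix_inv M) *v dir (axis \<alpha> 1, 0) m (x, s))"
  unfolding Lam_def pd_dir by (simp add: dir_slice(1)[OF smooth_differentiable[OF assms]])

lemma slice_Lam:
  fixes u :: "((real^'d::finite) \<times> real, real^('n::finite + 'p::finite)) fam"
    and M :: "real^'q::finite^('n + 'p)"
  assumes "reg u"
  shows "slice (Lam v M) u =
    (\<lambda>N h z. \<Sum>\<alpha>\<in>UNIV. (M ** diag (\<lambda>j. v j $ \<alpha>) ** matrix_inv M) *v fdir (axis \<alpha> 1, 0) u N h z)"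
  unfolding slice_def by (intro ext) (simp add: Lam_slice[OF reg_smooth[OF assms]])

lemma reg_slice_Lam:
  fixes u :: "((real^'d::finite) \<times> real, real^('n::finite + 'p::finite)) fam"
    and M :: "real^'q::finite^('n + 'p)"
  shows "reg u \<Longrightarrow> reg (slice (Lam v M) u)"
  by (simp only: slice_Lam) (intro reg_sum reg_bounded_linear[OF bounded_linear_matrix] reg_fdir)

lemma neg_slice_Lam:
  fixes u :: "((real^'d::finite) \<times> real, real^('n::finite + 'p::finite)) fam"
    and M :: "real^'q::finite^('n + 'p)"
  assumes "neg k t u" shows "neg k t (slice (Lam v M) u)"
  unfolding slice_Lam[OF neg_reg[OF assms]]
  by (intro neg_sum neg_linear[OF bounded_linear_matrix] neg_fdir assms)

lemma reg_slice:
  fixes U :: "((real^'d::finite) \<times> real, real^'n::finite) fam" and F :: "(real^'d \<Rightarrow> real^'n) \<Rightarrow> real^'d \<Rightarrow> real^'m::finite"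
  shows "diffop F \<Longrightarrow> reg U \<Longrightarrow> reg (slice F U)"
  unfolding slice_def[abs_def] by (rule diffop_reg)

text \<open>One derivative and one factor \<open>h\<close>: on families all of whose derivatives are
  controlled, this raises the order by one.\<close>

definition Rop :: "('q::finite \<Rightarrow> real^'d::finite) \<Rightarrow> real^'q^('n::finite + 'p::finite)
    \<Rightarrow> ((real^'d) \<times> real, real^('n + 'p)) fam \<Rightarrow> ((real^'d) \<times> real, real^('n + 'p)) fam" where
  "Rop v M u = (\<lambda>N h z. h *\<^sub>R (fdir (0, 1) u N h z + slice (Lam v M) u N h z))"

lemma neg_Rop: "neg k t u \<Longrightarrow> neg (Suc k) t (Rop v M u)"
  unfolding Rop_def by (intro neg_h neg_add neg_fdir neg_slice_Lam)

lemma subspace_neg: "subspace {u :: ('a::real_normed_vector \<times> real, 'b::real_normed_vector) fam. neg k t u}"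
proof (unfold subspace_def, intro conjI ballI allI)
  show "0 \<in> {u :: ('a \<times> real, 'b) fam. neg k t u}" by (simp add: zero_fun_def)
  fix u w :: "('a \<times> real, 'b) fam" and c :: real
  assume u: "u \<in> {u. neg k t u}"
  have "c *\<^sub>R u = (\<lambda>N h z. c *\<^sub>R u N h z)" by (simp add: fun_eq_iff)
  then show "c *\<^sub>R u \<in> {u. neg k t u}" using u neg_cscaleR[of k t u c] by simp
  assume w: "w \<in> {u. neg k t u}"
  have "u + w = (\<lambda>N h z. u N h z + w N h z)" by (simp add: fun_eq_iff)
  then show "u + w \<in> {u. neg k t u}" using u w neg_add[of k t u w] by simp
qed

lemma filtered_neg: "filtered (\<lambda>k. {u :: ('a::real_normed_vector \<times> real, 'b::real_normed_vector) fam. neg k t u}) {u. neg 5 t u}"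
  by unfold_locales (auto intro: subspace_neg neg_mono)

lemma raises_Rop:
  fixes v :: "'q::finite \<Rightarrow> real^'d::finite" and M :: "real^'q::finite^('n::finite + 'p::finite)"
  shows "filtered.raises (\<lambda>k. {u. neg k t u}) {u. neg 5 t u} (Rop v M)"
  unfolding filtered.raises_def[OF filtered_neg]
proof (intro conjI ballI allI)
  fix u w :: "((real^'d) \<times> real, real^('n + 'p)) fam" and c
  assume u: "u \<in> {u. neg 0 t u}"
  then have ru: "reg u" using neg_reg by blast
  have "dir e (\<lambda>z. c *\<^sub>R u N h z) z = c *\<^sub>R dir e (u N h) z" for e N h z
    by (rule dir_cscaleR[OF reg_differentiable[OF ru]])
  moreover have "Lam v M (\<lambda>y. c *\<^sub>R u N h (y, s)) x = c *\<^sub>R Lam v M (\<lambda>y. u N h (y, s)) x" for N h s x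
    by (rule Lam_cscaleR[OF smooth_slice[OF reg_smooth[OF ru]]])
  moreover have "(c *\<^sub>R u) N h = (\<lambda>z. c *\<^sub>R u N h z)" for N h by (simp add: fun_eq_iff)
  ultimately show "Rop v M (c *\<^sub>R u) = c *\<^sub>R Rop v M u"
    unfolding Rop_def slice_def by (intro ext) (simp add: scaleR_add_right mult.commute[of c])
  assume w: "w \<in> {u. neg 0 t u}"
  then have rw: "reg w" using neg_reg by blast
  have "dir e (\<lambda>z. u N h z + w N h z) z = dir e (u N h) z + dir e (w N h) z" for e N h z
    by (rule dir_add[OF reg_differentiable[OF ru] reg_differentiable[OF rw]])
  moreover have "Lam v M (\<lambda>y. u N h (y, s) + w N h (y, s)) x = Lam v M (\<lambda>y. u N h (y, s)) x + Lam v M (\<lambda>y. w N h (y, s)) x" for N h s x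
    by (rule Lam_add[OF smooth_slice[OF reg_smooth[OF ru]] smooth_slice[OF reg_smooth[OF rw]]])
  moreover have "(u + w) N h = (\<lambda>z. u N h z + w N h z)" for N h by (simp add: fun_eq_iff)
  ultimately show "Rop v M (u + w) = Rop v M u + Rop v M w"
    unfolding Rop_def slice_def by (intro ext) (simp add: scaleR_add_right algebra_simps)
next
  fix k and u :: "((real^'d) \<times> real, real^('n + 'p)) fam" assume "u \<in> {u. neg k t u}"
  then show "Rop v M u \<in> {u. neg (Suc k) t u}" by (simp add: neg_Rop)
next
  fix u :: "((real^'d) \<times> real, real^('n + 'p)) fam" assume "u \<in> {u. neg 5 t u}"
  then have "neg 6 t (Rop v M u)" using neg_Rop[of 5 t u v M] by simp
  from neg_mono[OF this, of 5] show "Rop v M u \<in> {u. neg 5 t u}" by simp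
qed

lemma neg_fun_add: "neg k t u \<Longrightarrow> neg k t w \<Longrightarrow> neg k t (u + w)"
  and neg_fun_diff: "neg k t u \<Longrightarrow> neg k t w \<Longrightarrow> neg k t (u - w)"
  and neg_fun_scaleR: "neg k t u \<Longrightarrow> neg k t (c *\<^sub>R u)"
  using subspace_add[OF subspace_neg, of u k t w] subspace_diff[OF subspace_neg, of u k t w]
    subspace_scale[OF subspace_neg, of u k t c] by auto

context lbm
begin

lemma inv_M_apply: "M *v (matrix_inv M *v y) = y" "matrix_inv M *v (M *v g) = g"
  by (simp_all add: matrix_vector_mul_assoc matrix_inv_inverse[OF inv_M])

lemma dir_velocity:
  fixes g :: "(real^'d) \<times> real \<Rightarrow> 'b::real_normed_vector"
  assumes "smooth g"
  shows "dir (a, 1) g z = dir (0, 1) g z + (\<Sum>\<alpha>\<in>UNIV. a $ \<alpha> *\<^sub>R dir (axis \<alpha> 1, 0) g z)"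
proof -
  have l: "linear (\<lambda>e. dir e g z)" by (rule linear_dir[OF smooth_differentiable[OF assms]])
  have "(a, 1) = (0, 1) + (\<Sum>\<alpha>\<in>UNIV. a $ \<alpha> *\<^sub>R (axis \<alpha> 1, 0 :: real))"
    by (simp add: prod_eq_iff fst_sum snd_sum vec_eq_sum_axis[symmetric])
  then have "dir (a, 1) g z = dir ((0, 1) + (\<Sum>\<alpha>\<in>UNIV. a $ \<alpha> *\<^sub>R (axis \<alpha> 1, 0 :: real))) g z" by (rule arg_cong)
  then show ?thesis by (simp only: linear_add[OF l] linear_sum[OF l] linear_scale[OF l])
qed

lemma diag_apply: "diag c *v x = (\<chi> j. c j * x $ j)"
  by (simp add: vec_eq_iff matrix_vector_mult_def diag_def if_distrib if_distribR cong: if_cong)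

text \<open>Conjugation by \<open>M\<close> diagonalises Lambda, so on the particle distribution R
  is \<open>h\<close> times the derivative of each component along its own space-time direction
  \<open>(v j, 1)\<close>.\<close>

lemma Rop_moments:
  fixes g :: "((real^'d) \<times> real, real^'q) fam"
  assumes g: "reg g"
  shows "Rop v M (\<lambda>N h z. h ^ l *\<^sub>R (M *v g N h z)) =
    (\<lambda>N h z. h ^ Suc l *\<^sub>R (M *v (\<chi> j. dir (v j, 1) (\<lambda>z. g N h z $ j) z)))"
proof (intro ext)
  fix N h z
  have sg: "smooth (g N h)" by (rule reg_smooth[OF g])
  have sM: "smooth (\<lambda>z. h ^ l *\<^sub>R (M *v g N h z))"
    by (intro smooth_cscaleR smooth_bounded_linear[OF bounded_linear_matrix] sg)
  have d: "dir e (\<lambda>z. h ^ l *\<^sub>R (M *v g N h z)) z = h ^ l *\<^sub>R (M *v dir e (g N h) z)" for e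
    using dir_bounded_linear[where T = "\<lambda>x. h ^ l *\<^sub>R (M *v x)" and f = "g N h",
        OF bounded_linear_compose[OF bounded_linear_scaleR_right bounded_linear_matrix] smooth_differentiable[OF sg]] .
  have "fdir (0, 1) (\<lambda>N h z. h ^ l *\<^sub>R (M *v g N h z)) N h z + slice (Lam v M) (\<lambda>N h z. h ^ l *\<^sub>R (M *v g N h z)) N h z
    = h ^ l *\<^sub>R (M *v dir (0, 1) (g N h) z) +
      (\<Sum>\<alpha>\<in>UNIV. (M ** diag (\<lambda>j. v j $ \<alpha>) ** matrix_inv M) *v (h ^ l *\<^sub>R (M *v dir (axis \<alpha> 1, 0) (g N h) z)))"
    unfolding slice_def using Lam_slice[OF sM, of v M "snd z" "fst z"] by (simp add: d)
  also have "\<dots> = h ^ l *\<^sub>R (M *v (dir (0, 1) (g N h) z + (\<Sum>\<alpha>\<in>UNIV. diag (\<lambda>j. v j $ \<alpha>) *v dir (axis \<alpha> 1, 0) (g N h) z)))"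
    by (simp add: matrix_vector_mult_scaleR matrix_vector_mul_assoc[symmetric] inv_M_apply scaleR_add_right
        matrix_vector_right_distrib scaleR_sum_right linear_sum[OF matrix_vector_mul_linear])
  also have "dir (0, 1) (g N h) z + (\<Sum>\<alpha>\<in>UNIV. diag (\<lambda>j. v j $ \<alpha>) *v dir (axis \<alpha> 1, 0) (g N h) z)
      = (\<chi> j. dir (v j, 1) (\<lambda>z. g N h z $ j) z)"
  proof (rule iffD2[OF vec_eq_iff], rule allI)
    fix i
    show "(dir (0, 1) (g N h) z + (\<Sum>\<alpha>\<in>UNIV. diag (\<lambda>j. v j $ \<alpha>) *v dir (axis \<alpha> 1, 0) (g N h) z)) $ i =
      (\<chi> j. dir (v j, 1) (\<lambda>z. g N h z $ j) z) $ i"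
      using dir_velocity[OF sg, of "v i" z]
      by (simp add: diag_apply sum_component dir_nth[OF smooth_differentiable[OF sg]])
  qed
  finally show "Rop v M (\<lambda>N h z. h ^ l *\<^sub>R (M *v g N h z)) N h z =
      h ^ Suc l *\<^sub>R (M *v (\<chi> j. dir (v j, 1) (\<lambda>z. g N h z $ j) z))"
    unfolding Rop_def by simp
qed

lemma Rop_pow_moments:
  fixes f :: "((real^'d) \<times> real, real^'q) fam"
  assumes f: "reg f"
  shows "(Rop v M ^^ l) (\<lambda>N h z. M *v f N h z) =
    (\<lambda>N h z. h ^ l *\<^sub>R (M *v (\<chi> j. (dir (v j, 1) ^^ l) (\<lambda>z. f N h z $ j) z)))"
proof (induction l)
  case (Suc l)
  have "reg (\<lambda>N h z. \<chi> j. (dir (v j, 1) ^^ l) (\<lambda>z. f N h z $ j) z)"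
    by (rule reg_vecI) (simp add: reg_dir_pow[OF reg_bounded_linear[OF bounded_linear_nth f]])
  from Rop_moments[OF this, of l] show ?case by (simp add: Suc)
qed simp

text \<open>By \<open>Rop_moments\<close>, exp(R) m is \<open>M\<close> applied to the Taylor
  polynomials of the components f_j at distance \<open>h\<close> along \<open>(v j, 1)\<close>, so
  it encodes advection up to O(h^5).\<close>

lemma residual_iff:
  fixes f :: "((real^'d) \<times> real, real^'q) fam"
  assumes f: "reg f"
  shows "neg 5 t (\<lambda>N h. residual v M \<Phi> S (f N) h) \<longleftrightarrow>
    neg 5 t (exp4 (Rop v M) (\<lambda>N h z. M *v f N h z) - (\<lambda>N h z. M *v relax M \<Phi> S (f N h z)))"
proof -
  let ?m = "\<lambda>N h z. M *v f N h z"
  have m: "reg ?m" by (rule reg_bounded_linear[OF bounded_linear_matrix f])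
  define fs where "fs = (\<lambda>N h z. relax M \<Phi> S (f N h z))"
  have fs_eq: "fs N h z = matrix_inv M *v join (cpart (M *v f N h z)) (npart (M *v f N h z) + S *v (\<Phi> (cpart (M *v f N h z)) - npart (M *v f N h z)))" for N h z
    by (simp add: fs_def relax_def Let_def)
  have r\<Phi>: "reg (\<lambda>N h z. \<Phi> (cpart (M *v f N h z)))"
    using diffop_reg[OF diffop_\<Phi>W reg_bounded_linear[OF bounded_linear_cpart m]] by simp
  have fs: "reg fs"
    unfolding fs_eq[abs_def]
    by (intro reg_bounded_linear[OF bounded_linear_matrix] reg_join reg_add reg_diff r\<Phi>
        reg_bounded_linear[OF bounded_linear_cpart] reg_bounded_linear[OF bounded_linear_npart] f)
  \<comment> \<open>Component j of the residual is moved by \<open>h *\<^sub>R v j\<close>, so that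
    the relaxed distribution is evaluated at the base point. The shift is spatial and invertible,
    hence negligibility passes in both directions.\<close>
  define \<rho> where "\<rho> = (\<lambda>N h z. (\<chi> j. f N h (z + h *\<^sub>R (v j, 1)) $ j - fs N h z $ j) :: real^'q)"
  have shift1: "residual v M \<Phi> S (f N) h (z + h *\<^sub>R (v j, 0)) $ j = \<rho> N h z $ j" for N h z j
    by (cases z) (simp add: residual_def \<rho>_def fs_def)
  have shift2: "\<rho> N h (z + h *\<^sub>R (- v j, 0)) $ j = residual v M \<Phi> S (f N) h z $ j" for N h z j
    by (cases z) (simp add: residual_def \<rho>_def fs_def)
  have 1: "neg 5 t (\<lambda>N h. residual v M \<Phi> S (f N) h) \<longleftrightarrow> neg 5 t \<rho>"
  proof
    assume n: "neg 5 t (\<lambda>N h. residual v M \<Phi> S (f N) h)"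
    show "neg 5 t \<rho>"
    proof (rule neg_vecI)
      fix j
      show "neg 5 t (\<lambda>N h z. \<rho> N h z $ j)"
        using neg_nth[OF neg_shift[OF n, of "v j"], of j] unfolding shift1 .
    qed
  next
    assume n: "neg 5 t \<rho>"
    show "neg 5 t (\<lambda>N h. residual v M \<Phi> S (f N) h)"
    proof (rule neg_vecI)
      fix j
      show "neg 5 t (\<lambda>N h z. residual v M \<Phi> S (f N) h z $ j)"
        using neg_nth[OF neg_shift[OF n, of "- v j"], of j] unfolding shift2 .
    qed
  qed
  \<comment> \<open>The advected value is replaced by its Taylor polynomial of degree 4 along the
    trajectory.\<close>
  define \<sigma> where "\<sigma> = (\<lambda>N h z. (\<chi> j. (\<Sum>l<5. (h ^ l / fact l) *\<^sub>R (dir (v j, 1) ^^ l) (\<lambda>z. f N h z $ j) z) - fs N h z $ j) :: real^'q)"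
  have "neg 5 t (\<lambda>N h z. \<rho> N h z - \<sigma> N h z)"
  proof (rule neg_vecI)
    fix j
    show "neg 5 t (\<lambda>N h z. (\<rho> N h z - \<sigma> N h z) $ j)"
      using neg_taylor[where u = "\<lambda>N h z. f N h z $ j" and k = 5 and e = "(v j, 1)" and t = t, OF reg_bounded_linear[OF bounded_linear_nth f]]
      by (simp add: \<rho>_def \<sigma>_def)
  qed
  then have 2: "neg 5 t \<rho> \<longleftrightarrow> neg 5 t \<sigma>"
    using neg_add[of 5 t "\<lambda>N h z. \<rho> N h z - \<sigma> N h z" \<sigma>] neg_diff[of 5 t \<rho> "\<lambda>N h z. \<rho> N h z - \<sigma> N h z"] by auto
  have eq: "exp4 (Rop v M) ?m - (\<lambda>N h z. M *v fs N h z) = (\<lambda>N h z. M *v \<sigma> N h z)"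
  proof (intro ext)
    fix N h z
    have "exp4 (Rop v M) ?m N h z = (\<Sum>l\<le>4. (1 / fact l) *\<^sub>R (h ^ l *\<^sub>R (M *v (\<chi> j. (dir (v j, 1) ^^ l) (\<lambda>z. f N h z $ j) z))))"
      unfolding exp4_def Rop_pow_moments[OF f] by (simp add: sum_fun_apply)
    also have "\<dots> = M *v (\<Sum>l<5. (h ^ l / fact l) *\<^sub>R (\<chi> j. (dir (v j, 1) ^^ l) (\<lambda>z. f N h z $ j) z))"
      by (simp add: linear_sum[OF matrix_vector_mul_linear] matrix_vector_mult_scaleR matrix_vector_right_distrib lessThan_Suc_atMost[symmetric] eval_nat_numeral)
    also have "(\<Sum>l<5. (h ^ l / fact l) *\<^sub>R (\<chi> j. (dir (v j, 1) ^^ l) (\<lambda>z. f N h z $ j) z)) = \<sigma> N h z + fs N h z"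
      by (simp add: vec_eq_iff \<sigma>_def sum_component)
    finally show "(exp4 (Rop v M) ?m - (\<lambda>N h z. M *v fs N h z)) N h z = M *v \<sigma> N h z"
      by (simp add: matrix_vector_right_distrib)
  qed
  have 3: "neg 5 t \<sigma> \<longleftrightarrow> neg 5 t (\<lambda>N h z. M *v \<sigma> N h z)"
    using neg_linear[OF bounded_linear_matrix, of 5 t \<sigma> M] neg_linear[OF bounded_linear_matrix, of 5 t "\<lambda>N h z. M *v \<sigma> N h z" "matrix_inv M"]
    by (auto simp: inv_M_apply)
  show ?thesis unfolding 1 2 3 eq[symmetric] fs_def ..
qed

end

section \<open>Inserting a solution of the recursion into the scheme: the remainders and their
  orders\<close>

locale lbm_sol = lbm v M \<Phi> S
  for v :: "'q::finite \<Rightarrow> real^'d::finite"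
    and M :: "real^'q^('n::finite + 'p::finite)"
    and \<Phi> :: "real^'n \<Rightarrow> real^'p"
    and S :: "real^'p^'p" +
  fixes \<Gamma> :: "nat \<Rightarrow> (real^'d \<Rightarrow> real^'n) \<Rightarrow> real^'d \<Rightarrow> real^'n"
    and \<psi> :: "nat \<Rightarrow> (real^'d \<Rightarrow> real^'n) \<Rightarrow> real^'d \<Rightarrow> real^'p"
  \<comment> \<open>The coefficient \<psi>_4 is carried along although Y is expanded to order 3
    only: with it the nonconserved block of the scheme also holds up to O(h^5). Beyond index 4 the
    coefficients vanish, so all series below are finite sums.\<close>
  assumes d\<Gamma>: "diffop (\<Gamma> k)" and d\<psi>: "diffop (\<psi> k)" and \<psi>_outside: "k = 0 \<or> 4 < k \<Longrightarrow> \<psi> k = (\<lambda>W x. 0)"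
    and rec\<Gamma>: "N \<in> {1..4} \<Longrightarrow> smooth W \<Longrightarrow> \<Gamma> N W x = recC \<Gamma> \<psi> N W x"
    and rec\<psi>: "N \<in> {1..4} \<Longrightarrow> smooth W \<Longrightarrow> \<psi> N W x = recN \<Gamma> \<psi> N W x"
begin

lemma Z_vanishes: "N \<le> 4 \<Longrightarrow> smooth W \<Longrightarrow> Z \<Gamma> \<psi> N W x = 0"
proof (cases "N = 0")
  case True
  then show ?thesis using Z_0[where \<psi> = \<psi>] \<psi>_outside by simp
next
  case False
  assume "N \<le> 4" and W: "smooth W"
  then have N: "N \<in> {1..4}" using False by simp
  show ?thesis using Z_join[where \<Gamma> = \<Gamma> and \<psi> = \<psi>, OF d\<psi> \<psi>_outside W d\<Gamma> N] rec\<Gamma>[OF N W, of x] rec\<psi>[OF N W, of x] by simp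
qed

lemma d_gser: "diffop (gser \<Phi> \<Sigma> \<psi> N)"
  by (rule diffop_gser[OF smooth_\<Phi> d\<psi>])

lemma d_user: "diffop (user \<psi> N)"
  by (rule diffop_user[OF d\<psi>])

lemma d_Z: "diffop (Z \<Gamma> \<psi> N)"
  unfolding Zser_def[abs_def] by (intro diffop_add diffop_cscaleR diffop_Rser d_gser d_user d\<Gamma>)

lemma Tser_outside:
  assumes "\<And>i. K < i \<Longrightarrow> a i = (\<lambda>W x. 0)" "K + 4 < N"
  shows "Tser \<Gamma> a N W x = 0"
  unfolding Tser_def by (rule sum.neutral) (use assms in \<open>auto simp: dd_zero\<close>)

lemma Lam_zero [simp]: "Lam v M (\<lambda>x. 0) x = 0"
  using Lam_sum[of "{}" _ v M x] by simp

lemma Rser_outside: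
  assumes "\<And>i. K < i \<Longrightarrow> a i = (\<lambda>W x. 0)" "K + 4 < N"
  shows "Rser v M \<Gamma> a N = (\<lambda>W x. 0)"
proof (intro ext)
  fix W x
  have "a (N - 1) = (\<lambda>W x. 0)" using assms by simp
  then show "Rser v M \<Gamma> a N W x = 0"
    unfolding Rser_def shift_def using Tser_outside[where a = a, OF assms] by simp
qed

lemma gser_outside: "4 < N \<Longrightarrow> gser \<Phi> \<Sigma> \<psi> N = (\<lambda>W x. 0)"
  by (simp add: gser_def fun_eq_iff \<psi>_outside)

lemma user_outside: "4 < N \<Longrightarrow> user \<psi> N = (\<lambda>W x. 0)"
  by (simp add: user_def fun_eq_iff \<psi>_outside)

context
  fixes W :: "((real^'d) \<times> real, real^'n) fam"
  assumes W: "reg W"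
begin

text \<open>The remainder of the evolution equation; the goal is that it is O(h^4).\<close>

definition eta :: "((real^'d) \<times> real, real^'n) fam" where
  "eta = (\<lambda>N h z. fdir (0, 1) W N h z + (\<Sum>k\<in>{1..4}. h ^ (k - 1) *\<^sub>R slice (\<Gamma> k) W N h z))"

text \<open>The bound 12 loses nothing: the series have indices up to 4, and each of at most two
  applications of \<open>Rser\<close> adds up to 4.\<close>

definition ev :: "(nat \<Rightarrow> (real^'d \<Rightarrow> real^'n) \<Rightarrow> real^'d \<Rightarrow> real^'m::finite) \<Rightarrow> ((real^'d) \<times> real, real^'m) fam" where
  "ev a = (\<lambda>N h z. \<Sum>i\<le>12. h ^ i *\<^sub>R slice (a i) W N h z)"

text \<open>The error made by replacing the time derivative of W by minus the sum of the h^(k-1)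
  \<Gamma>_k: the linearisation of the series in the direction \<open>eta\<close>.\<close>

definition Elin :: "(nat \<Rightarrow> (real^'d \<Rightarrow> real^'n) \<Rightarrow> real^'d \<Rightarrow> real^'m::finite) \<Rightarrow> ((real^'d) \<times> real, real^'m) fam" where
  "Elin a = (\<lambda>N h z. \<Sum>i\<le>12. h ^ i *\<^sub>R dd (a i) (\<lambda>_ y. eta N h (y, snd z)) (\<lambda>y. W N h (y, snd z)) (fst z))"

lemma reg_eta: "reg eta"
  unfolding eta_def by (intro reg_add reg_fdir W reg_sum reg_scaleR reg_h reg_slice d\<Gamma>)

lemma reg_ev: "(\<And>i. diffop (a i)) \<Longrightarrow> reg (ev a)"
  unfolding ev_def by (intro reg_sum reg_scaleR reg_h reg_slice W)

lemma smooth_Ws: "smooth (\<lambda>y. W N h (y, s))"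
  by (rule smooth_slice[OF reg_smooth[OF W]])

lemma neg_dd_eta: "diffop F \<Longrightarrow> neg k t eta \<Longrightarrow> neg k t (\<lambda>N h z. dd F (\<lambda>_ y. eta N h (y, snd z)) (\<lambda>y. W N h (y, snd z)) (fst z))"
  by (rule diffop_dd_neg[OF _ W])

lemma neg_Elin: "(\<And>i. diffop (a i)) \<Longrightarrow> neg k t eta \<Longrightarrow> neg k t (Elin a)"
  unfolding Elin_def by (intro neg_sum neg_scaleR reg_h neg_dd_eta)

lemma neg_Elin_diff:
  assumes "\<And>i. diffop (a i)" "neg k t eta"
  shows "neg (Suc k) t (\<lambda>N h z. Elin a N h z - dd (a 0) (\<lambda>_ y. eta N h (y, snd z)) (\<lambda>y. W N h (y, snd z)) (fst z))"
proof -
  have "neg (Suc k) t (\<lambda>N h z. \<Sum>i<12. h ^ Suc i *\<^sub>R dd (a (Suc i)) (\<lambda>_ y. eta N h (y, snd z)) (\<lambda>y. W N h (y, snd z)) (fst z))"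
  proof (rule neg_sum)
    fix i
    have "neg (Suc i + k) t (\<lambda>N h z. h ^ Suc i *\<^sub>R dd (a (Suc i)) (\<lambda>_ y. eta N h (y, snd z)) (\<lambda>y. W N h (y, snd z)) (fst z))"
      by (rule neg_hpow[OF neg_dd_eta[OF assms]])
    then show "neg (Suc k) t (\<lambda>N h z. h ^ Suc i *\<^sub>R dd (a (Suc i)) (\<lambda>_ y. eta N h (y, snd z)) (\<lambda>y. W N h (y, snd z)) (fst z))"
      by (rule neg_mono) simp
  qed
  moreover have "Elin a N h z - dd (a 0) (\<lambda>_ y. eta N h (y, snd z)) (\<lambda>y. W N h (y, snd z)) (fst z) =
      (\<Sum>i<12. h ^ Suc i *\<^sub>R dd (a (Suc i)) (\<lambda>_ y. eta N h (y, snd z)) (\<lambda>y. W N h (y, snd z)) (fst z))" for N h z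
  proof -
    have "{..12::nat} = {..<Suc 12}" by auto
    then show ?thesis unfolding Elin_def by (simp only: sum.lessThan_Suc_shift) simp
  qed
  ultimately show ?thesis by simp
qed

lemma sum_Tser_regroup:
  assumes "\<And>i. 8 < i \<Longrightarrow> a i = (\<lambda>W x. 0)"
  shows "(\<Sum>N\<le>12. h ^ N *\<^sub>R Tser \<Gamma> a N V x) = (\<Sum>i\<le>12. \<Sum>k\<in>{1..4}. h ^ (i + k) *\<^sub>R dd (a i) (\<Gamma> k) V x)"
proof -
  let ?f = "\<lambda>(i, k). h ^ (i + k) *\<^sub>R dd (a i) (\<Gamma> k) V x"
  have "(\<Sum>N\<le>12. h ^ N *\<^sub>R Tser \<Gamma> a N V x) = (\<Sum>(N, k)\<in>(SIGMA N:{..12}. {1..min 4 N}). h ^ N *\<^sub>R dd (a (N - k)) (\<Gamma> k) V x)"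
    unfolding Tser_def scaleR_sum_right by (subst sum.Sigma) simp_all
  also have "\<dots> = sum ?f {(i, k). i + k \<le> 12 \<and> k \<in> {1..4}}"
    by (rule sum.reindex_bij_witness[where i = "\<lambda>(i, k). (i + k, k)" and j = "\<lambda>(N, k). (N - k, k)"]) auto
  also have "\<dots> = sum ?f ({..12} \<times> {1..4})"
  proof (rule sum.mono_neutral_left)
    show "\<forall>p\<in>{..12} \<times> {1..4} - {(i, k). i + k \<le> 12 \<and> k \<in> {1..4}}. ?f p = 0"
    proof
      fix p assume "p \<in> {..12} \<times> {1..4} - {(i, k). i + k \<le> 12 \<and> k \<in> {1..4::nat}}"
      then obtain i k where p: "p = (i, k)" "8 < i" by (cases p) auto
      then show "?f p = 0" by (simp add: assms dd_zero)
    qed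
  qed auto
  finally show ?thesis by (simp add: sum.cartesian_product)
qed

text \<open>The true time derivative of a_i(W) is d(a_i) in the direction \<open>eta\<close> minus
  the \<Gamma>_k terms, by the chain rule; the latter are exactly the ones built into
  \<open>Rser\<close>.\<close>

lemma Rop_ev:
  assumes a: "\<And>i. diffop (a i)" and out: "\<And>i. 8 < i \<Longrightarrow> a i = (\<lambda>W x. 0)"
  shows "Rop v M (ev a) = ev (Rser v M \<Gamma> a) + (\<lambda>N h z. h *\<^sub>R Elin a N h z)"
proof (intro ext)
  fix N h and z :: "(real^'d) \<times> real"
  obtain x s where z: "z = (x, s)" by (cases z)
  define V where "V = (\<lambda>y. W N h (y, s))"
  have V: "smooth V" unfolding V_def by (rule smooth_Ws)
  have sl: "smooth (slice (a i) W N h)" for i by (rule reg_smooth[OF reg_slice[OF a W]])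
  have se: "smooth (\<lambda>y. eta N h (y, s))" by (rule smooth_slice[OF reg_smooth[OF reg_eta]])
  have dt: "dir (0, 1) (slice (a i) W N h) z = dd (a i) (\<lambda>_ y. eta N h (y, s)) V x - (\<Sum>k\<in>{1..4}. h ^ (k - 1) *\<^sub>R dd (a i) (\<Gamma> k) V x)" for i
  proof -
    \<comment> \<open>Index 0 stands for \<open>eta\<close>, the indices 1 to 4 for the \<Gamma>_k,
      so that the time derivative of W is one finite linear combination of directions.\<close>
    define c where "c = (\<lambda>k. if k = 0 then 1 else - (h ^ (k - 1)))"
    define H where "H = (\<lambda>k. if k = 0 then (\<lambda>y. eta N h (y, s)) else \<Gamma> k V)"
    have sH: "smooth (H k)" for k unfolding H_def using se diffop_smooth[OF d\<Gamma> V] by simp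
    have split: "(\<Sum>k\<in>{0..4}. f k) = f 0 + (\<Sum>k\<in>{1..4}. f k)" for f :: "nat \<Rightarrow> 'x::comm_monoid_add"
      by (simp add: sum.atLeast_Suc_atMost)
    have "(\<lambda>y. dir (0, 1) (W N h) (y, s)) = (\<lambda>y. \<Sum>k\<in>{0..4}. c k *\<^sub>R H k y)"
      unfolding split by (simp add: c_def H_def eta_def slice_def V_def fun_eq_iff sum_negf)
    moreover have "dir (0, 1) (slice (a i) W N h) z = dd (a i) (\<lambda>_ y. dir (0, 1) (W N h) (y, s)) V x"
      unfolding z slice_def[abs_def] V_def by (rule diffop_dt[OF a reg_smooth[OF W]])
    ultimately have "dir (0, 1) (slice (a i) W N h) z = dd (a i) (\<lambda>_ y. \<Sum>k\<in>{0..4}. c k *\<^sub>R H k y) V x" by simp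
    also have "\<dots> = (\<Sum>k\<in>{0..4}. c k *\<^sub>R dd (a i) (\<lambda>_. H k) V x)"
      by (rule dd_direction_lincomb[OF a V sH]) simp
    also have "\<dots> = dd (a i) (\<lambda>_ y. eta N h (y, s)) V x - (\<Sum>k\<in>{1..4}. h ^ (k - 1) *\<^sub>R dd (a i) (\<lambda>_. \<Gamma> k V) V x)"
      unfolding split by (simp add: c_def H_def sum_negf)
    also have "(\<lambda>k. dd (a i) (\<lambda>_. \<Gamma> k V) V x) = (\<lambda>k. dd (a i) (\<Gamma> k) V x)" by (simp add: dd_def)
    finally show ?thesis by (simp add: fun_eq_iff)
  qed
  have "fdir (0, 1) (ev a) N h z = (\<Sum>i\<le>12. h ^ i *\<^sub>R dir (0, 1) (slice (a i) W N h) z)"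
    unfolding ev_def by (simp add: dir_sum smooth_cscaleR sl dir_cscaleR smooth_differentiable)
  moreover have "slice (Lam v M) (ev a) N h z = (\<Sum>i\<le>12. h ^ i *\<^sub>R Lam v M (a i V) x)"
  proof -
    have "slice (Lam v M) (ev a) N h z = Lam v M (\<lambda>y. \<Sum>i\<le>12. h ^ i *\<^sub>R a i V y) x"
      by (simp add: slice_def ev_def z V_def)
    also have "\<dots> = (\<Sum>i\<le>12. Lam v M (\<lambda>y. h ^ i *\<^sub>R a i V y) x)"
      by (rule Lam_sum) (simp_all add: smooth_cscaleR diffop_smooth[OF a V])
    finally show ?thesis by (simp add: Lam_cscaleR diffop_smooth[OF a V])
  qed
  ultimately have L: "Rop v M (ev a) N h z = h *\<^sub>R Elin a N h z
      - (\<Sum>i\<le>12. \<Sum>k\<in>{1..4}. h ^ (i + k) *\<^sub>R dd (a i) (\<Gamma> k) V x) + (\<Sum>i\<le>12. h ^ Suc i *\<^sub>R Lam v M (a i V) x)"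
  proof -
    assume 1: "fdir (0, 1) (ev a) N h z = (\<Sum>i\<le>12. h ^ i *\<^sub>R dir (0, 1) (slice (a i) W N h) z)"
      and 2: "slice (Lam v M) (ev a) N h z = (\<Sum>i\<le>12. h ^ i *\<^sub>R Lam v M (a i V) x)"
    have hk: "h * (h ^ i * h ^ (k - 1)) = h ^ (i + k)" if "k \<in> {1..4}" for i k
      using that by (cases k) (simp_all add: power_add mult_ac)
    have "(\<Sum>i\<le>12. \<Sum>k\<in>{1..4}. h ^ (i + k) *\<^sub>R dd (a i) (\<Gamma> k) V x)
        = h *\<^sub>R (\<Sum>i\<le>12. h ^ i *\<^sub>R (\<Sum>k\<in>{1..4}. h ^ (k - 1) *\<^sub>R dd (a i) (\<Gamma> k) V x))"
      unfolding scaleR_sum_right scaleR_scaleR by (intro sum.cong refl) (simp only: hk mult.assoc)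
    then show ?thesis
      unfolding Rop_def 1 2 dt Elin_def
      by (simp add: scaleR_add_right scaleR_diff_right sum_subtractf scaleR_sum_right z V_def)
  qed
  have sh: "(\<Sum>N\<le>12. h ^ N *\<^sub>R shift (Lam v M) a N V x) = (\<Sum>i\<le>12. h ^ Suc i *\<^sub>R Lam v M (a i V) x)"
  proof -
    have "{..12::nat} = {..Suc 11}" by auto
    then have "(\<Sum>N\<le>12. h ^ N *\<^sub>R shift (Lam v M) a N V x) = (\<Sum>i\<le>11. h ^ Suc i *\<^sub>R Lam v M (a i V) x)"
      by (simp only: sum.atMost_Suc_shift) (simp add: shift_def)
    also have "\<dots> = (\<Sum>i\<le>Suc 11. h ^ Suc i *\<^sub>R Lam v M (a i V) x)"
      unfolding sum.atMost_Suc using out[of "Suc 11"] by simp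
    finally show ?thesis by simp
  qed
  have "ev (Rser v M \<Gamma> a) N h z = (\<Sum>i\<le>12. h ^ Suc i *\<^sub>R Lam v M (a i V) x) - (\<Sum>i\<le>12. \<Sum>k\<in>{1..4}. h ^ (i + k) *\<^sub>R dd (a i) (\<Gamma> k) V x)"
    unfolding sh[symmetric] using sum_Tser_regroup[where a = a and h = h and V = V and x = x, OF out]
    by (simp add: ev_def slice_def z V_def Rser_def scaleR_diff_right sum_subtractf)
  then show "Rop v M (ev a) N h z = (ev (Rser v M \<Gamma> a) + (\<lambda>N h z. h *\<^sub>R Elin a N h z)) N h z"
    unfolding L by simp
qed

context
  fixes P :: "((real^'d) \<times> real, real^'p) fam"
  assumes P: "reg P"
begin

definition delta :: "((real^'d) \<times> real, real^'p) fam" where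
  "delta = (\<lambda>N h z. P N h z - (\<Sum>k\<in>{1..4}. h ^ k *\<^sub>R slice (\<psi> k) W N h z))"

definition gfam :: "((real^'d) \<times> real, real^('n + 'p)) fam" where
  "gfam = (\<lambda>N h z. join (W N h z) (\<Phi> (W N h z) + \<Sigma> *v P N h z))"

definition ufam :: "((real^'d) \<times> real, real^('n + 'p)) fam" where
  "ufam = (\<lambda>N h z. join 0 (P N h z))"

text \<open>The left side of the tanh form of the scheme for actual functions, with P = S (Y -
  \<Phi>(W)) in the application; m' - m corresponds to \<open>- ufam\<close>.\<close>

definition Zfam :: "((real^'d) \<times> real, real^('n + 'p)) fam" where
  "Zfam = Rop v M gfam + ufam + (1/12) *\<^sub>R Rop v M (Rop v M ufam)"

lemma reg_delta: "reg delta"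
  unfolding delta_def by (intro reg_diff reg_sum P reg_scaleR reg_h reg_slice d\<psi> W)

lemma P_eq: "P N h z = (\<Sum>k\<in>{1..4}. h ^ k *\<^sub>R slice (\<psi> k) W N h z) + delta N h z"
  by (simp add: delta_def)

lemma ev_split:
  assumes "\<And>i. 4 < i \<Longrightarrow> a i = (\<lambda>W x. 0)"
  shows "ev a N h z = slice (a 0) W N h z + (\<Sum>k\<in>{1..4}. h ^ k *\<^sub>R slice (a k) W N h z)"
proof -
  have "ev a N h z = (\<Sum>i\<in>{0..4}. h ^ i *\<^sub>R slice (a i) W N h z)"
    unfolding ev_def by (rule sum.mono_neutral_right) (auto simp: assms slice_def)
  then show ?thesis by (simp add: sum.atLeast_Suc_atMost)
qed

lemma gfam_eq: "gfam = ev (gser \<Phi> \<Sigma> \<psi>) + (\<lambda>N h z. join 0 (\<Sigma> *v delta N h z))"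
proof (intro ext)
  fix N h z
  have j: "join w (y + y') = join w y + join 0 y'" for w :: "real^'n" and y y' :: "real^'p"
    using join_add[of w 0 y y'] by simp
  have s0: "slice (gser \<Phi> \<Sigma> \<psi> 0) W N h z = join (W N h z) (\<Phi> (W N h z))"
    by (simp add: slice_def gser_def \<psi>_outside)
  have "(\<Sum>k\<in>{1..4}. h ^ k *\<^sub>R slice (gser \<Phi> \<Sigma> \<psi> k) W N h z) = (\<Sum>k\<in>{1..4}. join 0 (\<Sigma> *v (h ^ k *\<^sub>R slice (\<psi> k) W N h z)))"
    by (intro sum.cong refl) (simp add: slice_def gser_def join2_lin[symmetric] matrix_vector_mult_scaleR)
  also have "\<dots> = join 0 (\<Sigma> *v (\<Sum>k\<in>{1..4}. h ^ k *\<^sub>R slice (\<psi> k) W N h z))"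
    by (simp only: linear_sum[OF matrix_vector_mul_linear] linear_sum[OF bounded_linear.linear[OF bounded_linear_join2]])
  finally show "gfam N h z = (ev (gser \<Phi> \<Sigma> \<psi>) + (\<lambda>N h z. join 0 (\<Sigma> *v delta N h z))) N h z"
    unfolding gfam_def P_eq[of N h z]
    by (simp add: ev_split[OF gser_outside] s0 matrix_vector_right_distrib j add.assoc[symmetric])
qed

lemma ufam_eq: "ufam = ev (user \<psi>) + (\<lambda>N h z. join 0 (delta N h z))"
proof (intro ext)
  fix N h z
  have s0: "slice (user \<psi> 0) W N h z = 0"
    by (simp add: slice_def user_def \<psi>_outside)
  have "(\<Sum>k\<in>{1..4}. h ^ k *\<^sub>R slice (user \<psi> k) W N h z) = (\<Sum>k\<in>{1..4}. join 0 (h ^ k *\<^sub>R slice (\<psi> k) W N h z))"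
    by (intro sum.cong refl) (simp add: slice_def user_def join2_lin[symmetric])
  also have "\<dots> = join 0 (\<Sum>k\<in>{1..4}. h ^ k *\<^sub>R slice (\<psi> k) W N h z)"
    by (simp only: linear_sum[OF bounded_linear.linear[OF bounded_linear_join2]])
  finally show "ufam N h z = (ev (user \<psi>) + (\<lambda>N h z. join 0 (delta N h z))) N h z"
    unfolding ufam_def P_eq[of N h z]
    by (simp add: ev_split[OF user_outside] s0 join2_lin)
qed

definition rest :: "((real^'d) \<times> real, real^('n + 'p)) fam" where
  "rest = Rop v M (\<lambda>N h z. join 0 (\<Sigma> *v delta N h z)) + (1/12) *\<^sub>R ((\<lambda>N h z. h *\<^sub>R Elin (Rser v M \<Gamma> (user \<psi>)) N h z)
     + Rop v M (\<lambda>N h z. h *\<^sub>R Elin (user \<psi>) N h z) + Rop v M (Rop v M (\<lambda>N h z. join 0 (delta N h z))))"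

text \<open>The formal series \<open>Z\<close>, which vanishes up to order 4, is separated from the
  terms linear in \<open>eta\<close> and \<open>delta\<close>. Those listed explicitly are the
  leading ones; \<open>rest\<close> collects the higher ones.\<close>

lemma Zfam_eq:
  "Zfam = ev (Z \<Gamma> \<psi>) + (\<lambda>N h z. join 0 (delta N h z)) + (\<lambda>N h z. h *\<^sub>R Elin (gser \<Phi> \<Sigma> \<psi>) N h z) + rest"
proof -
  interpret filtered "\<lambda>k. {u :: ((real^'d) \<times> real, real^('n + 'p)) fam. neg k (\<lambda>_. 0) u}" "{u. neg 5 (\<lambda>_. 0) u}"
    by (rule filtered_neg)
  have r: "raises (Rop v M)" by (rule raises_Rop)
  have lin: "Rop v M (a + b) = Rop v M a + Rop v M b" if "reg a" "reg b" for a b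
    using raises_plus[OF r] that neg_0 by blast
  have rR: "reg (Rop v M a)" if "reg a" for a using neg_reg[OF neg_Rop[OF neg_0[OF that]]] .
  have rE: "reg (\<lambda>N h z. h *\<^sub>R Elin a N h z)" if "\<And>i. diffop (a i)" for a :: "nat \<Rightarrow> (real^'d \<Rightarrow> real^'n) \<Rightarrow> real^'d \<Rightarrow> real^'m"
    using neg_reg[OF neg_h[OF neg_Elin[OF that neg_0[OF reg_eta]]]] .
  have d1: "reg (\<lambda>N h z. join 0 (\<Sigma> *v delta N h z) :: real^('n + 'p))" and d2: "reg (\<lambda>N h z. join 0 (delta N h z) :: real^('n + 'p))"
    by (intro reg_join reg_const reg_bounded_linear[OF bounded_linear_matrix] reg_delta)+
  have dR: "diffop (Rser v M \<Gamma> (user \<psi>) i)" for i by (rule diffop_Rser[OF d_user d\<Gamma>])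
  have g: "Rop v M gfam = ev (Rser v M \<Gamma> (gser \<Phi> \<Sigma> \<psi>)) + (\<lambda>N h z. h *\<^sub>R Elin (gser \<Phi> \<Sigma> \<psi>) N h z) + Rop v M (\<lambda>N h z. join 0 (\<Sigma> *v delta N h z))"
    unfolding gfam_eq lin[OF reg_ev[OF d_gser] d1] by (simp add: Rop_ev[OF d_gser gser_outside])
  have u: "Rop v M ufam = ev (Rser v M \<Gamma> (user \<psi>)) + ((\<lambda>N h z. h *\<^sub>R Elin (user \<psi>) N h z) + Rop v M (\<lambda>N h z. join 0 (delta N h z)))"
    unfolding ufam_eq lin[OF reg_ev[OF d_user] d2] by (simp add: Rop_ev[OF d_user user_outside] add.assoc)
  have "reg ((\<lambda>N h z. h *\<^sub>R Elin (user \<psi>) N h z) + Rop v M (\<lambda>N h z. join 0 (delta N h z)))"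
    using neg_reg[OF neg_fun_add[OF neg_0[OF rE[OF d_user]] neg_0[OF rR[OF d2]]]] .
  then have uu: "Rop v M (Rop v M ufam) = ev (Rser v M \<Gamma> (Rser v M \<Gamma> (user \<psi>))) + ((\<lambda>N h z. h *\<^sub>R Elin (Rser v M \<Gamma> (user \<psi>)) N h z)
      + Rop v M (\<lambda>N h z. h *\<^sub>R Elin (user \<psi>) N h z) + Rop v M (Rop v M (\<lambda>N h z. join 0 (delta N h z))))"
    unfolding u by (simp add: lin reg_ev[OF dR] rE[OF d_user] rR[OF d2] Rop_ev[OF dR Rser_outside[OF user_outside]] add.assoc)
  have evZ: "ev (Z \<Gamma> \<psi>) = ev (Rser v M \<Gamma> (gser \<Phi> \<Sigma> \<psi>)) + ev (user \<psi>) + (1/12) *\<^sub>R ev (Rser v M \<Gamma> (Rser v M \<Gamma> (user \<psi>)))"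
    unfolding ev_def Zser_def[abs_def] slice_def
    by (intro ext) (simp add: sum.distrib scaleR_add_right scaleR_sum_right mult.commute)
  show ?thesis
    unfolding Zfam_def g uu unfolding evZ rest_def ufam_eq by (simp add: scaleR_add_right add_ac)
qed

lemma neg_ev_Z: "neg 5 t (ev (Z \<Gamma> \<psi>))"
proof -
  have "ev (Z \<Gamma> \<psi>) = (\<lambda>N h z. \<Sum>i\<in>{5..12}. h ^ i *\<^sub>R slice (Z \<Gamma> \<psi> i) W N h z)"
    unfolding ev_def
  proof (intro ext sum.mono_neutral_right)
    fix N h and z :: "(real^'d) \<times> real"
    show "\<forall>i\<in>{..12} - {5..12}. h ^ i *\<^sub>R slice (Z \<Gamma> \<psi> i) W N h z = 0"
      using Z_vanishes[OF _ smooth_Ws] by (auto simp: slice_def)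
  qed auto
  moreover have "neg 5 t (\<lambda>N h z. \<Sum>i\<in>{5..12}. h ^ i *\<^sub>R slice (Z \<Gamma> \<psi> i) W N h z)"
    by (rule neg_sum) (rule neg_hpow_reg[OF reg_slice[OF d_Z W]], simp)
  ultimately show ?thesis by simp
qed

lemma neg_delta_join:
  assumes "neg k t delta"
  shows "neg k t (\<lambda>N h z. join 0 (\<Sigma> *v delta N h z) :: real^('n + 'p))" "neg k t (\<lambda>N h z. join 0 (delta N h z) :: real^('n + 'p))"
  by (intro neg_linear[OF bounded_linear_join2] neg_linear[OF bounded_linear_matrix] assms)+

lemma neg_rest_npart:
  assumes "neg j t eta" "neg j t delta" shows "neg (Suc j) t rest"
proof -
  have dR: "diffop (Rser v M \<Gamma> (user \<psi>) i)" for i by (rule diffop_Rser[OF d_user d\<Gamma>])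
  have 1: "neg (Suc j) t (\<lambda>N h z. h *\<^sub>R Elin (user \<psi>) N h z)" by (rule neg_h[OF neg_Elin[OF d_user assms(1)]])
  show ?thesis unfolding rest_def
    by (intro neg_fun_add neg_fun_scaleR neg_Rop neg_delta_join assms neg_h neg_Elin dR
        neg_mono[OF neg_Rop[OF 1]] neg_mono[OF neg_Rop[OF neg_Rop[OF neg_delta_join(2)[OF assms(2)]]]]) auto
qed

text \<open>Compared with \<open>neg_rest_npart\<close> one more power of \<open>h\<close> is
  gained: \<open>delta\<close> is already one order better, and the linearised series
  \<open>Rser v M \<Gamma> (user \<psi>)\<close> has no term of order 0.\<close>

lemma neg_rest_cpart:
  assumes "neg j t eta" "neg (Suc j) t delta" shows "neg (Suc (Suc j)) t rest"
proof -
  have dR: "diffop (Rser v M \<Gamma> (user \<psi>) i)" for i by (rule diffop_Rser[OF d_user d\<Gamma>])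
  have 1: "neg (Suc j) t (\<lambda>N h z. h *\<^sub>R Elin (user \<psi>) N h z)" by (rule neg_h[OF neg_Elin[OF d_user assms(1)]])
  have "Rser v M \<Gamma> (user \<psi>) 0 = (\<lambda>W x. 0)" by (simp add: Rser_def shift_def Tser_def fun_eq_iff)
  then have 2: "neg (Suc j) t (Elin (Rser v M \<Gamma> (user \<psi>)))"
    using neg_Elin_diff[where a = "Rser v M \<Gamma> (user \<psi>)", OF dR assms(1)] by (simp add: dd_zero)
  show ?thesis unfolding rest_def
    by (intro neg_fun_add neg_fun_scaleR neg_Rop neg_delta_join assms neg_h 1 2
        neg_mono[OF neg_Rop[OF neg_Rop[OF neg_delta_join(2)[OF assms(2)]]]]) auto
qed

text \<open>All contributions of \<open>eta\<close> and of \<open>delta\<close>, other than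
  \<open>delta\<close> itself, carry a factor \<open>h\<close>.\<close>

lemma npart_Zfam:
  assumes "neg j t eta" "neg j t delta" "j \<le> 4"
  shows "neg (Suc j) t (\<lambda>N h z. npart (Zfam N h z) - delta N h z)"
proof -
  have "neg (Suc j) t (ev (Z \<Gamma> \<psi>) + (\<lambda>N h z. h *\<^sub>R Elin (gser \<Phi> \<Sigma> \<psi>) N h z) + rest)"
    using assms(3) by (intro neg_fun_add neg_mono[OF neg_ev_Z] neg_h neg_Elin d_gser neg_rest_npart assms) simp
  from neg_linear[OF bounded_linear_npart this]
  show ?thesis unfolding Zfam_eq by (simp add: npart_simps algebra_simps)
qed

text \<open>The leading term is \<open>h\<close> times the linearisation of (W, \<Phi>(W)) in the
  direction \<open>eta\<close>, whose conserved part is \<open>eta\<close> itself;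
  \<open>delta\<close> enters this block only through \<open>rest\<close>.\<close>

lemma cpart_Zfam:
  assumes e: "neg j t eta" and "neg (Suc j) t delta" "j \<le> 3"
  shows "neg (Suc (Suc j)) t (\<lambda>N h z. cpart (Zfam N h z) - h *\<^sub>R eta N h z)"
proof -
  have 1: "cpart (dd (gser \<Phi> \<Sigma> \<psi> 0) (\<lambda>_ y. eta N h (y, snd z)) (\<lambda>y. W N h (y, snd z)) (fst z)) = eta N h z" for N h z
  proof -
    have eq: "gser \<Phi> \<Sigma> \<psi> 0 = (\<lambda>W x. join (W x) (\<Phi> (W x)))" by (simp add: gser_def fun_eq_iff \<psi>_outside)
    have "dd (\<lambda>W x. join (W x) (\<Phi> (W x))) (\<lambda>_ y. eta N h (y, snd z)) (\<lambda>y. W N h (y, snd z)) (fst z)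
      = join (dd (\<lambda>W. W) (\<lambda>_ y. eta N h (y, snd z)) (\<lambda>y. W N h (y, snd z)) (fst z))
         (dd \<Phi>W (\<lambda>_ y. eta N h (y, snd z)) (\<lambda>y. W N h (y, snd z)) (fst z))"
      by (rule dd_join[OF diffop_id diffop_\<Phi>W smooth_Ws smooth_slice[OF reg_smooth[OF reg_eta]]])
    then show ?thesis unfolding eq by (simp add: dd_id)
  qed
  have "neg (Suc j) t (\<lambda>N h z. cpart (Elin (gser \<Phi> \<Sigma> \<psi>) N h z) - eta N h z)"
    using neg_linear[OF bounded_linear_cpart neg_Elin_diff[where a = "gser \<Phi> \<Sigma> \<psi>", OF d_gser e]]
    by (simp add: cpart_simps 1)
  then have 2: "neg (Suc (Suc j)) t (\<lambda>N h z. h *\<^sub>R (cpart (Elin (gser \<Phi> \<Sigma> \<psi>) N h z) - eta N h z))" by (rule neg_h)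
  have "neg (Suc (Suc j)) t (ev (Z \<Gamma> \<psi>) + rest)"
    using assms(3) by (intro neg_fun_add neg_mono[OF neg_ev_Z] neg_rest_cpart assms) simp
  from neg_add[OF neg_linear[OF bounded_linear_cpart this] 2]
  show ?thesis unfolding Zfam_eq by (simp add: cpart_simps algebra_simps)
qed

end

end

end

section \<open>The solution of the recursion is a Taylor expansion of the scheme\<close>

subsection \<open>The Taylor expansion\<close>

lemma unif_O_cong:
  assumes "\<forall>\<^sub>F h in at_right 0. \<forall>z\<in>K. u h z = w h z" "unif_O n K w"
  shows "unif_O n K u"
proof -
  obtain C where C: "\<forall>\<^sub>F h in at_right 0. \<forall>z\<in>K. norm (w h z) \<le> C * h ^ n"
    using assms(2) unfolding unif_O_def by blast
  have "\<forall>\<^sub>F h in at_right 0. \<forall>z\<in>K. norm (u h z) \<le> C * h ^ n"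
    using assms(1) C by eventually_elim simp
  then show ?thesis unfolding unif_O_def by blast
qed

lemma vector_derivative_time:
  assumes "smooth U" shows "vector_derivative (\<lambda>s. U (x, s)) (at t) = dir (0, 1) U (x, t)"
proof (rule vector_derivative_at)
  have "((\<lambda>s. (x, s)) has_derivative (\<lambda>u. (0, u))) (at t)"
    by (intro has_derivative_Pair has_derivative_ident has_derivative_const)
  from has_derivative_compose[OF this has_derivative_smooth[OF assms]]
  have "((\<lambda>s. U (x, s)) has_derivative (\<lambda>u. dir (0, u) U (x, t))) (at t)" .
  moreover have "(\<lambda>u. dir (0, u) U (x, t)) = (\<lambda>u. u *\<^sub>R dir (0, 1) U (x, t))"
  proof
    fix u
    show "dir (0, u) U (x, t) = u *\<^sub>R dir (0, 1) U (x, t)"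
      using linear_scale[OF linear_dir[OF smooth_differentiable[OF assms]], of u "(0, 1)" "(x, t)"] by simp
  qed
  ultimately show "((\<lambda>s. U (x, s)) has_vector_derivative dir (0, 1) U (x, t)) (at t)"
    unfolding has_vector_derivative_def by (rule back_subst)
qed

context lbm
begin

lemma reg_\<Phi>: "reg W \<Longrightarrow> reg (\<lambda>N h (z :: (real^'d) \<times> real). \<Phi> (W N h z))"
  using diffop_reg[OF diffop_\<Phi>W, of W] by simp

lemma reg_residual:
  fixes f :: "((real^'d) \<times> real, real^'q) fam"
  assumes f: "reg f" shows "reg (\<lambda>N h. residual v M \<Phi> S (f N) h)"
proof (rule reg_vecI)
  fix j
  have m: "reg (\<lambda>N h z. M *v f N h z)" by (rule reg_bounded_linear[OF bounded_linear_matrix f])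
  have fs: "reg (\<lambda>N h z. relax M \<Phi> S (f N h z))"
    unfolding relax_def Let_def
    by (intro reg_bounded_linear[OF bounded_linear_matrix] reg_join reg_add reg_diff reg_\<Phi>
        reg_bounded_linear[OF bounded_linear_cpart] reg_bounded_linear[OF bounded_linear_npart] f)
  have eq: "residual v M \<Phi> S (f N) h z $ j = f N h (z + h *\<^sub>R (0, 1)) $ j - relax M \<Phi> S (f N h (z + h *\<^sub>R (- v j, 0))) $ j" for N h z
    by (cases z) (simp add: residual_def)
  show "reg (\<lambda>N h z. residual v M \<Phi> S (f N) h z $ j)"
    unfolding eq
    by (intro reg_diff reg_bounded_linear[OF bounded_linear_nth] reg_shift[OF f] reg_shift[OF fs])
qed

end

context lbm_sol
begin

text \<open>Here m' - m = -(0, P) and the mean of m and m' is \<open>gfam W P\<close>, so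
  \<open>exp4_iff_tanh\<close> converts the scheme into an equation for \<open>Zfam\<close>. The
  converse asks for P of order 1, the condition of the tanh lemma on m' - m.\<close>

lemma residual_Zfam:
  fixes f :: "((real^'d) \<times> real, real^'q) fam"
  assumes f: "reg f"
  defines "W \<equiv> (\<lambda>N h z. cpart (M *v f N h z))"
  defines "P \<equiv> (\<lambda>N h z. S *v (npart (M *v f N h z) - \<Phi> (cpart (M *v f N h z))))"
  shows "neg 5 t (\<lambda>N h. residual v M \<Phi> S (f N) h) \<Longrightarrow> neg 5 t (Zfam W P)"
    and "neg 1 t P \<Longrightarrow> neg 5 t (Zfam W P) \<Longrightarrow> neg 5 t (\<lambda>N h. residual v M \<Phi> S (f N) h)"
    and "reg W" "reg P"
proof -
  define m where "m = (\<lambda>N h z. M *v f N h z)"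
  define m' where "m' = (\<lambda>N h z. M *v relax M \<Phi> S (f N h z))"
  have m: "reg m" unfolding m_def by (rule reg_bounded_linear[OF bounded_linear_matrix f])
  show W: "reg W" unfolding W_def by (rule reg_bounded_linear[OF bounded_linear_cpart m[unfolded m_def]])
  show P: "reg P" unfolding P_def
    by (intro reg_bounded_linear[OF bounded_linear_matrix] reg_diff reg_bounded_linear[OF bounded_linear_npart] reg_\<Phi> W[unfolded W_def] f)
  have Seq: "matrix_inv S *v (S *v y) = y" for y
    by (simp add: matrix_vector_mul_assoc matrix_inv_inverse[OF inv_S])
  have m_eq: "m = (\<lambda>N h z. join (W N h z) (npart (m N h z)))"
    by (simp add: W_def m_def)
  have m'_eq: "m' = m - ufam P"
  proof (intro ext)
    fix N h z
    have "m' N h z = join (W N h z) (npart (m N h z) - P N h z)"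
      by (simp add: m'_def relax_def Let_def inv_M_apply W_def P_def m_def matrix_vector_mult_diff_distrib algebra_simps)
    also have "\<dots> = m N h z - join 0 (P N h z)"
      by (subst (2) m_eq) (simp add: join_diff[symmetric])
    finally show "m' N h z = (m - ufam P) N h z" by (simp add: ufam_def[OF W P])
  qed
  have g_eq: "(1/2) *\<^sub>R (m + m') = gfam W P"
  proof (intro ext)
    fix N h z
    have \<Sigma>P: "\<Sigma> *v P N h z = npart (m N h z) - \<Phi> (W N h z) - (1/2) *\<^sub>R P N h z"
      unfolding Sigma_apply by (simp add: P_def Seq m_def W_def)
    have "(1/2) *\<^sub>R (m N h z + (m N h z - join 0 (P N h z))) = m N h z - (1/2) *\<^sub>R join 0 (P N h z)"
      by (rule eq_by_functionals) (simp add: linear_add linear_diff linear_scale)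
    also have "\<dots> = join (W N h z) (npart (m N h z) - (1/2) *\<^sub>R P N h z)"
      by (subst (1) m_eq) (simp add: join2_lin(2)[symmetric] join_diff[symmetric])
    finally show "((1/2) *\<^sub>R (m + m')) N h z = gfam W P N h z"
      unfolding m'_eq by (simp add: gfam_def[OF W P] \<Sigma>P ufam_def[OF W P])
  qed
  have d_eq: "m' - m = - ufam P" unfolding m'_eq by simp
  interpret filtered "\<lambda>k. {u :: ((real^'d) \<times> real, real^('n + 'p)) fam. neg k t u}" "{u. neg 5 t u}"
    by (rule filtered_neg)
  have r: "raises (Rop v M)" by (rule raises_Rop)
  have u0: "ufam P \<in> {u. neg 0 t u}"
    unfolding ufam_def[OF W P] by (intro CollectI neg_0 reg_join reg_const P)
  have Rneg: "Rop v M (- u) = - Rop v M u" if "u \<in> {u. neg 0 t u}" for u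
    using raises_scale[OF r that, of "-1"] by simp
  have Zeq: "Rop v M ((1/2) *\<^sub>R (m + m')) - (m' - m) - (1/12) *\<^sub>R Rop v M (Rop v M (m' - m)) = Zfam W P"
    unfolding g_eq d_eq Rneg[OF u0] Rneg[OF raises_F0[OF r u0]] Zfam_def[OF W P] by simp
  have m0: "m \<in> {u. neg 0 t u}" by (intro CollectI neg_0 m)
  have m'0: "m' \<in> {u. neg 0 t u}" unfolding m'_eq by (rule subspace_diff[OF subspace_F m0 u0])
  note iff = residual_iff[OF f, of t, folded m_def m'_def]
  note tanh = exp4_iff_tanh[OF r m0 m'0, unfolded Zeq]
  show "neg 5 t (Zfam W P)" if "neg 5 t (\<lambda>N h. residual v M \<Phi> S (f N) h)"
    using tanh(1) that iff by simp
  assume P1: "neg 1 t P" and Z5: "neg 5 t (Zfam W P)"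
  have "neg 1 t (ufam P)" unfolding ufam_def[OF W P] by (rule neg_linear[OF bounded_linear_join2 P1])
  then have "m' - m \<in> {u. neg 1 t u}" unfolding d_eq using neg_fun_scaleR[of 1 t "ufam P" "-1"] by simp
  then show "neg 5 t (\<lambda>N h. residual v M \<Phi> S (f N) h)"
    using tanh(2) Z5 iff by simp
qed

text \<open>A bootstrap: the nonconserved block first improves \<open>delta\<close> by one order,
  and with this the conserved block improves \<open>eta\<close> by one order, after division by
  \<open>h\<close>. The bound O(h^5) on \<open>Zfam\<close> stops the process at order 4.\<close>

lemma eta_delta_neg:
  assumes W: "reg W" and P: "reg P" and Z5: "neg 5 t (Zfam W P)" and j: "j \<le> 4"
  shows "neg j t (eta W) \<and> neg j t (delta W P)"
  using j
proof (induction j)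
  case 0
  show ?case by (intro conjI neg_0 reg_eta[OF W] reg_delta[OF W P])
next
  case (Suc j)
  then have e: "neg j t (eta W)" and d: "neg j t (delta W P)" and j: "j \<le> 3" by auto
  have "neg (Suc j) t (\<lambda>N h z. npart (Zfam W P N h z) - (npart (Zfam W P N h z) - delta W P N h z))"
    using j by (intro neg_diff neg_mono[OF neg_linear[OF bounded_linear_npart Z5]] npart_Zfam[OF W P e d]) auto
  then have d': "neg (Suc j) t (delta W P)" by simp
  have "neg (Suc (Suc j)) t (\<lambda>N h z. cpart (Zfam W P N h z) - (cpart (Zfam W P N h z) - h *\<^sub>R eta W N h z))"
    using j by (intro neg_diff neg_mono[OF neg_linear[OF bounded_linear_cpart Z5]] cpart_Zfam[OF W P e d']) auto
  then have "neg (Suc (Suc j)) t (\<lambda>N h z. h *\<^sub>R eta W N h z)" by simp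
  then have "neg (Suc j) t (eta W)" using neg_h_iff[OF reg_eta[OF W]] by blast
  then show ?case using d' by blast
qed

text \<open>Where f(h) is not smooth it is replaced by 0, which affects no statement about small
  \<open>h\<close>.\<close>

lemma very_regular_modify:
  fixes f :: "nat \<Rightarrow> real \<Rightarrow> ((real^'d) \<times> real) \<Rightarrow> real^'q"
  assumes "\<And>N. very_regular (f N)"
  defines "g \<equiv> (\<lambda>N h z. if smooth (f N h) then f N h z else 0)"
  shows "reg g" and "\<forall>\<^sub>F h in at_right 0. g N h = f N h"
proof -
  have ev: "\<forall>\<^sub>F h in at_right 0. g N h = f N h" for N
    using assms(1)[of N] unfolding very_regular_def by (elim conjE eventually_mono) (simp add: g_def)
  show "reg g"
    unfolding reg_def
  proof (intro conjI allI)
    show "smooth (g N h)" for N h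
      by (cases "smooth (f N h)") (simp_all add: g_def smooth_const)
    show "bdd (\<lambda>N h. nder us (g N h))" for us
      unfolding bdd_def
    proof (intro allI impI)
      fix N and K :: "((real^'d) \<times> real) set" assume K: "compact K"
      have "unif_O 0 K (\<lambda>h. nder us (f N h))" using assms(1)[of N] K unfolding very_regular_def by blast
      moreover have "\<forall>\<^sub>F h in at_right 0. \<forall>z\<in>K. nder us (g N h) z = nder us (f N h) z"
        using ev[of N] by eventually_elim simp
      ultimately show "unif_O 0 K (\<lambda>h. nder us (g N h))" by (rule unif_O_cong[rotated])
    qed
  qed
  show "\<forall>\<^sub>F h in at_right 0. g N h = f N h" by (rule ev)
qed

text \<open>The order \<open>r\<close> of admissible differentiation is not computed. If none
  sufficed, there would be a counterexample for each \<open>r\<close>; these form one sequence, for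
  which the residual is negligible in the sense of \<open>neg\<close>, and then the conclusion holds
  from some member on, a contradiction.\<close>

lemma taylor_exists: "taylor_expansion v M \<Phi> S \<Gamma> \<psi>"
proof -
  define good where "good = (\<lambda>(f :: real \<Rightarrow> ((real^'d) \<times> real) \<Rightarrow> real^'q) t K.
      unif_O 4 K (\<lambda>h x. vector_derivative (\<lambda>s. cpart (M *v f h (x, s))) (at t)
                               + (\<Sum>k=1..4. h ^ (k - 1) *\<^sub>R \<Gamma> k (\<lambda>x. cpart (M *v f h (x, t))) x)) \<and>
      unif_O 4 K (\<lambda>h x. npart (M *v f h (x, t)) - (\<Phi> (cpart (M *v f h (x, t)))
                               + matrix_inv S *v (\<Sum>k=1..3. h ^ k *\<^sub>R \<psi> k (\<lambda>x. cpart (M *v f h (x, t))) x))))"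
  have "\<exists>r. \<forall>f t K. very_regular f \<longrightarrow> scheme_at r v M \<Phi> S f t \<longrightarrow> compact K \<longrightarrow> good f t K"
  proof (rule ccontr)
    assume "\<nexists>r. \<forall>f t K. very_regular f \<longrightarrow> scheme_at r v M \<Phi> S f t \<longrightarrow> compact K \<longrightarrow> good f t K"
    then have bad0: "\<exists>f t K. very_regular f \<and> scheme_at r v M \<Phi> S f t \<and> compact K \<and> \<not> good f t K" for r
      unfolding not_ex not_all not_imp by (elim allE[of _ r]) assumption
    define Q where "Q = (\<lambda>r (p :: (real \<Rightarrow> ((real^'d) \<times> real) \<Rightarrow> real^'q) \<times> real \<times> (real^'d) set).
      case p of (f, t, K) \<Rightarrow> very_regular f \<and> scheme_at r v M \<Phi> S f t \<and> compact K \<and> \<not> good f t K)"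
    have "\<exists>p. Q r p" for r
      using bad0[of r] unfolding Q_def split_paired_Ex prod.case .
    then have "Q r (SOME p. Q r p)" for r by (rule someI_ex)
    then obtain p where p: "\<And>r. Q r (p r)" by (rule that)
    define f where "f = (\<lambda>r. fst (p r))"
    define t where "t = (\<lambda>r. fst (snd (p r)))"
    define K where "K = (\<lambda>r. snd (snd (p r)))"
    have bad: "very_regular (f r)" "scheme_at r v M \<Phi> S (f r) (t r)" "compact (K r)" "\<not> good (f r) (t r) (K r)" for r
      using p[of r] unfolding Q_def f_def t_def K_def case_prod_beta by simp_all
    define g where "g = (\<lambda>N h z. if smooth (f N h) then f N h z else 0)"
    have g: "reg g" and ev: "\<And>N. \<forall>\<^sub>F h in at_right 0. g N h = f N h"
      unfolding g_def by (rule very_regular_modify[of f, OF bad(1)])+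
    have "neg 5 t (\<lambda>N h. residual v M \<Phi> S (g N) h)"
      unfolding neg_def
    proof (intro conjI allI reg_residual[OF g])
      fix r
      show "\<forall>\<^sub>F N in sequentially. small r 5 (t N) (\<lambda>h. residual v M \<Phi> S (g N) h)"
        using eventually_ge_at_top[of r]
      proof eventually_elim
        case (elim N)
        show ?case
        proof (rule smallI)
          fix us :: "((real^'d) \<times> real) list" and K :: "(real^'d) set" assume us: "length us \<le> r" and K: "compact K"
          have "unif_O 5 (K \<times> {t N}) (\<lambda>h. nder us (residual v M \<Phi> S (f N) h))"
            by (rule bad(2)[unfolded scheme_at_def, rule_format, OF order_trans[OF us elim] K])
          moreover have "\<forall>\<^sub>F h in at_right 0. \<forall>z\<in>K \<times> {t N}. nder us (residual v M \<Phi> S (g N) h) z = nder us (residual v M \<Phi> S (f N) h) z"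
            using ev[of N]
          proof eventually_elim
            case (elim h)
            then have "residual v M \<Phi> S (g N) h = residual v M \<Phi> S (f N) h"
              by (simp add: residual_def fun_eq_iff)
            then show ?case by simp
          qed
          ultimately show "unif_O 5 (K \<times> {t N}) (\<lambda>h. nder us (residual v M \<Phi> S (g N) h))" by (rule unif_O_cong[rotated])
        qed
      qed
    qed
    define W where "W = (\<lambda>N h z. cpart (M *v g N h z))"
    define P where "P = (\<lambda>N h z. S *v (npart (M *v g N h z) - \<Phi> (cpart (M *v g N h z))))"
    note res = residual_Zfam(1)[OF g, folded W_def P_def]
    have W: "reg W" and P: "reg P" unfolding W_def P_def by (rule residual_Zfam(3,4)[OF g])+
    have "neg 4 t (eta W) \<and> neg 4 t (delta W P)"
      by (rule eta_delta_neg[OF W P res]) (fact, simp)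
    then have e4: "neg 4 t (eta W)" and d4: "neg 4 t (delta W P)" by blast+
    \<comment> \<open>The expansion of Y stops at order 3, whereas \<open>delta\<close> has h^4
      \<psi>_4 subtracted; adding this term back does no harm at order 4.\<close>
    have "neg 4 t (\<lambda>N h z. matrix_inv S *v (delta W P N h z + h ^ 4 *\<^sub>R slice (\<psi> 4) W N h z))"
      by (intro neg_linear[OF bounded_linear_matrix] neg_add d4 neg_hpow_reg reg_slice d\<psi> W order_refl)
    then have "\<forall>\<^sub>F N in sequentially. small 0 4 (t N) (eta W N) \<and>
        small 0 4 (t N) (\<lambda>h z. matrix_inv S *v (delta W P N h z + h ^ 4 *\<^sub>R slice (\<psi> 4) W N h z))"
      using e4 unfolding neg_def by (simp add: eventually_conj)
    then obtain N where N: "small 0 4 (t N) (eta W N)"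
        "small 0 4 (t N) (\<lambda>h z. matrix_inv S *v (delta W P N h z + h ^ 4 *\<^sub>R slice (\<psi> 4) W N h z))"
      using eventually_happens'[OF sequentially_bot] by blast
    have K: "compact (K N)" by (rule bad(3))
    have "good (f N) (t N) (K N)" unfolding good_def
    proof (intro conjI)
      have "unif_O 4 (K N) (\<lambda>h x. eta W N h (x, t N))"
        using smallD[OF N(1) _ K, of "[]"] unfolding unif_O_def by simp
      then show "unif_O 4 (K N) (\<lambda>h x. vector_derivative (\<lambda>s. cpart (M *v f N h (x, s))) (at (t N))
          + (\<Sum>k=1..4. h ^ (k - 1) *\<^sub>R \<Gamma> k (\<lambda>x. cpart (M *v f N h (x, t N))) x))"
      proof (rule unif_O_cong[rotated])
        show "\<forall>\<^sub>F h in at_right 0. \<forall>x\<in>K N. vector_derivative (\<lambda>s. cpart (M *v f N h (x, s))) (at (t N))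
          + (\<Sum>k=1..4. h ^ (k - 1) *\<^sub>R \<Gamma> k (\<lambda>x. cpart (M *v f N h (x, t N))) x) = eta W N h (x, t N)"
          using ev[of N]
        proof eventually_elim
          case (elim h)
          have Weq: "W N h = (\<lambda>z. cpart (M *v f N h z))" unfolding W_def elim ..
          show ?case
            using vector_derivative_time[OF reg_smooth[OF W], of N h _ "t N"] unfolding Weq
            by (simp add: eta_def[OF W] slice_def Weq)
        qed
      qed
      have "unif_O 4 (K N) (\<lambda>h x. matrix_inv S *v (delta W P N h (x, t N) + h ^ 4 *\<^sub>R slice (\<psi> 4) W N h (x, t N)))"
        using smallD[OF N(2) _ K, of "[]"] unfolding unif_O_def by simp
      then show "unif_O 4 (K N) (\<lambda>h x. npart (M *v f N h (x, t N)) - (\<Phi> (cpart (M *v f N h (x, t N)))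
          + matrix_inv S *v (\<Sum>k=1..3. h ^ k *\<^sub>R \<psi> k (\<lambda>x. cpart (M *v f N h (x, t N))) x)))"
      proof (rule unif_O_cong[rotated])
        show "\<forall>\<^sub>F h in at_right 0. \<forall>x\<in>K N. npart (M *v f N h (x, t N)) - (\<Phi> (cpart (M *v f N h (x, t N)))
          + matrix_inv S *v (\<Sum>k=1..3. h ^ k *\<^sub>R \<psi> k (\<lambda>x. cpart (M *v f N h (x, t N))) x))
          = matrix_inv S *v (delta W P N h (x, t N) + h ^ 4 *\<^sub>R slice (\<psi> 4) W N h (x, t N))"
          using ev[of N]
        proof eventually_elim
          case (elim h)
          have Weq: "W N h = (\<lambda>z. cpart (M *v f N h z))" unfolding W_def elim ..
          have Peq: "P N h = (\<lambda>z. S *v (npart (M *v f N h z) - \<Phi> (cpart (M *v f N h z))))" unfolding P_def elim ..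
          have s4: "(\<Sum>k=1..4. F k) = (\<Sum>k=1..3. F k) + F 4" for F :: "nat \<Rightarrow> real^'p"
            by (simp add: numeral_eq_Suc)
          have Seq: "matrix_inv S *v (S *v y) = y" for y
            by (simp add: matrix_vector_mul_assoc matrix_inv_inverse[OF inv_S])
          show ?case
            unfolding delta_def[OF W P] s4 slice_def Weq Peq
            by (simp add: matrix_vector_mult_diff_distrib matrix_vector_right_distrib linear_neg[OF matrix_vector_mul_linear] Seq)
        qed
      qed
    qed
    then show False using bad(4) by (rule notE[rotated])
  qed
  then show ?thesis unfolding taylor_expansion_def Let_def good_def using d\<Gamma> d\<psi> by simp
qed

end

section \<open>Uniqueness of the Taylor expansion, through solutions formal in time\<close>

subsection \<open>Flat functions and formal solutions\<close>

text \<open>Vanishing to order n at time 0, uniformly in no sense but at every point of space; this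
  is the ideal modulo which the evolution equation is solved.\<close>

definition flat :: "nat \<Rightarrow> ('a::real_normed_vector \<times> real \<Rightarrow> real) \<Rightarrow> bool" where
  "flat n f \<longleftrightarrow> smooth f \<and> (\<forall>us x. length us < n \<longrightarrow> nder us f (x, 0) = 0)"

lemma flatD: "flat n f \<Longrightarrow> length us < n \<Longrightarrow> nder us f (x, 0) = 0"
  and flat_smooth: "flat n f \<Longrightarrow> smooth f"
  by (simp_all add: flat_def)

lemma flat_mono: "flat n f \<Longrightarrow> m \<le> n \<Longrightarrow> flat m f"
  by (simp add: flat_def)

lemma flat_0 [simp]: "flat 0 f \<longleftrightarrow> smooth f"
  by (simp add: flat_def)

lemma flat_Suc: "flat (Suc n) f \<longleftrightarrow> smooth f \<and> (\<forall>x. f (x, 0) = 0) \<and> (\<forall>e. flat n (dir e f))"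
proof
  assume f: "flat (Suc n) f"
  show "smooth f \<and> (\<forall>x. f (x, 0) = 0) \<and> (\<forall>e. flat n (dir e f))"
  proof (intro conjI allI)
    show "smooth f" by (rule flat_smooth[OF f])
    show "f (x, 0) = 0" for x using flatD[OF f, of "[]"] by simp
    show "flat n (dir e f)" for e
      using flatD[OF f, of "us @ [e]" for us] smooth_dir[OF flat_smooth[OF f]] by (simp add: flat_def nder_snoc)
  qed
next
  assume a: "smooth f \<and> (\<forall>x. f (x, 0) = 0) \<and> (\<forall>e. flat n (dir e f))"
  show "flat (Suc n) f"
    unfolding flat_def
  proof (intro conjI allI impI)
    show "smooth f" using a by (elim conjE)
    fix us :: "('a \<times> real) list" and x assume us: "length us < Suc n"
    show "nder us f (x, 0) = 0"
    proof (cases us rule: rev_cases)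
      case Nil
      then show ?thesis using a by simp
    next
      case (snoc vs e)
      have "flat n (dir e f)" using a by (elim conjE allE[of _ e])
      from flatD[OF this, of vs x] show ?thesis using us by (simp only: snoc nder_snoc) simp
    qed
  qed
qed

lemma flat_add: "flat n f \<Longrightarrow> flat n g \<Longrightarrow> flat n (\<lambda>z. f z + g z)"
  by (simp add: flat_def smooth_add nder_add)

lemma flat_zero: "flat n (\<lambda>z. 0)"
  by (simp add: flat_def smooth_const nder_zero)

lemma flat_sum: "(\<And>i. i \<in> I \<Longrightarrow> flat n (f i)) \<Longrightarrow> flat n (\<lambda>z. \<Sum>i\<in>I. f i z)"
  by (induction I rule: infinite_finite_induct) (simp_all add: flat_add flat_zero)

lemma flat_cmult: "flat n f \<Longrightarrow> flat n (\<lambda>z. c * f z)"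
  using nder_cscaleR[of f _ c] smooth_cscaleR[of f c] by (simp add: flat_def)

lemma flat_diff: "flat n f \<Longrightarrow> flat n g \<Longrightarrow> flat n (\<lambda>z. f z - g z)"
  using flat_add[of n f "\<lambda>z. -1 * g z"] flat_cmult[of n g "-1"] by simp

lemma smooth_mult: "smooth c \<Longrightarrow> smooth f \<Longrightarrow> smooth (\<lambda>z. c z * f z :: real)"
  using reg_mult[of "\<lambda>N h. c" "\<lambda>N h. f"] by (simp only: reg_const_fam_iff)

lemma flat_mult: "smooth c \<Longrightarrow> flat n f \<Longrightarrow> flat n (\<lambda>z. c z * f z)"
proof (induction n arbitrary: c f)
  case 0
  then show ?case by (simp add: smooth_mult)
next
  case (Suc n)
  have "dir e (\<lambda>z. c z * f z) = (\<lambda>z. c z * dir e f z + dir e c z * f z)" for e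
    by (rule ext, rule dir_bilinear[OF bounded_bilinear_mult])
      (intro smooth_differentiable Suc.prems flat_smooth[OF Suc.prems(2)])+
  moreover have "flat n (dir e f)" for e using Suc.prems(2) by (simp only: flat_Suc)
  then have "flat n (\<lambda>z. c z * dir e f z)" for e by (rule Suc.IH[OF Suc.prems(1)])
  moreover have "flat n (\<lambda>z. dir e c z * f z)" for e
    by (intro Suc.IH smooth_dir Suc.prems(1) flat_mono[OF Suc.prems(2)] le_SucI order_refl)
  ultimately show ?case
    using Suc.prems by (simp add: flat_Suc smooth_mult flat_add)
qed

text \<open>A function that vanishes on the whole slice t = 0 has vanishing space derivatives there,
  so space derivatives cost no order.\<close>

lemma flat_dir_space:
  assumes "flat n f" shows "flat n (dir (a, 0) f)"
  unfolding flat_def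
proof (intro conjI allI impI)
  have f: "smooth f" by (rule flat_smooth[OF assms])
  show "smooth (dir (a, 0) f)" by (rule smooth_dir[OF f])
  fix us :: "('a \<times> real) list" and x assume us: "length us < n"
  have "nder us (dir (a, 0) f) (x, 0) = dir a (\<lambda>y. nder us f (y, 0)) x"
    by (simp add: nder_dir_commute_real[OF f] dir_slice(1)[OF smooth_differentiable[OF smooth_nder[OF f]]])
  then show "nder us (dir (a, 0) f) (x, 0) = 0" by (simp add: flatD[OF assms us])
qed

text \<open>Consequently only time derivatives need checking; a general direction is a combination
  of a spatial one and (0, 1).\<close>

lemma flat_SucI:
  assumes "smooth f" "\<And>x. f (x, 0) = 0" "flat n (dir (0, 1) f)"
  shows "flat (Suc n) f"
  using assms
proof (induction n arbitrary: f)
  case 0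
  then show ?case by (simp add: flat_Suc smooth_dir)
next
  case (Suc n)
  have "flat (Suc n) (dir (a, 0) f)" for a
  proof (rule Suc.IH)
    show "smooth (dir (a, 0) f)" by (rule smooth_dir[OF Suc.prems(1)])
    show "dir (a, 0) f (x, 0) = 0" for x
      using dir_slice(1)[of f x 0 a, OF smooth_differentiable[OF Suc.prems(1)]] Suc.prems(2) by simp
    have "flat n (dir (a, 0) (dir (0, 1) f))"
      by (rule flat_dir_space[OF flat_mono[OF Suc.prems(3)]]) simp
    then show "flat n (dir (0, 1) (dir (a, 0) f))"
      by (simp only: dir_commute_real[OF Suc.prems(1), of "(0, 1)"])
  qed
  then have "flat (Suc n) (\<lambda>z. dir (a, 0) f z + b * dir (0, 1) f z)" for a b
    by (intro flat_add flat_cmult Suc.prems(3))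
  moreover have "(\<lambda>z. dir (a, 0) f z + b * dir (0, 1) f z) = dir (a, b) f" for a b
    using dir_lin_direction[OF Suc.prems(1), of 1 "(a, 0)" b "(0, 1)"] by (simp add: fun_eq_iff)
  ultimately have "flat (Suc n) (dir (a, b) f)" for a b by (simp only:)
  then show ?case using Suc.prems(1,2) by (subst flat_Suc) simp
qed

lemma nder_replicate_Suc: "nder (replicate (Suc n) e) f = nder (replicate n e) (dir e f)"
  using nder_snoc[of "replicate n e" e f] by (simp only: replicate_append_same replicate_Suc)

lemma flat_step:
  "flat n f \<Longrightarrow> (\<And>x. nder (replicate n (0, 1)) f (x, 0) = 0) \<Longrightarrow> flat (Suc n) f"
proof (induction n arbitrary: f)
  case 0
  then show ?case by (simp add: flat_Suc smooth_dir)
next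
  case (Suc n)
  have "flat (Suc n) (dir (0, 1) f)"
    using Suc.prems(1) Suc.prems(2)[unfolded nder_replicate_Suc] by (intro Suc.IH) (simp_all only: flat_Suc)
  then show ?case using Suc.prems(1) by (intro flat_SucI) (simp_all add: flat_Suc)
qed

lemma smooth_snd_pow: "smooth (\<lambda>z :: 'a::real_normed_vector \<times> real. snd z ^ k)"
  by (induction k) (simp_all add: smooth_const smooth_mult
      linear_conv_bounded_linear bounded_linear_imp_smooth bounded_linear_snd)

lemma dir_snd_pow_mult:
  assumes "smooth f" and f: "\<And>z. dir (0, 1) f z = 0"
  shows "dir (0, 1) (\<lambda>z :: 'a::real_normed_vector \<times> real. snd z ^ Suc k * f z) = (\<lambda>z. real (Suc k) * (snd z ^ k * f z))"
proof
  fix z :: "'a \<times> real"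
  have "dir (0, 1) (\<lambda>z. snd z ^ Suc k * f z) z = snd z ^ Suc k * dir (0, 1) f z + dir (0, 1) (\<lambda>z. snd z ^ Suc k) z * f z"
    by (rule dir_bilinear[OF bounded_bilinear_mult]) (intro smooth_differentiable smooth_snd_pow assms)+
  moreover have "dir (0, 1) (\<lambda>z. snd z ^ Suc k) z = real (Suc k) * snd z ^ k"
  proof -
    have "((\<lambda>z. snd z ^ Suc k) has_derivative (\<lambda>u. of_nat (Suc k) * snd u * snd z ^ k)) (at z)"
      using has_derivative_power[OF has_derivative_snd[OF has_derivative_ident], where n = "Suc k" and S = UNIV and x = z] by simp
    from dir_eqI[OF this, of "(0, 1)"] show ?thesis by simp
  qed
  ultimately show "dir (0, 1) (\<lambda>z. snd z ^ Suc k * f z) z = real (Suc k) * (snd z ^ k * f z)"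
    by (simp add: f)
qed

lemma flat_snd_pow:
  assumes f: "smooth f" "\<And>z. dir (0, 1) f z = 0"
  shows "flat k (\<lambda>z :: 'a::real_normed_vector \<times> real. snd z ^ k * f z)"
proof (induction k)
  case 0
  then show ?case using f by simp
next
  case (Suc k)
  show ?case
    by (rule flat_SucI) (simp_all only: dir_snd_pow_mult[OF f] flat_cmult[OF Suc.IH] smooth_mult[OF smooth_snd_pow f(1)], simp)
qed

lemma nder_snd_pow:
  assumes f: "smooth f" "\<And>z. dir (0, 1) f z = 0"
  shows "nder (replicate k (0, 1)) (\<lambda>z :: 'a::real_normed_vector \<times> real. snd z ^ k * f z) z = fact k * f z"
proof (induction k)
  case (Suc k)
  have "nder (replicate (Suc k) (0, 1)) (\<lambda>z. snd z ^ Suc k * f z) z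
     = nder (replicate k (0, 1)) (\<lambda>z. real (Suc k) *\<^sub>R (snd z ^ k * f z)) z"
    by (simp only: nder_replicate_Suc dir_snd_pow_mult[OF f] real_scaleR_def)
  also have "\<dots> = real (Suc k) *\<^sub>R (fact k * f z)"
    by (simp only: nder_cscaleR[OF smooth_mult[OF smooth_snd_pow f(1)]] Suc.IH)
  finally show ?case by (simp add: mult_ac)
qed simp

text \<open>Induction on \<open>n\<close>: the derivative of the difference is a sum of products,
  each with a factor that is a difference of the same kind and flat of one order less.\<close>

lemma flat_smooth_fin:
  fixes p p' :: "'j \<Rightarrow> 'a::real_normed_vector \<times> real \<Rightarrow> real"
  assumes "smooth_fin J g" "\<And>j. smooth (p j)" "\<And>j. smooth (p' j)" "\<And>j. flat n (\<lambda>z. p' j z - p j z)"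
  shows "flat n (\<lambda>z. g (\<lambda>j. p' j z) - g (\<lambda>j. p j z))"
proof -
  have sm: "smooth (\<lambda>z. g (\<lambda>j. q j z))" if "smooth_fin J g" "\<And>j. smooth (q j)" for g and q :: "'j \<Rightarrow> 'a \<times> real \<Rightarrow> real"
    using reg_smooth_fin[of J g "\<lambda>N h z j. q j z"] that by (simp only: reg_const_fam_iff)
  show ?thesis
    using assms(1,4)
  proof (induction n arbitrary: g)
  case 0
  then show ?case by (simp add: smooth_diff sm assms(2,3))
next
  case (Suc n)
  have j: "finite J" by (rule smooth_fin_finite[OF Suc.prems(1)])
  have eq0: "p' j (x, 0) = p j (x, 0)" for j x using Suc.prems(2)[of j] by (simp add: flat_Suc)
  have fd: "flat n (\<lambda>z. dir e (p' j) z - dir e (p j) z)" for e j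
  proof -
    have "dir e (\<lambda>z. p' j z + (-1) *\<^sub>R p j z) = (\<lambda>z. dir e (p' j) z - dir e (p j) z)"
      by (intro ext) (simp only: dir_add[OF smooth_differentiable[OF assms(3)] smooth_differentiable[OF smooth_cscaleR[OF assms(2)]]]
         dir_cscaleR[OF smooth_differentiable[OF assms(2)]], simp)
    moreover have "flat n (dir e (\<lambda>z. p' j z - p j z))" using Suc.prems(2)[of j] by (simp only: flat_Suc)
    ultimately show ?thesis by simp
  qed
  have d: "dir e (\<lambda>z. g (\<lambda>j. q j z)) = (\<lambda>z. \<Sum>j\<in>J. coord_deriv j g (\<lambda>j. q j z) * dir e (q j) z)"
    if "\<And>j. smooth (q j)" for e and q :: "'j \<Rightarrow> 'a \<times> real \<Rightarrow> real"
    by (intro ext dir_smooth_fin(1)[OF Suc.prems(1)] smooth_differentiable that)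
  have "dir e (\<lambda>z. g (\<lambda>j. p' j z) + (-1) *\<^sub>R g (\<lambda>j. p j z)) = (\<lambda>z. \<Sum>j\<in>J.
      dir e (p' j) z * (coord_deriv j g (\<lambda>j. p' j z) - coord_deriv j g (\<lambda>j. p j z))
      + coord_deriv j g (\<lambda>j. p j z) * (dir e (p' j) z - dir e (p j) z))" for e
    by (intro ext) (simp only: dir_add[OF smooth_differentiable[OF sm[OF Suc.prems(1) assms(3)]] smooth_differentiable[OF smooth_cscaleR[OF sm[OF Suc.prems(1) assms(2)]]]]
         dir_cscaleR[OF smooth_differentiable[OF sm[OF Suc.prems(1) assms(2)]]] d[OF assms(2)] d[OF assms(3)],
       simp add: sum_subtractf[symmetric] algebra_simps)
  moreover have "flat n (\<lambda>z. \<Sum>j\<in>J.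
      dir e (p' j) z * (coord_deriv j g (\<lambda>j. p' j z) - coord_deriv j g (\<lambda>j. p j z))
      + coord_deriv j g (\<lambda>j. p j z) * (dir e (p' j) z - dir e (p j) z))" for e
  proof (rule flat_sum, rule flat_add)
    fix j
    have "flat n (\<lambda>z. p' j z - p j z)" for j by (rule flat_mono[OF Suc.prems(2)]) simp
    note IH = Suc.IH[OF smooth_fin_coord_deriv[OF Suc.prems(1), of j] this]
    show "flat n (\<lambda>z. dir e (p' j) z * (coord_deriv j g (\<lambda>j. p' j z) - coord_deriv j g (\<lambda>j. p j z)))"
      by (rule flat_mult[OF smooth_dir[OF assms(3)] IH])
    show "flat n (\<lambda>z. coord_deriv j g (\<lambda>j. p j z) * (dir e (p' j) z - dir e (p j) z))"
      by (rule flat_mult[OF sm[OF smooth_fin_coord_deriv[OF Suc.prems(1)] assms(2)] fd])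
  qed
  ultimately have fl: "flat n (dir e (\<lambda>z. g (\<lambda>j. p' j z) + (-1) *\<^sub>R g (\<lambda>j. p j z)))" for e
    by (simp only:)
  have eq: "(\<lambda>z. g (\<lambda>j. p' j z) + (-1) *\<^sub>R g (\<lambda>j. p j z)) = (\<lambda>z. g (\<lambda>j. p' j z) - g (\<lambda>j. p j z))" by simp
  show ?case
    unfolding flat_Suc using fl[unfolded eq]
    by (intro conjI allI smooth_diff sm[OF Suc.prems(1)] assms(2,3)) (simp_all only: eq0 diff_self)
qed
qed

lemma flat_nder_axt: "flat n f \<Longrightarrow> flat n (nder (axt as) f)"
proof (induction as)
  case (Cons a as)
  then show ?case unfolding list.map nder_Cons_dir by (intro flat_dir_space)
qed simp

lemma flat_diffop:
  fixes U U' :: "(real^'d::finite) \<times> real \<Rightarrow> real^'n::finite"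
  assumes F: "diffop F" and U: "smooth U" and U': "smooth U'" and f: "\<And>i. flat n (\<lambda>z. U' z $ i - U z $ i)"
  shows "flat n (\<lambda>z. F (\<lambda>y. U' (y, snd z)) (fst z) $ i - F (\<lambda>y. U (y, snd z)) (fst z) $ i)"
proof -
  obtain J g where g: "smooth_fin J g" "\<forall>W x. smooth W \<longrightarrow> F W x $ i = g (jet W x)"
    using diffop_scalar[OF F, of i] unfolding scalar_diffop_def by (elim exE conjE) (rule that)
  define p where "p = (\<lambda>V :: (real^'d) \<times> real \<Rightarrow> real^'n. \<lambda>(as, i) z. nder (axt as) (\<lambda>z. V z $ i) z)"
  have p: "F (\<lambda>y. V (y, snd z)) (fst z) $ i = g (\<lambda>j. p V j z)" if V: "smooth V" for V z
  proof -
    have "jet (\<lambda>y. V (y, snd z)) (fst z) = (\<lambda>j. p V j z)"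
      by (intro ext) (auto simp: p_def jet_slice[OF V] nder_nth[OF V])
    then show ?thesis using g(2) smooth_slice[OF V, of "snd z"] by simp
  qed
  have sp: "smooth (p V j)" if "smooth V" for V j
    by (cases j) (simp add: p_def smooth_nder smooth_nth[OF that])
  have fp: "flat n (\<lambda>z. p U' j z - p U j z)" for j
  proof (cases j)
    case (Pair as k)
    have "nder (axt as) (\<lambda>z. U' z $ k + (-1) *\<^sub>R (U z $ k)) = (\<lambda>z. p U' j z - p U j z)"
      by (simp only: nder_add[OF smooth_nth[OF U'] smooth_cscaleR[OF smooth_nth[OF U]]] nder_cscaleR[OF smooth_nth[OF U]])
        (simp add: p_def Pair)
    then show ?thesis using flat_nder_axt[OF f[of k], of as] by simp
  qed
  show ?thesis unfolding p[OF U] p[OF U'] by (rule flat_smooth_fin[OF g(1) sp[OF U] sp[OF U'] fp])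
qed


text \<open>Letting \<open>h\<close> tend to 0 kills the constant coefficient; then one factor
  \<open>h\<close> is divided out and the argument repeats.\<close>

lemma unif_O_polynomial:
  fixes c :: "nat \<Rightarrow> 'b::real_normed_vector"
  assumes "unif_O n {x} (\<lambda>h _. \<Sum>k<n. h ^ k *\<^sub>R c k)" "k < n"
  shows "c k = 0"
  using assms
proof (induction n arbitrary: c k)
  case (Suc n)
  obtain B where B: "\<forall>\<^sub>F h in at_right 0. norm (\<Sum>k<Suc n. h ^ k *\<^sub>R c k) \<le> B * h ^ Suc n"
    using Suc.prems(1) unfolding unif_O_def by auto
  have L: "((\<lambda>h. \<Sum>k<Suc n. h ^ k *\<^sub>R c k) \<longlongrightarrow> (\<Sum>k<Suc n. 0 ^ k *\<^sub>R c k)) (at_right 0)"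
    by (intro tendsto_intros)
  have s0: "(\<Sum>k<Suc n. 0 ^ k *\<^sub>R c k) = c 0"
    by (simp add: sum.lessThan_Suc_shift del: sum.lessThan_Suc)
  have L0: "((\<lambda>h. \<Sum>k<Suc n. h ^ k *\<^sub>R c k) \<longlongrightarrow> 0) (at_right 0)"
  proof (rule tendsto_0_le[where K = 1])
    have "((\<lambda>h. B * h ^ Suc n) \<longlongrightarrow> B * 0 ^ Suc n) (at_right 0)" by (intro tendsto_intros)
    then show "((\<lambda>h. B * h ^ Suc n) \<longlongrightarrow> 0) (at_right 0)" by simp
    show "\<forall>\<^sub>F h in at_right 0. norm (\<Sum>k<Suc n. h ^ k *\<^sub>R c k) \<le> norm (B * h ^ Suc n) * 1"
      using B by eventually_elim simp
  qed
  have c0: "c 0 = 0"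
    by (rule tendsto_unique[OF trivial_limit_at_right_real L[unfolded s0] L0])
  then have "(\<Sum>k<Suc n. h ^ k *\<^sub>R c k) = h ^ 1 *\<^sub>R (\<Sum>k<n. h ^ k *\<^sub>R c (Suc k))" for h
    by (simp add: sum.lessThan_Suc_shift scaleR_sum_right del: sum.lessThan_Suc)
  then have "unif_O (1 + n) {x} (\<lambda>h _. \<Sum>k<Suc n. h ^ k *\<^sub>R c k) \<longleftrightarrow> unif_O n {x} (\<lambda>h _. \<Sum>k<n. h ^ k *\<^sub>R c (Suc k))"
    by (intro unif_O_hpow always_eventually) simp
  then have "unif_O n {x} (\<lambda>h _. \<Sum>k<n. h ^ k *\<^sub>R c (Suc k))" using Suc.prems(1) by simp
  from Suc.IH[of "\<lambda>k. c (Suc k)", OF this] show ?case using c0 Suc.prems(2) by (cases k) auto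
qed simp

text \<open>The equation itself need not be solvable, as space derivatives of any order may occur.
  Modulo flat functions it is: a polynomial in time is built coefficient by coefficient, and the
  \<Gamma>_k do not interfere because a flat change of W changes \<Gamma>_k(W) by an equally flat
  amount.\<close>

lemma formal_solution:
  fixes \<Gamma> :: "nat \<Rightarrow> (real^'d::finite \<Rightarrow> real^'n::finite) \<Rightarrow> real^'d \<Rightarrow> real^'n"
  assumes d\<Gamma>: "\<And>k. diffop (\<Gamma> k)" and W0: "smooth W0"
  defines "E \<equiv> (\<lambda>w (h::real) z. dir (0, 1) (w h) z + (\<Sum>k\<in>{1..4}. h ^ (k - 1) *\<^sub>R \<Gamma> k (\<lambda>y. w h (y, snd z)) (fst z)))"
  shows "\<exists>w. reg (\<lambda>N :: nat. w) \<and> (\<forall>h x. w h (x, 0) = W0 x) \<and> (\<forall>h i. flat n (\<lambda>z. E w h z $ i))"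
proof (induction n)
  have rE: "reg (\<lambda>N. E w)" if "reg (\<lambda>N. w)" for w :: "real \<Rightarrow> (real^'d) \<times> real \<Rightarrow> real^'n"
    unfolding E_def by (intro reg_add reg_fdir that reg_sum reg_scaleR reg_h diffop_reg[OF d\<Gamma>])
  case 0
  have "reg (\<lambda>N h (z :: (real^'d) \<times> real). W0 (fst z))" by (simp only: reg_const_fam_iff smooth_fst[OF W0])
  then show ?case
    by (intro exI[of _ "\<lambda>h z. W0 (fst z)"] conjI allI) (simp_all add: smooth_nth[OF reg_smooth[OF rE]])
  case (Suc n)
  then obtain w where w: "reg (\<lambda>N :: nat. w)" and w0: "\<And>h x. w h (x, 0) = W0 x" and f: "\<And>h i. flat n (\<lambda>z. E w h z $ i)"
    by (elim exE conjE) (rule that, auto)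
  \<comment> \<open>The first nonvanishing time derivative of the residual at time 0, extended
    constantly in time. Subtracting t^(n+1)/(n+1)! times \<open>q\<close> lowers the time derivative
    of w by t^n/n! times \<open>q\<close>, which removes it.\<close>
  define q where "q = (\<lambda>h (z :: (real^'d) \<times> real). nder (replicate n (0, 1)) (E w h) (fst z, 0))"
  define w' where "w' = (\<lambda>h z. w h z - (1 / fact (Suc n)) *\<^sub>R (snd z ^ Suc n *\<^sub>R q h z))"
  have bl: "bounded_linear (\<lambda>z :: (real^'d) \<times> real. (fst z, 0 :: real))"
    by (intro bounded_linear_Pair bounded_linear_fst bounded_linear_zero)
  have q: "reg (\<lambda>N :: nat. q)"
    unfolding q_def using reg_comp_linear[OF bl reg_nder[OF rE[OF w]]] .
  have sp: "reg (\<lambda>(N :: nat) (h :: real) (z :: (real^'d) \<times> real). snd z ^ Suc n)"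
    by (simp only: reg_const_fam_iff smooth_snd_pow)
  have w': "reg (\<lambda>N :: nat. w')"
    unfolding w'_def by (intro reg_diff reg_cscaleR reg_scaleR w q sp)
  have sq: "smooth (q h)" and sw: "smooth (w h)" and sw': "smooth (w' h)" for h
    by (rule reg_smooth[OF q] reg_smooth[OF w] reg_smooth[OF w'])+
  have sqi: "smooth (\<lambda>z. q h z $ i)" for h i by (rule smooth_nth[OF sq])
  have dq: "dir (0, 1) (\<lambda>z. q h z $ i) z = 0" for h i z
  proof -
    have sE: "smooth (\<lambda>z. nder (replicate n (0, 1)) (E w h) z $ i)"
      by (intro smooth_nth smooth_nder reg_smooth[OF rE[OF w]])
    have "dir (0, 1) (\<lambda>z. q h z $ i) z = dir (fst (0 :: real^'d, 1 :: real), 0) (\<lambda>z. nder (replicate n (0, 1)) (E w h) z $ i) (fst z, 0)"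
      unfolding q_def
      by (rule dir_comp_linear[OF bl, where f = "\<lambda>z. nder (replicate n (0, 1)) (E w h) z $ i", OF smooth_differentiable[OF sE]])
    also have "\<dots> = 0"
      using linear_0[OF linear_dir[OF smooth_differentiable[OF sE]], of "(fst z, 0)"] by (simp add: zero_prod_def)
    finally show ?thesis .
  qed
  have diff: "w' h z $ i - w h z $ i = - (1 / fact (Suc n)) * (snd z ^ Suc n * q h z $ i)" for h z i
    by (simp add: w'_def)
  have "flat (Suc n) (\<lambda>z. w' h z $ i - w h z $ i)" for h i
    unfolding diff by (rule flat_cmult[OF flat_snd_pow[OF sqi dq]])
  then have fD: "flat (Suc n) (\<lambda>z. \<Gamma> k (\<lambda>y. w' h (y, snd z)) (fst z) $ i - \<Gamma> k (\<lambda>y. w h (y, snd z)) (fst z) $ i)" for k h i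
    by (rule flat_diffop[OF d\<Gamma> sw sw'])
  have dw: "dir (0, 1) (w' h) z $ i = dir (0, 1) (w h) z $ i - (1 / fact n) * (snd z ^ n * q h z $ i)" for h z i
  proof -
    have "dir (0, 1) (\<lambda>z. w' h z $ i + (- 1) *\<^sub>R (w h z $ i)) z = dir (0, 1) (w' h) z $ i - dir (0, 1) (w h) z $ i"
      by (simp only: dir_add[OF smooth_differentiable[OF smooth_nth[OF sw']] smooth_differentiable[OF smooth_cscaleR[OF smooth_nth[OF sw]]]]
         dir_cscaleR[OF smooth_differentiable[OF smooth_nth[OF sw]]] dir_nth[OF smooth_differentiable[OF sw]] dir_nth[OF smooth_differentiable[OF sw']]) simp
    moreover have "(\<lambda>z. w' h z $ i + (- 1) *\<^sub>R (w h z $ i)) = (\<lambda>z. (- (1 / fact (Suc n))) *\<^sub>R (snd z ^ Suc n * q h z $ i))"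
      using diff[of h _ i] by (simp add: fun_eq_iff)
    moreover have "dir (0, 1) (\<lambda>z. (- (1 / fact (Suc n))) *\<^sub>R (snd z ^ Suc n * q h z $ i)) z
        = (- (1 / fact (Suc n))) *\<^sub>R (real (Suc n) * (snd z ^ n * q h z $ i))"
      by (simp only: dir_cscaleR[OF smooth_differentiable[OF smooth_mult[OF smooth_snd_pow sqi]]] dir_snd_pow_mult[OF sqi dq])
    moreover have "(- (1 / fact (Suc n))) *\<^sub>R (real (Suc n) * a) = - (1 / fact n) * a" for a :: real
    proof -
      have "- (1 / (r * f)) * (r * a) = - (1 / f) * a" if "r \<noteq> 0" for r f :: real using that by simp
      from this[of "real (Suc n)" "fact n"] show ?thesis by (simp only: fact_Suc real_scaleR_def)
    qed
    ultimately show ?thesis by (simp only:)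
  qed
  have fn: "flat n (\<lambda>z. E w h z $ i - (1 / fact n) * (snd z ^ n * q h z $ i))" for h i
    by (intro flat_diff f flat_cmult flat_snd_pow sqi dq)
  have fS: "flat (Suc n) (\<lambda>z. E w h z $ i - (1 / fact n) * (snd z ^ n * q h z $ i))" for h i
  proof (rule flat_step[OF fn])
    fix x
    have s: "smooth (\<lambda>z. E w h z $ i)" "smooth (\<lambda>z. snd z ^ n * q h z $ i)"
      by (intro smooth_nth reg_smooth[OF rE[OF w]] smooth_mult smooth_snd_pow sqi)+
    have "nder (replicate n (0, 1)) (\<lambda>z. E w h z $ i + (- (1 / fact n)) *\<^sub>R (snd z ^ n * q h z $ i)) (x, 0)
        = q h (x, 0) $ i - (1 / fact n) * (fact n * q h (x, 0) $ i)"
      by (simp only: nder_add[OF s(1) smooth_cscaleR[OF s(2)]] nder_cscaleR[OF s(2)] nder_snd_pow[OF sqi dq]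
          nder_nth[OF reg_smooth[OF rE[OF w]]]) (simp add: q_def)
    then show "nder (replicate n (0, 1)) (\<lambda>z. E w h z $ i - (1 / fact n) * (snd z ^ n * q h z $ i)) (x, 0) = 0" by simp
  qed
  have "E w' h z $ i = (E w h z $ i - (1 / fact n) * (snd z ^ n * q h z $ i))
      + (\<Sum>k\<in>{1..4}. h ^ (k - 1) * (\<Gamma> k (\<lambda>y. w' h (y, snd z)) (fst z) $ i - \<Gamma> k (\<lambda>y. w h (y, snd z)) (fst z) $ i))" for h z i
    unfolding E_def by (simp add: dw sum_subtractf right_diff_distrib)
  moreover have "flat (Suc n) (\<lambda>z. (E w h z $ i - (1 / fact n) * (snd z ^ n * q h z $ i))
      + (\<Sum>k\<in>{1..4}. h ^ (k - 1) * (\<Gamma> k (\<lambda>y. w' h (y, snd z)) (fst z) $ i - \<Gamma> k (\<lambda>y. w h (y, snd z)) (fst z) $ i)))" for h i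
    by (intro flat_add fS flat_sum flat_cmult fD)
  ultimately have "\<forall>h i. flat (Suc n) (\<lambda>z. E w' h z $ i)" by simp
  moreover have "\<forall>h x. w' h (x, 0) = W0 x" by (simp add: w'_def w0)
  ultimately show ?case using w' by (intro exI[of _ w'] conjI)
qed

context lbm_sol
begin

text \<open>W is taken from \<open>formal_solution\<close> and Y is prescribed by the expansion
  including \<psi>_4, so \<open>delta\<close> is 0 and \<open>eta\<close> is flat at time 0. Then
  \<open>Zfam\<close> is negligible, and the converse half of \<open>residual_Zfam\<close> returns
  to the scheme.\<close>

lemma approximate_solution:
  assumes W0: "smooth W0"
  shows "\<exists>f. very_regular f \<and> scheme_at r v M \<Phi> S f 0 \<and>
    (\<forall>h x. cpart (M *v f h (x, 0)) = W0 x) \<and>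
    (\<forall>h x. npart (M *v f h (x, 0)) = \<Phi> (W0 x) + matrix_inv S *v (\<Sum>k\<in>{1..4}. h ^ k *\<^sub>R \<psi> k W0 x)) \<and>
    (\<forall>h x. vector_derivative (\<lambda>s. cpart (M *v f h (x, s))) (at 0) = - (\<Sum>k\<in>{1..4}. h ^ (k - 1) *\<^sub>R \<Gamma> k W0 x))"
proof -
  define E where "E = (\<lambda>w (h::real) (z :: (real^'d) \<times> real). dir (0, 1) (w h) z + (\<Sum>k\<in>{1..4}. h ^ (k - 1) *\<^sub>R \<Gamma> k (\<lambda>y. w h (y, snd z)) (fst z)))"
  define good where "good = (\<lambda>(n::nat) (w :: real \<Rightarrow> (real^'d) \<times> real \<Rightarrow> real^'n). reg (\<lambda>N :: nat. w) \<and> (\<forall>h x. w h (x, 0) = W0 x) \<and> (\<forall>h i. flat n (\<lambda>z. E w h z $ i)))"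
  have "\<exists>w. good n w" for n
    unfolding good_def E_def by (rule formal_solution[where \<Gamma> = \<Gamma>, OF d\<Gamma> W0])
  then have "good n (SOME w. good n w)" for n by (rule someI_ex)
  \<comment> \<open>The sequence index serves as the order of flatness, so for every
    \<open>r\<close> all members from some point on have a remainder whose derivatives up to order
    \<open>r\<close> vanish at time 0.\<close>
  then obtain W where "\<And>n. good n (W n)" by (rule that)
  then have regW: "\<And>n. reg (\<lambda>N :: nat. W n)" and W_0: "\<And>n h x. W n h (x, 0) = W0 x"
    and flatE: "\<And>n h i. flat n (\<lambda>z. E (W n) h z $ i)"
    unfolding good_def by simp_all
  have W: "reg W" using regW unfolding reg_def bdd_def by simp
  define P where "P = (\<lambda>N h z. \<Sum>k\<in>{1..4}. h ^ k *\<^sub>R slice (\<psi> k) W N h z)"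
  have P: "reg P" unfolding P_def by (intro reg_sum reg_scaleR reg_h reg_slice d\<psi> W)
  define f where "f = (\<lambda>N h z. matrix_inv M *v join (W N h z) (\<Phi> (W N h z) + matrix_inv S *v P N h z))"
  have f: "reg f" unfolding f_def
    by (intro reg_bounded_linear[OF bounded_linear_matrix] reg_join W reg_add reg_\<Phi> P)
  have Weq: "cpart (M *v f N h z) = W N h z" for N h z by (simp add: f_def inv_M_apply)
  have Yeq: "npart (M *v f N h z) = \<Phi> (W N h z) + matrix_inv S *v P N h z" for N h z by (simp add: f_def inv_M_apply)
  have SS: "S *v (matrix_inv S *v y) = y" for y
    by (simp add: matrix_vector_mul_assoc matrix_inv_inverse[OF inv_S])
  have Peq: "S *v (npart (M *v f N h z) - \<Phi> (cpart (M *v f N h z))) = P N h z" for N h z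
    unfolding Weq Yeq by (simp add: SS)
  have eta_E: "eta W N h z = E (W N) h z" for N h z
    by (simp add: eta_def[OF W] E_def slice_def)
  have eta0: "nder us (eta W N h) (x, 0) = 0" if "length us < N" for us N h x
  proof (rule iffD2[OF vec_eq_iff], rule allI)
    fix i
    have "(\<lambda>z. E (W N) h z $ i) = (\<lambda>z. eta W N h z $ i)" by (simp add: eta_E)
    then have "flat N (\<lambda>z. eta W N h z $ i)" using flatE[of N h i] by simp
    from flatD[OF this that] show "nder us (eta W N h) (x, 0) $ i = 0 $ i"
      by (simp add: nder_nth[OF reg_smooth[OF reg_eta[OF W]]])
  qed
  have eta5: "neg k (\<lambda>N. 0) (eta W)" for k
    unfolding neg_def
  proof (intro conjI allI reg_eta[OF W])
    fix r
    show "\<forall>\<^sub>F N in sequentially. small r k 0 (eta W N)"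
      using eventually_gt_at_top[of r]
    proof eventually_elim
      case (elim N)
      show ?case
      proof (rule smallI)
        fix us :: "((real^'d) \<times> real) list" and K :: "(real^'d) set"
        assume "length us \<le> r"
        then have "nder us (eta W N h) z = 0" if "z \<in> K \<times> {0}" for h z
          using eta0[of us N h "fst z"] elim that by (cases z) auto
        then show "unif_O k (K \<times> {0}) (\<lambda>h. nder us (eta W N h))"
          unfolding unif_O_def by (intro exI[of _ 0]) simp
      qed
    qed
  qed
  have "delta W P = (\<lambda>N h z. 0)" unfolding delta_def[OF W P] by (simp add: P_def)
  then have delta5: "neg k (\<lambda>N. 0) (delta W P)" for k by simp
  have Zn: "neg 5 (\<lambda>N. 0) (\<lambda>N h z. npart (Zfam W P N h z))"
    using neg_add[OF npart_Zfam[OF W P eta5 delta5 order_refl] delta5[of "Suc 4"]] by simp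
  have Zc: "neg 5 (\<lambda>N. 0) (\<lambda>N h z. cpart (Zfam W P N h z))"
    using neg_add[OF cpart_Zfam[OF W P eta5 delta5 order_refl] neg_h[OF eta5[of "Suc 3"]]] by simp
  have "neg 5 (\<lambda>N. 0) (\<lambda>N h z. join (cpart (Zfam W P N h z)) 0 + join 0 (npart (Zfam W P N h z)))"
    by (intro neg_add neg_linear[OF bounded_linear_join1 Zc] neg_linear[OF bounded_linear_join2 Zn])
  then have Z5: "neg 5 (\<lambda>N. 0) (Zfam W P)" by (simp add: join_split[symmetric])
  have P1: "neg 1 (\<lambda>N. 0) P" unfolding P_def
  proof (rule neg_sum)
    fix k :: nat assume "k \<in> {1..4}"
    then show "neg 1 (\<lambda>N. 0) (\<lambda>N h z. h ^ k *\<^sub>R slice (\<psi> k) W N h z)"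
      by (intro neg_hpow_reg reg_slice d\<psi> W) simp
  qed
  have "neg 5 (\<lambda>N. 0) (\<lambda>N h. residual v M \<Phi> S (f N) h)"
    by (rule residual_Zfam(2)[OF f, unfolded Peq, unfolded Weq, OF P1 Z5])
  then have "\<forall>\<^sub>F N in sequentially. small r 5 0 (\<lambda>h. residual v M \<Phi> S (f N) h)"
    unfolding neg_def by (elim conjE allE[of _ r])
  \<comment> \<open>Positivity of \<open>N\<close> ensures that the remainder itself, with no
    derivative taken, vanishes at time 0; this gives the formula for the time derivative of
    W.\<close>
  then have "\<forall>\<^sub>F N in sequentially. small r 5 0 (\<lambda>h. residual v M \<Phi> S (f N) h) \<and> N > 0"
    by (intro eventually_conj eventually_gt_at_top)
  then obtain N where N: "small r 5 0 (\<lambda>h. residual v M \<Phi> S (f N) h)" "N > 0"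
    using eventually_happens'[OF sequentially_bot] by blast
  show ?thesis
  proof (intro exI[of _ "f N"] conjI allI)
    show "very_regular (f N)" using f unfolding very_regular_def reg_def bdd_def by simp
    show "scheme_at r v M \<Phi> S (f N) 0" using N(1) unfolding scheme_at_def small_def .
    fix h x
    show "cpart (M *v f N h (x, 0)) = W0 x" by (simp add: Weq W_0)
    show "npart (M *v f N h (x, 0)) = \<Phi> (W0 x) + matrix_inv S *v (\<Sum>k\<in>{1..4}. h ^ k *\<^sub>R \<psi> k W0 x)"
      by (simp add: Yeq W_0 P_def slice_def)
    have "dir (0, 1) (W N h) (x, 0) + (\<Sum>k\<in>{1..4}. h ^ (k - 1) *\<^sub>R \<Gamma> k W0 x) = 0"
      using eta0[of "[]" N h x] N(2) by (simp add: eta_E E_def W_0)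
    then show "vector_derivative (\<lambda>s. cpart (M *v f N h (x, s))) (at 0) = - (\<Sum>k\<in>{1..4}. h ^ (k - 1) *\<^sub>R \<Gamma> k W0 x)"
      unfolding Weq vector_derivative_time[OF reg_smooth[OF W]] by (rule eq_neg_iff_add_eq_0[THEN iffD2])
  qed
qed

text \<open>The approximate solution is made for the \<open>r\<close> that the given expansion
  provides. At one point, two expansions of the same quantities then differ by a polynomial of
  degree at most 3 in \<open>h\<close> that is O(h^4), so their coefficients agree.\<close>

lemma taylor_unique:
  assumes T: "taylor_expansion v M \<Phi> S \<Gamma>' \<Psi>'" and W0: "smooth W0"
  shows "k \<in> {1..4} \<Longrightarrow> \<Gamma>' k W0 x = \<Gamma> k W0 x" and "k \<in> {1..3} \<Longrightarrow> \<Psi>' k W0 x = \<psi> k W0 x"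
proof -
  obtain r where r: "\<forall>f t K. very_regular f \<longrightarrow> scheme_at r v M \<Phi> S f t \<longrightarrow> compact K \<longrightarrow>
        (let W = (\<lambda>h s x. cpart (M *v f h (x, s))); Y = (\<lambda>h s x. npart (M *v f h (x, s)))
         in unif_O 4 K (\<lambda>h x. vector_derivative (\<lambda>s. W h s x) (at t)
                               + (\<Sum>k=1..4. h ^ (k - 1) *\<^sub>R \<Gamma>' k (W h t) x)) \<and>
            unif_O 4 K (\<lambda>h x. Y h t x - (\<Phi> (W h t x)
                               + matrix_inv S *v (\<Sum>k=1..3. h ^ k *\<^sub>R \<Psi>' k (W h t) x))))"
    using T unfolding taylor_expansion_def by (elim conjE exE) (rule that)
  obtain f where f0: "very_regular f \<and> scheme_at r v M \<Phi> S f 0 \<and>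
    (\<forall>h x. cpart (M *v f h (x, 0)) = W0 x) \<and>
    (\<forall>h x. npart (M *v f h (x, 0)) = \<Phi> (W0 x) + matrix_inv S *v (\<Sum>k\<in>{1..4}. h ^ k *\<^sub>R \<psi> k W0 x)) \<and>
    (\<forall>h x. vector_derivative (\<lambda>s. cpart (M *v f h (x, s))) (at 0) = - (\<Sum>k\<in>{1..4}. h ^ (k - 1) *\<^sub>R \<Gamma> k W0 x))"
    using approximate_solution[OF W0, of r] by (rule exE)
  note f = f0[THEN conjunct1] f0[THEN conjunct2, THEN conjunct1]
  note Wf = f0[THEN conjunct2, THEN conjunct2, THEN conjunct1, rule_format]
  note Yf = f0[THEN conjunct2, THEN conjunct2, THEN conjunct2, THEN conjunct1, rule_format]
  note Df = f0[THEN conjunct2, THEN conjunct2, THEN conjunct2, THEN conjunct2, rule_format]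
  have "compact {x}" by simp
  note res = r[rule_format, OF f this, unfolded Let_def Wf Yf Df]
  have g: "unif_O 4 {x} (\<lambda>h x. - (\<Sum>k\<in>{1..4}. h ^ (k - 1) *\<^sub>R \<Gamma> k W0 x) + (\<Sum>k=1..4. h ^ (k - 1) *\<^sub>R \<Gamma>' k W0 x))"
    and y: "unif_O 4 {x} (\<lambda>h x. \<Phi> (W0 x) + matrix_inv S *v (\<Sum>k\<in>{1..4}. h ^ k *\<^sub>R \<psi> k W0 x) - (\<Phi> (W0 x)
        + matrix_inv S *v (\<Sum>k=1..3. h ^ k *\<^sub>R \<Psi>' k W0 x)))"
    using res by (rule conjunct1, rule conjunct2)
  have ix: "{1..4} = Suc ` {..<4::nat}"
    by (simp add: image_Suc_lessThan)
  have "unif_O 4 {x} (\<lambda>h _. \<Sum>k<4. h ^ k *\<^sub>R (\<Gamma>' (Suc k) W0 x - \<Gamma> (Suc k) W0 x))"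
    by (rule unif_O_cong[OF _ g], unfold ix sum.reindex[OF inj_Suc])
      (simp add: sum_subtractf scaleR_diff_right)
  note pg = unif_O_polynomial[OF this]
  show "\<Gamma>' k W0 x = \<Gamma> k W0 x" if "k \<in> {1..4}"
    using pg[of "k - 1"] that by (cases k) auto
  define c where "c = (\<lambda>k. if k = 0 then 0 else \<psi> k W0 x - \<Psi>' k W0 x)"
  have SS: "S *v (matrix_inv S *v y) = y" for y
    by (simp add: matrix_vector_mul_assoc matrix_inv_inverse[OF inv_S])
  \<comment> \<open>The approximate solution contains the term with \<psi>_4, which the expansion to
    be compared lacks; it is of the neglected order.\<close>
  have h4: "unif_O 4 {x} (\<lambda>h (_::real^'d). h ^ 4 *\<^sub>R (- \<psi> 4 W0 x))"
    unfolding unif_O_def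
    by (intro exI[of _ "norm (\<psi> 4 W0 x)"] always_eventually) (simp add: mult.commute)
  have s4: "(\<Sum>k=1..4. F k) = (\<Sum>k=1..3. F k) + F 4" for F :: "nat \<Rightarrow> real^'p"
    by (simp add: numeral_eq_Suc)
  have s3: "(\<Sum>k<4. h ^ k *\<^sub>R c k) = (\<Sum>k=1..3. h ^ k *\<^sub>R \<psi> k W0 x) - (\<Sum>k=1..3. h ^ k *\<^sub>R \<Psi>' k W0 x)" for h
    by (simp add: c_def numeral_eq_Suc scaleR_diff_right)
  have "unif_O 4 {x} (\<lambda>h _. \<Sum>k<4. h ^ k *\<^sub>R c k)"
  proof (rule unif_O_cong[OF _ unif_O_add[OF unif_O_linear[OF bounded_linear_matrix[of S] y] h4]], intro always_eventually allI ballI)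
    fix h z assume "z \<in> {x}"
    then show "(\<Sum>k<4. h ^ k *\<^sub>R c k) = S *v (\<Phi> (W0 z) + matrix_inv S *v (\<Sum>k\<in>{1..4}. h ^ k *\<^sub>R \<psi> k W0 z) - (\<Phi> (W0 z)
        + matrix_inv S *v (\<Sum>k=1..3. h ^ k *\<^sub>R \<Psi>' k W0 z))) + h ^ 4 *\<^sub>R (- \<psi> 4 W0 x)"
      unfolding s3 s4 by (simp add: matrix_vector_mult_diff_distrib SS)
  qed
  from unif_O_polynomial[OF this, of k] show "\<Psi>' k W0 x = \<psi> k W0 x" if "k \<in> {1..3}"
    using that by (simp add: c_def)
qed

end

section \<open>Unrolling the recursion at orders 1 to 4\<close>

subsection \<open>The explicit formulas\<close>

lemma Tser_values:
  assumes "a 0 = (\<lambda>W x. 0)"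
  shows "Tser \<Gamma> a 0 = (\<lambda>W x. 0)" "Tser \<Gamma> a 1 = (\<lambda>W x. 0)" "Tser \<Gamma> a 2 = dd (a 1) (\<Gamma> 1)"
    "Tser \<Gamma> a 3 = (\<lambda>W x. dd (a 2) (\<Gamma> 1) W x + dd (a 1) (\<Gamma> 2) W x)"
proof -
  have s: "{1..min 4 0} = ({} :: nat set)" "{1..min 4 1} = {1 :: nat}" "{1..min 4 2} = {1, 2 :: nat}" "{1..min 4 3} = {1, 2, 3 :: nat}"
    by auto
  show "Tser \<Gamma> a 0 = (\<lambda>W x. 0)" "Tser \<Gamma> a 1 = (\<lambda>W x. 0)" "Tser \<Gamma> a 2 = dd (a 1) (\<Gamma> 1)"
    "Tser \<Gamma> a 3 = (\<lambda>W x. dd (a 2) (\<Gamma> 1) W x + dd (a 1) (\<Gamma> 2) W x)"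
    unfolding fun_eq_iff Tser_def s by (simp_all add: assms dd_zero)
qed

context lbm
begin

lemma blk_diff:
  "smooth p \<Longrightarrow> smooth q \<Longrightarrow> B (\<lambda>x. p x - q x) x = B p x - B q x"
  "smooth p \<Longrightarrow> smooth q \<Longrightarrow> D (\<lambda>x. p x - q x) x = D p x - D q x"
proof -
  assume p: "smooth p" and q: "smooth q"
  have e: "(\<lambda>x. p x - q x) = (\<lambda>x. p x + (- 1) *\<^sub>R q x)" by simp
  show "B (\<lambda>x. p x - q x) x = B p x - B q x"
    unfolding e blk_add(2)[OF p smooth_cscaleR[OF q]] blk_cscaleR(2)[OF q] by simp
  show "D (\<lambda>x. p x - q x) x = D p x - D q x"
    unfolding e blk_add(4)[OF p smooth_cscaleR[OF q]] blk_cscaleR(4)[OF q] by simp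
qed

text \<open>The formulas through \<Psi>_3 are the recursion read off directly, AB + BD and CB + D^2
  being the blocks of Lambda^2. Only \<Gamma>_4 is stated in a different shape.\<close>

lemma explicit_formulas:
  assumes d\<Gamma>: "\<And>k. k \<in> {1..4} \<Longrightarrow> diffop (\<Gamma> k)" and d\<Psi>: "\<And>k. k \<in> {1..3} \<Longrightarrow> diffop (\<Psi> k)"
    and rC: "\<And>N W x. N \<in> {1..4} \<Longrightarrow> smooth W \<Longrightarrow> \<Gamma> N W x = recC \<Gamma> (trunc 3 \<Psi>) N W x"
    and rN: "\<And>N W x. N \<in> {1..3} \<Longrightarrow> smooth W \<Longrightarrow> \<Psi> N W x = recN \<Gamma> (trunc 3 \<Psi>) N W x"
    and W: "smooth W"
  shows "\<Gamma> 1 W x = A W x + B (\<Phi>W W) x"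
    and "\<Psi> 1 W x = dd \<Phi>W (\<Gamma> 1) W x - (C W x + D (\<Phi>W W) x)"
    and "\<Gamma> 2 W x = B (\<lambda>y. \<Sigma> *v \<Psi> 1 W y) x"
    and "\<Psi> 2 W x = \<Sigma> *v dd (\<Psi> 1) (\<Gamma> 1) W x + dd \<Phi>W (\<Gamma> 2) W x - D (\<lambda>y. \<Sigma> *v \<Psi> 1 W y) x"
    and "\<Gamma> 3 W x = B (\<lambda>y. \<Sigma> *v \<Psi> 2 W y) x - (1/6) *\<^sub>R B (dd (\<Psi> 1) (\<Gamma> 1) W) x
        + (1/12) *\<^sub>R blkB (Lam v M \<circ> Lam v M) (\<Psi> 1 W) x"
    and "\<Psi> 3 W x = \<Sigma> *v dd (\<Psi> 1) (\<Gamma> 2) W x + dd \<Phi>W (\<Gamma> 3) W x - D (\<lambda>y. \<Sigma> *v \<Psi> 2 W y) x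
        + \<Sigma> *v dd (\<Psi> 2) (\<Gamma> 1) W x + (1/6) *\<^sub>R D (dd (\<Psi> 1) (\<Gamma> 1) W) x
        - (1/12) *\<^sub>R blkD (Lam v M \<circ> Lam v M) (\<Psi> 1 W) x - (1/12) *\<^sub>R dd (dd (\<Psi> 1) (\<Gamma> 1)) (\<Gamma> 1) W x"
    and "\<Gamma> 4 W x = B (\<lambda>y. \<Sigma> *v \<Psi> 3 W y) x + (1/4) *\<^sub>R blkB (Lam v M \<circ> Lam v M) (\<Psi> 2 W) x
        + (1/6) *\<^sub>R B (blkD (Lam v M \<circ> Lam v M) (\<lambda>y. \<Sigma> *v \<Psi> 1 W y)) x - (1/6) *\<^sub>R A (B (\<Psi> 2 W)) x
        - (1/6) *\<^sub>R B (dd (dd \<Phi>W (\<Gamma> 1)) (\<Gamma> 2) W) x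
        - (1/6) *\<^sub>R B (dd (dd \<Phi>W (\<Gamma> 2)) (\<Gamma> 1) W) x
        - (1/6) *\<^sub>R B (\<lambda>y. \<Sigma> *v dd (dd (\<Psi> 1) (\<Gamma> 1)) (\<Gamma> 1) W y) x"
proof -
  let ?\<psi> = "trunc 3 \<Psi>"
  have t: "?\<psi> 0 = (\<lambda>W x. 0)" "?\<psi> 1 = \<Psi> 1" "?\<psi> 2 = \<Psi> 2" "?\<psi> 3 = \<Psi> 3"
    by (simp_all add: trunc_def fun_eq_iff)
  note T = Tser_values[of ?\<psi> \<Gamma>, OF t(1), unfolded t]
  note TT = Tser_values[of "Tser \<Gamma> ?\<psi>" \<Gamma>, OF T(1), unfolded T]
  have d: "diffop (\<Gamma> 1)" "diffop (\<Gamma> 2)" "diffop (\<Gamma> 3)" "diffop (\<Psi> 1)" "diffop (\<Psi> 2)" "diffop (\<Psi> 3)"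
    by (rule d\<Gamma> d\<Psi>, simp)+
  have sh: "shift L u 1 V y = L (u 0 V) y" "shift L u 2 V y = L (u 1 V) y" "shift L u 3 V y = L (u 2 V) y" "shift L u 4 V y = L (u 3 V) y"
    for L :: "(real^'d \<Rightarrow> 'b) \<Rightarrow> real^'d \<Rightarrow> 'c::zero" and u :: "nat \<Rightarrow> (real^'d \<Rightarrow> real^'n) \<Rightarrow> real^'d \<Rightarrow> 'b" and V y
    by (simp_all add: shift_def)
  have shf: "shift L u 0 V = (\<lambda>y. 0)" "shift L u 1 V = L (u 0 V)" "shift L u 2 V = L (u 1 V)" "shift L u 3 V = L (u 2 V)"
    for L :: "(real^'d \<Rightarrow> 'b) \<Rightarrow> real^'d \<Rightarrow> 'c::zero" and u :: "nat \<Rightarrow> (real^'d \<Rightarrow> real^'n) \<Rightarrow> real^'d \<Rightarrow> 'b" and V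
    by (simp_all add: shift_def fun_eq_iff)
  note E = recC_def recN_def sh shf T TT t
  have B0: "B (\<lambda>y. 0) = (\<lambda>y. 0)" "D (\<lambda>y. 0) = (\<lambda>y. 0)" by (simp_all add: fun_eq_iff)
  have \<Gamma>1: "\<Gamma> 1 V y = A V y + B (\<Phi>W V) y" if "smooth V" for V y
    using rC[of 1, OF _ that, of y] unfolding E by (simp add: B0 dd_zero)
  have \<Psi>1: "\<Psi> 1 V y = dd \<Phi>W (\<Gamma> 1) V y - (C V y + D (\<Phi>W V) y)" if "smooth V" for V y
    using rN[of 1, OF _ that, of y] unfolding E by (simp add: B0 dd_zero)
  have \<Gamma>2: "\<Gamma> 2 V y = B (\<lambda>y. \<Sigma> *v \<Psi> 1 V y) y" if "smooth V" for V y
    using rC[of 2, OF _ that, of y] unfolding E by (simp add: B0 dd_zero)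
  have \<Psi>2: "\<Psi> 2 V y = \<Sigma> *v dd (\<Psi> 1) (\<Gamma> 1) V y + dd \<Phi>W (\<Gamma> 2) V y - D (\<lambda>y. \<Sigma> *v \<Psi> 1 V y) y" if "smooth V" for V y
    using rN[of 2, OF _ that, of y] unfolding E by (simp add: B0 dd_zero)
  have s: "smooth (\<Psi> 1 W)" "smooth (\<Psi> 2 W)" "smooth (\<Gamma> 1 W)" "smooth (\<Gamma> 2 W)"
    by (rule diffop_smooth[OF _ W], rule d)+
  note b2 = blk2[OF s(1)] blk2[OF s(2)]
  \<comment> \<open>The compact form of \<Gamma>_4; the derivatives of \<Psi>_2 and \<Psi>_1 in it
    are now eliminated.\<close>
  have \<Gamma>4: "\<Gamma> 4 W x = B (\<lambda>y. \<Sigma> *v \<Psi> 3 W y) x + (1/12) *\<^sub>R (blkB (Lam v M \<circ> Lam v M) (\<Psi> 2 W) x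
      - 2 *\<^sub>R B (\<lambda>y. dd (\<Psi> 2) (\<Gamma> 1) W y + dd (\<Psi> 1) (\<Gamma> 2) W y) x)"
    using rC[of 4, OF _ W, of x] unfolding E by (simp add: b2)
  show "\<Gamma> 1 W x = A W x + B (\<Phi>W W) x" by (rule \<Gamma>1[OF W])
  show "\<Psi> 1 W x = dd \<Phi>W (\<Gamma> 1) W x - (C W x + D (\<Phi>W W) x)" by (rule \<Psi>1[OF W])
  show "\<Gamma> 2 W x = B (\<lambda>y. \<Sigma> *v \<Psi> 1 W y) x" by (rule \<Gamma>2[OF W])
  show "\<Psi> 2 W x = \<Sigma> *v dd (\<Psi> 1) (\<Gamma> 1) W x + dd \<Phi>W (\<Gamma> 2) W x - D (\<lambda>y. \<Sigma> *v \<Psi> 1 W y) x" by (rule \<Psi>2[OF W])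
  show "\<Gamma> 3 W x = B (\<lambda>y. \<Sigma> *v \<Psi> 2 W y) x - (1/6) *\<^sub>R B (dd (\<Psi> 1) (\<Gamma> 1) W) x
        + (1/12) *\<^sub>R blkB (Lam v M \<circ> Lam v M) (\<Psi> 1 W) x"
    using rC[of 3, OF _ W, of x] unfolding E b2 by (simp add: scaleR_diff_right)
  show "\<Psi> 3 W x = \<Sigma> *v dd (\<Psi> 1) (\<Gamma> 2) W x + dd \<Phi>W (\<Gamma> 3) W x - D (\<lambda>y. \<Sigma> *v \<Psi> 2 W y) x
        + \<Sigma> *v dd (\<Psi> 2) (\<Gamma> 1) W x + (1/6) *\<^sub>R D (dd (\<Psi> 1) (\<Gamma> 1) W) x
        - (1/12) *\<^sub>R blkD (Lam v M \<circ> Lam v M) (\<Psi> 1 W) x - (1/12) *\<^sub>R dd (dd (\<Psi> 1) (\<Gamma> 1)) (\<Gamma> 1) W x"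
    using rN[of 3, OF _ W, of x] unfolding E b2 by (simp add: scaleR_diff_right scaleR_add_right matrix_vector_right_distrib dd_zero)
  define P where "P = dd (dd \<Phi>W (\<Gamma> 1)) (\<Gamma> 2) W"
  define Q where "Q = dd (dd \<Phi>W (\<Gamma> 2)) (\<Gamma> 1) W"
  define R where "R = (\<lambda>y. \<Sigma> *v dd (dd (\<Psi> 1) (\<Gamma> 1)) (\<Gamma> 1) W y)"
  define U where "U = blkD (Lam v M \<circ> Lam v M) (\<lambda>y. \<Sigma> *v \<Psi> 1 W y)"
  have d\<Sigma>: "diffop (\<lambda>W y. \<Sigma> *v \<Psi> 1 W y)" by (rule diffop_linear[OF bounded_linear_matrix d(4)])
  have s\<Sigma>: "smooth (\<lambda>y. \<Sigma> *v \<Psi> 1 W y)" by (rule diffop_smooth[OF d\<Sigma> W])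
  have U_eq: "U = (\<lambda>y. C (B (\<lambda>y. \<Sigma> *v \<Psi> 1 W y)) y + D (D (\<lambda>y. \<Sigma> *v \<Psi> 1 W y)) y)"
    unfolding U_def by (rule ext) (rule blk2(2)[OF s\<Sigma>])
  have sP: "smooth P" and sQ: "smooth Q" and sR: "smooth R" and sU: "smooth U"
    unfolding P_def Q_def R_def U_eq
    by (intro diffop_smooth[OF diffop_dd] diffop_dd diffop_\<Phi>W d W smooth_bounded_linear[OF bounded_linear_matrix] smooth_add blk_smooth s\<Sigma>)+
  have sD\<Psi>: "smooth (D (\<Psi> 2 W))" by (rule blk_smooth(4)[OF s(2)])
  \<comment> \<open>The formula for \<Psi>_2, differentiated in the direction \<Gamma>_1.\<close>
  have dd2: "dd (\<Psi> 2) (\<Gamma> 1) W y = R y + Q y - D (\<lambda>y. \<Sigma> *v dd (\<Psi> 1) (\<Gamma> 1) W y) y" for y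
  proof -
    have d1: "diffop (\<lambda>W y. \<Sigma> *v dd (\<Psi> 1) (\<Gamma> 1) W y)" and d2: "diffop (dd \<Phi>W (\<Gamma> 2))"
      and d3: "diffop (\<lambda>W. D (\<lambda>y. \<Sigma> *v \<Psi> 1 W y))"
      by (intro diffop_linear[OF bounded_linear_matrix] diffop_dd diffop_\<Phi>W d diffop_blk(4))+
    have "dd (\<Psi> 2) (\<Gamma> 1) W y = dd (\<lambda>W y. (\<Sigma> *v dd (\<Psi> 1) (\<Gamma> 1) W y + dd \<Phi>W (\<Gamma> 2) W y) + (- 1) *\<^sub>R D (\<lambda>y. \<Sigma> *v \<Psi> 1 W y) y) (\<Gamma> 1) W y"
      by (rule dd_cong, simp only: \<Psi>2 scaleR_minus_left scaleR_one add_uminus_conv_diff, rule W, rule refl, rule s(3))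
    also have "\<dots> = (dd (\<lambda>W y. \<Sigma> *v dd (\<Psi> 1) (\<Gamma> 1) W y) (\<Gamma> 1) W y + dd (dd \<Phi>W (\<Gamma> 2)) (\<Gamma> 1) W y)
        + (- 1) *\<^sub>R dd (\<lambda>W. D (\<lambda>y. \<Sigma> *v \<Psi> 1 W y)) (\<Gamma> 1) W y"
      unfolding dd_add[where G = "\<Gamma> 1", OF diffop_add[OF d1 d2] diffop_linear[OF bounded_linear_scaleR_right d3] W s(3)]
        dd_add[where G = "\<Gamma> 1", OF d1 d2 W s(3)] dd_linear[where G = "\<Gamma> 1", OF bounded_linear_scaleR_right d3 W s(3)] ..
    also have "dd (\<lambda>W y. \<Sigma> *v dd (\<Psi> 1) (\<Gamma> 1) W y) (\<Gamma> 1) W y = R y"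
      unfolding R_def by (rule dd_linear[where G = "\<Gamma> 1", OF bounded_linear_matrix diffop_dd[OF d(4) d(1)] W s(3)])
    also have "dd (\<lambda>W. D (\<lambda>y. \<Sigma> *v \<Psi> 1 W y)) (\<Gamma> 1) W y = D (dd (\<lambda>W y. \<Sigma> *v \<Psi> 1 W y) (\<Gamma> 1) W) y"
      by (rule dd_blk(4)[where G = "\<Gamma> 1" and F = "\<lambda>W. W", OF diffop_id d\<Sigma> W s(3)])
    also have "dd (\<lambda>W y. \<Sigma> *v \<Psi> 1 W y) (\<Gamma> 1) W = (\<lambda>y. \<Sigma> *v dd (\<Psi> 1) (\<Gamma> 1) W y)"
      by (rule ext) (rule dd_linear[where G = "\<Gamma> 1", OF bounded_linear_matrix d(4) W s(3)])
    finally show ?thesis by (simp add: Q_def)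
  qed
  \<comment> \<open>The formula for \<Psi>_1, differentiated in the direction \<Gamma>_2. The
    operator C and D \<Phi> are treated as parts of one operator in W.\<close>
  have dd1: "dd (\<Psi> 1) (\<Gamma> 2) W y = P y - (C (\<Gamma> 2 W) y + D (dd \<Phi>W (\<Gamma> 2) W) y)" for y
  proof -
    have d1: "diffop (dd \<Phi>W (\<Gamma> 1))" and d2: "diffop (\<lambda>W. C W)" and d3: "diffop (\<lambda>W. D (\<Phi>W W))"
      by (intro diffop_dd diffop_\<Phi>W d diffop_blk diffop_id)+
    have "dd (\<Psi> 1) (\<Gamma> 2) W y = dd (\<lambda>W y. dd \<Phi>W (\<Gamma> 1) W y + (- 1) *\<^sub>R (C W y + D (\<Phi>W W) y)) (\<Gamma> 2) W y"
      by (rule dd_cong, simp only: \<Psi>1 scaleR_minus_left scaleR_one add_uminus_conv_diff, rule W, rule refl, rule s(4))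
    also have "\<dots> = dd (dd \<Phi>W (\<Gamma> 1)) (\<Gamma> 2) W y + (- 1) *\<^sub>R (dd (\<lambda>W. C W) (\<Gamma> 2) W y + dd (\<lambda>W. D (\<Phi>W W)) (\<Gamma> 2) W y)"
      unfolding dd_add[where G = "\<Gamma> 2", OF d1 diffop_linear[OF bounded_linear_scaleR_right diffop_add[OF d2 d3]] W s(4)]
        dd_linear[where G = "\<Gamma> 2", OF bounded_linear_scaleR_right diffop_add[OF d2 d3] W s(4)]
        dd_add[where G = "\<Gamma> 2", OF d2 d3 W s(4)] ..
    also have "dd (\<lambda>W. C W) (\<Gamma> 2) W y = C (dd (\<lambda>W. W) (\<Gamma> 2) W) y"
      by (rule dd_blk(3)[where G = "\<Gamma> 2" and F = "\<lambda>W. W", OF diffop_id d\<Sigma> W s(4)])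
    also have "dd (\<lambda>W. W) (\<Gamma> 2) W = \<Gamma> 2 W" by (rule ext) (simp add: dd_id)
    also have "dd (\<lambda>W. D (\<Phi>W W)) (\<Gamma> 2) W y = D (dd \<Phi>W (\<Gamma> 2) W) y"
      by (rule dd_blk(4)[where G = "\<Gamma> 2" and F = "\<lambda>W. W", OF diffop_id diffop_\<Phi>W W s(4)])
    finally show ?thesis by (simp add: P_def)
  qed
  have D\<Psi>2: "D (\<Psi> 2 W) y = D (\<lambda>y. \<Sigma> *v dd (\<Psi> 1) (\<Gamma> 1) W y) y + D (dd \<Phi>W (\<Gamma> 2) W) y - D (D (\<lambda>y. \<Sigma> *v \<Psi> 1 W y)) y" for y
  proof -
    have s1: "smooth (\<lambda>y. \<Sigma> *v dd (\<Psi> 1) (\<Gamma> 1) W y)" and s2: "smooth (dd \<Phi>W (\<Gamma> 2) W)" and s3: "smooth (D (\<lambda>y. \<Sigma> *v \<Psi> 1 W y))"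
      by (intro smooth_bounded_linear[OF bounded_linear_matrix] diffop_smooth[OF diffop_dd] diffop_\<Phi>W d W blk_smooth s\<Sigma>)+
    have "\<Psi> 2 W = (\<lambda>y. (\<Sigma> *v dd (\<Psi> 1) (\<Gamma> 1) W y + dd \<Phi>W (\<Gamma> 2) W y) - D (\<lambda>y. \<Sigma> *v \<Psi> 1 W y) y)"
      using \<Psi>2[OF W] by (simp only: fun_eq_iff) simp
    then show ?thesis by (simp only: blk_diff(2)[OF smooth_add[OF s1 s2] s3] blk_add(4)[OF s1 s2])
  qed
  have \<Gamma>2W: "\<Gamma> 2 W = B (\<lambda>y. \<Sigma> *v \<Psi> 1 W y)" using \<Gamma>2[OF W] by (simp only: fun_eq_iff) simp
  \<comment> \<open>The terms with D recombine to D \<Psi>_2 by the formula for \<Psi>_2, up to D^2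
    \<Sigma> \<Psi>_1. This joins C \<Gamma>_2 = C B \<Sigma> \<Psi>_1 to give the block D_2 of
    Lambda^2.\<close>
  have "(\<lambda>y. dd (\<Psi> 2) (\<Gamma> 1) W y + dd (\<Psi> 1) (\<Gamma> 2) W y) = (\<lambda>y. (P y + Q y + R y) - (U y + D (\<Psi> 2 W) y))"
    unfolding dd1 dd2 D\<Psi>2 \<Gamma>2W U_eq by (simp add: algebra_simps)
  then have "B (\<lambda>y. dd (\<Psi> 2) (\<Gamma> 1) W y + dd (\<Psi> 1) (\<Gamma> 2) W y) x = B P x + B Q x + B R x - (B U x + B (D (\<Psi> 2 W)) x)"
    by (simp only: blk_diff(1)[OF smooth_add[OF smooth_add[OF sP sQ] sR] smooth_add[OF sU sD\<Psi>]]
        blk_add(2)[OF smooth_add[OF sP sQ] sR] blk_add(2)[OF sP sQ] blk_add(2)[OF sU sD\<Psi>])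
  \<comment> \<open>From B_2 = A B + B D. Together with the original 1/12 the resulting 1/6 makes
    the coefficient 1/4 of B_2 \<Psi>_2.\<close>
  also have "B (D (\<Psi> 2 W)) x = blkB (Lam v M \<circ> Lam v M) (\<Psi> 2 W) x - A (B (\<Psi> 2 W)) x"
    unfolding b2 by simp
  finally have "\<Gamma> 4 W x = B (\<lambda>y. \<Sigma> *v \<Psi> 3 W y) x + (1/12) *\<^sub>R (blkB (Lam v M \<circ> Lam v M) (\<Psi> 2 W) x
      - 2 *\<^sub>R (B P x + B Q x + B R x - (B U x + (blkB (Lam v M \<circ> Lam v M) (\<Psi> 2 W) x - A (B (\<Psi> 2 W)) x))))"
    unfolding \<Gamma>4 by (simp only:)
  moreover have "b + (1/12) *\<^sub>R (e - 2 *\<^sub>R (p + q + r - (u + (e - a)))) =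
      b + (1/4) *\<^sub>R e + (1/6) *\<^sub>R u - (1/6) *\<^sub>R a - (1/6) *\<^sub>R p - (1/6) *\<^sub>R q - (1/6) *\<^sub>R r" for a b e p q r u :: "real^'n"
    by (simp add: vec_eq_iff field_simps)
  ultimately show "\<Gamma> 4 W x = B (\<lambda>y. \<Sigma> *v \<Psi> 3 W y) x + (1/4) *\<^sub>R blkB (Lam v M \<circ> Lam v M) (\<Psi> 2 W) x
        + (1/6) *\<^sub>R B (blkD (Lam v M \<circ> Lam v M) (\<lambda>y. \<Sigma> *v \<Psi> 1 W y)) x - (1/6) *\<^sub>R A (B (\<Psi> 2 W)) x
        - (1/6) *\<^sub>R B (dd (dd \<Phi>W (\<Gamma> 1)) (\<Gamma> 2) W) x
        - (1/6) *\<^sub>R B (dd (dd \<Phi>W (\<Gamma> 2)) (\<Gamma> 1) W) x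
        - (1/6) *\<^sub>R B (\<lambda>y. \<Sigma> *v dd (dd (\<Psi> 1) (\<Gamma> 1)) (\<Gamma> 1) W y) x"
    unfolding P_def[symmetric] Q_def[symmetric] R_def[symmetric] U_def[symmetric] by (simp only:)
qed

end

section \<open>A reference solution of the recursion, and the comparison of both expansions with
  it\<close>

context lbm
begin

text \<open>The equations see only values on smooth fields and coefficients up to order
  \<open>m\<close>. Operators that agree with a solution in this sense are therefore solutions as
  well.\<close>

lemma rec_transfer:
  assumes d\<Gamma>: "\<And>k. k \<in> {1..4} \<Longrightarrow> diffop (\<Gamma> k)"
    and rC: "\<And>N W x. N \<in> {1..4} \<Longrightarrow> smooth W \<Longrightarrow> \<Gamma> N W x = recC \<Gamma> \<psi> N W x"
    and rN: "\<And>N W x. N \<in> {1..m} \<Longrightarrow> smooth W \<Longrightarrow> \<psi> N W x = recN \<Gamma> \<psi> N W x"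
    and m: "m \<in> {3, 4}"
    and eq\<Gamma>: "\<And>N W x. N \<in> {1..4} \<Longrightarrow> smooth W \<Longrightarrow> \<Gamma> N W x = \<Gamma>' N W x"
    and eq\<psi>: "\<And>N W x. N \<le> m \<Longrightarrow> smooth W \<Longrightarrow> \<psi> N W x = \<psi>' N W x"
  shows "N \<in> {1..4} \<Longrightarrow> smooth W \<Longrightarrow> \<Gamma>' N W x = recC \<Gamma>' \<psi>' N W x"
    and "N \<in> {1..m} \<Longrightarrow> smooth W \<Longrightarrow> \<psi>' N W x = recN \<Gamma>' \<psi>' N W x"
proof -
  assume W: "smooth W"
  show "\<Gamma>' N W x = recC \<Gamma>' \<psi>' N W x" if N: "N \<in> {1..4}"
  proof -
    have "recC \<Gamma> \<psi> N W x = recC \<Gamma>' \<psi>' N W x"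
    proof (rule rec_cong(1)[where \<Gamma> = \<Gamma> and \<Gamma>' = \<Gamma>' and \<psi> = \<psi> and \<psi>' = \<psi>', OF _ W d\<Gamma>])
      show "\<psi> j V y = \<psi>' j V y" if "j < N" "smooth V" for j V y
        by (rule eq\<psi>[OF _ that(2)]) (use that(1) N m in auto)
    qed ((assumption | rule eq\<Gamma>)+)
    then show ?thesis using rC[OF N W, of x] eq\<Gamma>[OF N W, of x] by simp
  qed
  show "\<psi>' N W x = recN \<Gamma>' \<psi>' N W x" if N: "N \<in> {1..m}"
  proof -
    have N4: "N \<in> {1..4}" using N m by auto
    have "recN \<Gamma> \<psi> N W x = recN \<Gamma>' \<psi>' N W x"
    proof (rule rec_cong(2)[where \<Gamma> = \<Gamma> and \<Gamma>' = \<Gamma>' and \<psi> = \<psi> and \<psi>' = \<psi>', OF _ W d\<Gamma> _ N4])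
      show "\<psi> j V y = \<psi>' j V y" if "j < N" "smooth V" for j V y
        by (rule eq\<psi>[OF _ that(2)]) (use that(1) N in auto)
      show "\<Gamma> N V y = \<Gamma>' N V y" if "smooth V" for V y by (rule eq\<Gamma>[OF N4 that])
    qed ((assumption | rule eq\<Gamma>)+)
    then show ?thesis using rN[OF N W, of x] eq\<psi>[OF _ W, of N x] N by simp
  qed
qed

lemma sol_exists: "\<exists>\<Gamma> \<psi>. lbm_sol v M \<Phi> S \<Gamma> \<psi>"
proof -
  obtain \<Gamma> \<psi> where d\<Gamma>: "\<And>k. diffop (\<Gamma> k)" and d\<psi>: "\<And>k. diffop (\<psi> k)" and \<psi>0: "\<psi> 0 = (\<lambda>W x. 0)"
    and rC: "\<And>N W x. N \<in> {1..4} \<Longrightarrow> smooth W \<Longrightarrow> \<Gamma> N W x = recC \<Gamma> \<psi> N W x"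
    and rN: "\<And>N W x. N \<in> {1..4} \<Longrightarrow> smooth W \<Longrightarrow> \<psi> N W x = recN \<Gamma> \<psi> N W x"
    using rec_exists by blast
  have eq: "\<psi> N W x = trunc 4 \<psi> N W x" if "N \<le> 4" for N W x
    using that \<psi>0 by (cases "N = 0") (auto simp: trunc_def)
  have "trunc 4 \<psi> k = (if 1 \<le> k \<and> k \<le> 4 then \<psi> k else (\<lambda>W x. 0))" for k
    by (intro ext) (auto simp: trunc_def)
  then have dt: "diffop (trunc 4 \<psi> k)" for k
    using d\<psi>[of k] by (simp add: diffop_zero)
  note tr = rec_transfer[where \<Gamma> = \<Gamma> and \<Gamma>' = \<Gamma> and \<psi> = \<psi> and \<psi>' = "trunc 4 \<psi>" and m = 4, OF d\<Gamma> rC rN _ refl eq]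
  have "lbm_sol v M \<Phi> S \<Gamma> (trunc 4 \<psi>)"
  proof (rule lbm_sol.intro[OF lbm_axioms], unfold_locales)
    show "diffop (\<Gamma> k)" for k by (rule d\<Gamma>)
    show "diffop (trunc 4 \<psi> k)" for k by (rule dt)
    show "trunc 4 \<psi> k = (\<lambda>W x. 0)" if "k = 0 \<or> 4 < k" for k using that by (auto simp: trunc_def fun_eq_iff)
    show "\<Gamma> N W x = recC \<Gamma> (trunc 4 \<psi>) N W x" if "N \<in> {1..4}" "smooth W" for N W x
      by (rule tr(1)) (use that in simp_all)
    show "trunc 4 \<psi> N W x = recN \<Gamma> (trunc 4 \<psi>) N W x" if "N \<in> {1..4}" "smooth W" for N W x
      by (rule tr(2)) (use that in simp_all)
  qed
  then show ?thesis by blast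
qed

end

context lbm_sol
begin

lemma CE_unique:
  assumes ce: "chapman_enskog v M \<Phi> S \<tau> \<Gamma>' \<Psi>'" and \<tau>: "\<tau> > 0" and W: "smooth W"
  shows "k \<in> {1..4} \<Longrightarrow> \<Gamma> k W x = \<Gamma>' k W x" and "k \<in> {1..3} \<Longrightarrow> \<psi> k W x = \<Psi>' k W x"
proof -
  have "trunc 3 \<Psi>' 0 = (\<lambda>W x. 0)" by (simp add: trunc_def fun_eq_iff)
  moreover have "\<psi> 0 = (\<lambda>W x. 0)" by (rule \<psi>_outside) simp
  moreover have "\<psi> N W x = recN \<Gamma> \<psi> N W x" if "N \<in> {1..3}" "smooth W" for N W x
    by (rule rec\<psi>[OF _ that(2)]) (use that(1) in simp)
  ultimately have "\<forall>W x. smooth W \<longrightarrow> (k \<in> {1..4} \<longrightarrow> \<Gamma> k W x = \<Gamma>' k W x) \<and> (k \<le> 3 \<longrightarrow> \<psi> k W x = trunc 3 \<Psi>' k W x)" for k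
    by (intro rec_unique[where \<Gamma> = \<Gamma> and \<psi> = \<psi> and \<Gamma>' = \<Gamma>' and \<psi>' = "trunc 3 \<Psi>'", OF d\<Gamma>] rec\<Gamma> CE_rec(3,4)[OF ce \<tau>])
  then have *: "k \<in> {1..4} \<longrightarrow> \<Gamma> k W x = \<Gamma>' k W x" "k \<le> 3 \<longrightarrow> \<psi> k W x = trunc 3 \<Psi>' k W x" for k
    using W by simp_all
  show "\<Gamma> k W x = \<Gamma>' k W x" if "k \<in> {1..4}" using *(1) that by simp
  show "\<psi> k W x = \<Psi>' k W x" if "k \<in> {1..3}" using *(2)[of k] that by (simp add: trunc_def)
qed

text \<open>Taylor operators coincide with the reference solution, so they inherit its recursion;
  this makes \<open>explicit_formulas\<close> applicable to them.\<close>

lemma taylor_rec: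
  assumes T: "taylor_expansion v M \<Phi> S \<Gamma>' \<Psi>'"
  shows "\<And>N W x. N \<in> {1..4} \<Longrightarrow> smooth W \<Longrightarrow> \<Gamma>' N W x = recC \<Gamma>' (trunc 3 \<Psi>') N W x"
    and "\<And>N W x. N \<in> {1..3} \<Longrightarrow> smooth W \<Longrightarrow> \<Psi>' N W x = recN \<Gamma>' (trunc 3 \<Psi>') N W x"
proof -
  have 0: "\<psi> 0 = (\<lambda>W x. 0)" by (rule \<psi>_outside) simp
  have eq: "\<psi> N W x = trunc 3 \<Psi>' N W x" if "N \<le> 3" "smooth W" for N W x
    using that taylor_unique(2)[OF T that(2), of N x] by (cases "N = 0") (auto simp: trunc_def 0)
  have r3: "\<psi> N W x = recN \<Gamma> \<psi> N W x" if "N \<in> {1..3}" "smooth W" for N W x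
    by (rule rec\<psi>[OF _ that(2)]) (use that(1) in simp)
  note tr = rec_transfer[where \<Gamma> = \<Gamma> and \<Gamma>' = \<Gamma>' and \<psi> = \<psi> and \<psi>' = "trunc 3 \<Psi>'" and m = 3,
      OF d\<Gamma> rec\<Gamma> r3 _ taylor_unique(1)[OF T, symmetric] eq]
  show "\<Gamma>' N W x = recC \<Gamma>' (trunc 3 \<Psi>') N W x" if "N \<in> {1..4}" "smooth W" for N W x
    by (rule tr(1)) (use that in simp_all)
  show "\<Psi>' N W x = recN \<Gamma>' (trunc 3 \<Psi>') N W x" if "N \<in> {1..3}" "smooth W" for N W x
  proof -
    have "trunc 3 \<Psi>' N W x = recN \<Gamma>' (trunc 3 \<Psi>') N W x"
      by (rule tr(2)) (use that in simp_all)
    then show ?thesis using that by (simp add: trunc_def)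
  qed
qed

end

theorem proposition3:
  fixes v :: "'q::finite \<Rightarrow> real^'d::finite"
    and M :: "real^'q^('n::finite + 'p::finite)"
    and \<Phi> :: "real^'n \<Rightarrow> real^'p"
    and S :: "real^'p^'p"
    and \<tau>\<^sub>0 :: real
  assumes "invertible M" and "smooth \<Phi>" and "invertible S" and "\<tau>\<^sub>0 > 0"
  defines "A \<equiv> blkA (Lam v M)" and "B \<equiv> blkB (Lam v M)"
    and "C \<equiv> blkC (Lam v M)" and "D \<equiv> blkD (Lam v M)"
    and "B2 \<equiv> blkB (Lam v M \<circ> Lam v M)" and "D2 \<equiv> blkD (Lam v M \<circ> Lam v M)"
    and "\<Sigma> \<equiv> matrix_inv S - (1/2) *\<^sub>R mat 1"
    and "\<Phi>W \<equiv> (\<lambda>W x. \<Phi> (W x))"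
  shows "(\<exists>\<Gamma> \<Psi>. taylor_expansion v M \<Phi> S \<Gamma> \<Psi>) \<and>
    (\<exists>\<Gamma> \<Psi>. chapman_enskog v M \<Phi> S \<tau>\<^sub>0 \<Gamma> \<Psi>) \<and>
    (\<forall>\<Gamma> \<Psi> \<Gamma>' \<Psi>'. taylor_expansion v M \<Phi> S \<Gamma> \<Psi> \<longrightarrow> chapman_enskog v M \<Phi> S \<tau>\<^sub>0 \<Gamma>' \<Psi>' \<longrightarrow>
      (\<forall>W x. smooth W \<longrightarrow>
        (\<forall>k\<in>{1..4}. \<Gamma> k W x = \<Gamma>' k W x) \<and>
        (\<forall>k\<in>{1..3}. \<Psi> k W x = \<Psi>' k W x) \<and>
        \<Gamma> 1 W x = A W x + B (\<Phi>W W) x \<and>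
        \<Psi> 1 W x = dd \<Phi>W (\<Gamma> 1) W x - (C W x + D (\<Phi>W W) x) \<and>
        \<Gamma> 2 W x = B (\<lambda>y. \<Sigma> *v \<Psi> 1 W y) x \<and>
        \<Psi> 2 W x = \<Sigma> *v dd (\<Psi> 1) (\<Gamma> 1) W x + dd \<Phi>W (\<Gamma> 2) W x - D (\<lambda>y. \<Sigma> *v \<Psi> 1 W y) x \<and>
        \<Gamma> 3 W x = B (\<lambda>y. \<Sigma> *v \<Psi> 2 W y) x - (1/6) *\<^sub>R B (dd (\<Psi> 1) (\<Gamma> 1) W) x
                 + (1/12) *\<^sub>R B2 (\<Psi> 1 W) x \<and>
        \<Psi> 3 W x = \<Sigma> *v dd (\<Psi> 1) (\<Gamma> 2) W x + dd \<Phi>W (\<Gamma> 3) W x - D (\<lambda>y. \<Sigma> *v \<Psi> 2 W y) x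
                 + \<Sigma> *v dd (\<Psi> 2) (\<Gamma> 1) W x + (1/6) *\<^sub>R D (dd (\<Psi> 1) (\<Gamma> 1) W) x
                 - (1/12) *\<^sub>R D2 (\<Psi> 1 W) x - (1/12) *\<^sub>R dd (dd (\<Psi> 1) (\<Gamma> 1)) (\<Gamma> 1) W x \<and>
        \<Gamma> 4 W x = B (\<lambda>y. \<Sigma> *v \<Psi> 3 W y) x + (1/4) *\<^sub>R B2 (\<Psi> 2 W) x
                 + (1/6) *\<^sub>R B (D2 (\<lambda>y. \<Sigma> *v \<Psi> 1 W y)) x - (1/6) *\<^sub>R A (B (\<Psi> 2 W)) x
                 - (1/6) *\<^sub>R B (dd (dd \<Phi>W (\<Gamma> 1)) (\<Gamma> 2) W) x
                 - (1/6) *\<^sub>R B (dd (dd \<Phi>W (\<Gamma> 2)) (\<Gamma> 1) W) x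
                 - (1/6) *\<^sub>R B (\<lambda>y. \<Sigma> *v dd (dd (\<Psi> 1) (\<Gamma> 1)) (\<Gamma> 1) W y) x))"
proof -
  interpret lbm v M \<Phi> S using assms(1-3) by unfold_locales
  note defs = A_def B_def C_def D_def B2_def D2_def \<Sigma>_def \<Phi>W_def
  \<comment> \<open>One solution of the recursion is fixed; the operators of the Taylor and of the
    Chapman-Enskog expansion are both compared with it.\<close>
  obtain \<Gamma>\<^sub>0 \<psi>\<^sub>0 where sol: "lbm_sol v M \<Phi> S \<Gamma>\<^sub>0 \<psi>\<^sub>0" using sol_exists by (elim exE)
  interpret sol: lbm_sol v M \<Phi> S \<Gamma>\<^sub>0 \<psi>\<^sub>0 by (rule sol)
  have taylor: "\<exists>\<Gamma> \<Psi>. taylor_expansion v M \<Phi> S \<Gamma> \<Psi>"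
    by (rule exI, rule exI, rule sol.taylor_exists)
  show ?thesis
    unfolding defs
  proof (intro conjI taylor CE_exists assms(4), intro allI impI, goal_cases)
    case (1 \<Gamma> \<Psi> \<Gamma>' \<Psi>' W x)
    note T = 1(1) and ce = 1(2) and W = 1(3)
    have d: "diffop (\<Gamma> k)" if "k \<in> {1..4}" for k using T that unfolding taylor_expansion_def by blast
    have d': "diffop (\<Psi> k)" if "k \<in> {1..3}" for k using T that unfolding taylor_expansion_def by blast
    have \<Gamma>: "\<forall>k\<in>{1..4}. \<Gamma> k W x = \<Gamma>' k W x"
      by (intro ballI trans[OF sol.taylor_unique(1)[OF T W] sol.CE_unique(1)[OF ce assms(4) W]])
    have \<Psi>: "\<forall>k\<in>{1..3}. \<Psi> k W x = \<Psi>' k W x"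
      by (intro ballI trans[OF sol.taylor_unique(2)[OF T W] sol.CE_unique(2)[OF ce assms(4) W]])
    note formulas = explicit_formulas[where \<Gamma> = \<Gamma> and \<Psi> = \<Psi> and x = x, OF d d' sol.taylor_rec[OF T] W]
    show ?case by (intro conjI \<Gamma> \<Psi>; rule formulas; assumption)
  qed
qed

end
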